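(* Assume that $p,p_x,d\in L^\infty(Q)$ and that for some constant $K>0$ and all $(x,t)\in Q$ $$|p(x,t)|\leq K\sqrt{a(x)},\qquad |d(x,t)|\leq K a(x),\qquad |a_x(x)|\leq K\sqrt{a(x)}.$$ Consider the degenerate mean-field game system $$\begin{cases} u_t+a(x)u_{xx}-\frac{p(x,t)}{2}|u_x|^2+d(x,t)m=F(x,t) & \text{in }Q,\\ m_t-(a(x)m)_{xx}-(p(x,t)\,m\,u_x)_x=G(x,t) & \text{in }Q,\\ u=am=0 & \text{on }\Sigma. \end{cases}\qquad(\ast)$$ Let $t_0\in(0,T)$ and let $(u_k,m_k)\in H^2_{\frac1a}(0,1)\times H_{2,a}(0,1)$, $k=1,2$, satisfy $(\ast)$ and be such that $$\|u_k(\cdot,0)\|_{1,\frac1a}\leq M,\qquad \|m_k(\cdot,0)\|_{1,a}\leq M,$$ and $$\partial_x^l u_k\in L^\infty(Q),\quad \partial_x^n m_k\in L^\infty(Q),\qquad l=0,1,2,\quad n=0,1.$$ Then there exist constants $C>0$ and $\theta\in(0,1)$ depending on $t_0$ and $M$ such that $$\|u_2(\cdot,t_0)-u_1(\cdot,t_0)\|_{\frac1a}+\|m_2(\cdot,t_0)-m_1(\cdot,t_0)\|_a\leq C\left(D_0^\theta+D_0\right),$$ where $$D_0=\|u_2(\cdot,T)-u_1(\cdot,T)\|_{1,\frac1a}+\|m_2(\cdot,T)-m_1(\cdot,T)\|_{1,a}.$$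
   Context: Let $T>0$, $Q=(0,1)\times(0,T)$, $\Sigma=\{0,1\}\times(0,T)$. The coefficient $a$ satisfies $a\in C([0,1])\cap C^1(0,1)$, $a(x)>0$ for $x\in(0,1)$ and $a(0)=a(1)=0$. Here $F,G$ are given functions on $Q$, the same for both solutions. The functions $u_k,m_k$ are real-valued functions of $(x,t)$; the membership $(u_k,m_k)\in H^2_{\frac1a}(0,1)\times H_{2,a}(0,1)$ refers to the space variable $x$. Weighted spaces: $L^2_{\frac1a}(0,1)=\{u\in L^2(0,1): \|u\|_{\frac1a}<\infty\}$ with $\|u\|_{\frac1a}^2=\int_0^1 \frac{u^2}{a}\,dx$; $H^1_{\frac1a}(0,1)=L^2_{\frac1a}(0,1)\cap H^1_0(0,1)$ with $\|u\|_{1,\frac1a}^2=\|u\|_{\frac1a}^2+\|u_x\|_{L^2(0,1)}^2$; $H^2_{\frac1a}(0,1)=\{u\in H^1_{\frac1a}(0,1): a u_{xx}\in L^2_{\frac1a}(0,1)\}$ with $\|u\|_{2,\frac1a}^2=\|u\|_{1,\frac1a}^2+\int_0^1 a\,u_{xx}^2\,dx$. $L^2_a(0,1)=\{u \text{ measurable}: \|u\|_a<\infty\}$ with $\|u\|_a^2=\int_0^1 a u^2\,dx$; $H_{1,a}(0,1)=\{u\in L^2_a(0,1): \int_0^1|(au)_x|^2dx<\infty,\ (au)(0)=(au)(1)=0\}$ with $\|u\|_{1,a}^2=\|u\|_a^2+\int_0^1|(au)_x|^2dx$; $H_{2,a}(0,1)=\{u\in H_{1,a}(0,1): (au)_{xx}\in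 L^2_a(0,1)\}$ with $\|u\|_{2,a}^2=\|u\|_{1,a}^2+\int_0^1 a|(au)_{xx}|^2dx$.
   Formalization: The constants C and θ may depend, besides t_0, M and the fixed data, on a common bound N for the L^∞(Q) norms of ∂_x^l u_k (l ≤ 2) and ∂_x^n m_k (n ≤ 1); uniformity in t_0 and M alone fails. *)

theory Defs
  imports "HOL-Analysis.Analysis"
begin

section \<open>Weak derivatives and Sobolev spaces on the unit interval\<close>

definition test_fun :: "(real \<Rightarrow> real) \<Rightarrow> bool" where
  "test_fun \<phi> \<longleftrightarrow> (\<forall>k x. (deriv ^^ k) \<phi> differentiable (at x)) \<and>
     (\<exists>\<alpha> \<beta>. 0 < \<alpha> \<and> \<beta> < 1 \<and> (\<forall>x. x \<notin> {\<alpha>..\<beta>} \<longrightarrow> \<phi> x = 0))"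

definition L1_loc :: "(real \<Rightarrow> real) \<Rightarrow> bool" where
  "L1_loc f \<longleftrightarrow> (\<forall>\<alpha> \<beta>. 0 < \<alpha> \<longrightarrow> \<beta> < 1 \<longrightarrow> set_integrable lebesgue {\<alpha>..\<beta>} f)"

definition weak_deriv :: "(real \<Rightarrow> real) \<Rightarrow> (real \<Rightarrow> real) \<Rightarrow> bool" where
  "weak_deriv f g \<longleftrightarrow> L1_loc f \<and> L1_loc g \<and>
     (\<forall>\<phi>. test_fun \<phi> \<longrightarrow>
        (LINT x:{0<..<1}|lebesgue. f x * deriv \<phi> x) = - (LINT x:{0<..<1}|lebesgue. g x * \<phi> x))"

definition weakly_differentiable :: "(real \<Rightarrow> real) \<Rightarrow> bool" where
  "weakly_differentiable f \<longleftrightarrow> (\<exists>g. weak_deriv f g)"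

text \<open>The choice below is immaterial: weak derivatives are unique almost everywhere on the
  interval, and \<^term>\<open>wd f\<close> is only used under integrals or inside \<^const>\<open>weak_deriv\<close>.\<close>

definition wd :: "(real \<Rightarrow> real) \<Rightarrow> real \<Rightarrow> real" where
  "wd f = (SOME g. weak_deriv f g)"

text \<open>The weighted space of square integrable functions; the weight \<open>\<lambda>x. 1\<close> gives the plain space.\<close>

definition L2w :: "(real \<Rightarrow> real) \<Rightarrow> (real \<Rightarrow> real) \<Rightarrow> bool" where
  "L2w \<rho> f \<longleftrightarrow> set_borel_measurable lebesgue {0<..<1} f \<and>
     set_integrable lebesgue {0<..<1} (\<lambda>x. \<rho> x * (f x)\<^sup>2)"

abbreviation L2 :: "(real \<Rightarrow> real) \<Rightarrow> bool" where
  "L2 \<equiv> L2w (\<lambda>x. 1)"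

definition normw :: "(real \<Rightarrow> real) \<Rightarrow> (real \<Rightarrow> real) \<Rightarrow> real" where
  "normw \<rho> f = sqrt (LINT x:{0<..<1}|lebesgue. \<rho> x * (f x)\<^sup>2)"

text \<open>Zero boundary values are understood for the continuous representative. (The pointwise
  equation \<open>a 0 * u 0 = 0\<close> would be void, since \<open>a\<close> vanishes at the end points.)\<close>

definition zero_trace :: "(real \<Rightarrow> real) \<Rightarrow> bool" where
  "zero_trace f \<longleftrightarrow> (\<exists>g. continuous_on {0..1} g \<and>
     (AE x in lebesgue. x \<in> {0<..<1} \<longrightarrow> f x = g x) \<and> g 0 = 0 \<and> g 1 = 0)"

definition H1_0 :: "(real \<Rightarrow> real) \<Rightarrow> bool" where
  "H1_0 f \<longleftrightarrow> L2 f \<and> weakly_differentiable f \<and> L2 (wd f) \<and> zero_trace f"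

section \<open>The weighted spaces with weight \<open>1/a\<close> (for \<open>u\<close>) and \<open>a\<close> (for \<open>m\<close>)\<close>

definition L2_inv :: "(real \<Rightarrow> real) \<Rightarrow> (real \<Rightarrow> real) \<Rightarrow> bool" where
  "L2_inv a u \<longleftrightarrow> L2 u \<and> L2w (\<lambda>x. 1 / a x) u"

definition H1_inv :: "(real \<Rightarrow> real) \<Rightarrow> (real \<Rightarrow> real) \<Rightarrow> bool" where
  "H1_inv a u \<longleftrightarrow> L2_inv a u \<and> H1_0 u"

definition H2_inv :: "(real \<Rightarrow> real) \<Rightarrow> (real \<Rightarrow> real) \<Rightarrow> bool" where
  "H2_inv a u \<longleftrightarrow> H1_inv a u \<and> weakly_differentiable (wd u) \<and>
     L2_inv a (\<lambda>x. a x * wd (wd u) x)"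

definition norm_inv :: "(real \<Rightarrow> real) \<Rightarrow> (real \<Rightarrow> real) \<Rightarrow> real" where
  "norm_inv a u = normw (\<lambda>x. 1 / a x) u"

definition norm1_inv :: "(real \<Rightarrow> real) \<Rightarrow> (real \<Rightarrow> real) \<Rightarrow> real" where
  "norm1_inv a u = sqrt ((norm_inv a u)\<^sup>2 + (normw (\<lambda>x. 1) (wd u))\<^sup>2)"

definition H1_a :: "(real \<Rightarrow> real) \<Rightarrow> (real \<Rightarrow> real) \<Rightarrow> bool" where
  "H1_a a u \<longleftrightarrow> L2w a u \<and> weakly_differentiable (\<lambda>x. a x * u x) \<and>
     L2 (wd (\<lambda>x. a x * u x)) \<and> zero_trace (\<lambda>x. a x * u x)"

definition H2_a :: "(real \<Rightarrow> real) \<Rightarrow> (real \<Rightarrow> real) \<Rightarrow> bool" where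
  "H2_a a u \<longleftrightarrow> H1_a a u \<and> weakly_differentiable (wd (\<lambda>x. a x * u x)) \<and>
     L2w a (wd (wd (\<lambda>x. a x * u x)))"

definition norm_a :: "(real \<Rightarrow> real) \<Rightarrow> (real \<Rightarrow> real) \<Rightarrow> real" where
  "norm_a a u = normw a u"

definition norm1_a :: "(real \<Rightarrow> real) \<Rightarrow> (real \<Rightarrow> real) \<Rightarrow> real" where
  "norm1_a a u = sqrt ((norm_a a u)\<^sup>2 + (normw (\<lambda>x. 1) (wd (\<lambda>x. a x * u x)))\<^sup>2)"

section \<open>Functions on the space-time cylinder\<close>

text \<open>Functions of \<open>(x, t)\<close> are curried, \<open>f x t\<close>; the slice at time \<open>t\<close> is \<open>\<lambda>x. f x t\<close>.\<close>

definition Q :: "real \<Rightarrow> (real \<times> real) set" where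
  "Q T = {0<..<1} \<times> {0<..<T}"

definition AE_Q :: "real \<Rightarrow> (real \<Rightarrow> real \<Rightarrow> bool) \<Rightarrow> bool" where
  "AE_Q T P \<longleftrightarrow> (AE z in lebesgue. z \<in> Q T \<longrightarrow> P (fst z) (snd z))"

definition meas_Q :: "real \<Rightarrow> (real \<Rightarrow> real \<Rightarrow> real) \<Rightarrow> bool" where
  "meas_Q T f \<longleftrightarrow> set_borel_measurable lebesgue (Q T) (\<lambda>z. f (fst z) (snd z))"

definition Linf_le :: "real \<Rightarrow> real \<Rightarrow> (real \<Rightarrow> real \<Rightarrow> real) \<Rightarrow> bool" where
  "Linf_le T B f \<longleftrightarrow> meas_Q T f \<and> AE_Q T (\<lambda>x t. \<bar>f x t\<bar> \<le> B)"

definition Linf :: "real \<Rightarrow> (real \<Rightarrow> real \<Rightarrow> real) \<Rightarrow> bool" where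
  "Linf T f \<longleftrightarrow> (\<exists>B. Linf_le T B f)"

text \<open>\<open>weak_dx T f g\<close>: \<open>g\<close> is a (jointly measurable) weak derivative of \<open>f\<close> in the space variable.\<close>

definition weak_dx :: "real \<Rightarrow> (real \<Rightarrow> real \<Rightarrow> real) \<Rightarrow> (real \<Rightarrow> real \<Rightarrow> real) \<Rightarrow> bool" where
  "weak_dx T f g \<longleftrightarrow> meas_Q T g \<and>
     (AE t in lebesgue. t \<in> {0<..<T} \<longrightarrow> weak_deriv (\<lambda>x. f x t) (\<lambda>x. g x t))"

primrec weak_dx_iter ::
  "real \<Rightarrow> nat \<Rightarrow> (real \<Rightarrow> real \<Rightarrow> real) \<Rightarrow> (real \<Rightarrow> real \<Rightarrow> real) \<Rightarrow> bool" where
  "weak_dx_iter T 0 f g \<longleftrightarrow> g = f"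
| "weak_dx_iter T (Suc l) f g \<longleftrightarrow> (\<exists>h. weak_dx_iter T l f h \<and> weak_dx T h g)"

text \<open>\<open>time_H1 T \<rho> f ft\<close>: \<open>f\<close> is the continuous-in-time representative of an element of
  \<open>H\<^sup>1(0,T; L\<^sup>2\<^sub>\<rho>(0,1))\<close> with time derivative \<open>ft\<close>. In particular all slices \<open>\<lambda>x. f x t\<close> for
  \<open>0 \<le> t \<le> T\<close> are meaningful as elements of \<open>L\<^sup>2\<^sub>\<rho>(0,1)\<close>.\<close>

definition time_H1 ::
  "real \<Rightarrow> (real \<Rightarrow> real) \<Rightarrow> (real \<Rightarrow> real \<Rightarrow> real) \<Rightarrow> (real \<Rightarrow> real \<Rightarrow> real) \<Rightarrow> bool" where
  "time_H1 T \<rho> f ft \<longleftrightarrow> meas_Q T f \<and> meas_Q T ft \<and>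
     (\<forall>t\<in>{0..T}. L2w \<rho> (\<lambda>x. f x t)) \<and>
     set_integrable lebesgue (Q T) (\<lambda>z. \<rho> (fst z) * (ft (fst z) (snd z))\<^sup>2) \<and>
     (\<forall>t\<in>{0..T}. AE x in lebesgue. x \<in> {0<..<1} \<longrightarrow>
        f x t = f x 0 + (LINT s:{0..t}|lebesgue. ft x s))"

section \<open>The degenerate mean field game system\<close>

text \<open>Strong solutions: the equations hold almost everywhere. Here \<open>ut\<close>, \<open>mt\<close> are time derivatives,
  \<open>ux\<close>, \<open>uxx\<close> space derivatives of \<open>u\<close>, \<open>amx\<close>, \<open>amxx\<close> space derivatives of \<open>a m\<close>, and \<open>qx\<close> is the
  space derivative of the flux \<open>p m u\<^sub>x\<close>. The slices belong to the second order spaces for almost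
  every time and to the first order spaces at the two end times, where their norms are used.\<close>

definition mfg_solution ::
  "real \<Rightarrow> (real \<Rightarrow> real) \<Rightarrow> (real \<Rightarrow> real \<Rightarrow> real) \<Rightarrow> (real \<Rightarrow> real \<Rightarrow> real) \<Rightarrow>
   (real \<Rightarrow> real \<Rightarrow> real) \<Rightarrow> (real \<Rightarrow> real \<Rightarrow> real) \<Rightarrow>
   (real \<Rightarrow> real \<Rightarrow> real) \<Rightarrow> (real \<Rightarrow> real \<Rightarrow> real) \<Rightarrow> bool" where
  "mfg_solution T a p d F G u m \<longleftrightarrow>
     (AE t in lebesgue. t \<in> {0<..<T} \<longrightarrow> H2_inv a (\<lambda>x. u x t) \<and> H2_a a (\<lambda>x. m x t)) \<and>
     (\<forall>t\<in>{0, T}. H1_inv a (\<lambda>x. u x t) \<and> H1_a a (\<lambda>x. m x t)) \<and>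
     (\<exists>ut ux uxx mt amx amxx qx.
        time_H1 T (\<lambda>x. 1 / a x) u ut \<and> weak_dx T u ux \<and> weak_dx T ux uxx \<and>
        time_H1 T a m mt \<and> weak_dx T (\<lambda>x t. a x * m x t) amx \<and> weak_dx T amx amxx \<and>
        weak_dx T (\<lambda>x t. p x t * m x t * ux x t) qx \<and>
        AE_Q T (\<lambda>x t. ut x t + a x * uxx x t - p x t / 2 * (ux x t)\<^sup>2 + d x t * m x t = F x t) \<and>
        AE_Q T (\<lambda>x t. mt x t - amxx x t - qx x t = G x t)) \<and>
     (AE t in lebesgue. t \<in> {0<..<T} \<longrightarrow>
        zero_trace (\<lambda>x. u x t) \<and> zero_trace (\<lambda>x. a x * m x t))"

end

theory Submission
  imports Defs
begin

text \<open>Put \<open>v = u\<^sub>2 - u\<^sub>1\<close>, \<open>w = m\<^sub>2 - m\<^sub>1\<close>, so that \<open>w\<^sub>t = ((a w)\<^sub>x + q)\<^sub>x\<close>, where \<open>q\<close> is the difference of the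
  fluxes \<open>p m u\<^sub>x\<close>. The weight \<open>exp (2 s exp (\<lambda> t))\<close> depends on time only. The equation for \<open>v\<close> is
  well-posed backwards in time, and its energy \<open>V = \<integral> v\<^sup>2 / a\<close> satisfies \<open>V' \<ge> \<integral> v\<^sub>x\<^sup>2 - C V - P\<close>
  with \<open>P = \<integral> a w\<^sup>2\<close>; this controls \<open>\<integral> q\<^sup>2\<close>. The equation for \<open>w\<close> is ill-posed backwards. With the
  multiplier method one wants to complete the square of \<open>(a w)\<^sub>x + \<beta> W\<close>, where \<open>W\<close> is a primitive of
  \<open>w\<close>; here \<open>\<integral> (a w)\<^sub>x W = - P\<close>, and \<open>J = \<integral> W\<^sup>2\<close> is differentiated in time as well. The final
  value of \<open>J\<close> must be bounded by that of \<open>P\<close> although \<open>a\<close> vanishes at the end points. So \<open>W\<close> is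
  taken only on finitely many intervals that cover \<open>{2 \<delta> \<le> a}\<close>, on which \<open>a \<ge> \<delta>\<close> and at whose end
  points \<open>a = \<delta>\<close>, and has mean zero on each of them. Then \<open>J T \<le> P T / \<delta>\<close>, and as \<open>w\<close> is bounded,
  the errors from the boundary terms and from the rest of the interval are \<open>O(\<delta>)\<close>. With \<open>\<delta>\<close>
  comparable to the final data, the choice \<open>s \<sim> ln (1 / \<delta>)\<close> gives the Hoelder estimate.\<close>

section \<open>Smooth bump functions\<close>

text \<open>\<open>P\<close> need not control a primitive of \<open>w\<close> up to the ends, where
  \<open>a\<close> may vanish fast. Hence one number \<open>\<delta>\<close> has three roles:
  truncation level of \<open>a\<close>, size of the errors, upper bound for the final norms. The
  estimate is proved for every positive \<open>\<delta>\<close> above the final data; vanishing data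
  are a limit. Origin of the weight: with \<open>z = (a w)_x\<close> one has
  \<open>P' = - 2 \<integral> z (z + q)\<close> and, by the zero means,
  \<open>J' = 2 \<integral> W (z + q)\<close>. For \<open>e = exp (2 s exp (l t))\<close> and
  \<open>b = s l exp (l t)\<close>, \<open>e' = 2 b e\<close> and \<open>b' = l b\<close>, so the
  derivative of \<open>e (P - b J)\<close> contains just the terms that complete the square of
  \<open>z + b W + q / 2\<close>, and \<open>b'\<close> adds \<open>- l b J\<close>, of good sign.
  The hypothesis \<open>|p| \<le> K sqrt a\<close> gives \<open>q^2 \<le> C (a w^2 + v_x^2)\<close>,
  so that \<open>P\<close> rather than \<open>\<integral> w^2\<close> appears; the bound on
  \<open>a_x\<close> keeps \<open>z\<close> bounded. The equations hold almost everywhere only, so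
  the energies are treated as absolutely continuous functions of time, and weak derivatives in space
  are converted to primitives. The bumps serve this conversion.\<close>

definition exp_inv :: "nat \<Rightarrow> real \<Rightarrow> real" where
  "exp_inv k x = (if x > 0 then (1 / x) ^ k * exp (- 1 / x) else 0)"

text \<open>From the right, \<open>y = 1 / x\<close> turns this into
  \<open>y ^ k / exp y \<longrightarrow> 0\<close> at infinity. With \<open>Suc k\<close> in place
  of \<open>k\<close> it is also the limit of the difference quotients of \<open>exp_inv k\<close>
  at \<open>0\<close>.\<close>

lemma exp_inv_tendsto_0: "(exp_inv k \<longlongrightarrow> 0) (at 0)"
proof -
  have "((\<lambda>x::real. inverse x ^ k / exp (inverse x)) \<longlongrightarrow> 0) (at_right 0)"
    by (rule filterlim_compose[OF tendsto_power_div_exp_0 filterlim_inverse_at_top_right])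
  then have "(exp_inv k \<longlongrightarrow> 0) (at_right 0)"
    by (rule Lim_transform_eventually)
       (auto simp: eventually_at_filter exp_inv_def exp_minus field_simps)
  moreover have "(exp_inv k \<longlongrightarrow> 0) (at_left 0)"
    by (rule Lim_transform_eventually[OF tendsto_const])
       (auto simp: eventually_at_filter exp_inv_def)
  ultimately show ?thesis by (rule filterlim_split_at_real[rotated])
qed

text \<open>Differentiating \<open>exp (- 1 / x)\<close> produces powers of \<open>1 / x\<close>; a
  family that carries them is closed under derivatives up to linear combinations, which is what
  \<open>smooth_alg\<close> needs of its generators.\<close>

lemma exp_inv_deriv:
  "(exp_inv k has_real_derivative (exp_inv (k + 2) x - real k * exp_inv (k + 1) x)) (at x)"
proof (cases x "0::real" rule: linorder_cases)
  case less
  have "((\<lambda>_. 0) has_real_derivative 0) (at x)" by simp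
  then have "(exp_inv k has_real_derivative 0) (at x)"
    by (rule has_field_derivative_transform_within_open[where S="{..<0}"])
       (use less in \<open>auto simp: exp_inv_def\<close>)
  with less show ?thesis by (simp add: exp_inv_def)
next
  case equal
  have "((\<lambda>h. (exp_inv k (0 + h) - exp_inv k 0) / h) \<longlongrightarrow> 0) (at 0)"
    by (rule Lim_transform_eventually[OF exp_inv_tendsto_0[of "Suc k"]])
       (auto simp: exp_inv_def eventually_at_filter)
  then have "(exp_inv k has_real_derivative 0) (at 0)"
    by (simp add: DERIV_def)
  with equal show ?thesis by (simp add: exp_inv_def)
next
  case greater
  have "((\<lambda>x. (1 / x) ^ k * exp (- 1 / x)) has_real_derivative
      (exp_inv (k + 2) x - real k * exp_inv (k + 1) x)) (at x)"
    using greater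
    by (auto intro!: derivative_eq_intros
        simp: exp_inv_def divide_simps power_diff power_add power2_eq_square algebra_simps)
       (cases k; auto simp: field_simps)
  then show ?thesis
    by (rule has_field_derivative_transform_within_open[where S="{0<..}"])
       (use greater in \<open>auto simp: exp_inv_def\<close>)
qed

text \<open>An algebra of functions that is closed under derivatives, hence consists of smooth functions.\<close>

inductive smooth_alg :: "(real \<Rightarrow> real) \<Rightarrow> bool" where
  gen: "smooth_alg (\<lambda>x. exp_inv k (c * x + b))"
| const: "smooth_alg (\<lambda>x. c)"
| add: "smooth_alg f \<Longrightarrow> smooth_alg g \<Longrightarrow> smooth_alg (\<lambda>x. f x + g x)"
| mult: "smooth_alg f \<Longrightarrow> smooth_alg g \<Longrightarrow> smooth_alg (\<lambda>x. f x * g x)"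

lemma smooth_alg_has_deriv:
  "smooth_alg f \<Longrightarrow> \<exists>f'. smooth_alg f' \<and> (\<forall>x. (f has_real_derivative f' x) (at x))"
proof (induction rule: smooth_alg.induct)
  case (gen k c b)
  let ?f' = "\<lambda>x. c * (exp_inv (k + 2) (c * x + b) + (- real k) * exp_inv (k + 1) (c * x + b))"
  have "smooth_alg ?f'"
    by (intro smooth_alg.intros)
  moreover have "((\<lambda>x. exp_inv k (c * x + b)) has_real_derivative ?f' x) (at x)" for x
    by (rule DERIV_cong, rule DERIV_chain2[OF exp_inv_deriv])
       (auto intro!: derivative_eq_intros simp: algebra_simps)
  ultimately show ?case by (intro exI[of _ ?f']) blast
next
  case (const c)
  show ?case by (intro exI[of _ "\<lambda>_. 0"]) (auto intro: smooth_alg.intros)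
next
  case (add f g)
  then obtain f' g' where "smooth_alg f'" "smooth_alg g'"
    "\<forall>x. (f has_real_derivative f' x) (at x)" "\<forall>x. (g has_real_derivative g' x) (at x)"
    by blast
  then show ?case
    by (intro exI[of _ "\<lambda>x. f' x + g' x"]) (auto intro: smooth_alg.intros DERIV_add)
next
  case (mult f g)
  then obtain f' g' where "smooth_alg f'" "smooth_alg g'"
    "\<forall>x. (f has_real_derivative f' x) (at x)" "\<forall>x. (g has_real_derivative g' x) (at x)"
    by blast
  with mult show ?case
    by (intro exI[of _ "\<lambda>x. f' x * g x + g' x * f x"]) (auto intro: smooth_alg.intros DERIV_mult)
qed

lemma smooth_alg_higher_deriv: "smooth_alg f \<Longrightarrow> smooth_alg ((deriv ^^ k) f)"
proof (induction k)
  case (Suc k)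
  then obtain f' where "smooth_alg f'" "\<forall>x. ((deriv ^^ k) f has_real_derivative f' x) (at x)"
    using smooth_alg_has_deriv by blast
  moreover from this have "deriv ((deriv ^^ k) f) = f'"
    by (auto intro: DERIV_imp_deriv)
  ultimately show ?case by simp
qed simp

lemma smooth_alg_differentiable: "smooth_alg f \<Longrightarrow> f differentiable (at x)"
  by (meson smooth_alg_has_deriv real_differentiable_def)

lemma smooth_alg_continuous: "smooth_alg f \<Longrightarrow> continuous_on A f"
  by (meson smooth_alg_differentiable differentiable_imp_continuous_within continuous_at_imp_continuous_on)

lemma smooth_alg_test_fun:
  assumes "smooth_alg f" "0 < \<alpha>" "\<beta> < 1" "\<And>x. x \<notin> {\<alpha>..\<beta>} \<Longrightarrow> f x = 0"
  shows "test_fun f"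
  unfolding test_fun_def
  using assms smooth_alg_differentiable[OF smooth_alg_higher_deriv[OF assms(1)]] by blast

text \<open>A primitive of a function in \<open>smooth_alg\<close> is not known to lie in
  \<open>smooth_alg\<close> itself; its derivatives of positive order do, so only order
  \<open>0\<close> is treated apart.\<close>

lemma test_fun_primitive:
  assumes "smooth_alg f" "0 < \<alpha>" "\<beta> < 1" "\<And>x. x \<notin> {\<alpha>..\<beta>} \<Longrightarrow> f x = 0"
    and "\<And>x. (\<phi> has_real_derivative f x) (at x)" "\<And>x. x \<notin> {\<alpha>..\<beta>} \<Longrightarrow> \<phi> x = 0"
  shows "test_fun \<phi>" "deriv \<phi> = f"
proof -
  show d: "deriv \<phi> = f" using assms(5) by (auto intro: DERIV_imp_deriv)
  have "(deriv ^^ k) \<phi> differentiable (at x)" for k x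
  proof (cases k)
    case 0
    then show ?thesis using assms(5) by (auto simp: real_differentiable_def)
  next
    case (Suc j)
    then have "(deriv ^^ k) \<phi> = (deriv ^^ j) f" by (simp add: funpow_Suc_right d del: funpow.simps)
    then show ?thesis using smooth_alg_differentiable[OF smooth_alg_higher_deriv[OF assms(1)]] by simp
  qed
  then show "test_fun \<phi>" unfolding test_fun_def using assms by blast
qed

text \<open>Two flat steps facing each other. The arguments are written as \<open>c * x + b\<close>
  to match the generators of \<open>smooth_alg\<close>, and a larger \<open>n\<close> makes the
  edges steeper, so that bumps approximate indicators.\<close>

definition bump :: "nat \<Rightarrow> real \<Rightarrow> real \<Rightarrow> real \<Rightarrow> real" where
  "bump n \<alpha> \<beta> x = exp_inv 0 (real n * x + (- real n * \<alpha>)) * exp_inv 0 ((- real n) * x + real n * \<beta>)"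

lemma smooth_alg_bump: "smooth_alg (bump n \<alpha> \<beta>)"
  unfolding bump_def[abs_def] by (intro smooth_alg.intros)

lemma bump_range: "0 \<le> bump n \<alpha> \<beta> x" "bump n \<alpha> \<beta> x \<le> 1"
proof -
  have *: "0 \<le> exp_inv 0 y" "exp_inv 0 y \<le> 1" for y by (auto simp: exp_inv_def)
  show "0 \<le> bump n \<alpha> \<beta> x" "bump n \<alpha> \<beta> x \<le> 1"
    unfolding bump_def by (auto intro!: mult_nonneg_nonneg mult_le_one *)
qed

lemma bump_outside: "x \<notin> {\<alpha><..<\<beta>} \<Longrightarrow> bump n \<alpha> \<beta> x = 0"
proof -
  assume "x \<notin> {\<alpha><..<\<beta>}"
  then consider "x \<le> \<alpha>" | "\<beta> \<le> x" by fastforce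
  then have "real n * (x - \<alpha>) \<le> 0 \<or> real n * (\<beta> - x) \<le> 0"
    by cases (auto intro: mult_nonneg_nonpos)
  then show ?thesis
    by (auto simp: bump_def exp_inv_def algebra_simps)
qed

lemma bump_pos: "n > 0 \<Longrightarrow> x \<in> {\<alpha><..<\<beta>} \<Longrightarrow> 0 < bump n \<alpha> \<beta> x"
  by (auto simp: bump_def exp_inv_def algebra_simps)

text \<open>Inside the interval each factor has the form \<open>exp (- 1 / (n * y))\<close>, where
  \<open>y > 0\<close> is the distance of \<open>x\<close> to an end point, and tends to
  \<open>1\<close>.\<close>

lemma bump_tendsto_indicator: "(\<lambda>n. bump n \<alpha> \<beta> x) \<longlonglongrightarrow> indicator {\<alpha><..<\<beta>} x"
proof (cases "x \<in> {\<alpha><..<\<beta>}")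
  case False
  then show ?thesis by (simp add: bump_outside)
next
  case True
  have lim: "(\<lambda>n. exp (- (1 / y) / real n)) \<longlonglongrightarrow> 1" for y :: real
    using tendsto_exp[OF lim_const_over_n[of "- (1/y)"]] by simp
  have "(\<lambda>n. exp (- (1 / (x - \<alpha>)) / real n) * exp (- (1 / (\<beta> - x)) / real n)) \<longlonglongrightarrow> 1 * 1"
    by (intro tendsto_mult lim)
  moreover have "eventually (\<lambda>n. exp (- (1 / (x - \<alpha>)) / real n) * exp (- (1 / (\<beta> - x)) / real n)
      = bump n \<alpha> \<beta> x) sequentially"
    using eventually_gt_at_top[of 0]
  proof eventually_elim
    case (elim n)
    have e: "real n * x + - real n * \<alpha> = real n * (x - \<alpha>)" "- real n * x + real n * \<beta> = real n * (\<beta> - x)"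
      by (auto simp: algebra_simps)
    show ?case unfolding bump_def e using True elim by (simp add: exp_inv_def mult.commute)
  qed
  ultimately show ?thesis using True by (simp add: Lim_transform_eventually)
qed

section \<open>Integration by parts for primitives\<close>

lemma AE_lebesgue_iff: "(AE x in lebesgue. P x) \<longleftrightarrow> (AE x in lborel. P x)"
  by (rule AE_completion_iff)

lemma set_integrable_bounded_mult:
  fixes f g :: "'a \<Rightarrow> real"
  assumes "set_integrable M A g" "set_borel_measurable M A f" "AE x in M. x \<in> A \<longrightarrow> \<bar>f x\<bar> \<le> B"
  shows "set_integrable M A (\<lambda>x. f x * g x)"
proof (rule set_integrable_bound[where f="\<lambda>x. B * g x"])
  show "set_integrable M A (\<lambda>x. B * g x)" using assms(1) by simp
  have "(\<lambda>x. indicator A x *\<^sub>R g x) \<in> borel_measurable M"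
    using assms(1) by (auto simp: set_integrable_def)
  moreover have "(\<lambda>x. indicator A x *\<^sub>R f x) \<in> borel_measurable M"
    using assms(2) by (simp add: set_borel_measurable_def)
  ultimately have "(\<lambda>x. (indicator A x *\<^sub>R f x) * (indicator A x *\<^sub>R g x)) \<in> borel_measurable M"
    by measurable
  moreover have "(\<lambda>x. (indicator A x *\<^sub>R f x) * (indicator A x *\<^sub>R g x)) = (\<lambda>x. indicator A x *\<^sub>R (f x * g x))"
    by (auto simp: indicator_def)
  ultimately show "set_borel_measurable M A (\<lambda>x. f x * g x)"
    by (simp add: set_borel_measurable_def)
  show "AE x in M. x \<in> A \<longrightarrow> norm (f x * g x) \<le> norm (B * g x)"
    using assms(3) by eventually_elim (auto simp: abs_mult intro!: mult_right_mono)
qed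

text \<open>The hypotheses speak of Lebesgue measurability, whereas product measures and Fubini are
  used for Borel functions on \<open>lborel\<close>; this is the passage between the two.\<close>

lemma lebesgue_borel_rep:
  fixes f :: "'a::euclidean_space \<Rightarrow> real"
  assumes "set_borel_measurable lebesgue A f" and A: "A \<in> sets borel"
  obtains f0 where "f0 \<in> borel_measurable borel" "AE x in lborel. f0 x = indicator A x * f x"
    "\<And>x. x \<notin> A \<Longrightarrow> f0 x = 0"
proof -
  have "(\<lambda>x. indicator A x * f x) \<in> borel_measurable lebesgue"
    using assms(1) by (simp add: set_borel_measurable_def)
  from completion_ex_borel_measurable_real[OF this]
  obtain g where g: "g \<in> borel_measurable lborel" "AE x in lborel. indicator A x * f x = g x" by blast
  show ?thesis
  proof (rule that)
    show "(\<lambda>x. indicator A x * g x) \<in> borel_measurable borel" using g(1) A by simp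
    show "AE x in lborel. indicator A x * g x = indicator A x * f x"
      using g(2) by eventually_elim (auto simp: indicator_def split: if_splits)
  qed simp
qed

lemma set_integral_rep:
  fixes f :: "'a::euclidean_space \<Rightarrow> real"
  assumes f0: "f0 \<in> borel_measurable borel" "AE x in lborel. f0 x = indicator A x * f x"
    and B: "B \<in> sets borel" "B \<subseteq> A"
  shows "set_integrable lebesgue B f \<longleftrightarrow> set_integrable lborel B f0"
    and "(LINT x:B|lebesgue. f x) = (LINT x:B|lborel. f0 x)"
proof -
  have m: "(\<lambda>x. indicator B x *\<^sub>R f0 x) \<in> borel_measurable lborel" using f0 B by simp
  have ae: "AE x in lebesgue. indicator B x *\<^sub>R f0 x = indicator B x *\<^sub>R f x"
    unfolding AE_lebesgue_iff using f0(2) by eventually_elim (use B(2) in \<open>auto simp: indicator_def\<close>)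
  have m': "(\<lambda>x. indicator B x *\<^sub>R f0 x) \<in> borel_measurable lebesgue"
    using m by (rule measurable_completion)
  have m2: "(\<lambda>x. indicator B x *\<^sub>R f x) \<in> borel_measurable lebesgue"
    by (rule borel_measurable_AE[OF m' ae])
  have ae': "AE x in lebesgue. indicator B x *\<^sub>R f x = indicator B x *\<^sub>R f0 x"
    using ae by eventually_elim (rule sym)
  have "set_integrable lebesgue B f \<longleftrightarrow> integrable lebesgue (\<lambda>x. indicator B x *\<^sub>R f0 x)"
    unfolding set_integrable_def by (rule integrable_cong_AE[OF m2 m' ae'])
  also have "\<dots> \<longleftrightarrow> integrable lborel (\<lambda>x. indicator B x *\<^sub>R f0 x)"
    by (rule integrable_completion[OF m])
  finally show "set_integrable lebesgue B f \<longleftrightarrow> set_integrable lborel B f0"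
    by (simp add: set_integrable_def)
  have "(LINT x:B|lebesgue. f x) = integral\<^sup>L lebesgue (\<lambda>x. indicator B x *\<^sub>R f0 x)"
    unfolding set_lebesgue_integral_def
    by (rule integral_cong_AE[OF m2 m' ae'])
  also have "\<dots> = integral\<^sup>L lborel (\<lambda>x. indicator B x *\<^sub>R f0 x)"
    by (rule integral_completion[OF m])
  finally show "(LINT x:B|lebesgue. f x) = (LINT x:B|lborel. f0 x)"
    by (simp add: set_lebesgue_integral_def)
qed

lemma (in pair_sigma_finite) integrable_prod_mult:
  fixes f g :: "_ \<Rightarrow> real"
  assumes f: "integrable M1 f" and g: "integrable M2 g"
  shows "integrable (M1 \<Otimes>\<^sub>M M2) (\<lambda>(x, y). f x * g y)"
proof (rule Fubini_integrable)
  have [measurable]: "f \<in> borel_measurable M1" "g \<in> borel_measurable M2" using f g by auto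
  show "(\<lambda>(x, y). f x * g y) \<in> borel_measurable (M1 \<Otimes>\<^sub>M M2)" by measurable
  show "integrable M1 (\<lambda>x. LINT y|M2. norm (case (x, y) of (x, y) \<Rightarrow> f x * g y))"
    by (simp add: abs_mult integrable_abs[OF f])
  show "AE x in M1. integrable M2 (\<lambda>y. case (x, y) of (x, y) \<Rightarrow> f x * g y)"
    by (intro AE_I2) (use integrable_mult_right[OF g] in simp)
qed

text \<open>Fubini for \<open>f x * g y\<close> on the plane, cut along the diagonal: each half is
  one of the two iterated integrals on the left.\<close>

lemma parts_lborel:
  fixes f g :: "real \<Rightarrow> real"
  assumes f: "integrable lborel f" and g: "integrable lborel g"
  shows "integrable lborel (\<lambda>x. f x * (LINT y:{..x}|lborel. g y))"
    and "(LINT x|lborel. f x * (LINT y:{..x}|lborel. g y)) + (LINT x|lborel. g x * (LINT y:{..x}|lborel. f y))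
      = (LINT x|lborel. f x) * (LINT x|lborel. g x)"
proof -
  have [measurable]: "f \<in> borel_measurable borel" "g \<in> borel_measurable borel" using f g by auto
  have I: "integrable (lborel \<Otimes>\<^sub>M lborel) (\<lambda>(x, y). f x * g y)"
    by (rule lborel_pair.integrable_prod_mult[OF f g])
  have I1: "integrable (lborel \<Otimes>\<^sub>M lborel) (\<lambda>(x::real, y). f x * (indicator {..x} y * g y))"
    by (rule Bochner_Integration.integrable_bound[OF I]) (auto simp: indicator_def)
  have I2: "integrable (lborel \<Otimes>\<^sub>M lborel) (\<lambda>(x, y::real). indicator {..<y} x * f x * g y)"
    by (rule Bochner_Integration.integrable_bound[OF I]) (auto simp: indicator_def)
  show "integrable lborel (\<lambda>x. f x * (LINT y:{..x}|lborel. g y))"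
    using lborel_pair.integrable_fst[OF I1] by (simp add: set_lebesgue_integral_def)
  have "(LINT x|lborel. f x) * (LINT x|lborel. g x) = (LINT x|lborel. LINT y|lborel. f x * g y)"
    by simp
  also have "\<dots> = integral\<^sup>L (lborel \<Otimes>\<^sub>M lborel) (\<lambda>(x, y). f x * g y)"
    by (rule lborel_pair.integral_fst[OF I])
  also have "\<dots> = integral\<^sup>L (lborel \<Otimes>\<^sub>M lborel)
      (\<lambda>z. (case z of (x, y) \<Rightarrow> f x * (indicator {..x} y * g y)) + (case z of (x, y) \<Rightarrow> indicator {..<y} x * f x * g y))"
    by (intro Bochner_Integration.integral_cong) (auto simp: indicator_def)
  also have "\<dots> = integral\<^sup>L (lborel \<Otimes>\<^sub>M lborel) (\<lambda>(x, y). f x * (indicator {..x} y * g y)) +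
      integral\<^sup>L (lborel \<Otimes>\<^sub>M lborel) (\<lambda>(x, y). indicator {..<y} x * f x * g y)"
    by (rule Bochner_Integration.integral_add[OF I1 I2])
  also have "integral\<^sup>L (lborel \<Otimes>\<^sub>M lborel) (\<lambda>(x, y). f x * (indicator {..x} y * g y))
      = (LINT x|lborel. f x * (LINT y:{..x}|lborel. g y))"
    using lborel_pair.integral_fst[OF I1] by (simp add: set_lebesgue_integral_def)
  also have "integral\<^sup>L (lborel \<Otimes>\<^sub>M lborel) (\<lambda>(x, y). indicator {..<y} x * f x * g y)
      = (LINT y|lborel. g y * (LINT x|lborel. indicator {..<y} x * f x))"
    using lborel_pair.integral_snd[OF I2] by (simp add: mult.commute)
  also have "\<dots> = (LINT y|lborel. g y * (LINT x:{..y}|lborel. f x))"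
  proof -
    \<comment> \<open>The diagonal belongs to only one of the halves; in each section it is a single
      point, hence a null set.\<close>
    have "(LINT x|lborel. indicator {..<y} x * f x) = (LINT x:{..y}|lborel. f x)" for y
      unfolding set_lebesgue_integral_def
      by (intro integral_cong_AE) (use AE_lborel_singleton[of y] in \<open>auto simp: indicator_def\<close>)
    then show ?thesis by simp
  qed
  finally show "(LINT x|lborel. f x * (LINT y:{..x}|lborel. g y)) + (LINT x|lborel. g x * (LINT y:{..x}|lborel. f y))
      = (LINT x|lborel. f x) * (LINT x|lborel. g x)" by simp
qed

lemma primitive_continuous:
  fixes f F :: "real \<Rightarrow> real"
  assumes "set_integrable lebesgue {\<alpha>..\<beta>} f"
    and "\<And>x. x \<in> {\<alpha>..\<beta>} \<Longrightarrow> F x = c + (LINT y:{\<alpha>..x}|lebesgue. f y)"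
  shows "continuous_on {\<alpha>..\<beta>} F"
proof -
  have "continuous_on {\<alpha>..\<beta>} (\<lambda>x. c + integral {\<alpha>..x} f)"
    by (intro continuous_intros indefinite_integral_continuous_1 set_lebesgue_integral_eq_integral(1) assms(1))
  moreover have "F x = c + integral {\<alpha>..x} f" if "x \<in> {\<alpha>..\<beta>}" for x
    using assms(2)[OF that]
    by (subst set_lebesgue_integral_eq_integral(2)[symmetric])
       (use that in \<open>auto intro!: set_integrable_subset[OF assms(1)]\<close>)
  ultimately show ?thesis by (subst continuous_on_cong[OF refl]) auto
qed

lemma continuous_set_borel_measurable:
  fixes F :: "real \<Rightarrow> real"
  assumes "continuous_on A F" "A \<in> sets borel"
  shows "set_borel_measurable lebesgue A F"
proof -
  have "(\<lambda>x. indicator A x *\<^sub>R F x) \<in> borel_measurable borel"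
    using borel_measurable_continuous_on_indicator[OF assms(2,1)] .
  then show ?thesis unfolding set_borel_measurable_def
    by (intro measurable_completion) simp
qed

lemma continuous_mult_set_integrable:
  fixes F g :: "real \<Rightarrow> real"
  assumes "continuous_on {\<alpha>..\<beta>} F" "set_integrable lebesgue {\<alpha>..\<beta>} g"
  shows "set_integrable lebesgue {\<alpha>..\<beta>} (\<lambda>x. F x * g x)"
proof -
  have "bounded (F ` {\<alpha>..\<beta>})" using assms(1) by (intro compact_imp_bounded compact_continuous_image) auto
  then obtain B where "\<forall>x\<in>{\<alpha>..\<beta>}. \<bar>F x\<bar> \<le> B" by (auto simp: bounded_iff)
  then show ?thesis
    by (intro set_integrable_bounded_mult[where B=B] assms continuous_set_borel_measurable) auto
qed

text \<open>Integration by parts for absolutely continuous functions, whose classical derivative may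
  fail to exist at some points. The densities are extended by zero to the line and the initial
  values \<open>F \<alpha>\<close>, \<open>G \<alpha>\<close> are split off, which leaves
  \<open>parts_lborel\<close>.\<close>

lemma parts:
  fixes f g F G :: "real \<Rightarrow> real"
  assumes ab: "\<alpha> \<le> \<beta>" and f: "set_integrable lebesgue {\<alpha>..\<beta>} f" and g: "set_integrable lebesgue {\<alpha>..\<beta>} g"
    and F: "\<And>x. x \<in> {\<alpha>..\<beta>} \<Longrightarrow> F x = F \<alpha> + (LINT y:{\<alpha>..x}|lebesgue. f y)"
    and G: "\<And>x. x \<in> {\<alpha>..\<beta>} \<Longrightarrow> G x = G \<alpha> + (LINT y:{\<alpha>..x}|lebesgue. g y)"
  shows "set_integrable lebesgue {\<alpha>..\<beta>} (\<lambda>x. F x * g x)"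
    and "set_integrable lebesgue {\<alpha>..\<beta>} (\<lambda>x. f x * G x)"
    and "(LINT x:{\<alpha>..\<beta>}|lebesgue. F x * g x) + (LINT x:{\<alpha>..\<beta>}|lebesgue. f x * G x) = F \<beta> * G \<beta> - F \<alpha> * G \<alpha>"
proof -
  have cF: "continuous_on {\<alpha>..\<beta>} F" by (rule primitive_continuous[OF f F])
  have cG: "continuous_on {\<alpha>..\<beta>} G" by (rule primitive_continuous[OF g G])
  show i1: "set_integrable lebesgue {\<alpha>..\<beta>} (\<lambda>x. F x * g x)"
    by (rule continuous_mult_set_integrable[OF cF g])
  show i2: "set_integrable lebesgue {\<alpha>..\<beta>} (\<lambda>x. f x * G x)"
    using continuous_mult_set_integrable[OF cG f] by (simp add: mult.commute)
  have fm: "set_borel_measurable lebesgue {\<alpha>..\<beta>} f" "set_borel_measurable lebesgue {\<alpha>..\<beta>} g"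
    using f g unfolding set_integrable_def set_borel_measurable_def by auto
  obtain f0 where f0: "f0 \<in> borel_measurable borel" "AE x in lborel. f0 x = indicator {\<alpha>..\<beta>} x * f x"
      "\<And>x. x \<notin> {\<alpha>..\<beta>} \<Longrightarrow> f0 x = 0" using lebesgue_borel_rep[OF fm(1)] by auto
  obtain g0 where g0: "g0 \<in> borel_measurable borel" "AE x in lborel. g0 x = indicator {\<alpha>..\<beta>} x * g x"
      "\<And>x. x \<notin> {\<alpha>..\<beta>} \<Longrightarrow> g0 x = 0" using lebesgue_borel_rep[OF fm(2)] by auto
  have z: "indicator {\<alpha>..\<beta>} x * f0 x = f0 x" "indicator {\<alpha>..\<beta>} x * g0 x = g0 x" for x
    using f0(3) g0(3) by (auto simp: indicator_def)
  have intf: "integrable lborel f0" and intg: "integrable lborel g0"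
    using set_integral_rep(1)[OF f0(1,2), of "{\<alpha>..\<beta>}"] f set_integral_rep(1)[OF g0(1,2), of "{\<alpha>..\<beta>}"] g
    by (auto simp: set_integrable_def z)
  have Fx: "F x = F \<alpha> + (LINT y:{..x}|lborel. f0 y)" if "x \<in> {\<alpha>..\<beta>}" for x
  proof -
    have "(LINT y:{..x}|lborel. f0 y) = (LINT y:{\<alpha>..x}|lborel. f0 y)"
      unfolding set_lebesgue_integral_def using f0(3) that
      by (intro Bochner_Integration.integral_cong) (auto simp: indicator_def)
    then show ?thesis using F[OF that] set_integral_rep(2)[OF f0(1,2), of "{\<alpha>..x}"] that by auto
  qed
  have Gx: "G x = G \<alpha> + (LINT y:{..x}|lborel. g0 y)" if "x \<in> {\<alpha>..\<beta>}" for x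
  proof -
    have "(LINT y:{..x}|lborel. g0 y) = (LINT y:{\<alpha>..x}|lborel. g0 y)"
      unfolding set_lebesgue_integral_def using g0(3) that
      by (intro Bochner_Integration.integral_cong) (auto simp: indicator_def)
    then show ?thesis using G[OF that] set_integral_rep(2)[OF g0(1,2), of "{\<alpha>..x}"] that by auto
  qed
  have tot: "(LINT y:{..\<beta>}|lborel. f0 y) = (LINT y|lborel. f0 y)" "(LINT y:{..\<beta>}|lborel. g0 y) = (LINT y|lborel. g0 y)"
    unfolding set_lebesgue_integral_def using f0(3) g0(3)
    by (intro Bochner_Integration.integral_cong; auto simp: indicator_def)+
  note P = parts_lborel[OF intf intg] and P' = parts_lborel[OF intg intf]
  have e1: "(LINT x:{\<alpha>..\<beta>}|lebesgue. F x * g x) = (LINT x|lborel. F \<alpha> * g0 x + g0 x * (LINT y:{..x}|lborel. f0 y))"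
  proof -
    have "(LINT x:{\<alpha>..\<beta>}|lebesgue. F x * g x) = (LINT x:{\<alpha>..\<beta>}|lborel. F \<alpha> * g0 x + g0 x * (LINT y:{..x}|lborel. f0 y))"
    proof (rule set_integral_rep(2)[where A="{\<alpha>..\<beta>}"])
      show "(\<lambda>x. F \<alpha> * g0 x + g0 x * (LINT y:{..x}|lborel. f0 y)) \<in> borel_measurable borel"
        using P'(1) intg by (auto dest!: borel_measurable_integrable)
      show "AE x in lborel. F \<alpha> * g0 x + g0 x * (LINT y:{..x}|lborel. f0 y) = indicator {\<alpha>..\<beta>} x * (F x * g x)"
        using g0(2)
      proof eventually_elim
        case (elim x)
        then show ?case using g0(3)[of x] Fx[of x] by (cases "x \<in> {\<alpha>..\<beta>}") (simp_all add: algebra_simps)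
      qed
    qed auto
    also have "\<dots> = (LINT x|lborel. F \<alpha> * g0 x + g0 x * (LINT y:{..x}|lborel. f0 y))"
      unfolding set_lebesgue_integral_def
    proof (intro Bochner_Integration.integral_cong refl)
      fix x show "indicator {\<alpha>..\<beta>} x *\<^sub>R (F \<alpha> * g0 x + g0 x * (LINT y|lborel. indicator {..x} y *\<^sub>R f0 y))
        = F \<alpha> * g0 x + g0 x * (LINT y|lborel. indicator {..x} y *\<^sub>R f0 y)"
        using g0(3)[of x] by (cases "x \<in> {\<alpha>..\<beta>}") auto
    qed
    finally show ?thesis .
  qed
  have e2: "(LINT x:{\<alpha>..\<beta>}|lebesgue. f x * G x) = (LINT x|lborel. G \<alpha> * f0 x + f0 x * (LINT y:{..x}|lborel. g0 y))"
  proof -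
    have "(LINT x:{\<alpha>..\<beta>}|lebesgue. f x * G x) = (LINT x:{\<alpha>..\<beta>}|lborel. G \<alpha> * f0 x + f0 x * (LINT y:{..x}|lborel. g0 y))"
    proof (rule set_integral_rep(2)[where A="{\<alpha>..\<beta>}"])
      show "(\<lambda>x. G \<alpha> * f0 x + f0 x * (LINT y:{..x}|lborel. g0 y)) \<in> borel_measurable borel"
        using P(1) intf by (auto dest!: borel_measurable_integrable)
      show "AE x in lborel. G \<alpha> * f0 x + f0 x * (LINT y:{..x}|lborel. g0 y) = indicator {\<alpha>..\<beta>} x * (f x * G x)"
        using f0(2)
      proof eventually_elim
        case (elim x)
        then show ?case using f0(3)[of x] Gx[of x] by (cases "x \<in> {\<alpha>..\<beta>}") (simp_all add: algebra_simps)
      qed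
    qed auto
    also have "\<dots> = (LINT x|lborel. G \<alpha> * f0 x + f0 x * (LINT y:{..x}|lborel. g0 y))"
      unfolding set_lebesgue_integral_def
    proof (intro Bochner_Integration.integral_cong refl)
      fix x show "indicator {\<alpha>..\<beta>} x *\<^sub>R (G \<alpha> * f0 x + f0 x * (LINT y|lborel. indicator {..x} y *\<^sub>R g0 y))
        = G \<alpha> * f0 x + f0 x * (LINT y|lborel. indicator {..x} y *\<^sub>R g0 y)"
        using f0(3)[of x] by (cases "x \<in> {\<alpha>..\<beta>}") auto
    qed
    finally show ?thesis .
  qed
  have "(LINT x:{\<alpha>..\<beta>}|lebesgue. F x * g x) + (LINT x:{\<alpha>..\<beta>}|lebesgue. f x * G x)
    = F \<alpha> * (LINT x|lborel. g0 x) + G \<alpha> * (LINT x|lborel. f0 x) + (LINT x|lborel. f0 x) * (LINT x|lborel. g0 x)"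
    unfolding e1 e2 using intf intg P P' by simp
  also have "\<dots> = F \<beta> * G \<beta> - F \<alpha> * G \<alpha>"
    using Fx[of \<beta>] Gx[of \<beta>] ab by (simp add: tot algebra_simps)
  finally show "(LINT x:{\<alpha>..\<beta>}|lebesgue. F x * g x) + (LINT x:{\<alpha>..\<beta>}|lebesgue. f x * G x) = F \<beta> * G \<beta> - F \<alpha> * G \<alpha>" .
qed

text \<open>The positive and the negative part of \<open>h\<close> are densities of two finite
  measures that agree on all half-lines, hence everywhere. Then the densities agree almost
  everywhere, and \<open>max 0 y = max 0 (- y)\<close> holds only for \<open>y = 0\<close>.\<close>

lemma AE_zero_if_primitive_zero:
  fixes h :: "real \<Rightarrow> real"
  assumes h: "set_integrable lebesgue {\<alpha>..\<beta>} h"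
    and zero: "\<And>x. x \<in> {\<alpha>..\<beta>} \<Longrightarrow> (LINT y:{x..\<beta>}|lebesgue. h y) = 0"
  shows "AE x in lebesgue. x \<in> {\<alpha>..\<beta>} \<longrightarrow> h x = 0"
proof (cases "\<alpha> \<le> \<beta>")
  case ab: True
  have "set_borel_measurable lebesgue {\<alpha>..\<beta>} h"
    using h unfolding set_integrable_def set_borel_measurable_def by auto
  then obtain f where f: "f \<in> borel_measurable borel" "AE x in lborel. f x = indicator {\<alpha>..\<beta>} x * h x"
    "\<And>x. x \<notin> {\<alpha>..\<beta>} \<Longrightarrow> f x = 0" using lebesgue_borel_rep by (metis atLeastAtMost_borel)
  note [measurable] = f(1)
  have z: "indicator {\<alpha>..\<beta>} x * f x = f x" for x using f(3) by (auto simp: indicator_def)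
  have intf: "integrable lborel f"
    using set_integral_rep(1)[OF f(1,2), of "{\<alpha>..\<beta>}"] h by (simp add: set_integrable_def z)
  have fz: "(LINT y|lborel. indicator {x<..} y * f y) = 0" for x
  proof -
    have "(LINT y|lborel. indicator {x<..} y * f y) = (LINT y:{max x \<alpha>..\<beta>}|lborel. f y)"
      unfolding set_lebesgue_integral_def using f(3)
      by (intro integral_cong_AE) (use AE_lborel_singleton[of x] in \<open>auto simp: indicator_def\<close>)
    also have "\<dots> = 0"
    proof (cases "max x \<alpha> \<le> \<beta>")
      case True
      then show ?thesis using set_integral_rep(2)[OF f(1,2), of "{max x \<alpha>..\<beta>}"] zero[of "max x \<alpha>"] by auto
    next
      case False
      then show ?thesis by (simp add: set_lebesgue_integral_def)
    qed
    finally show ?thesis .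
  qed
  have fin: "integrable lborel (\<lambda>y. indicator {x<..} y * max 0 (f y))"
    "integrable lborel (\<lambda>y. indicator {x<..} y * max 0 (- f y))" for x
    by (rule Bochner_Integration.integrable_bound[OF intf]; auto intro!: always_eventually simp: indicator_def)+
  have em: "emeasure (density lborel (\<lambda>y. ennreal (max 0 (g y)))) {x<..}
      = ennreal (LINT y|lborel. indicator {x<..} y * max 0 (g y))"
    if "integrable lborel (\<lambda>y. indicator {x<..} y * max 0 (g y))" "g \<in> borel_measurable borel"
    for g :: "real \<Rightarrow> real" and x
  proof -
    have "emeasure (density lborel (\<lambda>y. ennreal (max 0 (g y)))) {x<..} = (\<integral>\<^sup>+ y. ennreal (indicator {x<..} y * max 0 (g y)) \<partial>lborel)"
      using that by (subst emeasure_density) (auto intro!: nn_integral_cong simp: indicator_def)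
    also have "\<dots> = ennreal (LINT y|lborel. indicator {x<..} y * max 0 (g y))"
      by (rule nn_integral_eq_integral[OF that(1)]) auto
    finally show ?thesis .
  qed
  have eq: "(LINT y|lborel. indicator {x<..} y * max 0 (f y)) = (LINT y|lborel. indicator {x<..} y * max 0 (- f y))" for x
  proof -
    have "(LINT y|lborel. indicator {x<..} y * max 0 (f y)) - (LINT y|lborel. indicator {x<..} y * max 0 (- f y))
      = (LINT y|lborel. indicator {x<..} y * f y)"
      by (subst Bochner_Integration.integral_diff[symmetric, OF fin])
         (auto intro!: Bochner_Integration.integral_cong simp: indicator_def)
    then show ?thesis using fz by simp
  qed
  have "density lborel (\<lambda>y. ennreal (max 0 (f y))) = density lborel (\<lambda>y. ennreal (max 0 (- f y)))"
    by (rule measure_eqI_lessThan) (auto simp: em[OF fin(1)] em[OF fin(2)] eq)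
  then have "AE x in lborel. ennreal (max 0 (f x)) = ennreal (max 0 (- f x))"
    by (subst (asm) sigma_finite_measure.density_unique_iff[OF sigma_finite_lborel]) auto
  then have "AE x in lborel. f x = 0" by eventually_elim (auto simp: max_def split: if_splits)
  then have "AE x in lborel. x \<in> {\<alpha>..\<beta>} \<longrightarrow> h x = 0"
    using f(2) by eventually_elim (auto simp: indicator_def)
  then show ?thesis by (simp add: AE_lebesgue_iff)
qed auto

section \<open>Weak derivatives and absolutely continuous representatives\<close>

text \<open>Local on compact subintervals, so nothing is demanded at \<open>0\<close> and
  \<open>1\<close>, where \<open>g\<close> may fail to be integrable; boundary values enter only
  through \<open>zero_trace\<close>.\<close>

definition ac_rep :: "(real \<Rightarrow> real) \<Rightarrow> (real \<Rightarrow> real) \<Rightarrow> bool" where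
  "ac_rep F g \<longleftrightarrow> (\<forall>\<alpha> \<beta>. 0 < \<alpha> \<longrightarrow> \<alpha> \<le> \<beta> \<longrightarrow> \<beta> < 1 \<longrightarrow>
     set_integrable lebesgue {\<alpha>..\<beta>} g \<and> F \<beta> - F \<alpha> = (LINT x:{\<alpha>..\<beta>}|lebesgue. g x))"

lemma ac_repD:
  assumes "ac_rep F g" "0 < \<alpha>" "\<alpha> \<le> \<beta>" "\<beta> < 1"
  shows "set_integrable lebesgue {\<alpha>..\<beta>} g" "F \<beta> = F \<alpha> + (LINT x:{\<alpha>..\<beta>}|lebesgue. g x)"
proof -
  have "set_integrable lebesgue {\<alpha>..\<beta>} g \<and> F \<beta> - F \<alpha> = (LINT x:{\<alpha>..\<beta>}|lebesgue. g x)"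
    using assms unfolding ac_rep_def by blast
  then show "set_integrable lebesgue {\<alpha>..\<beta>} g" "F \<beta> = F \<alpha> + (LINT x:{\<alpha>..\<beta>}|lebesgue. g x)"
    by linarith+
qed

lemma ac_rep_L1_loc: "ac_rep F g \<Longrightarrow> L1_loc g"
  unfolding L1_loc_def ac_rep_def
  by (metis atLeastatMost_empty linorder_le_less_linear set_integrable_empty)

lemma L1_loc_ac_rep:
  assumes "L1_loc g"
  obtains F where "ac_rep F g"
proof
  \<comment> \<open>The base point is interior because \<open>g\<close> need not be integrable up to
    \<open>0\<close>; one of the two integrals always runs over an empty or degenerate
    interval.\<close>
  define F where "F x = integral {1/2..x} g - integral {x..1/2} g" for x :: real
  have i: "g integrable_on {\<alpha>..\<beta>}" if "0 < \<alpha>" "\<beta> < 1" for \<alpha> \<beta>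
    using assms that set_lebesgue_integral_eq_integral(1) unfolding L1_loc_def by blast
  have FL: "F x = - integral {x..1/2} g" if "x \<le> 1/2" for x
  proof (cases "x < 1/2")
    case False
    with that have "x = 1/2" by simp
    then show ?thesis unfolding F_def \<open>x = 1/2\<close> by simp
  qed (simp add: F_def)
  have FR: "F x = integral {1/2..x} g" if "1/2 \<le> x" for x
  proof (cases "1/2 < x")
    case False
    with that have "x = 1/2" by simp
    then show ?thesis unfolding F_def \<open>x = 1/2\<close> by simp
  qed (simp add: F_def)
  show "ac_rep F g"
    unfolding ac_rep_def
  proof (intro allI impI conjI)
    fix \<alpha> \<beta> :: real assume ab: "0 < \<alpha>" "\<alpha> \<le> \<beta>" "\<beta> < 1"
    show s: "set_integrable lebesgue {\<alpha>..\<beta>} g" using assms ab by (auto simp: L1_loc_def)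
    have "F \<beta> - F \<alpha> = integral {\<alpha>..\<beta>} g"
    proof -
      consider "\<beta> \<le> 1/2" | "\<alpha> \<le> 1/2" "1/2 \<le> \<beta>" | "1/2 \<le> \<alpha>" by linarith
      then show ?thesis
      proof cases
        case 1
        have "integral {\<alpha>..\<beta>} g + integral {\<beta>..1/2} g = integral {\<alpha>..1/2} g"
          by (rule Henstock_Kurzweil_Integration.integral_combine) (use 1 ab in \<open>auto intro: i\<close>)
        with 1 ab show ?thesis using FL[of \<alpha>] FL[of \<beta>] by linarith
      next
        case 2
        have "integral {\<alpha>..1/2} g + integral {1/2..\<beta>} g = integral {\<alpha>..\<beta>} g"
          by (rule Henstock_Kurzweil_Integration.integral_combine) (use 2 ab in \<open>auto intro: i\<close>)
        with 2 ab show ?thesis using FL[of \<alpha>] FR[of \<beta>] by linarith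
      next
        case 3
        have "integral {1/2..\<alpha>} g + integral {\<alpha>..\<beta>} g = integral {1/2..\<beta>} g"
          by (rule Henstock_Kurzweil_Integration.integral_combine) (use 3 ab in \<open>auto intro: i\<close>)
        with 3 ab show ?thesis using FR[of \<alpha>] FR[of \<beta>] by linarith
      qed
    qed
    then show "F \<beta> - F \<alpha> = (LINT x:{\<alpha>..\<beta>}|lebesgue. g x)"
      using set_lebesgue_integral_eq_integral(2)[OF s] by simp
  qed
qed

text \<open>A compact exhaustion of the open interval; the shift by \<open>2\<close> makes the first
  member the point \<open>1 / 2\<close>, so that none is empty.\<close>

definition inner_interval :: "nat \<Rightarrow> real set" where
  "inner_interval n = {1 / real (n + 2)..1 - 1 / real (n + 2)}"

lemma inner_interval_bounds: "0 < 1 / real (n + 2)" "1 - 1 / real (n + 2) < 1"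
  "1 / real (n + 2) \<le> 1 - 1 / real (n + 2)"
  by (auto simp: field_simps)

lemma inner_interval_cover: "{0<..<1} = (\<Union>n. inner_interval n)"
proof (intro set_eqI iffI)
  fix x :: real assume x: "x \<in> {0<..<1}"
  obtain n where "inverse (real (Suc n)) < min x (1 - x)"
    using reals_Archimedean[of "min x (1 - x)"] x by auto
  moreover have "1 / real (n + 2) \<le> inverse (real (Suc n))" by (auto simp: field_simps)
  ultimately show "x \<in> (\<Union>n. inner_interval n)"
    unfolding inner_interval_def by (intro UN_I[of n]) auto
next
  fix x assume "x \<in> (\<Union>n. inner_interval n)"
  then obtain n where "x \<in> inner_interval n" by blast
  then show "x \<in> {0<..<1}"
    using inner_interval_bounds[of n] unfolding inner_interval_def atLeastAtMost_iff greaterThanLessThan_iff by linarith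
qed

lemma inner_interval_eventually:
  assumes "x \<in> {0<..<1}"
  shows "eventually (\<lambda>n. x \<in> inner_interval n) sequentially"
proof -
  have "(\<lambda>n. 1 / real (n + 2)) \<longlonglongrightarrow> 0"
    using LIMSEQ_ignore_initial_segment[OF lim_1_over_n, of 2] by simp
  then have "eventually (\<lambda>n. 1 / real (n + 2) < min x (1 - x)) sequentially"
    by (rule order_tendstoD) (use assms in auto)
  then show ?thesis by eventually_elim (auto simp: inner_interval_def)
qed

lemma L1_loc_inner: "L1_loc f \<Longrightarrow> set_integrable lebesgue (inner_interval n) f"
  unfolding L1_loc_def inner_interval_def using inner_interval_bounds by blast

lemma L1_loc_measurable:
  assumes "L1_loc f"
  shows "set_borel_measurable lebesgue {0<..<1} f"
proof -
  have "(\<lambda>x. indicator {0<..<1} x *\<^sub>R f x) \<in> borel_measurable lebesgue"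
  proof (rule borel_measurable_LIMSEQ_real)
    show "(\<lambda>x. indicator (inner_interval n) x *\<^sub>R f x) \<in> borel_measurable lebesgue" for n
      using L1_loc_inner[OF assms] unfolding set_integrable_def by auto
    fix x :: real
    show "(\<lambda>n. indicator (inner_interval n) x *\<^sub>R f x) \<longlonglongrightarrow> indicator {0<..<1} x *\<^sub>R f x"
    proof (cases "x \<in> {0<..<1}")
      case True
      show ?thesis
        by (rule tendsto_eventually)
           (use inner_interval_eventually[OF True] True in \<open>auto elim: eventually_mono simp: indicator_def\<close>)
    next
      case False
      then have "x \<notin> inner_interval n" for n using inner_interval_cover by auto
      with False show ?thesis by simp
    qed
  qed
  then show ?thesis by (simp add: set_borel_measurable_def)
qed

lemma set_integrable_const_Icc: "set_integrable lebesgue {\<alpha>..\<beta>::real} (\<lambda>_. c::real)"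
proof -
  have "continuous_on {\<alpha>..\<beta>} (\<lambda>_. c)" by simp
  then show ?thesis by (rule absolutely_integrable_continuous_real)
qed

lemma L1_loc_cong_AE:
  assumes "L1_loc f" "AE x in lebesgue. x \<in> {0<..<1} \<longrightarrow> f x = g x"
  shows "L1_loc g"
  unfolding L1_loc_def
proof (intro allI impI)
  fix \<alpha> \<beta> :: real assume ab: "0 < \<alpha>" "\<beta> < 1"
  have f: "integrable lebesgue (\<lambda>x. indicator {\<alpha>..\<beta>} x *\<^sub>R f x)"
    using assms(1) ab by (auto simp: L1_loc_def set_integrable_def)
  have ae: "AE x in lebesgue. indicator {\<alpha>..\<beta>} x *\<^sub>R f x = indicator {\<alpha>..\<beta>} x *\<^sub>R g x"
    using assms(2) by eventually_elim (use ab in \<open>auto simp: indicator_def\<close>)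
  have "(\<lambda>x. indicator {\<alpha>..\<beta>} x *\<^sub>R g x) \<in> borel_measurable lebesgue"
    by (rule borel_measurable_AE[OF _ ae]) (use f in auto)
  then show "set_integrable lebesgue {\<alpha>..\<beta>} g"
    unfolding set_integrable_def using integrable_cong_AE[OF _ _ ae] f by blast
qed

lemma L1_loc_add: "L1_loc f \<Longrightarrow> L1_loc g \<Longrightarrow> L1_loc (\<lambda>x. f x + g x)"
  and L1_loc_diff: "L1_loc f \<Longrightarrow> L1_loc g \<Longrightarrow> L1_loc (\<lambda>x. f x - g x)"
  unfolding L1_loc_def by auto

lemma continuous_L1_loc:
  assumes "continuous_on {0<..<1} f" shows "L1_loc f"
  unfolding L1_loc_def
proof (intro allI impI)
  fix \<alpha> \<beta> :: real assume ab: "0 < \<alpha>" "\<beta> < 1"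
  have "continuous_on {\<alpha>..\<beta>} f" by (rule continuous_on_subset[OF assms]) (use ab in auto)
  then show "set_integrable lebesgue {\<alpha>..\<beta>} f" by (rule absolutely_integrable_continuous_real)
qed

lemma set_integral_support:
  fixes f :: "real \<Rightarrow> real"
  assumes "\<And>x. x \<in> A \<Longrightarrow> x \<notin> B \<Longrightarrow> f x = 0" "B \<subseteq> A"
  shows "(LINT x:A|M. f x) = (LINT x:B|M. f x)" "set_integrable M A f \<longleftrightarrow> set_integrable M B f"
proof -
  have "(\<lambda>x. indicator A x *\<^sub>R f x) = (\<lambda>x. indicator B x *\<^sub>R f x)"
    using assms by (auto simp: indicator_def fun_eq_iff)
  then show "(LINT x:A|M. f x) = (LINT x:B|M. f x)" "set_integrable M A f \<longleftrightarrow> set_integrable M B f"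
    by (simp_all add: set_lebesgue_integral_def set_integrable_def)
qed

lemma L1_loc_mult_continuous:
  assumes "L1_loc f" "0 < \<alpha>" "\<beta> < 1" "\<And>x. x \<notin> {\<alpha>..\<beta>} \<Longrightarrow> \<psi> x = 0" "continuous_on {\<alpha>..\<beta>} \<psi>"
  shows "set_integrable lebesgue {0<..<1} (\<lambda>x. f x * \<psi> x)"
proof -
  have "set_integrable lebesgue {\<alpha>..\<beta>} (\<lambda>x. \<psi> x * f x)"
    using assms by (intro continuous_mult_set_integrable) (auto simp: L1_loc_def)
  then show ?thesis
    by (subst set_integral_support(2)[where B="{\<alpha>..\<beta>}"]) (use assms in \<open>auto simp: mult.commute\<close>)
qed

section \<open>Testing with intervals, bumps and test functions\<close>

lemma AE_zero_if_intervals_zero: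
  assumes h: "L1_loc h" and z: "\<And>\<alpha> \<beta>. 0 < \<alpha> \<Longrightarrow> \<alpha> < \<beta> \<Longrightarrow> \<beta> < 1 \<Longrightarrow> (LINT x:{\<alpha>..\<beta>}|lebesgue. h x) = 0"
  shows "AE x in lebesgue. x \<in> {0<..<1} \<longrightarrow> h x = 0"
proof -
  have "AE x in lebesgue. x \<in> inner_interval n \<longrightarrow> h x = 0" for n
    unfolding inner_interval_def
  proof (rule AE_zero_if_primitive_zero)
    show "set_integrable lebesgue {1 / real (n + 2)..1 - 1 / real (n + 2)} h"
      using L1_loc_inner[OF h, of n] by (simp add: inner_interval_def)
    fix x assume x: "x \<in> {1 / real (n + 2)..1 - 1 / real (n + 2)}"
    show "(LINT y:{x..1 - 1 / real (n + 2)}|lebesgue. h y) = 0"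
    proof (cases "x = 1 - 1 / real (n + 2)")
      case True
      have "AE y in lebesgue. indicator {x..x} y *\<^sub>R h y = 0"
        unfolding AE_lebesgue_iff using AE_lborel_singleton[of x] by eventually_elim (auto simp: indicator_def)
      then show ?thesis unfolding True[symmetric] set_lebesgue_integral_def
        by (rule integral_eq_zero_AE)
    next
      case False
      with x inner_interval_bounds[of n] show ?thesis
        unfolding atLeastAtMost_iff by (intro z) linarith+
    qed
  qed
  then have "AE x in lebesgue. \<forall>n. x \<in> inner_interval n \<longrightarrow> h x = 0" by (intro AE_all_countable[THEN iffD2] allI)
  then show ?thesis by eventually_elim (use inner_interval_cover in auto)
qed

text \<open>Bumps stay in \<open>{0..1}\<close> and tend to the indicator of their interval, so
  dominated convergence replaces them by intervals.\<close>

lemma AE_zero_if_bump_zero: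
  assumes h: "L1_loc h" and z: "\<And>n \<alpha> \<beta>. 0 < \<alpha> \<Longrightarrow> \<alpha> < \<beta> \<Longrightarrow> \<beta> < 1 \<Longrightarrow> (LINT x:{0<..<1}|lebesgue. h x * bump n \<alpha> \<beta> x) = 0"
  shows "AE x in lebesgue. x \<in> {0<..<1} \<longrightarrow> h x = 0"
proof (rule AE_zero_if_intervals_zero[OF h])
  fix \<alpha> \<beta> :: real assume ab: "0 < \<alpha>" "\<alpha> < \<beta>" "\<beta> < 1"
  have i: "integrable lebesgue (\<lambda>x. indicator {\<alpha>..\<beta>} x *\<^sub>R h x)"
    using h ab by (auto simp: L1_loc_def set_integrable_def)
  have bm: "bump n \<alpha> \<beta> \<in> borel_measurable lebesgue" for n
    by (intro measurable_completion)
       (use smooth_alg_continuous[OF smooth_alg_bump[of n \<alpha> \<beta>], of UNIV] in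
         \<open>auto intro: borel_measurable_continuous_onI\<close>)
  have "(\<lambda>n. LINT x|lebesgue. (indicator {\<alpha>..\<beta>} x *\<^sub>R h x) * bump n \<alpha> \<beta> x)
    \<longlonglongrightarrow> (LINT x|lebesgue. (indicator {\<alpha>..\<beta>} x *\<^sub>R h x) * indicator {\<alpha><..<\<beta>} x)"
  proof (rule integral_dominated_convergence[where w="\<lambda>x. norm (indicator {\<alpha>..\<beta>} x *\<^sub>R h x)"])
    show "(\<lambda>x. (indicator {\<alpha>..\<beta>} x *\<^sub>R h x) * indicator {\<alpha><..<\<beta>} x) \<in> borel_measurable lebesgue"
      using i by (intro borel_measurable_times borel_measurable_indicator) auto
    show "(\<lambda>x. (indicator {\<alpha>..\<beta>} x *\<^sub>R h x) * bump n \<alpha> \<beta> x) \<in> borel_measurable lebesgue" for n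
      using i bm[of n] by (intro borel_measurable_times) auto
    show "integrable lebesgue (\<lambda>x. norm (indicator {\<alpha>..\<beta>} x *\<^sub>R h x))"
      using i by (rule integrable_norm)
    show "AE x in lebesgue. (\<lambda>n. (indicator {\<alpha>..\<beta>} x *\<^sub>R h x) * bump n \<alpha> \<beta> x) \<longlonglongrightarrow> (indicator {\<alpha>..\<beta>} x *\<^sub>R h x) * indicator {\<alpha><..<\<beta>} x"
      by (intro AE_I2 tendsto_mult tendsto_const bump_tendsto_indicator)
    show "AE x in lebesgue. norm ((indicator {\<alpha>..\<beta>} x *\<^sub>R h x) * bump n \<alpha> \<beta> x) \<le> norm (indicator {\<alpha>..\<beta>} x *\<^sub>R h x)" for n
      using bump_range[of n \<alpha> \<beta>]
      by (intro AE_I2) (auto simp: abs_mult intro!: mult_left_le)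
  qed
  moreover have "(LINT x|lebesgue. (indicator {\<alpha>..\<beta>} x *\<^sub>R h x) * bump n \<alpha> \<beta> x) = 0" for n
  proof -
    have "(LINT x|lebesgue. (indicator {\<alpha>..\<beta>} x *\<^sub>R h x) * bump n \<alpha> \<beta> x) = (LINT x:{\<alpha>..\<beta>}|lebesgue. h x * bump n \<alpha> \<beta> x)"
      by (simp add: set_lebesgue_integral_def mult.assoc)
    also have "\<dots> = (LINT x:{0<..<1}|lebesgue. h x * bump n \<alpha> \<beta> x)"
      by (rule set_integral_support(1)[symmetric]) (use ab in \<open>auto intro: bump_outside\<close>)
    finally show ?thesis using z[OF ab] by simp
  qed
  ultimately have "(LINT x|lebesgue. (indicator {\<alpha>..\<beta>} x *\<^sub>R h x) * indicator {\<alpha><..<\<beta>} x) = 0"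
    by (simp add: LIMSEQ_const_iff)
  moreover have "(LINT x|lebesgue. (indicator {\<alpha>..\<beta>} x *\<^sub>R h x) * indicator {\<alpha><..<\<beta>} x) = (LINT x:{\<alpha>..\<beta>}|lebesgue. h x)"
    unfolding set_lebesgue_integral_def
  proof (rule integral_cong_AE)
    show "(\<lambda>x. (indicator {\<alpha>..\<beta>} x *\<^sub>R h x) * indicator {\<alpha><..<\<beta>} x) \<in> borel_measurable lebesgue"
      using i by (intro borel_measurable_times borel_measurable_indicator) auto
    show "AE x in lebesgue. indicat_real {\<alpha>..\<beta>} x *\<^sub>R h x * indicat_real {\<alpha><..<\<beta>} x = indicat_real {\<alpha>..\<beta>} x *\<^sub>R h x"
      unfolding AE_lebesgue_iff using AE_lborel_singleton[of \<alpha>] AE_lborel_singleton[of \<beta>]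
      by eventually_elim (auto simp: indicator_def)
  qed (use i in auto)
  ultimately show "(LINT x:{\<alpha>..\<beta>}|lebesgue. h x) = 0" by simp
qed

lemma test_funD:
  assumes "test_fun \<phi>"
  obtains \<alpha> \<beta> where "0 < \<alpha>" "\<alpha> < \<beta>" "\<beta> < 1" "\<And>x. x \<notin> {\<alpha><..<\<beta>} \<Longrightarrow> \<phi> x = 0"
    "\<And>x. x \<notin> {\<alpha>..\<beta>} \<Longrightarrow> deriv \<phi> x = 0" "\<And>x. (\<phi> has_real_derivative deriv \<phi> x) (at x)"
    "continuous_on A \<phi>" "continuous_on B (deriv \<phi>)"
proof -
  have d: "(deriv ^^ k) \<phi> differentiable (at x)" for k x using assms by (simp add: test_fun_def)
  obtain \<alpha> \<beta> where ab: "0 < \<alpha>" "\<beta> < 1" "\<And>x. x \<notin> {\<alpha>..\<beta>} \<Longrightarrow> \<phi> x = 0"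
    using assms unfolding test_fun_def by blast
  \<comment> \<open>\<open>test_fun\<close> permits an empty or degenerate
    \<open>{\<alpha>..\<beta>}\<close>. Enlarging it around \<open>1 / 2\<close> gives
    \<open>\<alpha>' < \<beta>'\<close>, and \<open>\<phi>\<close> vanishes at the new end points
    too, which removes boundary terms later.\<close>
  define \<alpha>' \<beta>' where "\<alpha>' = min \<alpha> (1/2) / 2" and "\<beta>' = (max \<beta> (1/2) + 1) / 2"
  show ?thesis
  proof (rule that[of \<alpha>' \<beta>'])
    show "0 < \<alpha>'" "\<alpha>' < \<beta>'" "\<beta>' < 1" using ab by (auto simp: \<alpha>'_def \<beta>'_def)
    have out: "y \<notin> {\<alpha>..\<beta>}" if "y \<notin> {\<alpha>'<..<\<beta>'}" for y
      using that ab(1,2) by (auto simp: \<alpha>'_def \<beta>'_def min_def max_def split: if_splits)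
    show "\<phi> x = 0" if "x \<notin> {\<alpha>'<..<\<beta>'}" for x
      by (intro ab(3) out that)
    show der: "(\<phi> has_real_derivative deriv \<phi> x) (at x)" for x
      using d[of 0 x] by (auto simp: DERIV_deriv_iff_real_differentiable)
    show "deriv \<phi> x = 0" if x: "x \<notin> {\<alpha>'..\<beta>'}" for x
    proof -
      have "((\<lambda>_. 0) has_real_derivative 0) (at x)" by simp
      then have "(\<phi> has_real_derivative 0) (at x)"
      proof (rule has_field_derivative_transform_within_open[where S="- {\<alpha>'..\<beta>'}"])
        show "0 = \<phi> y" if "y \<in> - {\<alpha>'..\<beta>'}" for y using ab(3)[OF out[of y]] that by auto
      qed (use x in auto)
      then show ?thesis by (rule DERIV_imp_deriv)
    qed
    show "continuous_on A \<phi>" using der by (meson DERIV_isCont continuous_at_imp_continuous_on)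
    show "continuous_on B (deriv \<phi>)" using d[of 1]
      by (auto intro!: continuous_at_imp_continuous_on differentiable_imp_continuous_within)
  qed
qed

lemma test_fun_integrable:
  assumes "test_fun \<phi>" "L1_loc f"
  shows "set_integrable lebesgue {0<..<1} (\<lambda>x. f x * \<phi> x)"
    "set_integrable lebesgue {0<..<1} (\<lambda>x. f x * deriv \<phi> x)"
proof -
  obtain \<alpha> \<beta> where t: "0 < \<alpha>" "\<alpha> < \<beta>" "\<beta> < 1" "\<And>x. x \<notin> {\<alpha><..<\<beta>} \<Longrightarrow> \<phi> x = 0"
    "\<And>x. x \<notin> {\<alpha>..\<beta>} \<Longrightarrow> deriv \<phi> x = 0" "\<And>x. (\<phi> has_real_derivative deriv \<phi> x) (at x)"
    "continuous_on UNIV \<phi>" "continuous_on UNIV (deriv \<phi>)"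
    using test_funD[OF assms(1), of UNIV UNIV] by metis
  show "set_integrable lebesgue {0<..<1} (\<lambda>x. f x * \<phi> x)"
    by (rule L1_loc_mult_continuous[OF assms(2) t(1,3)])
       (use t in \<open>auto intro: continuous_on_subset\<close>)
  show "set_integrable lebesgue {0<..<1} (\<lambda>x. f x * deriv \<phi> x)"
    by (rule L1_loc_mult_continuous[OF assms(2) t(1,3)])
       (use t in \<open>auto intro: continuous_on_subset\<close>)
qed

lemma ac_rep_continuous:
  assumes "ac_rep F g" shows "continuous_on {0<..<1} F"
proof -
  have "isCont F x" if x: "x \<in> {0<..<1}" for x
  proof -
    define \<alpha> \<beta> where "\<alpha> = x / 2" and "\<beta> = (x + 1) / 2"
    have ab: "0 < \<alpha>" "\<alpha> < x" "x < \<beta>" "\<beta> < 1" using x by (auto simp: \<alpha>_def \<beta>_def)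
    have "continuous_on {\<alpha>..\<beta>} F"
      by (rule primitive_continuous[where f=g and c="F \<alpha>"]; rule ac_repD[OF assms]) (use ab in auto)
    then show ?thesis using ab by (intro continuous_on_interior) auto
  qed
  then show ?thesis by (simp add: continuous_at_imp_continuous_on)
qed

lemma ac_rep_test_fun:
  assumes F: "ac_rep F g" and "test_fun \<phi>"
  shows "(LINT x:{0<..<1}|lebesgue. F x * deriv \<phi> x) = - (LINT x:{0<..<1}|lebesgue. g x * \<phi> x)"
proof -
  obtain \<alpha> \<beta> where t: "0 < \<alpha>" "\<alpha> < \<beta>" "\<beta> < 1" "\<And>x. x \<notin> {\<alpha><..<\<beta>} \<Longrightarrow> \<phi> x = 0"
    "\<And>x. x \<notin> {\<alpha>..\<beta>} \<Longrightarrow> deriv \<phi> x = 0" "\<And>x. (\<phi> has_real_derivative deriv \<phi> x) (at x)"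
    "continuous_on UNIV \<phi>" "continuous_on UNIV (deriv \<phi>)"
    using test_funD[OF assms(2), of UNIV UNIV] by metis
  have si: "set_integrable lebesgue {\<alpha>..\<gamma>} (deriv \<phi>)" for \<gamma>
    by (rule absolutely_integrable_continuous_real) (rule continuous_on_subset[OF t(8) subset_UNIV])
  have FTC: "\<phi> x = \<phi> \<alpha> + (LINT y:{\<alpha>..x}|lebesgue. deriv \<phi> y)" if "x \<in> {\<alpha>..\<beta>}" for x
  proof -
    have "(deriv \<phi> has_integral (\<phi> x - \<phi> \<alpha>)) {\<alpha>..x}"
      by (rule fundamental_theorem_of_calculus)
         (use that t(6) in \<open>auto simp: has_real_derivative_iff_has_vector_derivative[symmetric]
            intro: has_field_derivative_at_within\<close>)
    then show ?thesis using set_lebesgue_integral_eq_integral(2)[OF si[of x]] by (simp add: integral_unique)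
  qed
  have "(LINT x:{\<alpha>..\<beta>}|lebesgue. F x * deriv \<phi> x) + (LINT x:{\<alpha>..\<beta>}|lebesgue. g x * \<phi> x) = F \<beta> * \<phi> \<beta> - F \<alpha> * \<phi> \<alpha>"
  proof (rule parts(3)[OF _ _ si _ FTC])
    show "\<alpha> \<le> \<beta>" using t by simp
    show "set_integrable lebesgue {\<alpha>..\<beta>} g" by (rule ac_repD[OF F]) (use t in auto)
    show "F x = F \<alpha> + (LINT y:{\<alpha>..x}|lebesgue. g y)" if "x \<in> {\<alpha>..\<beta>}" for x
      by (rule ac_repD[OF F]) (use t that in auto)
  qed
  then have "(LINT x:{\<alpha>..\<beta>}|lebesgue. F x * deriv \<phi> x) = - (LINT x:{\<alpha>..\<beta>}|lebesgue. g x * \<phi> x)"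
    using t(4)[of \<alpha>] t(4)[of \<beta>] by simp
  moreover have "(LINT x:{0<..<1}|lebesgue. F x * deriv \<phi> x) = (LINT x:{\<alpha>..\<beta>}|lebesgue. F x * deriv \<phi> x)"
    by (rule set_integral_support(1)) (use t in auto)
  moreover have "(LINT x:{0<..<1}|lebesgue. g x * \<phi> x) = (LINT x:{\<alpha>..\<beta>}|lebesgue. g x * \<phi> x)"
    by (rule set_integral_support(1)) (use t in auto)
  ultimately show ?thesis by simp
qed

text \<open>Lebesgue measure is complete, so measurability passes along almost everywhere equality
  and need not be assumed on either side.\<close>

lemma set_integral_cong_lebesgue:
  fixes f g :: "'a::euclidean_space \<Rightarrow> real"
  assumes "AE x in lebesgue. x \<in> A \<longrightarrow> f x = g x"
  shows "set_integrable lebesgue A f \<longleftrightarrow> set_integrable lebesgue A g"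
    "(LINT x:A|lebesgue. f x) = (LINT x:A|lebesgue. g x)"
    "set_borel_measurable lebesgue A f \<longleftrightarrow> set_borel_measurable lebesgue A g"
proof -
  have ae: "AE x in lebesgue. indicator A x *\<^sub>R f x = indicator A x *\<^sub>R g x"
    using assms by eventually_elim (auto simp: indicator_def)
  have ae': "AE x in lebesgue. indicator A x *\<^sub>R g x = indicator A x *\<^sub>R f x"
    using assms by eventually_elim (auto simp: indicator_def)
  have m: "(\<lambda>x. indicator A x *\<^sub>R f x) \<in> borel_measurable lebesgue \<longleftrightarrow> (\<lambda>x. indicator A x *\<^sub>R g x) \<in> borel_measurable lebesgue"
    using borel_measurable_AE[OF _ ae] borel_measurable_AE[OF _ ae'] by blast
  then show "set_borel_measurable lebesgue A f \<longleftrightarrow> set_borel_measurable lebesgue A g"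
    by (simp add: set_borel_measurable_def)
  show i: "set_integrable lebesgue A f \<longleftrightarrow> set_integrable lebesgue A g"
    unfolding set_integrable_def
    using m integrable_cong_AE[OF _ _ ae] borel_measurable_integrable by blast
  show "(LINT x:A|lebesgue. f x) = (LINT x:A|lebesgue. g x)"
  proof (cases "set_integrable lebesgue A f")
    case True
    then show ?thesis using i unfolding set_lebesgue_integral_def set_integrable_def
      by (intro integral_cong_AE[OF _ _ ae]) auto
  next
    \<comment> \<open>If one function is not integrable, neither is the other, and both integrals
      take the default value \<open>0\<close>.\<close>
    case False
    then show ?thesis using i unfolding set_lebesgue_integral_def set_integrable_def
      by (simp add: not_integrable_integral_eq)
  qed
qed

section \<open>Calculus and uniqueness of weak derivatives\<close>

lemma weak_derivD:
  assumes "weak_deriv f g"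
  shows "L1_loc f" "L1_loc g"
    "test_fun \<phi> \<Longrightarrow> (LINT x:{0<..<1}|lebesgue. f x * deriv \<phi> x) = - (LINT x:{0<..<1}|lebesgue. g x * \<phi> x)"
  using assms by (auto simp: weak_deriv_def)

lemma weak_deriv_cong_AE:
  assumes "weak_deriv f g" "AE x in lebesgue. x \<in> {0<..<1} \<longrightarrow> f x = f' x"
    "AE x in lebesgue. x \<in> {0<..<1} \<longrightarrow> g x = g' x"
  shows "weak_deriv f' g'"
  unfolding weak_deriv_def
proof (intro conjI allI impI)
  show "L1_loc f'" "L1_loc g'" using assms weak_derivD L1_loc_cong_AE by blast+
  fix \<phi> assume "test_fun \<phi>"
  have "(LINT x:{0<..<1}|lebesgue. f x * deriv \<phi> x) = (LINT x:{0<..<1}|lebesgue. f' x * deriv \<phi> x)"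
    by (rule set_integral_cong_lebesgue) (use assms(2) in \<open>eventually_elim, auto\<close>)
  moreover have "(LINT x:{0<..<1}|lebesgue. g x * \<phi> x) = (LINT x:{0<..<1}|lebesgue. g' x * \<phi> x)"
    by (rule set_integral_cong_lebesgue) (use assms(3) in \<open>eventually_elim, auto\<close>)
  ultimately show "(LINT x:{0<..<1}|lebesgue. f' x * deriv \<phi> x) = - (LINT x:{0<..<1}|lebesgue. g' x * \<phi> x)"
    using weak_derivD(3)[OF assms(1) \<open>test_fun \<phi>\<close>] by simp
qed

lemma weak_deriv_add:
  assumes "weak_deriv f f'" "weak_deriv g g'"
  shows "weak_deriv (\<lambda>x. f x + g x) (\<lambda>x. f' x + g' x)"
  unfolding weak_deriv_def
proof (intro conjI allI impI)
  note L = weak_derivD(1,2)[OF assms(1)] weak_derivD(1,2)[OF assms(2)]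
  show "L1_loc (\<lambda>x. f x + g x)" "L1_loc (\<lambda>x. f' x + g' x)" using L by (auto intro: L1_loc_add)
  fix \<phi> assume t: "test_fun \<phi>"
  show "(LINT x:{0<..<1}|lebesgue. (f x + g x) * deriv \<phi> x) = - (LINT x:{0<..<1}|lebesgue. (f' x + g' x) * \<phi> x)"
    using weak_derivD(3)[OF assms(1) t] weak_derivD(3)[OF assms(2) t]
      test_fun_integrable[OF t L(1)] test_fun_integrable[OF t L(2)] test_fun_integrable[OF t L(3)] test_fun_integrable[OF t L(4)]
    by (simp add: distrib_right set_integral_add)
qed

lemma weak_deriv_diff:
  assumes "weak_deriv f f'" "weak_deriv g g'"
  shows "weak_deriv (\<lambda>x. f x - g x) (\<lambda>x. f' x - g' x)"
  unfolding weak_deriv_def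
proof (intro conjI allI impI)
  note L = weak_derivD(1,2)[OF assms(1)] weak_derivD(1,2)[OF assms(2)]
  show "L1_loc (\<lambda>x. f x - g x)" "L1_loc (\<lambda>x. f' x - g' x)" using L by (auto intro: L1_loc_diff)
  fix \<phi> assume t: "test_fun \<phi>"
  show "(LINT x:{0<..<1}|lebesgue. (f x - g x) * deriv \<phi> x) = - (LINT x:{0<..<1}|lebesgue. (f' x - g' x) * \<phi> x)"
    using weak_derivD(3)[OF assms(1) t] weak_derivD(3)[OF assms(2) t]
      test_fun_integrable[OF t L(1)] test_fun_integrable[OF t L(2)] test_fun_integrable[OF t L(3)] test_fun_integrable[OF t L(4)]
    by (simp add: left_diff_distrib set_integral_diff)
qed

lemma test_fun_bump:
  assumes "0 < \<alpha>" "\<beta> < 1" shows "test_fun (bump n \<alpha> \<beta>)"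
  by (rule smooth_alg_test_fun[OF smooth_alg_bump assms]) (auto intro: bump_outside)

lemma weak_deriv_unique:
  assumes "weak_deriv f g1" "weak_deriv f g2"
  shows "AE x in lebesgue. x \<in> {0<..<1} \<longrightarrow> g1 x = g2 x"
proof -
  note L = weak_derivD(2)[OF assms(1)] weak_derivD(2)[OF assms(2)]
  have "AE x in lebesgue. x \<in> {0<..<1} \<longrightarrow> g1 x - g2 x = 0"
  proof (rule AE_zero_if_bump_zero)
    show "L1_loc (\<lambda>x. g1 x - g2 x)" using L by (rule L1_loc_diff)
    fix n and \<alpha> \<beta> :: real assume "0 < \<alpha>" "\<alpha> < \<beta>" "\<beta> < 1"
    then have t: "test_fun (bump n \<alpha> \<beta>)" by (intro test_fun_bump)
    show "(LINT x:{0<..<1}|lebesgue. (g1 x - g2 x) * bump n \<alpha> \<beta> x) = 0"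
      using weak_derivD(3)[OF assms(1) t] weak_derivD(3)[OF assms(2) t]
        test_fun_integrable(1)[OF t L(1)] test_fun_integrable(1)[OF t L(2)]
      by (simp add: left_diff_distrib set_integral_diff)
  qed
  then show ?thesis by eventually_elim auto
qed

text \<open>Zero mean is exactly the condition under which the primitive that vanishes to the left
  of the support vanishes to its right as well.\<close>

lemma smooth_alg_primitive:
  assumes \<eta>: "smooth_alg \<eta>" and ab: "0 < \<alpha>" "\<alpha> \<le> \<beta>" "\<beta> < 1" and supp: "\<And>x. x \<notin> {\<alpha>..\<beta>} \<Longrightarrow> \<eta> x = 0"
    and zero: "(LINT x:{0<..<1}|lebesgue. \<eta> x) = 0"
  obtains \<phi> where "test_fun \<phi>" "deriv \<phi> = \<eta>"
proof -
  have cont: "continuous_on A \<eta>" for A by (rule smooth_alg_continuous[OF \<eta>])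
  have "\<exists>F. \<forall>x::real. - \<infinity> < ereal x \<longrightarrow> ereal x < \<infinity> \<longrightarrow> (F has_vector_derivative \<eta> x) (at x)"
    by (rule einterval_antiderivative) (use cont[of UNIV] in \<open>auto simp: continuous_on_eq_continuous_at\<close>)
  then obtain \<Phi> where \<Phi>: "(\<Phi> has_vector_derivative \<eta> x) (at x)" for x by auto
  have FTC: "(\<eta> has_integral (\<Phi> y - \<Phi> x)) {x..y}" if "x \<le> y" for x y
    by (rule fundamental_theorem_of_calculus[OF that]) (use \<Phi> in \<open>auto intro: has_vector_derivative_at_within\<close>)
  have left: "\<Phi> x = \<Phi> \<alpha>" if "x < \<alpha>" for x
  proof -
    have z: "(\<eta> has_integral 0) {x..\<alpha>}"
      by (rule has_integral_spike_finite[of "{\<alpha>}" _ _ "\<lambda>_. 0"]) (use that supp in auto)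
    show ?thesis using has_integral_unique[OF FTC[of x \<alpha>] z] that by simp
  qed
  have right: "\<Phi> x = \<Phi> \<beta>" if "\<beta> < x" for x
  proof -
    have z: "(\<eta> has_integral 0) {\<beta>..x}"
      by (rule has_integral_spike_finite[of "{\<beta>}" _ _ "\<lambda>_. 0"]) (use that supp in auto)
    show ?thesis using has_integral_unique[OF FTC[of \<beta> x] z] that by simp
  qed
  have "(LINT x:{\<alpha>..\<beta>}|lebesgue. \<eta> x) = 0"
    by (subst zero[symmetric], rule set_integral_support(1)[symmetric]) (use supp ab in auto)
  moreover have "(LINT x:{\<alpha>..\<beta>}|lebesgue. \<eta> x) = \<Phi> \<beta> - \<Phi> \<alpha>"
    using set_lebesgue_integral_eq_integral(2)[OF absolutely_integrable_continuous_real[OF cont]] FTC[OF ab(2)]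
    by (simp add: integral_unique)
  ultimately have eq: "\<Phi> \<beta> = \<Phi> \<alpha>" by simp
  have d: "((\<lambda>x. \<Phi> x - \<Phi> \<alpha>) has_real_derivative \<eta> x) (at x)" for x
    using \<Phi>[of x] by (auto simp: has_real_derivative_iff_has_vector_derivative intro!: derivative_eq_intros)
  have o: "\<Phi> x - \<Phi> \<alpha> = 0" if "x \<notin> {\<alpha>..\<beta>}" for x
    using that left[of x] right[of x] eq by (auto simp: not_le)
  show ?thesis
    by (rule that) (rule test_fun_primitive[OF \<eta> ab(1,3) supp d o]; assumption)+
qed

text \<open>The lemma of du Bois-Reymond: a mean-zero combination of two bumps is the derivative of a
  test function, so the difference of \<open>f\<close> and a primitive of \<open>g\<close> is constant.\<close>

lemma weak_deriv_ac_rep: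
  assumes "weak_deriv f g"
  obtains F where "ac_rep F g" "AE x in lebesgue. x \<in> {0<..<1} \<longrightarrow> f x = F x"
proof -
  note L = weak_derivD(1,2)[OF assms]
  obtain F0 where F0: "ac_rep F0 g" using L1_loc_ac_rep[OF L(2)] .
  define h where "h x = f x - F0 x" for x
  have LF: "L1_loc F0" by (rule continuous_L1_loc[OF ac_rep_continuous[OF F0]])
  have Lh: "L1_loc h" unfolding h_def[abs_def] by (rule L1_loc_diff[OF L(1) LF])
  have hz: "(LINT x:{0<..<1}|lebesgue. h x * deriv \<phi> x) = 0" if t: "test_fun \<phi>" for \<phi>
    using weak_derivD(3)[OF assms t] ac_rep_test_fun[OF F0 t]
      test_fun_integrable(2)[OF t L(1)] test_fun_integrable(2)[OF t LF]
    by (simp add: h_def left_diff_distrib set_integral_diff)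
  \<comment> \<open>A fixed reference bump with nonzero integral, used to correct the mean of every
    other bump.\<close>
  define \<psi>0 where "\<psi>0 = bump 1 (1/4) (3/4)"
  define I where "I \<psi> = (LINT x:{0<..<1}|lebesgue. \<psi> x)" for \<psi> :: "real \<Rightarrow> real"
  have one: "L1_loc (\<lambda>_. 1)" by (rule continuous_L1_loc) simp
  have t0: "test_fun \<psi>0" unfolding \<psi>0_def by (rule test_fun_bump) auto
  have i0: "set_integrable lebesgue {0<..<1} \<psi>0" using test_fun_integrable(1)[OF t0 one] by simp
  have "I \<psi>0 \<noteq> 0"
  proof
    assume "I \<psi>0 = 0"
    then have "AE x in lebesgue. indicator {0<..<1} x *\<^sub>R \<psi>0 x = 0"
      using i0 unfolding I_def set_lebesgue_integral_def set_integrable_def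
      by (subst (asm) integral_nonneg_eq_0_iff_AE) (auto simp: \<psi>0_def bump_range)
    then have "AE x in lborel. x \<notin> {1/4<..<3/4::real}"
      unfolding AE_lebesgue_iff by eventually_elim (use bump_pos[of 1 _ "1/4" "3/4"] in \<open>force simp: \<psi>0_def indicator_def split: if_splits\<close>)
    then have "emeasure lborel {1/4<..<3/4::real} = 0"
      by (subst (asm) AE_iff_null_sets[symmetric]) auto
    then show False by simp
  qed
  define c where "c = (LINT x:{0<..<1}|lebesgue. h x * \<psi>0 x) / I \<psi>0"
  have "AE x in lebesgue. x \<in> {0<..<1} \<longrightarrow> h x - c = 0"
  proof (rule AE_zero_if_bump_zero)
    show "L1_loc (\<lambda>x. h x - c)" by (rule L1_loc_diff[OF Lh continuous_L1_loc]) simp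
    fix n and \<alpha> \<beta> :: real assume ab: "0 < \<alpha>" "\<alpha> < \<beta>" "\<beta> < 1"
    define \<psi> where "\<psi> = bump n \<alpha> \<beta>"
    have t: "test_fun \<psi>" unfolding \<psi>_def using ab by (intro test_fun_bump)
    have i: "set_integrable lebesgue {0<..<1} \<psi>" using test_fun_integrable(1)[OF t one] by simp
    \<comment> \<open>This \<open>r\<close> makes the mean of \<open>\<psi> - r * \<psi>0\<close>
      vanish, so \<open>\<eta>\<close> is the derivative of a test function and integrates to zero
      against \<open>h\<close>.\<close>
    define r where "r = I \<psi> / I \<psi>0"
    define \<eta> where "\<eta> x = \<psi> x + (- r) * \<psi>0 x" for x
    have sm: "smooth_alg \<eta>"
      unfolding \<eta>_def[abs_def] by (intro smooth_alg.add smooth_alg.mult smooth_alg.const)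
        (auto simp: \<psi>_def \<psi>0_def smooth_alg_bump)
    have su: "\<eta> x = 0" if "x \<notin> {min \<alpha> (1/4)..max \<beta> (3/4)}" for x
    proof -
      have "x \<notin> {\<alpha><..<\<beta>}" "x \<notin> {1/4<..<3/4}" using that by auto
      then show ?thesis by (simp add: \<eta>_def \<psi>_def \<psi>0_def bump_outside del: greaterThanLessThan_iff)
    qed
    have ze: "(LINT x:{0<..<1}|lebesgue. \<eta> x) = 0"
    proof -
      have "(LINT x:{0<..<1}|lebesgue. \<eta> x) = I \<psi> + (LINT x:{0<..<1}|lebesgue. (- r) * \<psi>0 x)"
        unfolding \<eta>_def I_def by (rule set_integral_add(2)[OF i set_integrable_mult_right]) (use i0 in auto)
      also have "(LINT x:{0<..<1}|lebesgue. (- r) * \<psi>0 x) = (- r) * I \<psi>0"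
        unfolding I_def by (rule set_integral_mult_right)
      finally show ?thesis using \<open>I \<psi>0 \<noteq> 0\<close> by (simp add: r_def)
    qed
    obtain \<phi> where \<phi>: "test_fun \<phi>" "deriv \<phi> = \<eta>"
      by (rule smooth_alg_primitive[OF sm _ _ _ su ze]) (use ab in auto)
    have hi: "set_integrable lebesgue {0<..<1} (\<lambda>x. h x * \<psi> x)" "set_integrable lebesgue {0<..<1} (\<lambda>x. h x * \<psi>0 x)"
      using test_fun_integrable(1)[OF t Lh] test_fun_integrable(1)[OF t0 Lh] by auto
    have "0 = (LINT x:{0<..<1}|lebesgue. h x * \<psi> x + (- r) * (h x * \<psi>0 x))"
      using hz[OF \<phi>(1)] unfolding \<phi>(2) \<eta>_def by (simp add: algebra_simps)
    also have "\<dots> = (LINT x:{0<..<1}|lebesgue. h x * \<psi> x) + (LINT x:{0<..<1}|lebesgue. (- r) * (h x * \<psi>0 x))"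
      by (rule set_integral_add(2)[OF hi(1) set_integrable_mult_right]) (use hi(2) in auto)
    also have "(LINT x:{0<..<1}|lebesgue. (- r) * (h x * \<psi>0 x)) = (- r) * (LINT x:{0<..<1}|lebesgue. h x * \<psi>0 x)"
      by (rule set_integral_mult_right)
    finally have "(LINT x:{0<..<1}|lebesgue. h x * \<psi> x) = r * (LINT x:{0<..<1}|lebesgue. h x * \<psi>0 x)" by simp
    also have "\<dots> = c * I \<psi>" by (simp add: r_def c_def)
    finally show "(LINT x:{0<..<1}|lebesgue. (h x - c) * bump n \<alpha> \<beta> x) = 0"
      using hi(1) i by (simp add: left_diff_distrib set_integral_diff \<psi>_def[symmetric] I_def)
  qed
  then have ae: "AE x in lebesgue. x \<in> {0<..<1} \<longrightarrow> f x = F0 x + c" by eventually_elim (auto simp: h_def)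
  have "ac_rep (\<lambda>x. F0 x + c) g" using F0 by (simp add: ac_rep_def)
  then show ?thesis using ae by (rule that)
qed

lemma ac_rep_mult:
  assumes F: "ac_rep F f" and G: "ac_rep G g"
  shows "ac_rep (\<lambda>x. F x * G x) (\<lambda>x. F x * g x + f x * G x)"
  unfolding ac_rep_def
proof (intro allI impI)
  fix \<alpha> \<beta> :: real assume ab: "0 < \<alpha>" "\<alpha> \<le> \<beta>" "\<beta> < 1"
  have Fx: "F x = F \<alpha> + (LINT y:{\<alpha>..x}|lebesgue. f y)" if "x \<in> {\<alpha>..\<beta>}" for x
    by (rule ac_repD[OF F]) (use ab that in auto)
  have Gx: "G x = G \<alpha> + (LINT y:{\<alpha>..x}|lebesgue. g y)" if "x \<in> {\<alpha>..\<beta>}" for x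
    by (rule ac_repD[OF G]) (use ab that in auto)
  note P = parts[OF ab(2) ac_repD(1)[OF F ab] ac_repD(1)[OF G ab] Fx Gx]
  show "set_integrable lebesgue {\<alpha>..\<beta>} (\<lambda>x. F x * g x + f x * G x) \<and>
    F \<beta> * G \<beta> - F \<alpha> * G \<alpha> = (LINT x:{\<alpha>..\<beta>}|lebesgue. F x * g x + f x * G x)"
    using P by (subst set_integral_add(2)) auto
qed

lemma ac_rep_unique:
  assumes "ac_rep F f" "ac_rep F g"
  shows "AE x in lebesgue. x \<in> {0<..<1} \<longrightarrow> f x = g x"
proof -
  have "AE x in lebesgue. x \<in> {0<..<1} \<longrightarrow> f x - g x = 0"
  proof (rule AE_zero_if_intervals_zero)
    show "L1_loc (\<lambda>x. f x - g x)" using assms by (intro L1_loc_diff ac_rep_L1_loc)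
    fix \<alpha> \<beta> :: real assume "0 < \<alpha>" "\<alpha> < \<beta>" "\<beta> < 1"
    then have ab: "0 < \<alpha>" "\<alpha> \<le> \<beta>" "\<beta> < 1" by auto
    have "(LINT x:{\<alpha>..\<beta>}|lebesgue. f x) = (LINT x:{\<alpha>..\<beta>}|lebesgue. g x)"
      using ac_repD(2)[OF assms(1) ab] ac_repD(2)[OF assms(2) ab] by linarith
    then show "(LINT x:{\<alpha>..\<beta>}|lebesgue. f x - g x) = 0"
      using set_integral_diff(2)[OF ac_repD(1)[OF assms(1) ab] ac_repD(1)[OF assms(2) ab]] by simp
  qed
  then show ?thesis by eventually_elim auto
qed

section \<open>From almost everywhere to pointwise statements for continuous functions\<close>

lemma AE_continuous_nonpos:
  fixes f :: "real \<Rightarrow> real"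
  assumes c: "continuous_on {0<..<1} f" and ae: "AE x in lebesgue. x \<in> {0<..<1} \<longrightarrow> f x \<le> 0"
    and x: "x \<in> {0<..<1}"
  shows "f x \<le> 0"
proof (rule ccontr)
  assume "\<not> f x \<le> 0"
  then have "x \<in> f -` {0<..} \<inter> {0<..<1}" using x by auto
  moreover have o: "open (f -` {0<..} \<inter> {0<..<1})"
    using continuous_open_preimage[OF c, of "{0<..}"] by (simp add: Int_commute vimage_def)
  ultimately obtain e where e: "e > 0" "{x - e<..<x + e} \<subseteq> f -` {0<..} \<inter> {0<..<1}"
    by (metis ball_eq_greaterThanLessThan open_contains_ball)
  have "AE y in lborel. y \<notin> {x - e<..<x + e}"
    using ae unfolding AE_lebesgue_iff by eventually_elim (use e(2) in force)
  then have "emeasure lborel {x - e<..<x + e} = 0"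
    by (subst (asm) AE_iff_null_sets[symmetric]) auto
  with \<open>e > 0\<close> show False by simp
qed

lemma AE_continuous_eq:
  fixes f g :: "real \<Rightarrow> real"
  assumes "continuous_on {0<..<1} f" "continuous_on {0<..<1} g"
    and "AE x in lebesgue. x \<in> {0<..<1} \<longrightarrow> f x = g x" "x \<in> {0<..<1}"
  shows "f x = g x"
proof -
  have "f x - g x \<le> 0"
    by (rule AE_continuous_nonpos[OF continuous_on_diff[OF assms(1,2)] _ assms(4)])
       (use assms(3) in \<open>eventually_elim, auto\<close>)
  moreover have "g x - f x \<le> 0"
    by (rule AE_continuous_nonpos[OF continuous_on_diff[OF assms(2,1)] _ assms(4)])
       (use assms(3) in \<open>eventually_elim, auto\<close>)
  ultimately show ?thesis by simp
qed

text \<open>Essential bounds become pointwise bounds of the continuous representative; they are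
  needed at individual points, such as the end points of the level intervals.\<close>

lemma AE_continuous_abs_le:
  fixes f :: "real \<Rightarrow> real"
  assumes c: "continuous_on {0<..<1} f" and b: "continuous_on {0<..<1} b"
    and ae: "AE x in lebesgue. x \<in> {0<..<1} \<longrightarrow> \<bar>f x\<bar> \<le> b x"
    and x: "x \<in> {0<..<1}"
  shows "\<bar>f x\<bar> \<le> b x"
proof -
  have "\<bar>f x\<bar> - b x \<le> 0"
    by (rule AE_continuous_nonpos[OF _ _ x])
       (use c b ae in \<open>auto intro!: continuous_intros elim!: eventually_mono\<close>)
  then show ?thesis by simp
qed

lemma C1_ac_rep:
  assumes "a C1_differentiable_on {0<..<1}"
  shows "ac_rep a (deriv a)" "continuous_on {0<..<1} (deriv a)"
proof -
  have d: "(a has_real_derivative deriv a x) (at x)" if "x \<in> {0<..<1}" for x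
    using assms that by (auto simp: C1_differentiable_on_eq DERIV_deriv_iff_real_differentiable)
  have "continuous_on {0<..<1} (\<lambda>x. vector_derivative a (at x))"
    using assms by (simp add: C1_differentiable_on_eq)
  moreover have "vector_derivative a (at x) = deriv a x" if "x \<in> {0<..<1}" for x
    using d[OF that] by (intro vector_derivative_at) (simp add: has_real_derivative_iff_has_vector_derivative)
  ultimately show c: "continuous_on {0<..<1} (deriv a)" by (subst (asm) continuous_on_cong[OF refl]) auto
  show "ac_rep a (deriv a)"
    unfolding ac_rep_def
  proof (intro allI impI conjI)
    fix \<alpha> \<beta> :: real assume ab: "0 < \<alpha>" "\<alpha> \<le> \<beta>" "\<beta> < 1"
    show si: "set_integrable lebesgue {\<alpha>..\<beta>} (deriv a)"
      using continuous_L1_loc[OF c] ab by (auto simp: L1_loc_def)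
    have "(deriv a has_integral (a \<beta> - a \<alpha>)) {\<alpha>..\<beta>}"
      by (rule fundamental_theorem_of_calculus)
         (use ab d in \<open>auto simp: has_real_derivative_iff_has_vector_derivative[symmetric]
            intro: has_field_derivative_at_within\<close>)
    then show "a \<beta> - a \<alpha> = (LINT x:{\<alpha>..\<beta>}|lebesgue. deriv a x)"
      using set_lebesgue_integral_eq_integral(2)[OF si] by (simp add: integral_unique)
  qed
qed

lemma inner_interval_integral_tendsto:
  fixes f :: "real \<Rightarrow> real"
  assumes "set_integrable lebesgue {0<..<1} f"
  shows "(\<lambda>n. LINT x:inner_interval n|lebesgue. f x) \<longlonglongrightarrow> (LINT x:{0<..<1}|lebesgue. f x)"
  unfolding inner_interval_cover
proof (rule set_integral_cont_up)
  show "incseq inner_interval"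
    by (rule incseq_SucI) (auto simp: inner_interval_def field_simps)
  show "set_integrable lebesgue (\<Union>i. inner_interval i) f" using assms by (simp add: inner_interval_cover)
qed (auto simp: inner_interval_def)

text \<open>Only the product has to vanish at the ends: \<open>F\<close> tends to zero there and
  \<open>G\<close> stays bounded. Parts on the inner intervals, which exhaust
  \<open>{0<..<1}\<close>, then pass to the limit by the two integrability hypotheses.\<close>

lemma weak_ibp:
  assumes F: "weak_deriv F f" and G: "weak_deriv G g" and tr: "zero_trace F"
    and B: "AE x in lebesgue. x \<in> {0<..<1} \<longrightarrow> \<bar>G x\<bar> \<le> B"
    and i1: "set_integrable lebesgue {0<..<1} (\<lambda>x. F x * g x)"
    and i2: "set_integrable lebesgue {0<..<1} (\<lambda>x. f x * G x)"
  shows "(LINT x:{0<..<1}|lebesgue. F x * g x) = - (LINT x:{0<..<1}|lebesgue. f x * G x)"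
proof -
  obtain F' where F': "ac_rep F' f" "AE x in lebesgue. x \<in> {0<..<1} \<longrightarrow> F x = F' x"
    using weak_deriv_ac_rep[OF F] .
  obtain G' where G': "ac_rep G' g" "AE x in lebesgue. x \<in> {0<..<1} \<longrightarrow> G x = G' x"
    using weak_deriv_ac_rep[OF G] .
  obtain h where h: "continuous_on {0..1} h" "AE x in lebesgue. x \<in> {0<..<1} \<longrightarrow> F x = h x" "h 0 = 0" "h 1 = 0"
    using tr unfolding zero_trace_def by auto
  have Fh: "F' x = h x" if "x \<in> {0<..<1}" for x
  proof (rule AE_continuous_eq[OF ac_rep_continuous[OF F'(1)] _ _ that])
    show "continuous_on {0<..<1} h" by (rule continuous_on_subset[OF h(1)]) auto
    show "AE x in lebesgue. x \<in> {0<..<1} \<longrightarrow> F' x = h x" using F'(2) h(2) by eventually_elim auto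
  qed
  have GB: "\<bar>G' x\<bar> \<le> B" if "x \<in> {0<..<1}" for x
    by (rule AE_continuous_abs_le[OF ac_rep_continuous[OF G'(1)] _ _ that])
       (use G'(2) B in \<open>auto elim!: eventually_elim2\<close>)
  have e1: "(LINT x:A|lebesgue. F' x * g x) = (LINT x:A|lebesgue. F x * g x)"
    "(LINT x:A|lebesgue. f x * G' x) = (LINT x:A|lebesgue. f x * G x)"
    "set_integrable lebesgue A (\<lambda>x. F' x * g x) \<longleftrightarrow> set_integrable lebesgue A (\<lambda>x. F x * g x)"
    "set_integrable lebesgue A (\<lambda>x. f x * G' x) \<longleftrightarrow> set_integrable lebesgue A (\<lambda>x. f x * G x)" if "A \<subseteq> {0<..<1}" for A
    by (rule set_integral_cong_lebesgue; use F'(2) G'(2) in eventually_elim; use that in auto)+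
  let ?\<alpha> = "\<lambda>n. 1 / real (n + 2)"
  let ?\<beta> = "\<lambda>n. 1 - 1 / real (n + 2)"
  have eq: "(LINT x:inner_interval n|lebesgue. F x * g x) + (LINT x:inner_interval n|lebesgue. f x * G x)
    = F' (?\<beta> n) * G' (?\<beta> n) - F' (?\<alpha> n) * G' (?\<alpha> n)" for n
  proof -
    have s: "inner_interval n \<subseteq> {0<..<1}" using inner_interval_cover by auto
    note b = inner_interval_bounds[of n]
    have I: "set_integrable lebesgue (inner_interval n) (\<lambda>x. F' x * g x)"
      "set_integrable lebesgue (inner_interval n) (\<lambda>x. f x * G' x)"
      unfolding e1(3,4)[OF s] by (rule set_integrable_subset[OF i1 _ s] set_integrable_subset[OF i2 _ s]; simp add: inner_interval_def)+
    show ?thesis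
      using ac_repD(2)[OF ac_rep_mult[OF F'(1) G'(1)] b(1,3,2)] set_integral_add(2)[OF I]
      unfolding e1(1,2)[OF s] inner_interval_def[symmetric] by linarith
  qed
  have lim0: "(\<lambda>n. ?\<alpha> n) \<longlonglongrightarrow> 0" using LIMSEQ_ignore_initial_segment[OF lim_1_over_n, of 2] by simp
  have lim1: "(\<lambda>n. ?\<beta> n) \<longlonglongrightarrow> 1" using tendsto_diff[OF tendsto_const lim0, of 1] by simp
  have mem: "?\<alpha> n \<in> {0<..<1}" "?\<beta> n \<in> {0<..<1}" for n using inner_interval_bounds[of n] by (auto simp: field_simps)
  have cs: "(\<lambda>n. h (s n)) \<longlonglongrightarrow> h x" if "s \<longlonglongrightarrow> x" "x \<in> {0..1}" "\<And>n. s n \<in> {0<..<1}" for s x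
    using h(1) that unfolding continuous_on_sequentially comp_def by (auto simp: less_imp_le)
  have l0: "(\<lambda>n. F' (?\<alpha> n)) \<longlonglongrightarrow> 0" using cs[OF lim0 _ mem(1)] Fh[OF mem(1)] h(3) by simp
  have l1: "(\<lambda>n. F' (?\<beta> n)) \<longlonglongrightarrow> 0" using cs[OF lim1 _ mem(2)] Fh[OF mem(2)] h(4) by simp
  have prod0: "(\<lambda>n. F' (s n) * G' (s n)) \<longlonglongrightarrow> 0"
    if "(\<lambda>n. F' (s n)) \<longlonglongrightarrow> 0" "\<And>n. s n \<in> {0<..<1}" for s
  proof (rule Lim_null_comparison)
    show "(\<lambda>n. \<bar>F' (s n)\<bar> * B) \<longlonglongrightarrow> 0" using tendsto_mult_left_zero[OF tendsto_rabs_zero[OF that(1)]] .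
    show "\<forall>\<^sub>F n in sequentially. norm (F' (s n) * G' (s n)) \<le> \<bar>F' (s n)\<bar> * B"
      using GB[OF that(2)] by (intro always_eventually) (auto simp: abs_mult intro: mult_left_mono)
  qed
  have "(\<lambda>n. (LINT x:inner_interval n|lebesgue. F x * g x) + (LINT x:inner_interval n|lebesgue. f x * G x)) \<longlonglongrightarrow> 0"
    unfolding eq using tendsto_diff[OF prod0[OF l1 mem(2)] prod0[OF l0 mem(1)]] by simp
  moreover have "(\<lambda>n. (LINT x:inner_interval n|lebesgue. F x * g x) + (LINT x:inner_interval n|lebesgue. f x * G x))
    \<longlonglongrightarrow> (LINT x:{0<..<1}|lebesgue. F x * g x) + (LINT x:{0<..<1}|lebesgue. f x * G x)"
    by (intro tendsto_add inner_interval_integral_tendsto i1 i2)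
  ultimately show ?thesis using LIMSEQ_unique by fastforce
qed

section \<open>Mean-free primitives on level intervals\<close>

text \<open>Each clause serves one estimate: \<open>a = \<delta>\<close> at the end points keeps the
  boundary values of \<open>a w W\<close> of order \<open>\<delta>\<close>;
  \<open>\<delta> \<le> a\<close> inside bounds the square of a primitive of \<open>w\<close> by
  \<open>P / \<delta>\<close>; \<open>a \<le> 2 * \<delta>\<close> off the intervals makes the part
  of \<open>P\<close> lost there small.\<close>

definition level_intervals :: "(real \<Rightarrow> real) \<Rightarrow> real \<Rightarrow> (real \<times> real) set \<Rightarrow> bool" where
  "level_intervals a \<delta> \<C> \<longleftrightarrow> finite \<C> \<and>
     (\<forall>(\<alpha>, \<beta>)\<in>\<C>. 0 < \<alpha> \<and> \<alpha> < \<beta> \<and> \<beta> < 1 \<and> a \<alpha> = \<delta> \<and> a \<beta> = \<delta> \<and> (\<forall>x\<in>{\<alpha>..\<beta>}. \<delta> \<le> a x)) \<and>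
     disjoint_family_on (\<lambda>(\<alpha>, \<beta>). {\<alpha><..<\<beta>}) \<C> \<and>
     (\<forall>x\<in>{0<..<1}. (\<forall>(\<alpha>, \<beta>)\<in>\<C>. x \<notin> {\<alpha><..<\<beta>}) \<longrightarrow> a x \<le> 2 * \<delta>)"

lemma open_interval_real:
  fixes C :: "real set"
  assumes "open C" "connected C" "C \<noteq> {}" "bounded C"
  shows "C = {Inf C<..<Sup C}"
proof (intro set_eqI iffI)
  have bd: "bdd_below C" "bdd_above C"
    using assms(4) by (auto simp: bounded_imp_bdd_below bounded_imp_bdd_above)
  fix x
  { assume x: "x \<in> C"
    then obtain e where e: "e > 0" "ball x e \<subseteq> C" using assms(1) open_contains_ball by blast
    have "x - e/2 \<in> C" "x + e/2 \<in> C" using e by (auto simp: subset_iff dist_real_def)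
    then have "Inf C \<le> x - e/2" "x + e/2 \<le> Sup C" using bd by (auto intro: cInf_lower cSup_upper)
    then show "x \<in> {Inf C<..<Sup C}" using e by auto }
  { assume x: "x \<in> {Inf C<..<Sup C}"
    obtain c where "c \<in> C" "c < x" using x cInf_lessD[OF assms(3)] by auto
    moreover obtain d where "d \<in> C" "x < d" using x less_cSupD[OF assms(3)] by auto
    ultimately show "x \<in> C" using connected_contains_Icc[OF assms(2)] by fastforce }
qed

text \<open>The components of the open set \<open>{a > \<delta>}\<close> cover the compact set
  \<open>{a \<ge> 2 * \<delta>}\<close>, so finitely many of them do. The open set may have
  infinitely many components, which is why two different levels are used.\<close>

lemma level_intervals_exist:
  assumes c: "continuous_on {0..1} a" and a01: "a 0 = 0" "a 1 = 0" and \<delta>: "\<delta> > 0"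
  obtains \<C> where "level_intervals a \<delta> \<C>"
proof -
  define U where "U = {x \<in> {0<..<1}. \<delta> < a x}"
  define K where "K = {x \<in> {0..1}. 2 * \<delta> \<le> a x}"
  define L where "L = {x \<in> {0..1}. \<delta> \<le> a x}"
  have "U = {0<..<1} \<inter> a -` {\<delta><..}" by (auto simp: U_def)
  moreover have "continuous_on {0<..<1} a" by (rule continuous_on_subset[OF c]) auto
  ultimately have oU: "open U" by (simp add: continuous_open_preimage)
  have cl: "closed {x \<in> {0..1}. r \<le> a x}" for r
  proof -
    have "{x \<in> {0..1}. r \<le> a x} = {0..1} \<inter> a -` {r..}" by auto
    then show ?thesis using continuous_closed_preimage[OF c, of "{r..}"] by simp
  qed
  have "compact K" unfolding K_def compact_eq_bounded_closed
    using cl by (auto intro: bounded_subset[of "{0..1}"])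
  moreover have "K \<subseteq> \<Union>(components U)"
  proof
    fix x assume "x \<in> K"
    then have x: "0 \<le> x" "x \<le> 1" "2 * \<delta> \<le> a x" by (auto simp: K_def)
    then have "x \<noteq> 0" "x \<noteq> 1" using a01 \<delta> by auto
    with x \<delta> have "x \<in> U" by (auto simp: U_def)
    then show "x \<in> \<Union>(components U)" using Union_components by blast
  qed
  moreover have "\<And>C. C \<in> components U \<Longrightarrow> open C" using open_components[OF oU] .
  ultimately obtain \<D> where \<D>: "\<D> \<subseteq> components U" "finite \<D>" "K \<subseteq> \<Union>\<D>"
    by (rule compactE)
  have D: "C = {Inf C<..<Sup C}" "0 < Inf C" "Inf C < Sup C" "Sup C < 1" "a (Inf C) = \<delta>" "a (Sup C) = \<delta>"
    "\<forall>x\<in>{Inf C..Sup C}. \<delta> \<le> a x" if C: "C \<in> \<D>" for C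
  proof -
    have cU: "C \<in> components U" using \<D>(1) C by blast
    have sub: "C \<subseteq> U" using in_components_subset[OF cU] .
    have ne: "C \<noteq> {}" using in_components_nonempty[OF cU] .
    have con: "connected C" using in_components_connected[OF cU] .
    have bo: "bounded C" by (rule bounded_subset[of "{0..1}"]) (use sub in \<open>auto simp: U_def\<close>)
    show eq: "C = {Inf C<..<Sup C}" by (rule open_interval_real[OF open_components[OF oU cU] con ne bo])
    with ne show lt: "Inf C < Sup C" by (metis greaterThanLessThan_empty_iff2 not_less)
    have "closure C = {Inf C..Sup C}" using closure_greaterThanLessThan[OF lt] eq by metis
    moreover have "closure C \<subseteq> L"
      by (rule closure_minimal) (use sub cl in \<open>auto simp: L_def U_def\<close>)
    ultimately have sL: "{Inf C..Sup C} \<subseteq> L" by simp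
    then show "\<forall>x\<in>{Inf C..Sup C}. \<delta> \<le> a x" by (auto simp: L_def)
    \<comment> \<open>An end point lying in \<open>U\<close> could be joined to the component,
      against its maximality. Hence \<open>a \<le> \<delta>\<close> there, while
      \<open>\<delta> \<le> a\<close> holds on the closure.\<close>
    have nU: "x \<notin> U" if x: "x \<in> {Inf C, Sup C}" for x
    proof
      assume "x \<in> U"
      have "connected (insert x C)"
        by (rule connected_intermediate_closure[OF con]) (use x \<open>closure C = _\<close> lt closure_subset in auto)
      then have "insert x C \<subseteq> C"
        by (rule components_maximal[OF cU]) (use \<open>x \<in> U\<close> sub ne in auto)
      then have "x \<in> {Inf C<..<Sup C}" using eq by blast
      with x show False by auto
    qed
    have e: "a x = \<delta> \<and> 0 < x \<and> x < 1" if x: "x \<in> {Inf C, Sup C}" for x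
    proof -
      have "x \<in> L" using sL x lt by auto
      then have L: "0 \<le> x" "x \<le> 1" "\<delta> \<le> a x" by (auto simp: L_def)
      then have "x \<noteq> 0" "x \<noteq> 1" using a01 \<delta> by auto
      with L have x01: "0 < x" "x < 1" by auto
      with nU[OF x] have "a x \<le> \<delta>" by (auto simp: U_def)
      with L x01 show ?thesis by simp
    qed
    show "0 < Inf C" "Sup C < 1" "a (Inf C) = \<delta>" "a (Sup C) = \<delta>" using e by auto
  qed
  define \<C> where "\<C> = (\<lambda>C. (Inf C, Sup C)) ` \<D>"
  have "disjoint_family_on (\<lambda>(\<alpha>, \<beta>). {\<alpha><..<\<beta>}) \<C>"
    unfolding disjoint_family_on_def
  proof (intro ballI impI)
    fix p q assume "p \<in> \<C>" "q \<in> \<C>" "p \<noteq> q"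
    then obtain C D where CD: "C \<in> \<D>" "D \<in> \<D>" "p = (Inf C, Sup C)" "q = (Inf D, Sup D)" by (auto simp: \<C>_def)
    with \<open>p \<noteq> q\<close> have "C \<noteq> D" by auto
    then have "C \<inter> D = {}" using components_nonoverlap[of C U D] CD \<D>(1) by blast
    then show "(case p of (\<alpha>, \<beta>) \<Rightarrow> {\<alpha><..<\<beta>}) \<inter> (case q of (\<alpha>, \<beta>) \<Rightarrow> {\<alpha><..<\<beta>}) = {}"
      using D(1)[OF CD(1)] D(1)[OF CD(2)] CD(3,4) by auto
  qed
  moreover have "a x \<le> 2 * \<delta>" if "x \<in> {0<..<1}" "\<forall>(\<alpha>, \<beta>)\<in>\<C>. x \<notin> {\<alpha><..<\<beta>}" for x
  proof (rule ccontr)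
    assume "\<not> a x \<le> 2 * \<delta>"
    then have "x \<in> K" using that(1) by (auto simp: K_def)
    then obtain C where C: "C \<in> \<D>" "x \<in> C" using \<D>(3) by blast
    then have "x \<in> {Inf C<..<Sup C}" using D(1) by blast
    with that(2) C(1) show False by (auto simp: \<C>_def)
  qed
  ultimately have "level_intervals a \<delta> \<C>"
    unfolding level_intervals_def using \<D>(2) D by (auto simp: \<C>_def)
  then show ?thesis by (rule that)
qed

text \<open>\<open>mean_free_primitive \<C> f\<close> is, on each interval of \<open>\<C>\<close>, the primitive of \<open>f\<close> with mean
  zero, and \<open>0\<close> elsewhere.\<close>

definition mfp_kernel :: "(real \<times> real) set \<Rightarrow> real \<Rightarrow> real \<Rightarrow> real" where
  "mfp_kernel \<C> x \<xi> = (\<Sum>(\<alpha>, \<beta>)\<in>\<C>.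
     indicator {\<alpha><..<\<beta>} x * indicator {\<alpha><..<\<beta>} \<xi> * (indicator {..x} \<xi> - (\<beta> - \<xi>) / (\<beta> - \<alpha>)))"

definition mean_free_primitive :: "(real \<times> real) set \<Rightarrow> (real \<Rightarrow> real) \<Rightarrow> real \<Rightarrow> real" where
  "mean_free_primitive \<C> f x = (LINT \<xi>:{0<..<1}|lebesgue. mfp_kernel \<C> x \<xi> * f \<xi>)"

text \<open>The subtracted quotient is the mean of the first integral over the interval: after
  interchanging the integrations, \<open>f y\<close> is counted on a set of length
  \<open>\<beta> - y\<close>.\<close>

definition mfp_on :: "real \<Rightarrow> real \<Rightarrow> (real \<Rightarrow> real) \<Rightarrow> real \<Rightarrow> real" where
  "mfp_on \<alpha> \<beta> f x = (LINT y:{\<alpha>..x}|lebesgue. f y) - (LINT y:{\<alpha>..\<beta>}|lebesgue. (\<beta> - y) * f y) / (\<beta> - \<alpha>)"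

lemma mfp_kernel_in:
  assumes "level_intervals a \<delta> \<C>" "(\<alpha>, \<beta>) \<in> \<C>" "x \<in> {\<alpha><..<\<beta>}"
  shows "mfp_kernel \<C> x \<xi> = indicator {\<alpha><..<\<beta>} \<xi> * (indicator {..x} \<xi> - (\<beta> - \<xi>) / (\<beta> - \<alpha>))"
proof -
  have fin: "finite \<C>" and dis: "disjoint_family_on (\<lambda>(\<alpha>, \<beta>). {\<alpha><..<\<beta>}) \<C>"
    using assms(1) by (auto simp: level_intervals_def)
  have "x \<notin> {\<alpha>'<..<\<beta>'}" if "(\<alpha>', \<beta>') \<in> \<C> - {(\<alpha>, \<beta>)}" for \<alpha>' \<beta>'
    using disjoint_family_onD[OF dis, of "(\<alpha>, \<beta>)" "(\<alpha>', \<beta>')"] assms(2,3) that by auto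
  then have "(\<Sum>(\<alpha>', \<beta>')\<in>\<C> - {(\<alpha>, \<beta>)}. indicator {\<alpha>'<..<\<beta>'} x * indicator {\<alpha>'<..<\<beta>'} \<xi> *
      (indicator {..x} \<xi> - (\<beta>' - \<xi>) / (\<beta>' - \<alpha>'))) = 0"
    by (intro sum.neutral) (force simp: indicator_def simp del: greaterThanLessThan_iff)
  then show ?thesis unfolding mfp_kernel_def
    using assms(3) by (subst sum.remove[OF fin assms(2)]) auto
qed

lemma mfp_kernel_out:
  assumes "\<And>\<alpha> \<beta>. (\<alpha>, \<beta>) \<in> \<C> \<Longrightarrow> x \<notin> {\<alpha><..<\<beta>}"
  shows "mfp_kernel \<C> x \<xi> = 0"
  unfolding mfp_kernel_def using assms by (intro sum.neutral) auto

lemma mfp_kernel_bound: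
  assumes L: "level_intervals a \<delta> \<C>"
  shows "\<bar>mfp_kernel \<C> x \<xi>\<bar> \<le> 1"
proof (cases "\<exists>\<alpha> \<beta>. (\<alpha>, \<beta>) \<in> \<C> \<and> x \<in> {\<alpha><..<\<beta>}")
  case True
  then obtain \<alpha> \<beta> where p: "(\<alpha>, \<beta>) \<in> \<C>" "x \<in> {\<alpha><..<\<beta>}" by blast
  show ?thesis unfolding mfp_kernel_in[OF L p] by (auto simp: indicator_def abs_le_iff field_simps)
next
  case False
  then show ?thesis using mfp_kernel_out[of \<C> x] by auto
qed

text \<open>The kernel form is made for Fubini in time and for joint measurability, the form
  \<open>mfp_on\<close> for integration by parts in space; this identifies the two.\<close>

lemma mfp_eq:
  assumes L: "level_intervals a \<delta> \<C>" and p: "(\<alpha>, \<beta>) \<in> \<C>" and x: "x \<in> {\<alpha><..<\<beta>}"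
    and f: "set_integrable lebesgue {\<alpha>..\<beta>} f"
  shows "mean_free_primitive \<C> f x = mfp_on \<alpha> \<beta> f x"
proof -
  have ab: "0 < \<alpha>" "\<alpha> < \<beta>" "\<beta> < 1" using L p by (auto simp: level_intervals_def)
  have i1: "set_integrable lebesgue {\<alpha>..x} f" by (rule set_integrable_subset[OF f]) (use x in auto)
  have i1': "set_integrable lebesgue {\<alpha>..\<beta>} (\<lambda>y. indicator {\<alpha>..x} y * f y)"
  proof -
    have "(\<lambda>y. indicator {\<alpha>..\<beta>} y *\<^sub>R (indicator {\<alpha>..x} y * f y)) = (\<lambda>y. indicator {\<alpha>..x} y *\<^sub>R f y)"
      using x by (auto simp: indicator_def fun_eq_iff)
    then show ?thesis using i1 by (simp add: set_integrable_def)
  qed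
  have i2: "set_integrable lebesgue {\<alpha>..\<beta>} (\<lambda>y. (\<beta> - y) * f y)"
    by (rule continuous_mult_set_integrable[OF _ f]) (intro continuous_intros)
  have "mean_free_primitive \<C> f x = (LINT \<xi>:{0<..<1}|lebesgue. indicator {\<alpha><..<\<beta>} \<xi> * (indicator {..x} \<xi> - (\<beta> - \<xi>) / (\<beta> - \<alpha>)) * f \<xi>)"
    unfolding mean_free_primitive_def mfp_kernel_in[OF L p x] by simp
  also have "\<dots> = (LINT \<xi>:{\<alpha>..\<beta>}|lebesgue. indicator {\<alpha><..<\<beta>} \<xi> * (indicator {..x} \<xi> - (\<beta> - \<xi>) / (\<beta> - \<alpha>)) * f \<xi>)"
    by (rule set_integral_support(1)) (use ab in auto)
  also have "\<dots> = (LINT \<xi>:{\<alpha>..\<beta>}|lebesgue. indicator {\<alpha>..x} \<xi> * f \<xi> - (\<beta> - \<xi>) * f \<xi> / (\<beta> - \<alpha>))"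
  proof (rule set_integral_cong_lebesgue(2))
    show "AE y in lebesgue. y \<in> {\<alpha>..\<beta>} \<longrightarrow> indicator {\<alpha><..<\<beta>} y * (indicator {..x} y - (\<beta> - y) / (\<beta> - \<alpha>)) * f y
        = indicator {\<alpha>..x} y * f y - (\<beta> - y) * f y / (\<beta> - \<alpha>)"
      unfolding AE_lebesgue_iff using AE_lborel_singleton[of \<alpha>] AE_lborel_singleton[of \<beta>]
      by eventually_elim (auto simp: indicator_def algebra_simps)
  qed
  also have "\<dots> = (LINT \<xi>:{\<alpha>..\<beta>}|lebesgue. indicator {\<alpha>..x} \<xi> * f \<xi>) - (LINT \<xi>:{\<alpha>..\<beta>}|lebesgue. (\<beta> - \<xi>) * f \<xi> / (\<beta> - \<alpha>))"
    by (rule set_integral_diff(2)[OF i1']) (use i2 in auto)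
  also have "(LINT \<xi>:{\<alpha>..\<beta>}|lebesgue. indicator {\<alpha>..x} \<xi> * f \<xi>) = (LINT \<xi>:{\<alpha>..x}|lebesgue. f \<xi>)"
    unfolding set_lebesgue_integral_def using x
    by (intro Bochner_Integration.integral_cong) (auto simp: indicator_def)
  finally show ?thesis by (simp add: mfp_on_def)
qed

lemma mfp_out:
  assumes "\<And>\<alpha> \<beta>. (\<alpha>, \<beta>) \<in> \<C> \<Longrightarrow> x \<notin> {\<alpha><..<\<beta>}"
  shows "mean_free_primitive \<C> f x = 0"
  unfolding mean_free_primitive_def by (simp add: mfp_kernel_out[OF assms])

lemma set_integral_Ioo_Icc:
  fixes f :: "real \<Rightarrow> real"
  shows "set_integrable lebesgue {\<alpha><..<\<beta>} f \<longleftrightarrow> set_integrable lebesgue {\<alpha>..\<beta>} f"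
    "(LINT x:{\<alpha><..<\<beta>}|lebesgue. f x) = (LINT x:{\<alpha>..\<beta>}|lebesgue. f x)"
proof -
  have ae: "AE x in lebesgue. x \<in> UNIV \<longrightarrow> indicator {\<alpha><..<\<beta>} x * f x = indicator {\<alpha>..\<beta>} x * f x"
    unfolding AE_lebesgue_iff using AE_lborel_singleton[of \<alpha>] AE_lborel_singleton[of \<beta>]
    by eventually_elim (auto simp: indicator_def)
  show "set_integrable lebesgue {\<alpha><..<\<beta>} f \<longleftrightarrow> set_integrable lebesgue {\<alpha>..\<beta>} f"
    "(LINT x:{\<alpha><..<\<beta>}|lebesgue. f x) = (LINT x:{\<alpha>..\<beta>}|lebesgue. f x)"
    using set_integral_cong_lebesgue(1,2)[OF ae] by (simp_all add: set_integrable_def set_lebesgue_integral_def)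
qed

lemma level_intervals_sum:
  fixes \<psi> :: "real \<Rightarrow> real"
  assumes L: "level_intervals a \<delta> \<C>"
    and out: "\<And>x. (\<And>\<alpha> \<beta>. (\<alpha>, \<beta>) \<in> \<C> \<Longrightarrow> x \<notin> {\<alpha><..<\<beta>}) \<Longrightarrow> \<psi> x = 0"
    and int: "\<And>\<alpha> \<beta>. (\<alpha>, \<beta>) \<in> \<C> \<Longrightarrow> set_integrable lebesgue {\<alpha>..\<beta>} \<psi>"
  shows "set_integrable lebesgue {0<..<1} \<psi>"
    "(LINT x:{0<..<1}|lebesgue. \<psi> x) = (\<Sum>(\<alpha>, \<beta>)\<in>\<C>. LINT x:{\<alpha>..\<beta>}|lebesgue. \<psi> x)"
proof -
  have fin: "finite \<C>" and dis: "disjoint_family_on (\<lambda>(\<alpha>, \<beta>). {\<alpha><..<\<beta>}) \<C>"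
    using L by (auto simp: level_intervals_def)
  define O' where "O' = (\<Union>p\<in>\<C>. case p of (\<alpha>, \<beta>) \<Rightarrow> {\<alpha><..<\<beta>})"
  have sub: "O' \<subseteq> {0<..<1}" using L unfolding O'_def level_intervals_def by fastforce
  have z: "\<psi> x = 0" if "x \<notin> O'" for x using out[of x] that by (force simp: O'_def)
  have int': "set_integrable lebesgue (case p of (\<alpha>, \<beta>) \<Rightarrow> {\<alpha><..<\<beta>}) \<psi>" if "p \<in> \<C>" for p
    using int[of "fst p" "snd p"] that by (cases p) (simp add: set_integral_Ioo_Icc)
  have iO: "set_integrable lebesgue O' \<psi>" unfolding O'_def
    by (rule set_integrable_UN[OF fin int']) auto
  show "set_integrable lebesgue {0<..<1} \<psi>"
    using set_integral_support(2)[of "{0<..<1}" O' \<psi> lebesgue] z sub iO by blast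
  have "(LINT x:{0<..<1}|lebesgue. \<psi> x) = (LINT x:O'|lebesgue. \<psi> x)"
    by (rule set_integral_support(1)) (use z sub in auto)
  also have "\<dots> = (\<Sum>p\<in>\<C>. LINT x:(case p of (\<alpha>, \<beta>) \<Rightarrow> {\<alpha><..<\<beta>})|lebesgue. \<psi> x)"
    unfolding O'_def by (rule set_integral_finite_Union[OF fin dis int']) auto
  also have "\<dots> = (\<Sum>(\<alpha>, \<beta>)\<in>\<C>. LINT x:{\<alpha>..\<beta>}|lebesgue. \<psi> x)"
    by (rule sum.cong) (auto simp: set_integral_Ioo_Icc)
  finally show "(LINT x:{0<..<1}|lebesgue. \<psi> x) = (\<Sum>(\<alpha>, \<beta>)\<in>\<C>. LINT x:{\<alpha>..\<beta>}|lebesgue. \<psi> x)" .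
qed

lemma mfp_on_primitive:
  assumes "set_integrable lebesgue {\<alpha>..\<beta>} f" "\<alpha> \<le> \<beta>" "x \<in> {\<alpha>..\<beta>}"
  shows "mfp_on \<alpha> \<beta> f x = mfp_on \<alpha> \<beta> f \<alpha> + (LINT y:{\<alpha>..x}|lebesgue. f y)"
proof -
  have "(LINT y:{\<alpha>..\<alpha>}|lebesgue. f y) = 0"
    using set_integral_Ioo_Icc(2)[of \<alpha> \<alpha> f] by (simp add: set_lebesgue_integral_def)
  then show ?thesis by (simp add: mfp_on_def)
qed

text \<open>Parts against \<open>x - \<beta>\<close>, the primitive of \<open>1\<close> that
  vanishes at \<open>\<beta>\<close>: only the boundary term at \<open>\<alpha>\<close> survives,
  and the constant in \<open>mfp_on\<close> is made to cancel it.\<close>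

lemma mfp_on_mean:
  assumes f: "set_integrable lebesgue {\<alpha>..\<beta>} f" and ab: "\<alpha> < \<beta>"
  shows "set_integrable lebesgue {\<alpha>..\<beta>} (mfp_on \<alpha> \<beta> f)" "(LINT x:{\<alpha>..\<beta>}|lebesgue. mfp_on \<alpha> \<beta> f x) = 0"
proof -
  let ?F = "mfp_on \<alpha> \<beta> f"
  have F: "?F x = ?F \<alpha> + (LINT y:{\<alpha>..x}|lebesgue. f y)" if "x \<in> {\<alpha>..\<beta>}" for x
    by (rule mfp_on_primitive[OF f _ that]) (use ab in simp)
  have one: "(LINT y:{\<alpha>..x}|lebesgue. (1::real)) = x - \<alpha>" if "x \<in> {\<alpha>..\<beta>}" for x
    using that by (simp add: set_integral_const)
  note P = parts[OF _ f set_integrable_const_Icc[of \<alpha> \<beta> 1] F, where G="\<lambda>x. x - \<beta>"]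
  have G: "x - \<beta> = \<alpha> - \<beta> + (LINT y:{\<alpha>..x}|lebesgue. (1::real))" if "x \<in> {\<alpha>..\<beta>}" for x
    using one[OF that] by simp
  show "set_integrable lebesgue {\<alpha>..\<beta>} ?F" using P(1)[OF _ _ G] ab by simp
  have a: "?F \<alpha> = - (LINT y:{\<alpha>..\<beta>}|lebesgue. (\<beta> - y) * f y) / (\<beta> - \<alpha>)"
    using set_integral_Ioo_Icc(2)[of \<alpha> \<alpha> f] by (simp add: mfp_on_def set_lebesgue_integral_def)
  have m: "(LINT y:{\<alpha>..\<beta>}|lebesgue. (\<beta> - y) * f y) = - (LINT x:{\<alpha>..\<beta>}|lebesgue. f x * (x - \<beta>))"
  proof -
    have "(LINT y:{\<alpha>..\<beta>}|lebesgue. (\<beta> - y) * f y) = (LINT x:{\<alpha>..\<beta>}|lebesgue. (-1) * (f x * (x - \<beta>)))"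
      by (intro set_lebesgue_integral_cong) (auto simp: algebra_simps)
    also have "\<dots> = (-1) * (LINT x:{\<alpha>..\<beta>}|lebesgue. f x * (x - \<beta>))" by (rule set_integral_mult_right)
    finally show ?thesis by simp
  qed
  have "(LINT x:{\<alpha>..\<beta>}|lebesgue. ?F x * 1) + (LINT x:{\<alpha>..\<beta>}|lebesgue. f x * (x - \<beta>)) = ?F \<beta> * (\<beta> - \<beta>) - ?F \<alpha> * (\<alpha> - \<beta>)"
    by (rule P(3)[OF _ _ G]) (use ab in auto)
  moreover have "?F \<alpha> * (\<alpha> - \<beta>) = - (LINT x:{\<alpha>..\<beta>}|lebesgue. f x * (x - \<beta>))"
    unfolding a m using ab by (simp add: field_simps)
  ultimately show "(LINT x:{\<alpha>..\<beta>}|lebesgue. ?F x) = 0" by simp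
qed

section \<open>Energy inequalities on a time slice\<close>

lemma set_borel_measurable_arith:
  fixes f g :: "_ \<Rightarrow> real"
  assumes "set_borel_measurable M A f" "set_borel_measurable M A g"
  shows "set_borel_measurable M A (\<lambda>x. f x + g x)" "set_borel_measurable M A (\<lambda>x. f x - g x)"
    "set_borel_measurable M A (\<lambda>x. f x * g x)" "set_borel_measurable M A (\<lambda>x. f x / g x)"
proof -
  have m: "(\<lambda>x. indicator A x *\<^sub>R f x) \<in> borel_measurable M" "(\<lambda>x. indicator A x *\<^sub>R g x) \<in> borel_measurable M"
    using assms by (simp_all add: set_borel_measurable_def)
  have e: "(\<lambda>x. indicator A x *\<^sub>R (f x + g x)) = (\<lambda>x. indicator A x *\<^sub>R f x + indicator A x *\<^sub>R g x)"
    "(\<lambda>x. indicator A x *\<^sub>R (f x - g x)) = (\<lambda>x. indicator A x *\<^sub>R f x - indicator A x *\<^sub>R g x)"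
    "(\<lambda>x. indicator A x *\<^sub>R (f x * g x)) = (\<lambda>x. (indicator A x *\<^sub>R f x) * (indicator A x *\<^sub>R g x))"
    "(\<lambda>x. indicator A x *\<^sub>R (f x / g x)) = (\<lambda>x. (indicator A x *\<^sub>R f x) / (indicator A x *\<^sub>R g x))"
    by (auto simp: indicator_def fun_eq_iff)
  show "set_borel_measurable M A (\<lambda>x. f x + g x)" "set_borel_measurable M A (\<lambda>x. f x - g x)"
    "set_borel_measurable M A (\<lambda>x. f x * g x)" "set_borel_measurable M A (\<lambda>x. f x / g x)"
    unfolding set_borel_measurable_def e
    by (rule borel_measurable_add[OF m] borel_measurable_diff[OF m] borel_measurable_times[OF m] borel_measurable_divide[OF m])+
qed

lemma set_borel_measurable_const_Ioo: "set_borel_measurable lebesgue {0<..<1::real} (\<lambda>_. c::real)"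
  by (rule continuous_set_borel_measurable) auto

lemma set_integrable_measurable:
  "set_integrable M A f \<Longrightarrow> set_borel_measurable M A (f :: _ \<Rightarrow> real)"
  by (auto simp: set_integrable_def set_borel_measurable_def)

definition ess_bounded :: "(real \<Rightarrow> real) \<Rightarrow> bool" where
  "ess_bounded f \<longleftrightarrow> set_borel_measurable lebesgue {0<..<1} f \<and>
     (\<exists>B. AE x in lebesgue. x \<in> {0<..<1} \<longrightarrow> \<bar>f x\<bar> \<le> B)"

lemma ess_bounded_const: "ess_bounded (\<lambda>_. c)"
  unfolding ess_bounded_def by (auto intro: set_borel_measurable_const_Ioo)

lemma ess_bounded_add: "ess_bounded f \<Longrightarrow> ess_bounded g \<Longrightarrow> ess_bounded (\<lambda>x. f x + g x)"
  and ess_bounded_diff: "ess_bounded f \<Longrightarrow> ess_bounded g \<Longrightarrow> ess_bounded (\<lambda>x. f x - g x)"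
  and ess_bounded_mult: "ess_bounded f \<Longrightarrow> ess_bounded g \<Longrightarrow> ess_bounded (\<lambda>x. f x * g x)"
proof -
  assume f: "ess_bounded f" and g: "ess_bounded g"
  then have m: "set_borel_measurable lebesgue {0<..<1} f" "set_borel_measurable lebesgue {0<..<1} g"
    by (auto simp: ess_bounded_def)
  obtain B where B: "AE x in lebesgue. x \<in> {0<..<1} \<longrightarrow> \<bar>f x\<bar> \<le> B" using f by (auto simp: ess_bounded_def)
  obtain C where C: "AE x in lebesgue. x \<in> {0<..<1} \<longrightarrow> \<bar>g x\<bar> \<le> C" using g by (auto simp: ess_bounded_def)
  have "AE x in lebesgue. x \<in> {0<..<1} \<longrightarrow> \<bar>f x + g x\<bar> \<le> B + C" using B C by eventually_elim auto
  then show "ess_bounded (\<lambda>x. f x + g x)" using set_borel_measurable_arith[OF m] by (auto simp: ess_bounded_def)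
  have "AE x in lebesgue. x \<in> {0<..<1} \<longrightarrow> \<bar>f x - g x\<bar> \<le> B + C" using B C by eventually_elim auto
  then show "ess_bounded (\<lambda>x. f x - g x)" using set_borel_measurable_arith[OF m] by (auto simp: ess_bounded_def)
  have "AE x in lebesgue. x \<in> {0<..<1} \<longrightarrow> \<bar>f x * g x\<bar> \<le> B * C"
    using B C by eventually_elim (auto simp: abs_mult intro!: mult_mono)
  then show "ess_bounded (\<lambda>x. f x * g x)" using set_borel_measurable_arith[OF m] by (auto simp: ess_bounded_def)
qed

lemma set_integrable_one_Ioo: "set_integrable lebesgue {0<..<1::real} (\<lambda>_. 1::real)"
  using set_integrable_const_Icc[of 0 1 1] by (simp add: set_integral_Ioo_Icc)

lemma ess_bounded_integrable: "ess_bounded f \<Longrightarrow> set_integrable lebesgue {0<..<1} f"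
  unfolding ess_bounded_def using set_integrable_bounded_mult[OF set_integrable_one_Ioo] by fastforce

lemma ess_boundedI:
  "L1_loc f \<Longrightarrow> AE x in lebesgue. x \<in> {0<..<1} \<longrightarrow> \<bar>f x\<bar> \<le> B \<Longrightarrow> ess_bounded f"
  unfolding ess_bounded_def using L1_loc_measurable by blast

lemma ess_bounded_continuous:
  assumes "continuous_on {0..1} f" shows "ess_bounded f"
proof -
  have "bounded (f ` {0..1})" using assms by (intro compact_imp_bounded compact_continuous_image) auto
  then obtain B where "\<forall>x\<in>{0..1}. \<bar>f x\<bar> \<le> B" by (auto simp: bounded_iff)
  then have "AE x in lebesgue. x \<in> {0<..<1} \<longrightarrow> \<bar>f x\<bar> \<le> B" by (intro AE_I2) auto
  moreover have "set_borel_measurable lebesgue {0<..<1} f"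
    by (rule continuous_set_borel_measurable[OF continuous_on_subset[OF assms]]) auto
  ultimately show ?thesis by (auto simp: ess_bounded_def)
qed

lemma ess_bounded_zero_trace:
  assumes "zero_trace f" shows "ess_bounded f"
proof -
  obtain g where g: "continuous_on {0..1} g" "AE x in lebesgue. x \<in> {0<..<1} \<longrightarrow> f x = g x"
    using assms by (auto simp: zero_trace_def)
  obtain B where B: "AE x in lebesgue. x \<in> {0<..<1} \<longrightarrow> \<bar>g x\<bar> \<le> B" and m: "set_borel_measurable lebesgue {0<..<1} g"
    using ess_bounded_continuous[OF g(1)] by (auto simp: ess_bounded_def)
  have "AE x in lebesgue. x \<in> {0<..<1} \<longrightarrow> \<bar>f x\<bar> \<le> B" using B g(2) by eventually_elim auto
  then show ?thesis using m set_integral_cong_lebesgue(3)[OF g(2)] by (auto simp: ess_bounded_def)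
qed

lemma set_integrable_square_prod:
  fixes f g :: "real \<Rightarrow> real"
  assumes m: "set_borel_measurable lebesgue A f" "set_borel_measurable lebesgue A g" "set_borel_measurable lebesgue A \<rho>"
    and \<rho>: "\<And>x. x \<in> A \<Longrightarrow> 0 \<le> \<rho> x"
    and i: "set_integrable lebesgue A (\<lambda>x. \<rho> x * (f x)\<^sup>2)" "set_integrable lebesgue A (\<lambda>x. \<rho> x * (g x)\<^sup>2)"
  shows "set_integrable lebesgue A (\<lambda>x. \<rho> x * (f x * g x))"
proof (rule set_integrable_bound[OF set_integral_add(1)[OF i]])
  show "set_borel_measurable lebesgue A (\<lambda>x. \<rho> x * (f x * g x))"
    by (intro set_borel_measurable_arith m)
  show "AE x in lebesgue. x \<in> A \<longrightarrow> norm (\<rho> x * (f x * g x)) \<le> norm (\<rho> x * (f x)\<^sup>2 + \<rho> x * (g x)\<^sup>2)"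
  proof (intro AE_I2 impI)
    fix x assume x: "x \<in> A"
    have "\<bar>f x * g x\<bar> \<le> (f x)\<^sup>2 + (g x)\<^sup>2"
    proof -
      have "2 * \<bar>f x * g x\<bar> \<le> (f x)\<^sup>2 + (g x)\<^sup>2"
        using sum_squares_bound[of "\<bar>f x\<bar>" "\<bar>g x\<bar>"] by (simp add: abs_mult mult.assoc)
      then show ?thesis using abs_ge_zero[of "f x * g x"] by linarith
    qed
    then have "\<rho> x * \<bar>f x * g x\<bar> \<le> \<rho> x * ((f x)\<^sup>2 + (g x)\<^sup>2)" by (rule mult_left_mono[OF _ \<rho>[OF x]])
    then show "norm (\<rho> x * (f x * g x)) \<le> norm (\<rho> x * (f x)\<^sup>2 + \<rho> x * (g x)\<^sup>2)"
      using \<rho>[OF x] by (simp add: abs_mult algebra_simps)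
  qed
qed

text \<open>Division by \<open>a\<close> is compensated by the factors \<open>sqrt a\<close> and
  \<open>a\<close> in the bound on \<open>f\<close>: with \<open>y = |v| / sqrt a\<close> the
  products become multiples of \<open>y |vx|\<close> and \<open>y (sqrt a |w|)\<close>, to which
  Young's inequality applies. The coefficient of \<open>vx\<^sup>2\<close> is \<open>1\<close>,
  below the \<open>2\<close> that \<open>slice_v\<close> gains.\<close>

lemma young_two:
  fixes a K B v vx w f :: real
  assumes a: "0 < a" and K: "0 \<le> K" "0 \<le> B" and f: "\<bar>f\<bar> \<le> K * B * sqrt a * \<bar>vx\<bar> + K * a * \<bar>w\<bar>"
  shows "2 * \<bar>v * f / a\<bar> \<le> vx\<^sup>2 + a * w\<^sup>2 + (K\<^sup>2 * B\<^sup>2 + K\<^sup>2) * (v\<^sup>2 / a)"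
proof -
  define s where "s = sqrt a"
  have s: "s > 0" "a = s\<^sup>2" using a by (auto simp: s_def)
  define y where "y = \<bar>v\<bar> / s"
  have "\<bar>v * f / a\<bar> = y * (\<bar>f\<bar> / s)" using s by (simp add: y_def abs_mult power2_eq_square)
  also have "\<dots> \<le> y * (K * B * \<bar>vx\<bar> + K * (s * \<bar>w\<bar>))"
  proof (rule mult_left_mono)
    show "\<bar>f\<bar> / s \<le> K * B * \<bar>vx\<bar> + K * (s * \<bar>w\<bar>)"
      using f s unfolding s_def[symmetric] by (simp add: divide_le_eq algebra_simps power2_eq_square)
  qed (use s in \<open>simp add: y_def\<close>)
  finally have "2 * \<bar>v * f / a\<bar> \<le> 2 * (K * B * y) * \<bar>vx\<bar> + 2 * (K * y) * (s * \<bar>w\<bar>)" by (simp add: algebra_simps)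
  also have "\<dots> \<le> (K * B * y)\<^sup>2 + \<bar>vx\<bar>\<^sup>2 + ((K * y)\<^sup>2 + (s * \<bar>w\<bar>)\<^sup>2)"
    by (intro add_mono sum_squares_bound)
  also have "\<dots> = vx\<^sup>2 + a * w\<^sup>2 + (K\<^sup>2 * B\<^sup>2 + K\<^sup>2) * (v\<^sup>2 / a)"
    using s by (simp add: y_def power_mult_distrib power_divide algebra_simps)
  finally show ?thesis .
qed

text \<open>The weight \<open>1 / a\<close> cancels the coefficient of \<open>vxx\<close>:
  integration by parts turns \<open>- 2 \<integral> v v_xx\<close> into
  \<open>2 \<integral> v_x^2\<close>, and \<open>young_two\<close> spends one of the two copies on
  the lower order terms.\<close>

lemma slice_v:
  assumes a: "continuous_on {0<..<1} a" "\<And>x. x \<in> {0<..<1} \<Longrightarrow> 0 < a x" and KB: "0 \<le> K" "0 \<le> B"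
    and v: "weak_deriv v vx" "weak_deriv vx vxx" "zero_trace v"
      "AE x in lebesgue. x \<in> {0<..<1} \<longrightarrow> \<bar>vx x\<bar> \<le> B" "AE x in lebesgue. x \<in> {0<..<1} \<longrightarrow> \<bar>vxx x\<bar> \<le> B"
    and vt: "set_borel_measurable lebesgue {0<..<1} vt"
      "AE x in lebesgue. x \<in> {0<..<1} \<longrightarrow> \<bar>vt x + a x * vxx x\<bar> \<le> K * B * sqrt (a x) * \<bar>vx x\<bar> + K * a x * \<bar>w x\<bar>"
    and iv: "set_integrable lebesgue {0<..<1} (\<lambda>x. 1 / a x * (v x)\<^sup>2)"
    and ivt: "set_integrable lebesgue {0<..<1} (\<lambda>x. 1 / a x * (vt x)\<^sup>2)"
    and iw: "set_integrable lebesgue {0<..<1} (\<lambda>x. a x * (w x)\<^sup>2)"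
  shows "2 * (LINT x:{0<..<1}|lebesgue. 1 / a x * (v x * vt x)) \<ge> (LINT x:{0<..<1}|lebesgue. (vx x)\<^sup>2)
    - (K\<^sup>2 * B\<^sup>2 + K\<^sup>2) * (LINT x:{0<..<1}|lebesgue. 1 / a x * (v x)\<^sup>2) - (LINT x:{0<..<1}|lebesgue. a x * (w x)\<^sup>2)"
proof -
  note L = weak_derivD(1,2)[OF v(1)] weak_derivD(2)[OF v(2)]
  have bv: "ess_bounded v" by (rule ess_bounded_zero_trace[OF v(3)])
  have bvx: "ess_bounded vx" by (rule ess_boundedI[OF L(2) v(4)])
  have bvxx: "ess_bounded vxx" by (rule ess_boundedI[OF L(3) v(5)])
  have i1: "set_integrable lebesgue {0<..<1} (\<lambda>x. v x * vxx x)"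
    by (rule ess_bounded_integrable[OF ess_bounded_mult[OF bv bvxx]])
  have i2: "set_integrable lebesgue {0<..<1} (\<lambda>x. vx x * vx x)"
    by (rule ess_bounded_integrable[OF ess_bounded_mult[OF bvx bvx]])
  have ibp: "(LINT x:{0<..<1}|lebesgue. v x * vxx x) = - (LINT x:{0<..<1}|lebesgue. vx x * vx x)"
    by (rule weak_ibp[OF v(1,2,3,4) i1 i2])
  have ma: "set_borel_measurable lebesgue {0<..<1} (\<lambda>x. 1 / a x)"
    by (intro set_borel_measurable_arith(4) set_borel_measurable_const_Ioo continuous_set_borel_measurable[OF a(1)]) auto
  have i3: "set_integrable lebesgue {0<..<1} (\<lambda>x. 1 / a x * (v x * vt x))"
    by (rule set_integrable_square_prod[OF L1_loc_measurable[OF L(1)] vt(1) ma _ iv ivt]) (use a(2) in \<open>simp add: less_imp_le\<close>)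
  let ?c = "K\<^sup>2 * B\<^sup>2 + K\<^sup>2"
  have iR1: "set_integrable lebesgue {0<..<1} (\<lambda>x. (-2) * (v x * vxx x) - vx x * vx x)"
    by (intro set_integral_diff(1) set_integrable_mult_right i1 i2)
  have iR2: "set_integrable lebesgue {0<..<1} (\<lambda>x. (-2) * (v x * vxx x) - vx x * vx x - ?c * (1 / a x * (v x)\<^sup>2))"
    by (intro set_integral_diff(1) iR1 set_integrable_mult_right iv)
  have iR: "set_integrable lebesgue {0<..<1} (\<lambda>x. (-2) * (v x * vxx x) - vx x * vx x - ?c * (1 / a x * (v x)\<^sup>2) - a x * (w x)\<^sup>2)"
    by (intro set_integral_diff(1) iR2 iw)
  have "(LINT x:{0<..<1}|lebesgue. (-2) * (v x * vxx x) - vx x * vx x - ?c * (1 / a x * (v x)\<^sup>2) - a x * (w x)\<^sup>2)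
    \<le> (LINT x:{0<..<1}|lebesgue. 2 * (1 / a x * (v x * vt x)))"
  proof (rule set_integral_mono_AE[OF iR set_integrable_mult_right[OF i3]])
    show "AE x\<in>{0<..<1} in lebesgue. (-2) * (v x * vxx x) - vx x * vx x - ?c * (1 / a x * (v x)\<^sup>2) - a x * (w x)\<^sup>2
        \<le> 2 * (1 / a x * (v x * vt x))"
      using vt(2)
    proof eventually_elim
      case (elim x)
      show ?case
      proof
        assume x: "x \<in> {0<..<1}"
        define f where "f = vt x + a x * vxx x"
        have f: "\<bar>f\<bar> \<le> K * B * sqrt (a x) * \<bar>vx x\<bar> + K * a x * \<bar>w x\<bar>" using elim x by (simp add: f_def)
        have vtx: "vt x = f - a x * vxx x" by (simp add: f_def)
        have "2 * (1 / a x * (v x * vt x)) = (-2) * (v x * vxx x) + 2 * (v x * f / a x)"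
          unfolding vtx using a(2)[OF x] by (simp add: field_simps)
        moreover have "- ((vx x)\<^sup>2 + a x * (w x)\<^sup>2 + ?c * ((v x)\<^sup>2 / a x)) \<le> 2 * (v x * f / a x)"
          using young_two[OF a(2)[OF x] KB f, of "v x"] abs_ge_minus_self[of "v x * f / a x"] by linarith
        moreover have "1 / a x * (v x)\<^sup>2 = (v x)\<^sup>2 / a x" "vx x * vx x = (vx x)\<^sup>2" by (simp_all add: power2_eq_square)
        ultimately show "(-2) * (v x * vxx x) - vx x * vx x - ?c * (1 / a x * (v x)\<^sup>2) - a x * (w x)\<^sup>2 \<le> 2 * (1 / a x * (v x * vt x))"
          by (simp only:)
      qed
    qed
  qed
  also have "(LINT x:{0<..<1}|lebesgue. (-2) * (v x * vxx x) - vx x * vx x - ?c * (1 / a x * (v x)\<^sup>2) - a x * (w x)\<^sup>2)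
    = (LINT x:{0<..<1}|lebesgue. (-2) * (v x * vxx x)) - (LINT x:{0<..<1}|lebesgue. vx x * vx x)
      - (LINT x:{0<..<1}|lebesgue. ?c * (1 / a x * (v x)\<^sup>2)) - (LINT x:{0<..<1}|lebesgue. a x * (w x)\<^sup>2)"
    using set_integral_diff(2)[OF iR2 iw] set_integral_diff(2)[OF iR1 set_integrable_mult_right[OF iv]]
      set_integral_diff(2)[OF set_integrable_mult_right[OF i1] i2]
    by metis
  also have "(LINT x:{0<..<1}|lebesgue. (-2) * (v x * vxx x)) = (-2) * (LINT x:{0<..<1}|lebesgue. v x * vxx x)"
    by (rule set_integral_mult_right)
  also have "(LINT x:{0<..<1}|lebesgue. ?c * (1 / a x * (v x)\<^sup>2)) = ?c * (LINT x:{0<..<1}|lebesgue. 1 / a x * (v x)\<^sup>2)"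
    by (rule set_integral_mult_right)
  also have "(LINT x:{0<..<1}|lebesgue. 2 * (1 / a x * (v x * vt x))) = 2 * (LINT x:{0<..<1}|lebesgue. 1 / a x * (v x * vt x))"
    by (rule set_integral_mult_right)
  finally show ?thesis unfolding ibp by (simp add: power2_eq_square)
qed

text \<open>\<open>P\<close> is at most \<open>- \<integral> W zx\<close> up to the error
  \<open>6 * B\<^sup>2 * \<delta>\<close>. Given that, the first inequality says that the integral
  of a square is nonnegative, and the second is Young's inequality for
  \<open>\<integral> W q\<close> in the formula for \<open>J'\<close>.\<close>

lemma slice_w:
  assumes a: "continuous_on {0..1} a" "a C1_differentiable_on {0<..<1}" "\<And>x. x \<in> {0<..<1} \<Longrightarrow> 0 < a x"
      "\<And>x. x \<in> {0<..<1} \<Longrightarrow> \<bar>deriv a x\<bar> \<le> K * sqrt (a x)" "0 \<le> K" "0 \<le> B"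
    and L: "level_intervals a \<delta> \<C>" and \<delta>: "0 < \<delta>"
    and w: "weak_deriv w wx" "AE x in lebesgue. x \<in> {0<..<1} \<longrightarrow> \<bar>w x\<bar> \<le> B" "AE x in lebesgue. x \<in> {0<..<1} \<longrightarrow> \<bar>wx x\<bar> \<le> B"
    and z: "weak_deriv (\<lambda>x. a x * w x) zx" "zero_trace (\<lambda>x. a x * w x)"
    and q: "ess_bounded q" and R: "weak_deriv (\<lambda>x. zx x + q x) wt"
    and iwt: "set_integrable lebesgue {0<..<1} (\<lambda>x. a x * (wt x)\<^sup>2)"
  defines "W \<equiv> mean_free_primitive \<C> w" and "W' \<equiv> mean_free_primitive \<C> wt"
  defines "P \<equiv> (LINT x:{0<..<1}|lebesgue. a x * (w x)\<^sup>2)" and "J \<equiv> (LINT x:{0<..<1}|lebesgue. (W x)\<^sup>2)"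
    and "P' \<equiv> 2 * (LINT x:{0<..<1}|lebesgue. a x * (w x * wt x))" and "J' \<equiv> 2 * (LINT x:{0<..<1}|lebesgue. W x * W' x)"
    and "Qq \<equiv> (LINT x:{0<..<1}|lebesgue. (q x)\<^sup>2)"
  shows "0 \<le> \<beta> \<Longrightarrow> P' - \<beta> * J' + 2 * \<beta> * P - 2 * \<beta>\<^sup>2 * J \<le> Qq / 2 + 2 * \<beta> * (6 * B\<^sup>2 * \<delta>)"
    and "0 \<le> c \<Longrightarrow> c * J' \<le> c * (- 2 * P + 2 * (6 * B\<^sup>2 * \<delta>)) + Qq / 2 + 2 * c\<^sup>2 * J"
proof -
  let ?I = "\<lambda>f::real \<Rightarrow> real. LINT x:{0<..<1}|lebesgue. f x"
  let ?S = "set_integrable lebesgue {0<..<1}"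
  note Lw = weak_derivD(1,2)[OF w(1)] and Lz = weak_derivD(2)[OF z(1)] and Lt = weak_derivD(2)[OF R]
  have ba: "ess_bounded a" by (rule ess_bounded_continuous[OF a(1)])
  have bw: "ess_bounded w" by (rule ess_boundedI[OF Lw(1) w(2)])
  have ca: "continuous_on {0<..<1} a" by (rule continuous_on_subset[OF a(1)]) auto
  obtain w0 where w0: "ac_rep w0 wx" "AE x in lebesgue. x \<in> {0<..<1} \<longrightarrow> w x = w0 x"
    using weak_deriv_ac_rep[OF w(1)] .
  obtain z0 where z0: "ac_rep z0 zx" "AE x in lebesgue. x \<in> {0<..<1} \<longrightarrow> a x * w x = z0 x"
    using weak_deriv_ac_rep[OF z(1)] .
  obtain R0 where R0: "ac_rep R0 wt" "AE x in lebesgue. x \<in> {0<..<1} \<longrightarrow> zx x + q x = R0 x"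
    using weak_deriv_ac_rep[OF R] .
  have w0B: "\<bar>w0 x\<bar> \<le> B" if "x \<in> {0<..<1}" for x
    by (rule AE_continuous_abs_le[OF ac_rep_continuous[OF w0(1)] _ _ that])
       (use w0(2) w(2) in \<open>auto elim!: eventually_elim2\<close>)
  \<comment> \<open>Equality at every point, since \<open>z0\<close> is evaluated below at the end
    points of the level intervals.\<close>
  have zw: "z0 x = a x * w0 x" if "x \<in> {0<..<1}" for x
    by (rule AE_continuous_eq[OF ac_rep_continuous[OF z0(1)] _ _ that])
       (use w0(2) z0(2) in \<open>auto intro!: continuous_intros ca ac_rep_continuous[OF w0(1)] elim!: eventually_elim2\<close>)
  have aw: "ac_rep (\<lambda>x. a x * w0 x) (\<lambda>x. a x * wx x + deriv a x * w0 x)"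
    by (rule ac_rep_mult[OF C1_ac_rep(1)[OF a(2)] w0(1)])
  have "ac_rep (\<lambda>x. a x * w0 x) zx" using z0(1) zw unfolding ac_rep_def by auto
  from ac_rep_unique[OF this aw]
  have zx: "AE x in lebesgue. x \<in> {0<..<1} \<longrightarrow> zx x = a x * wx x + deriv a x * w0 x" .
  obtain A where A: "\<forall>x\<in>{0..1}. \<bar>a x\<bar> \<le> A"
    using compact_imp_bounded[OF compact_continuous_image[OF a(1) compact_Icc]] by (auto simp: bounded_iff)
  then have A0: "0 \<le> A" by (metis abs_ge_zero atLeastAtMost_iff order_refl order_trans zero_le_one)
  \<comment> \<open>Product rule for \<open>a w\<close>; near the ends \<open>deriv a\<close> is
    controlled by \<open>|a_x| \<le> K sqrt a\<close>.\<close>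
  have bzx: "ess_bounded zx"
  proof (rule ess_boundedI[OF Lz])
    show "AE x in lebesgue. x \<in> {0<..<1} \<longrightarrow> \<bar>zx x\<bar> \<le> A * B + K * sqrt A * B"
      using zx w(3)
    proof eventually_elim
      case (elim x)
      show ?case
      proof
        assume x: "x \<in> {0<..<1}"
        have "\<bar>a x * wx x\<bar> \<le> A * B" unfolding abs_mult
          by (rule mult_mono) (use x A A0 elim in auto)
        moreover have "\<bar>deriv a x\<bar> \<le> K * sqrt A"
          by (rule order_trans[OF a(4)[OF x]]) (use x A a(5) in \<open>auto intro!: mult_left_mono dest!: bspec[of _ _ x]\<close>)
        then have "\<bar>deriv a x * w0 x\<bar> \<le> K * sqrt A * B" unfolding abs_mult
          by (rule mult_mono) (use w0B[OF x] a(5) A0 in auto)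
        ultimately show "\<bar>zx x\<bar> \<le> A * B + K * sqrt A * B" using elim x by auto
      qed
    qed
  qed
  have mwt: "set_borel_measurable lebesgue {0<..<1} wt" by (rule L1_loc_measurable[OF Lt])
  have iw: "?S (\<lambda>x. a x * (w x)\<^sup>2)"
    unfolding power2_eq_square by (intro ess_bounded_integrable ess_bounded_mult ba bw)
  have bR: "ess_bounded (\<lambda>x. zx x + q x)" by (rule ess_bounded_add[OF bzx q])
  obtain BR where BR: "AE x in lebesgue. x \<in> {0<..<1} \<longrightarrow> \<bar>zx x + q x\<bar> \<le> BR"
    using bR by (auto simp: ess_bounded_def)
  have "?S (\<lambda>x. a x * (w x * wt x))"
    by (rule set_integrable_square_prod[OF _ mwt _ _ iw iwt])
       (use bw ba a(3) in \<open>auto simp: ess_bounded_def less_imp_le\<close>)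
  then have iawwt: "?S (\<lambda>x. (a x * w x) * wt x)" by (simp add: mult.assoc)
  have izR: "?S (\<lambda>x. zx x * (zx x + q x))"
    by (rule ess_bounded_integrable[OF ess_bounded_mult[OF bzx bR]])
  \<comment> \<open>No boundary terms arise: \<open>a w\<close> has zero trace and the flux
    \<open>zx + q\<close> is bounded.\<close>
  have P'eq: "P' = - 2 * ?I (\<lambda>x. zx x * (zx x + q x))"
    using weak_ibp[OF z(1) R z(2) BR iawwt izR] unfolding P'_def by (simp add: mult.assoc)

  have ab: "0 < \<alpha>" "\<alpha> < \<beta>" "\<beta> < 1" "a \<alpha> = \<delta>" "a \<beta> = \<delta>" if "(\<alpha>, \<beta>) \<in> \<C>" for \<alpha> \<beta>
    using L that by (auto simp: level_intervals_def)
  have si: "set_integrable lebesgue {\<alpha>..\<beta>} w" "set_integrable lebesgue {\<alpha>..\<beta>} wt" "set_integrable lebesgue {\<alpha>..\<beta>} zx"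
    if "(\<alpha>, \<beta>) \<in> \<C>" for \<alpha> \<beta>
    using Lw(1) Lt Lz ab[OF that] by (auto simp: L1_loc_def)
  have Wp: "mfp_on \<alpha> \<beta> f x = mfp_on \<alpha> \<beta> f \<alpha> + (LINT y:{\<alpha>..x}|lebesgue. f y)"
    if "(\<alpha>, \<beta>) \<in> \<C>" "set_integrable lebesgue {\<alpha>..\<beta>} f" "x \<in> {\<alpha>..\<beta>}" for \<alpha> \<beta> x f
    by (rule mfp_on_primitive[OF that(2) _ that(3)]) (use ab[OF that(1)] in simp)
  have cW: "continuous_on {\<alpha>..\<beta>} (mfp_on \<alpha> \<beta> f)" if "(\<alpha>, \<beta>) \<in> \<C>" "set_integrable lebesgue {\<alpha>..\<beta>} f" for \<alpha> \<beta> f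
    by (rule primitive_continuous[OF that(2) Wp[OF that]])
  have Wae: "AE x in lebesgue. x \<in> {\<alpha>..\<beta>} \<longrightarrow> mean_free_primitive \<C> f x = mfp_on \<alpha> \<beta> f x"
    if p: "(\<alpha>, \<beta>) \<in> \<C>" "set_integrable lebesgue {\<alpha>..\<beta>} f" for \<alpha> \<beta> f
    unfolding AE_lebesgue_iff using AE_lborel_singleton[of \<alpha>] AE_lborel_singleton[of \<beta>]
    by eventually_elim (use mfp_eq[OF L p(1) _ p(2)] in auto)
  have intle: "\<bar>LINT y:S|lebesgue. w y * r y\<bar> \<le> B * (\<beta> - \<alpha>)"
    if p: "(\<alpha>, \<beta>) \<in> \<C>" and S: "S = {\<alpha>..x}" "x \<in> {\<alpha>..\<beta>}" and r: "continuous_on {\<alpha>..\<beta>} r" "\<And>y. y \<in> {\<alpha>..\<beta>} \<Longrightarrow> \<bar>r y\<bar> \<le> 1"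
    for \<alpha> \<beta> S r x
  proof -
    have "set_integrable lebesgue {\<alpha>..\<beta>} (\<lambda>y. r y * w y)"
      by (rule continuous_mult_set_integrable[OF r(1) si(1)[OF p]])
    then have iS: "set_integrable lebesgue S (\<lambda>y. w y * r y)"
      using S by (auto intro: set_integrable_subset simp: mult.commute)
    have "norm (LINT y:S|lebesgue. w y * r y) \<le> (LINT y:S|lebesgue. norm (w y * r y))"
      by (rule set_integral_norm_bound[OF iS])
    also have "\<dots> \<le> (LINT y:S|lebesgue. B)"
    proof (rule set_integral_mono_AE)
      show "set_integrable lebesgue S (\<lambda>y. norm (w y * r y))" using set_integrable_abs[OF iS] by simp
      show "set_integrable lebesgue S (\<lambda>y. B)" unfolding S by (rule set_integrable_const_Icc)
      show "AE y\<in>S in lebesgue. norm (w y * r y) \<le> B"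
        using w(2) by eventually_elim
          (use S ab[OF p] r(2) a(6) in \<open>auto simp: abs_mult intro!: mult_le_one[THEN order_trans] order_trans[OF mult_left_le]\<close>)
    qed
    also have "\<dots> = B * (x - \<alpha>)" unfolding S(1) using S(2) by (simp add: set_integral_const)
    also have "\<dots> \<le> B * (\<beta> - \<alpha>)" by (rule mult_left_mono) (use S(2) a(6) in auto)
    finally show ?thesis by simp
  qed
  \<comment> \<open>The factor \<open>\<beta> - \<alpha>\<close> is kept because its sum over the
    disjoint intervals is at most \<open>1\<close>; the errors then do not depend on the number of
    intervals, over which there is no control.\<close>
  have Wb: "\<bar>mfp_on \<alpha> \<beta> w x\<bar> \<le> 2 * B * (\<beta> - \<alpha>)" if p: "(\<alpha>, \<beta>) \<in> \<C>" and x: "x \<in> {\<alpha>..\<beta>}" for \<alpha> \<beta> x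
  proof -
    have "\<bar>LINT y:{\<alpha>..x}|lebesgue. w y * 1\<bar> \<le> B * (\<beta> - \<alpha>)"
      by (rule intle[OF p refl x]) auto
    then have "\<bar>LINT y:{\<alpha>..x}|lebesgue. w y\<bar> \<le> B * (\<beta> - \<alpha>)" by simp
    moreover have "\<bar>LINT y:{\<alpha>..\<beta>}|lebesgue. w y * ((\<beta> - y) / (\<beta> - \<alpha>))\<bar> \<le> B * (\<beta> - \<alpha>)"
      by (rule intle[OF p refl]) (use ab[OF p] in \<open>auto intro!: continuous_intros simp: divide_simps\<close>)
    moreover have "(LINT y:{\<alpha>..\<beta>}|lebesgue. w y * ((\<beta> - y) / (\<beta> - \<alpha>))) = (LINT y:{\<alpha>..\<beta>}|lebesgue. (\<beta> - y) * w y) / (\<beta> - \<alpha>)"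
      unfolding set_integral_divide_zero[symmetric] by (intro set_lebesgue_integral_cong) (auto simp: mult.commute)
    ultimately show ?thesis unfolding mfp_on_def by linarith
  qed
  have len: "(\<Sum>(\<alpha>, \<beta>)\<in>\<C>. \<beta> - \<alpha>) \<le> 1"
  proof -
    define \<psi> :: "real \<Rightarrow> real" where "\<psi> x = (if \<exists>(\<alpha>, \<beta>)\<in>\<C>. x \<in> {\<alpha><..<\<beta>} then 1 else 0)" for x
    have ae: "AE x in lebesgue. x \<in> {\<alpha>..\<beta>} \<longrightarrow> \<psi> x = 1" if p: "(\<alpha>, \<beta>) \<in> \<C>" for \<alpha> \<beta>
      unfolding AE_lebesgue_iff using AE_lborel_singleton[of \<alpha>] AE_lborel_singleton[of \<beta>]
      by eventually_elim (use p in \<open>force simp: \<psi>_def\<close>)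
    have i\<psi>: "set_integrable lebesgue {\<alpha>..\<beta>} \<psi>" if p: "(\<alpha>, \<beta>) \<in> \<C>" for \<alpha> \<beta>
      using set_integral_cong_lebesgue(1)[OF ae[OF p]] set_integrable_const_Icc by blast
    have o\<psi>: "\<psi> x = 0" if "\<And>\<alpha> \<beta>. (\<alpha>, \<beta>) \<in> \<C> \<Longrightarrow> x \<notin> {\<alpha><..<\<beta>}" for x using that by (auto simp: \<psi>_def)
    have i\<psi>': "?S \<psi>" by (rule level_intervals_sum(1)[OF L o\<psi> i\<psi>])
    have "(\<Sum>(\<alpha>, \<beta>)\<in>\<C>. \<beta> - \<alpha>) = (\<Sum>(\<alpha>, \<beta>)\<in>\<C>. LINT x:{\<alpha>..\<beta>}|lebesgue. \<psi> x)"
    proof (intro sum.cong refl, clarify)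
      fix \<alpha> \<beta> assume p: "(\<alpha>, \<beta>) \<in> \<C>"
      show "\<beta> - \<alpha> = (LINT x:{\<alpha>..\<beta>}|lebesgue. \<psi> x)"
        using ab[OF p] unfolding set_integral_cong_lebesgue(2)[OF ae[OF p]] by (simp add: set_integral_const)
    qed
    also have "\<dots> = ?I \<psi>" by (rule level_intervals_sum(2)[OF L o\<psi> i\<psi>, symmetric])
    also have "\<dots> \<le> ?I (\<lambda>_::real. 1)"
      by (rule set_integral_mono[OF i\<psi>' set_integrable_one_Ioo]) (auto simp: \<psi>_def)
    also have "\<dots> = 1" using set_integral_Ioo_Icc(2)[of 0 1 "\<lambda>_. 1"] by (simp add: set_integral_const)
    finally show ?thesis .
  qed
  have Wout: "W x = 0" if "\<And>\<alpha> \<beta>. (\<alpha>, \<beta>) \<in> \<C> \<Longrightarrow> x \<notin> {\<alpha><..<\<beta>}" for x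
    unfolding W_def by (rule mfp_out[OF that])
  have bW: "ess_bounded W"
    unfolding ess_bounded_def
  proof (intro conjI exI AE_I2 impI)
    have "?S W"
    proof (rule level_intervals_sum(1)[OF L Wout])
      fix \<alpha> \<beta> assume p: "(\<alpha>, \<beta>) \<in> \<C>"
      show "set_integrable lebesgue {\<alpha>..\<beta>} W"
        unfolding W_def set_integral_cong_lebesgue(1)[OF Wae[OF p si(1)[OF p]]]
        by (rule mfp_on_mean(1)[OF si(1)[OF p] ab(2)[OF p]])
    qed
    then show "set_borel_measurable lebesgue {0<..<1} W" by (rule set_integrable_measurable)
    show "\<bar>W x\<bar> \<le> 2 * B" for x
    proof (cases "\<exists>\<alpha> \<beta>. (\<alpha>, \<beta>) \<in> \<C> \<and> x \<in> {\<alpha><..<\<beta>}")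
      case True
      then obtain \<alpha> \<beta> where p: "(\<alpha>, \<beta>) \<in> \<C>" "x \<in> {\<alpha><..<\<beta>}" by blast
      have "\<bar>W x\<bar> \<le> 2 * B * (\<beta> - \<alpha>)"
        unfolding W_def mfp_eq[OF L p si(1)[OF p(1)]] by (rule Wb[OF p(1)]) (use p(2) in auto)
      also have "\<dots> \<le> 2 * B * 1" by (rule mult_left_mono) (use ab[OF p(1)] a(6) in auto)
      finally show ?thesis by simp
    next
      case False
      then show ?thesis using Wout[of x] a(6) by auto
    qed
  qed
  have W_sum: "?I (\<lambda>x. W x * g x) = (\<Sum>(\<alpha>, \<beta>)\<in>\<C>. LINT x:{\<alpha>..\<beta>}|lebesgue. mfp_on \<alpha> \<beta> w x * h \<alpha> \<beta> x)"
    if h: "\<And>\<alpha> \<beta>. (\<alpha>, \<beta>) \<in> \<C> \<Longrightarrow> set_integrable lebesgue {\<alpha>..\<beta>} (\<lambda>x. mfp_on \<alpha> \<beta> w x * h \<alpha> \<beta> x)"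
      and gh: "\<And>\<alpha> \<beta>. (\<alpha>, \<beta>) \<in> \<C> \<Longrightarrow> AE x in lebesgue. x \<in> {\<alpha>..\<beta>} \<longrightarrow> g x = h \<alpha> \<beta> x" for g h
  proof -
    have ae: "AE x in lebesgue. x \<in> {\<alpha>..\<beta>} \<longrightarrow> W x * g x = mfp_on \<alpha> \<beta> w x * h \<alpha> \<beta> x" if p: "(\<alpha>, \<beta>) \<in> \<C>" for \<alpha> \<beta>
      using Wae[OF p si(1)[OF p]] gh[OF p] unfolding W_def by eventually_elim auto
    have "?I (\<lambda>x. W x * g x) = (\<Sum>(\<alpha>, \<beta>)\<in>\<C>. LINT x:{\<alpha>..\<beta>}|lebesgue. W x * g x)"
      by (rule level_intervals_sum(2)[OF L]) (use Wout set_integral_cong_lebesgue(1)[OF ae] h in auto)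
    also have "\<dots> = (\<Sum>(\<alpha>, \<beta>)\<in>\<C>. LINT x:{\<alpha>..\<beta>}|lebesgue. mfp_on \<alpha> \<beta> w x * h \<alpha> \<beta> x)"
      by (intro sum.cong refl) (use set_integral_cong_lebesgue(2)[OF ae] in auto)
    finally show ?thesis .
  qed
  \<comment> \<open>On each interval \<open>W'\<close> and the flux differ by a constant almost
    everywhere, and the zero mean of \<open>W\<close> annihilates it. Thus no boundary value of the
    flux is needed.\<close>
  have J'eq: "?I (\<lambda>x. W x * W' x) = ?I (\<lambda>x. W x * (zx x + q x))"
  proof -
    have "?I (\<lambda>x. W x * W' x) = (\<Sum>(\<alpha>, \<beta>)\<in>\<C>. LINT x:{\<alpha>..\<beta>}|lebesgue. mfp_on \<alpha> \<beta> w x * mfp_on \<alpha> \<beta> wt x)"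
    proof (rule W_sum)
      fix \<alpha> \<beta> assume p: "(\<alpha>, \<beta>) \<in> \<C>"
      show "set_integrable lebesgue {\<alpha>..\<beta>} (\<lambda>x. mfp_on \<alpha> \<beta> w x * mfp_on \<alpha> \<beta> wt x)"
        by (intro absolutely_integrable_continuous_real continuous_intros cW p si)
      show "AE x in lebesgue. x \<in> {\<alpha>..\<beta>} \<longrightarrow> W' x = mfp_on \<alpha> \<beta> wt x"
        unfolding W'_def by (rule Wae[OF p si(2)[OF p]])
    qed
    also have "\<dots> = (\<Sum>(\<alpha>, \<beta>)\<in>\<C>. LINT x:{\<alpha>..\<beta>}|lebesgue. mfp_on \<alpha> \<beta> w x * R0 x)"
    proof (intro sum.cong refl, clarify)
      fix \<alpha> \<beta> assume p: "(\<alpha>, \<beta>) \<in> \<C>"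
      define c where "c = R0 \<alpha> - mfp_on \<alpha> \<beta> wt \<alpha>"
      have c: "R0 x = mfp_on \<alpha> \<beta> wt x + c" if x: "x \<in> {\<alpha>..\<beta>}" for x
        using ac_repD(2)[OF R0(1), of \<alpha> x] Wp[OF p si(2)[OF p] x] ab[OF p] x unfolding c_def by force
      have i1: "set_integrable lebesgue {\<alpha>..\<beta>} (\<lambda>x. mfp_on \<alpha> \<beta> w x * mfp_on \<alpha> \<beta> wt x)"
        by (intro absolutely_integrable_continuous_real continuous_intros cW p si)
      have "(LINT x:{\<alpha>..\<beta>}|lebesgue. mfp_on \<alpha> \<beta> w x * R0 x)
        = (LINT x:{\<alpha>..\<beta>}|lebesgue. mfp_on \<alpha> \<beta> w x * mfp_on \<alpha> \<beta> wt x + mfp_on \<alpha> \<beta> w x * c)"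
        by (intro set_lebesgue_integral_cong) (auto simp: c algebra_simps)
      also have "\<dots> = (LINT x:{\<alpha>..\<beta>}|lebesgue. mfp_on \<alpha> \<beta> w x * mfp_on \<alpha> \<beta> wt x)"
        using set_integral_add(2)[OF i1 set_integrable_mult_left] mfp_on_mean[OF si(1)[OF p] ab(2)[OF p]] by simp
      finally show "(LINT x:{\<alpha>..\<beta>}|lebesgue. mfp_on \<alpha> \<beta> w x * mfp_on \<alpha> \<beta> wt x) = (LINT x:{\<alpha>..\<beta>}|lebesgue. mfp_on \<alpha> \<beta> w x * R0 x)" ..
    qed
    also have "\<dots> = ?I (\<lambda>x. W x * (zx x + q x))"
    proof (rule W_sum[symmetric])
      fix \<alpha> \<beta> assume p: "(\<alpha>, \<beta>) \<in> \<C>"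
      have "continuous_on {\<alpha>..\<beta>} R0" by (rule continuous_on_subset[OF ac_rep_continuous[OF R0(1)]]) (use ab[OF p] in auto)
      then show "set_integrable lebesgue {\<alpha>..\<beta>} (\<lambda>x. mfp_on \<alpha> \<beta> w x * R0 x)"
        by (intro absolutely_integrable_continuous_real continuous_intros cW p si)
      show "AE x in lebesgue. x \<in> {\<alpha>..\<beta>} \<longrightarrow> zx x + q x = R0 x"
        using R0(2) by eventually_elim (use ab[OF p] in auto)
    qed
    finally show ?thesis .
  qed
  \<comment> \<open>Origin of the \<open>6\<close>: off the intervals \<open>a w\<^sup>2\<close> is
    at most \<open>2 * \<delta> * B\<^sup>2\<close>, and the boundary terms of all intervals
    together contribute at most \<open>4 * B\<^sup>2 * \<delta>\<close>.\<close>
  have Pest: "P \<le> 6 * B\<^sup>2 * \<delta> - ?I (\<lambda>x. W x * zx x)"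
  proof -
    define \<psi> where "\<psi> x = (if \<exists>(\<alpha>, \<beta>)\<in>\<C>. x \<in> {\<alpha><..<\<beta>} then a x * (w x)\<^sup>2 else 0)" for x
    have ae: "AE x in lebesgue. x \<in> {\<alpha>..\<beta>} \<longrightarrow> \<psi> x = w x * z0 x" if p: "(\<alpha>, \<beta>) \<in> \<C>" for \<alpha> \<beta>
    proof -
      have "AE x in lebesgue. x \<noteq> \<alpha>" "AE x in lebesgue. x \<noteq> \<beta>"
        unfolding AE_lebesgue_iff by (rule AE_lborel_singleton)+
      then show ?thesis using z0(2)
        by eventually_elim (use p ab[OF p] in \<open>force simp: \<psi>_def power2_eq_square\<close>)
    qed
    have cz: "continuous_on {\<alpha>..\<beta>} z0" if p: "(\<alpha>, \<beta>) \<in> \<C>" for \<alpha> \<beta>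
      by (rule continuous_on_subset[OF ac_rep_continuous[OF z0(1)]]) (use ab[OF p] in auto)
    have i\<psi>: "set_integrable lebesgue {\<alpha>..\<beta>} \<psi>" if p: "(\<alpha>, \<beta>) \<in> \<C>" for \<alpha> \<beta>
      unfolding set_integral_cong_lebesgue(1)[OF ae[OF p]]
      using continuous_mult_set_integrable[OF cz[OF p] si(1)[OF p]] by (simp add: mult.commute)
    have o\<psi>: "\<psi> x = 0" if "\<And>\<alpha> \<beta>. (\<alpha>, \<beta>) \<in> \<C> \<Longrightarrow> x \<notin> {\<alpha><..<\<beta>}" for x using that by (auto simp: \<psi>_def)
    have i\<psi>': "?S \<psi>" by (rule level_intervals_sum(1)[OF L o\<psi> i\<psi>])
    have sum\<psi>: "?I \<psi> = (\<Sum>(\<alpha>, \<beta>)\<in>\<C>. LINT x:{\<alpha>..\<beta>}|lebesgue. \<psi> x)"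
      by (rule level_intervals_sum(2)[OF L o\<psi> i\<psi>])
    have one: "?I (\<lambda>_::real. c) = c" for c :: real
      using set_integral_Ioo_Icc(2)[of 0 1 "\<lambda>_. c"] by (simp add: set_integral_const)
    have "P \<le> ?I (\<lambda>x. 2 * \<delta> * B\<^sup>2 + \<psi> x)"
      unfolding P_def
    proof (rule set_integral_mono_AE[OF iw set_integral_add(1)[OF _ i\<psi>']])
      show "?S (\<lambda>_::real. 2 * \<delta> * B\<^sup>2)" by (rule ess_bounded_integrable[OF ess_bounded_const])
      show "AE x\<in>{0<..<1} in lebesgue. a x * (w x)\<^sup>2 \<le> 2 * \<delta> * B\<^sup>2 + \<psi> x"
        using w(2)
      proof eventually_elim
        case (elim x)
        show ?case
        proof
          assume x: "x \<in> {0<..<1}"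
          show "a x * (w x)\<^sup>2 \<le> 2 * \<delta> * B\<^sup>2 + \<psi> x"
          proof (cases "\<exists>(\<alpha>, \<beta>)\<in>\<C>. x \<in> {\<alpha><..<\<beta>}")
            case True
            then show ?thesis using \<delta> by (simp add: \<psi>_def)
          next
            case False
            then have "a x \<le> 2 * \<delta>" using L x by (auto simp: level_intervals_def)
            moreover have "(w x)\<^sup>2 \<le> B\<^sup>2" using elim x abs_le_square_iff[of "w x" B] a(6) by auto
            ultimately have "a x * (w x)\<^sup>2 \<le> 2 * \<delta> * B\<^sup>2" using \<delta> by (intro mult_mono) auto
            with False show ?thesis by (simp only: \<psi>_def if_False)
          qed
        qed
      qed
    qed
    also have "\<dots> = 2 * \<delta> * B\<^sup>2 + ?I \<psi>"
      using set_integral_add(2)[OF ess_bounded_integrable[OF ess_bounded_const] i\<psi>', of "2 * \<delta> * B\<^sup>2"] one by simp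
    also have "?I \<psi> = (\<Sum>(\<alpha>, \<beta>)\<in>\<C>. LINT x:{\<alpha>..\<beta>}|lebesgue. w x * z0 x)"
      unfolding sum\<psi>
      by (intro sum.cong refl) (use set_integral_cong_lebesgue(2)[OF ae] in auto)
    also have "\<dots> \<le> (\<Sum>(\<alpha>, \<beta>)\<in>\<C>. 4 * B\<^sup>2 * \<delta> * (\<beta> - \<alpha>) - (LINT x:{\<alpha>..\<beta>}|lebesgue. mfp_on \<alpha> \<beta> w x * zx x))"
    proof (rule sum_mono, clarify)
      fix \<alpha> \<beta> assume p: "(\<alpha>, \<beta>) \<in> \<C>"
      let ?M = "mfp_on \<alpha> \<beta> w"
      have "(LINT x:{\<alpha>..\<beta>}|lebesgue. ?M x * zx x) + (LINT x:{\<alpha>..\<beta>}|lebesgue. w x * z0 x) = ?M \<beta> * z0 \<beta> - ?M \<alpha> * z0 \<alpha>"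
      proof (rule parts(3)[OF _ si(1,3)[OF p] Wp[OF p si(1)[OF p]]])
        show "z0 x = z0 \<alpha> + (LINT y:{\<alpha>..x}|lebesgue. zx y)" if "x \<in> {\<alpha>..\<beta>}" for x
          by (rule ac_repD(2)[OF z0(1)]) (use ab[OF p] that in auto)
      qed (use ab[OF p] in simp)
      \<comment> \<open>At an end point the primitive is at most
        \<open>2 * B * (\<beta> - \<alpha>)\<close> and \<open>a w\<close> at most
        \<open>\<delta> * B\<close> in modulus; the two end points together give the factor
        \<open>4\<close>.\<close>
      moreover have "\<bar>?M x * z0 x\<bar> \<le> 2 * B\<^sup>2 * \<delta> * (\<beta> - \<alpha>)" if x: "x = \<alpha> \<or> x = \<beta>" for x
      proof -
        have x01: "x \<in> {0<..<1}" "x \<in> {\<alpha>..\<beta>}" "a x = \<delta>" using x ab[OF p] by auto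
        have "\<bar>z0 x\<bar> \<le> \<delta> * B" unfolding zw[OF x01(1)] abs_mult
          using w0B[OF x01(1)] x01(3) \<delta> by (auto intro: mult_left_mono)
        then have "\<bar>?M x\<bar> * \<bar>z0 x\<bar> \<le> (2 * B * (\<beta> - \<alpha>)) * (\<delta> * B)"
          by (intro mult_mono Wb[OF p x01(2)]) (use ab[OF p] a(6) in auto)
        then show ?thesis by (simp add: abs_mult power2_eq_square algebra_simps)
      qed
      from this[of \<alpha>] this[of \<beta>] have "?M \<beta> * z0 \<beta> - ?M \<alpha> * z0 \<alpha> \<le> 4 * B\<^sup>2 * \<delta> * (\<beta> - \<alpha>)" by (simp add: abs_le_iff)
      ultimately show "(LINT x:{\<alpha>..\<beta>}|lebesgue. w x * z0 x) \<le> 4 * B\<^sup>2 * \<delta> * (\<beta> - \<alpha>) - (LINT x:{\<alpha>..\<beta>}|lebesgue. ?M x * zx x)"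
        by simp
    qed
    also have "\<dots> = 4 * B\<^sup>2 * \<delta> * (\<Sum>(\<alpha>, \<beta>)\<in>\<C>. \<beta> - \<alpha>) - (\<Sum>(\<alpha>, \<beta>)\<in>\<C>. LINT x:{\<alpha>..\<beta>}|lebesgue. mfp_on \<alpha> \<beta> w x * zx x)"
      by (simp only: sum_distrib_left sum_subtractf[symmetric] case_prod_unfold)
    also have "(\<Sum>(\<alpha>, \<beta>)\<in>\<C>. LINT x:{\<alpha>..\<beta>}|lebesgue. mfp_on \<alpha> \<beta> w x * zx x) = ?I (\<lambda>x. W x * zx x)"
      by (rule W_sum[symmetric]) (auto intro!: continuous_mult_set_integrable cW si)
    also have "4 * B\<^sup>2 * \<delta> * (\<Sum>(\<alpha>, \<beta>)\<in>\<C>. \<beta> - \<alpha>) \<le> 4 * B\<^sup>2 * \<delta> * 1"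
      by (rule mult_left_mono[OF len]) (use \<delta> in auto)
    finally show ?thesis by (simp add: algebra_simps)
  qed

  have b2: "?S (\<lambda>x. zx x * (zx x + q x))" "?S (\<lambda>x. W x * (zx x + q x))" "?S (\<lambda>x. W x * zx x)" "?S (\<lambda>x. W x * q x)"
    "?S (\<lambda>x. (W x)\<^sup>2)" "?S (\<lambda>x. (q x)\<^sup>2)"
    unfolding power2_eq_square by (intro ess_bounded_integrable ess_bounded_mult ess_bounded_add bzx bW q)+
  have split: "?I (\<lambda>x. W x * (zx x + q x)) = ?I (\<lambda>x. W x * zx x) + ?I (\<lambda>x. W x * q x)"
    using set_integral_add(2)[OF b2(3,4)] by (simp add: algebra_simps)
  { assume \<beta>: "0 \<le> \<beta>"
    have "?I (\<lambda>x. (-2) * (zx x * (zx x + q x)) + (-2 * \<beta>) * (W x * (zx x + q x)) + (-2 * \<beta>) * (W x * zx x) + (-2 * \<beta>\<^sup>2) * (W x)\<^sup>2)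
      \<le> ?I (\<lambda>x. (1/2) * (q x)\<^sup>2)"
    proof (rule set_integral_mono)
      fix x
      \<comment> \<open>The difference of the two sides is exactly this square; the summand
        \<open>q / 2\<close> accounts for the products of \<open>q\<close> with \<open>zx\<close>
        and \<open>W\<close> and costs \<open>q\<^sup>2 / 2\<close>.\<close>
      have "0 \<le> 2 * (zx x + \<beta> * W x + q x / 2)\<^sup>2" by simp
      then show "(-2) * (zx x * (zx x + q x)) + (-2 * \<beta>) * (W x * (zx x + q x)) + (-2 * \<beta>) * (W x * zx x) + (-2 * \<beta>\<^sup>2) * (W x)\<^sup>2 \<le> (1/2) * (q x)\<^sup>2"
        by (simp add: power2_eq_square algebra_simps)
    qed (intro set_integral_add(1) set_integrable_mult_right b2)+
    also have "?I (\<lambda>x. (-2) * (zx x * (zx x + q x)) + (-2 * \<beta>) * (W x * (zx x + q x)) + (-2 * \<beta>) * (W x * zx x) + (-2 * \<beta>\<^sup>2) * (W x)\<^sup>2)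
      = (-2) * ?I (\<lambda>x. zx x * (zx x + q x)) + (-2 * \<beta>) * ?I (\<lambda>x. W x * (zx x + q x)) + (-2 * \<beta>) * ?I (\<lambda>x. W x * zx x) + (-2 * \<beta>\<^sup>2) * ?I (\<lambda>x. (W x)\<^sup>2)"
    proof -
      have add: "?I (\<lambda>x. f x + c * g x) = ?I f + c * ?I g" if "?S f" "?S g" for f g c
        using set_integral_add(2)[OF that(1) set_integrable_mult_right[of c, OF that(2)]] by simp
      have "?I (\<lambda>x. (-2) * (zx x * (zx x + q x))) = (-2) * ?I (\<lambda>x. zx x * (zx x + q x))" by (rule set_integral_mult_right)
      then show ?thesis
        by (simp only: add b2 set_integral_add(1) set_integrable_mult_right)
    qed
    also have "?I (\<lambda>x. (1/2) * (q x)\<^sup>2) = (1/2) * Qq" unfolding Qq_def by (rule set_integral_mult_right)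
    finally have "P' - \<beta> * J' - 2 * \<beta> * ?I (\<lambda>x. W x * zx x) - 2 * \<beta>\<^sup>2 * J \<le> Qq / 2"
      unfolding P'eq J'_def J'eq J_def by (simp add: algebra_simps)
    moreover have "2 * \<beta> * P \<le> 2 * \<beta> * (6 * B\<^sup>2 * \<delta> - ?I (\<lambda>x. W x * zx x))"
      by (rule mult_left_mono[OF Pest]) (use \<beta> in simp)
    ultimately show "P' - \<beta> * J' + 2 * \<beta> * P - 2 * \<beta>\<^sup>2 * J \<le> Qq / 2 + 2 * \<beta> * (6 * B\<^sup>2 * \<delta>)"
      by (simp add: algebra_simps) }
  { assume c: "0 \<le> c"
    have "?I (\<lambda>x. (2 * c) * (W x * q x)) \<le> ?I (\<lambda>x. (1/2) * (q x)\<^sup>2 + (2 * c\<^sup>2) * (W x)\<^sup>2)"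
    proof (rule set_integral_mono)
      fix x
      have "0 \<le> (1/2) * (q x - 2 * c * W x)\<^sup>2" by simp
      then show "(2 * c) * (W x * q x) \<le> (1/2) * (q x)\<^sup>2 + (2 * c\<^sup>2) * (W x)\<^sup>2"
        by (simp add: power2_eq_square algebra_simps)
    qed (intro set_integral_add(1) set_integrable_mult_right b2)+
    also have "\<dots> = Qq / 2 + 2 * c\<^sup>2 * J"
      unfolding Qq_def J_def
      by (subst set_integral_add(2)[OF set_integrable_mult_right set_integrable_mult_right]) (use b2 in auto)
    finally have "2 * c * ?I (\<lambda>x. W x * q x) \<le> Qq / 2 + 2 * c\<^sup>2 * J" by simp
    moreover have "2 * c * ?I (\<lambda>x. W x * zx x) \<le> 2 * c * (6 * B\<^sup>2 * \<delta> - P)"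
      by (rule mult_left_mono) (use c Pest in auto)
    ultimately show "c * J' \<le> c * (- 2 * P + 2 * (6 * B\<^sup>2 * \<delta>)) + Qq / 2 + 2 * c\<^sup>2 * J"
      unfolding J'_def J'eq split by (simp add: algebra_simps) }
qed

section \<open>The Carleman estimate in time\<close>

text \<open>Absolute continuity up to both end points, in contrast to \<open>ac_rep\<close>. The
  energies need not be differentiable at every time, but this suffices for a product rule and for
  comparison.\<close>

definition primitive_on :: "real \<Rightarrow> (real \<Rightarrow> real) \<Rightarrow> (real \<Rightarrow> real) \<Rightarrow> bool" where
  "primitive_on T f f' \<longleftrightarrow> set_integrable lebesgue {0..T} f' \<and>
     (\<forall>t\<in>{0..T}. f t = f 0 + (LINT s:{0..t}|lebesgue. f' s))"

lemma primitive_on_sub: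
  assumes "primitive_on T f f'" "0 \<le> t1" "t1 \<le> t2" "t2 \<le> T"
  shows "set_integrable lebesgue {t1..t2} f'" "f t2 = f t1 + (LINT s:{t1..t2}|lebesgue. f' s)"
proof -
  have i: "set_integrable lebesgue {x..y} f'" if "0 \<le> x" "y \<le> T" for x y
    using assms(1) that by (auto simp: primitive_on_def intro: set_integrable_subset)
  show "set_integrable lebesgue {t1..t2} f'" using i assms by auto
  note s = set_lebesgue_integral_eq_integral[OF i]
  have "integral {0..t1} f' + integral {t1..t2} f' = integral {0..t2} f'"
    by (rule Henstock_Kurzweil_Integration.integral_combine) (use assms s(1) in auto)
  moreover have "f t = f 0 + integral {0..t} f'" if "t \<in> {0..T}" for t
  proof -
    have "f t = f 0 + (LINT s:{0..t}|lebesgue. f' s)" using assms(1) that unfolding primitive_on_def by blast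
    then show ?thesis using s(2)[of 0 t] that by simp
  qed
  from this[of t1] this[of t2] have "f t1 = f 0 + integral {0..t1} f'" "f t2 = f 0 + integral {0..t2} f'"
    using assms by simp_all
  ultimately show "f t2 = f t1 + (LINT s:{t1..t2}|lebesgue. f' s)" using s(2)[of t1 t2] assms by linarith
qed

lemma primitive_on_continuous: "primitive_on T f f' \<Longrightarrow> continuous_on {0..T} f"
  unfolding primitive_on_def by (rule primitive_continuous[where c="f 0"]) blast+

lemma primitive_on_mult:
  assumes f: "primitive_on T f f'" and g: "primitive_on T g g'"
  shows "primitive_on T (\<lambda>t. f t * g t) (\<lambda>t. f t * g' t + f' t * g t)"
proof (cases "0 \<le> T")
  case True
  have P: "set_integrable lebesgue {0..t} (\<lambda>x. f x * g' x)" "set_integrable lebesgue {0..t} (\<lambda>x. f' x * g x)"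
    "(LINT x:{0..t}|lebesgue. f x * g' x) + (LINT x:{0..t}|lebesgue. f' x * g x) = f t * g t - f 0 * g 0"
    if t: "t \<in> {0..T}" for t
  proof -
    have t': "0 \<le> t" "t \<le> T" using t by auto
    have fx: "f x = f 0 + (LINT s:{0..x}|lebesgue. f' s)" and gx: "g x = g 0 + (LINT s:{0..x}|lebesgue. g' s)"
      if "x \<in> {0..t}" for x
      using primitive_on_sub(2)[OF f, of 0 x] primitive_on_sub(2)[OF g, of 0 x] that t' by auto
    note p = parts[OF t'(1) primitive_on_sub(1)[OF f order_refl t'] primitive_on_sub(1)[OF g order_refl t'] fx gx]
    show "set_integrable lebesgue {0..t} (\<lambda>x. f x * g' x)" by (rule p(1))
    show "set_integrable lebesgue {0..t} (\<lambda>x. f' x * g x)" by (rule p(2))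
    show "(LINT x:{0..t}|lebesgue. f x * g' x) + (LINT x:{0..t}|lebesgue. f' x * g x) = f t * g t - f 0 * g 0"
      by (rule p(3))
  qed
  show ?thesis unfolding primitive_on_def
  proof (intro conjI ballI)
    show "set_integrable lebesgue {0..T} (\<lambda>t. f t * g' t + f' t * g t)"
      using P(1,2)[of T] True by (intro set_integral_add(1)) auto
    show "f t * g t = f 0 * g 0 + (LINT s:{0..t}|lebesgue. f s * g' s + f' s * g s)" if "t \<in> {0..T}" for t
      using P(3)[OF that] set_integral_add(2)[OF P(1,2)[OF that]] by simp
  qed
qed (simp add: primitive_on_def)

lemma primitive_on_add:
  assumes f: "primitive_on T f f'" and g: "primitive_on T g g'"
  shows "primitive_on T (\<lambda>t. f t + g t) (\<lambda>t. f' t + g' t)"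
  unfolding primitive_on_def
proof (intro conjI ballI)
  show "set_integrable lebesgue {0..T} (\<lambda>t. f' t + g' t)"
    using f g by (intro set_integral_add(1)) (auto simp: primitive_on_def)
  fix t assume t: "t \<in> {0..T}"
  have "set_integrable lebesgue {0..t} f'" "set_integrable lebesgue {0..t} g'"
    using primitive_on_sub(1)[OF f, of 0 t] primitive_on_sub(1)[OF g, of 0 t] t by auto
  from set_integral_add(2)[OF this]
  show "f t + g t = f 0 + g 0 + (LINT s:{0..t}|lebesgue. f' s + g' s)"
    using primitive_on_sub(2)[OF f, of 0 t] primitive_on_sub(2)[OF g, of 0 t] t by simp
qed

lemma primitive_on_deriv:
  assumes "\<And>t. (g has_real_derivative g' t) (at t)" "continuous_on UNIV g'"
  shows "primitive_on T g g'"
  unfolding primitive_on_def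
proof (intro conjI ballI)
  have i: "set_integrable lebesgue {0..t} g'" for t
    by (rule absolutely_integrable_continuous_real[OF continuous_on_subset[OF assms(2)]]) auto
  then show "set_integrable lebesgue {0..T} g'" .
  fix t assume "t \<in> {0..T}"
  then have "(g' has_integral (g t - g 0)) {0..t}"
    by (intro fundamental_theorem_of_calculus)
       (use assms(1) in \<open>auto simp: has_real_derivative_iff_has_vector_derivative[symmetric]
          intro: has_field_derivative_at_within\<close>)
  then show "g t = g 0 + (LINT s:{0..t}|lebesgue. g' s)"
    using set_lebesgue_integral_eq_integral(2)[OF i] by (simp add: integral_unique)
qed

lemma primitive_on_cmult: "primitive_on T f f' \<Longrightarrow> primitive_on T (\<lambda>t. c * f t) (\<lambda>t. c * f' t)"
  using primitive_on_mult[OF primitive_on_deriv[of "\<lambda>_. c" "\<lambda>_. 0"]] by auto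

lemma primitive_on_le:
  assumes f: "primitive_on T f f'" and t: "0 \<le> t1" "t1 \<le> t2" "t2 \<le> T"
    and ae: "AE t in lebesgue. t \<in> {0<..<T} \<longrightarrow> f' t \<le> h t" and h: "set_integrable lebesgue {t1..t2} h"
  shows "f t2 \<le> f t1 + (LINT t:{t1..t2}|lebesgue. h t)"
proof -
  note s = primitive_on_sub[OF f t]
  have "AE t in lebesgue. t \<noteq> 0" "AE t in lebesgue. t \<noteq> T" unfolding AE_lebesgue_iff by (rule AE_lborel_singleton)+
  with ae have "AE x\<in>{t1..t2} in lebesgue. f' x \<le> h x" by eventually_elim (use t in auto)
  from set_integral_mono_AE[OF s(1) h this] s(2) show ?thesis by simp
qed

text \<open>At a fixed time; \<open>p\<close>, \<open>j\<close>, \<open>v\<close> are the time derivatives of the energies \<open>P\<close>, \<open>J\<close>, \<open>V\<close>, and \<open>Q\<close>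
  stands for \<open>\<integral> q\<^sup>2\<close>.\<close>

definition energy_ineq :: "real \<Rightarrow> real \<Rightarrow> real \<Rightarrow> real \<Rightarrow> real \<Rightarrow> real \<Rightarrow> real \<Rightarrow> real \<Rightarrow> real \<Rightarrow> bool" where
  "energy_ineq C1 C3 \<epsilon> P J V p j v \<longleftrightarrow> (\<exists>Q\<ge>0.
     (\<forall>\<beta>\<ge>0. p - \<beta> * j + 2 * \<beta> * P - 2 * \<beta>\<^sup>2 * J \<le> Q / 2 + 2 * \<beta> * \<epsilon>) \<and>
     (\<forall>c\<ge>0. c * j \<le> c * (- 2 * P + 2 * \<epsilon>) + Q / 2 + 2 * c\<^sup>2 * J) \<and>
     Q \<le> C1 * (2 * P + v + C3 * V))"

text \<open>Up to the positive factor \<open>exp (2 s exp (l t))\<close>, the left hand side is the time derivative of the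
  product of that factor with \<open>P - b J + l / 4 * J - C1 V\<close>, where \<open>b = s l exp (l t)\<close>. The term \<open>l / 4 * J\<close>
  buys the additional multiple of \<open>P\<close> that absorbs the \<open>P\<close> in the bound for \<open>Q\<close>.\<close>

lemma carleman_pointwise:
  assumes E: "energy_ineq C1 C3 \<epsilon> P J V p j v" and pos: "0 \<le> P" "0 \<le> J" "0 \<le> V" "0 \<le> C1"
    and l: "l = 4 * C1 + 2" and b: "l / 4 \<le> b" "C3 \<le> 2 * b"
  shows "(p + 2 * b * P) - (b * j + 2 * b\<^sup>2 * J + l * b * J) + l / 4 * (j + 2 * b * J) - C1 * (v + 2 * b * V)
    \<le> - P + (2 * b + l / 2) * \<epsilon>"
proof -
  have b0: "0 \<le> b" "0 \<le> l" using b l pos by auto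
  \<comment> \<open>The first clause is used with \<open>\<beta> = b\<close>, half the logarithmic
    derivative of the weight, the second with \<open>c = l / 4\<close>.\<close>
  obtain Q where Q: "p - b * j + 2 * b * P - 2 * b\<^sup>2 * J \<le> Q / 2 + 2 * b * \<epsilon>"
    "l / 4 * j \<le> l / 4 * (- 2 * P + 2 * \<epsilon>) + Q / 2 + 2 * (l / 4)\<^sup>2 * J" "Q \<le> C1 * (2 * P + v + C3 * V)"
    using E b0 unfolding energy_ineq_def by (metis divide_nonneg_nonneg zero_le_numeral)
  \<comment> \<open>\<open>Q / 2\<close> occurs twice, so \<open>2 * C1 * P\<close> has to be
    absorbed by \<open>2 * k * P\<close>. The choice \<open>l = 4 * C1 + 2\<close> makes
    \<open>2 * k * P = 2 * C1 * P + P\<close> and leaves \<open>- P\<close>.\<close>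
  define k where "k = l / 4"
  have k: "l / 4 = k" "l / 2 = 2 * k" "l * b * J = 4 * (k * b * J)" "k * P = C1 * P + P / 2"
    by (simp_all add: k_def l field_simps)
  \<comment> \<open>The term \<open>- l * b * J\<close>, which comes from the derivative of
    \<open>b\<close>, pays for both \<open>2 * k * b * J\<close> and
    \<open>2 * k\<^sup>2 * J\<close>; this needs \<open>l / 4 \<le> b\<close>.\<close>
  have "0 \<le> 2 * k * ((b - k) * J)" using b(1) b0 pos by (simp add: k_def)
  then have "0 \<le> 2 * (k * b * J) - 2 * (k\<^sup>2 * J)" by (simp add: algebra_simps power2_eq_square)
  \<comment> \<open>Through the growth of the weight, \<open>- C1 * V\<close> contributes
    \<open>- 2 * C1 * b * V\<close>, which absorbs \<open>C1 * C3 * V\<close>.\<close>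
  moreover have "0 \<le> C1 * ((2 * b - C3) * V)" using b pos by simp
  then have "0 \<le> 2 * (C1 * b * V) - C1 * C3 * V" by (simp add: algebra_simps)
  moreover have "Q \<le> 2 * (C1 * P) + C1 * v + C1 * C3 * V" using Q(3) by (simp add: algebra_simps)
  moreover have "k * j \<le> - 2 * (k * P) + 2 * (k * \<epsilon>) + Q / 2 + 2 * (k\<^sup>2 * J)"
    using Q(2) unfolding k(1) by (simp add: algebra_simps)
  moreover have "p - b * j + 2 * (b * P) - 2 * (b\<^sup>2 * J) \<le> Q / 2 + 2 * (b * \<epsilon>)"
    using Q(1) by (simp add: algebra_simps)
  moreover have "(p + 2 * b * P) - (b * j + 2 * b\<^sup>2 * J + l * b * J) + l / 4 * (j + 2 * b * J) - C1 * (v + 2 * b * V)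
    = p + 2 * (b * P) - b * j - 2 * (b\<^sup>2 * J) - 4 * (k * b * J) + k * j + 2 * (k * b * J) - C1 * v - 2 * (C1 * b * V)"
    unfolding k by (simp add: algebra_simps)
  moreover have "- P + (2 * b + l / 2) * \<epsilon> = - P + 2 * (b * \<epsilon>) + 2 * (k * \<epsilon>)" unfolding k by (simp add: algebra_simps)
  ultimately show ?thesis using k(4) by linarith
qed

text \<open>Integrating the pointwise inequality bounds \<open>\<integral> e P\<close> by
  \<open>S\<close>, the initial data carrying \<open>e 0\<close> and the final data
  \<open>e T\<close>. Going back from \<open>T\<close>, the inequality for \<open>V\<close> then
  bounds \<open>V\<close> on all of \<open>{t0 / 2..T}\<close>, where
  \<open>e \<ge> e (t0 / 2)\<close>. For \<open>P\<close> only time integrals are available at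
  first; a growth bound and averaging over \<open>{t0 / 2..t0}\<close> give its value at
  \<open>t0\<close>.\<close>

lemma carleman_bound:
  fixes P J V p j v :: "real \<Rightarrow> real"
  assumes t0: "0 < t0" "t0 < T" and C: "0 < C1" "0 \<le> C3" "0 \<le> \<epsilon>"
    and prim: "primitive_on T P p" "primitive_on T J j" "primitive_on T V v"
    and pos: "\<And>t. t \<in> {0..T} \<Longrightarrow> 0 \<le> P t \<and> 0 \<le> J t \<and> 0 \<le> V t"
    and E: "AE t in lebesgue. t \<in> {0<..<T} \<longrightarrow> energy_ineq C1 C3 \<epsilon> (P t) (J t) (V t) (p t) (j t) (v t)"
    and l: "l = 4 * C1 + 2" and s: "1 + C3 \<le> s"
  defines "b \<equiv> \<lambda>t. s * l * exp (l * t)" and "e \<equiv> \<lambda>t. exp (2 * s * exp (l * t))"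
  defines "S \<equiv> e 0 * (P 0 + l / 4 * J 0) + e T * (b T * J T + C1 * V T + 4 * b T * \<epsilon> * T)"
  defines "Y \<equiv> (e T * V T + 2 * S) / e (t0 / 2)"
  shows "V t0 \<le> Y" "P t0 \<le> (2 / t0 + 3 / 2 * C1 + C1 * C3 * T / 2) * Y"
proof -
  have l2: "2 \<le> l" using l C by simp
  have s1: "1 \<le> s" using s C by simp
  have e0: "0 < e t" for t by (simp add: e_def)
  have emono: "e t \<le> e t'" "b t \<le> b t'" if "t \<le> t'" for t t'
    using that l2 s1 by (auto simp: e_def b_def)
  have bt: "l / 4 \<le> b t" "C3 \<le> 2 * b t" if "0 \<le> t" for t
  proof -
    have "s * l * 1 \<le> b t" unfolding b_def by (rule mult_left_mono) (use that l2 s1 in auto)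
    moreover have "s * 2 \<le> s * l" by (rule mult_left_mono) (use l2 s1 in auto)
    moreover have "1 * l \<le> s * l" by (rule mult_right_mono) (use l2 s1 in auto)
    ultimately show "l / 4 \<le> b t" "C3 \<le> 2 * b t" using l2 s1 s by linarith+
  qed
  have db: "(b has_real_derivative l * b t) (at t)" for t
    unfolding b_def by (auto intro!: derivative_eq_intros)
  have de: "(e has_real_derivative 2 * b t * e t) (at t)" for t
    unfolding e_def b_def by (auto intro!: derivative_eq_intros)
  have cb: "continuous_on A b" and ce: "continuous_on A e" for A
    unfolding b_def e_def by (auto intro!: continuous_intros)
  have pe: "primitive_on T e (\<lambda>t. 2 * b t * e t)"
    by (rule primitive_on_deriv[OF de]) (intro continuous_intros cb ce)
  have pb: "primitive_on T b (\<lambda>t. l * b t)"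
    by (rule primitive_on_deriv[OF db]) (intro continuous_intros cb)
  have cP: "continuous_on {0..T} P" and cV: "continuous_on {0..T} V"
    using prim primitive_on_continuous by blast+
  have int: "set_integrable lebesgue {x..y} f" if "continuous_on {0..T} f" "0 \<le> x" "y \<le> T" for x y and f :: "real \<Rightarrow> real"
    by (rule absolutely_integrable_continuous_real[OF continuous_on_subset[OF that(1)]]) (use that in auto)
  define \<Phi> where "\<Phi> t = e t * (P t + ((-1) * (b t * J t) + (l / 4 * J t + (- C1) * V t)))" for t
  define D where "D t = e t * (p t + ((-1) * (b t * j t + l * b t * J t) + (l / 4 * j t + (- C1) * v t)))
    + 2 * b t * e t * (P t + ((-1) * (b t * J t) + (l / 4 * J t + (- C1) * V t)))" for t
  have pPhi: "primitive_on T \<Phi> D"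
    unfolding \<Phi>_def[abs_def] D_def[abs_def]
    by (intro primitive_on_mult primitive_on_add primitive_on_cmult pe pb prim)
  have DT: "AE t in lebesgue. t \<in> {0<..<T} \<longrightarrow> D t \<le> (-1) * (e t * P t) + 4 * b T * e T * \<epsilon>"
    using E
  proof eventually_elim
    case (elim t)
    show ?case
    proof
      assume t: "t \<in> {0<..<T}"
      have "e t * ((p t + 2 * b t * P t) - (b t * j t + 2 * (b t)\<^sup>2 * J t + l * b t * J t) + l / 4 * (j t + 2 * b t * J t) - C1 * (v t + 2 * b t * V t))
        \<le> e t * (- P t + (2 * b t + l / 2) * \<epsilon>)"
        by (intro mult_left_mono carleman_pointwise[OF _ _ _ _ _ l bt(1) bt(2)]) (use elim t pos[of t] C e0[of t] in auto)
      also have "\<dots> \<le> (-1) * (e t * P t) + 4 * b T * e T * \<epsilon>"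
      proof -
        \<comment> \<open>\<open>l / 4 \<le> b t\<close> gives
          \<open>2 * b t + l / 2 \<le> 4 * b t\<close>, and both \<open>b\<close> and
          \<open>e\<close> increase.\<close>
        have "e t * ((2 * b t + l / 2) * \<epsilon>) \<le> e T * ((4 * b T) * \<epsilon>)"
          by (intro mult_mono) (use emono[of t T] bt[of t] bt[of T] t e0[of t] e0[of T] l2 C in auto)
        then show ?thesis by (simp add: algebra_simps)
      qed
      finally show "D t \<le> (-1) * (e t * P t) + 4 * b T * e T * \<epsilon>"
        by (simp add: D_def algebra_simps power2_eq_square)
    qed
  qed
  have ieP: "set_integrable lebesgue {x..y} (\<lambda>t. e t * P t)" if "0 \<le> x" "y \<le> T" for x y
    by (rule int) (intro continuous_intros ce cP that)+
  have eP_le: "(LINT t:{x..y}|lebesgue. e t * P t) \<le> S" if xy: "0 \<le> x" "x \<le> y" "y \<le> T" for x y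
  proof -
    have "(LINT t:{x..y}|lebesgue. e t * P t) \<le> (LINT t:{0..T}|lebesgue. e t * P t)"
    proof -
      have "(LINT t:{x..y}|lebesgue. e t * P t) = integral {x..y} (\<lambda>t. e t * P t)"
        "(LINT t:{0..T}|lebesgue. e t * P t) = integral {0..T} (\<lambda>t. e t * P t)"
        using set_lebesgue_integral_eq_integral(2)[OF ieP] xy by auto
      then show ?thesis
        using integral_subset_le[OF _ set_lebesgue_integral_eq_integral(1)[OF ieP] set_lebesgue_integral_eq_integral(1)[OF ieP], of x y 0 T] xy pos e0
        by (auto simp: less_imp_le)
    qed
    also have "\<dots> \<le> \<Phi> 0 - \<Phi> T + 4 * b T * e T * \<epsilon> * T"
    proof -
      have "\<Phi> T \<le> \<Phi> 0 + (LINT t:{0..T}|lebesgue. (-1) * (e t * P t) + 4 * b T * e T * \<epsilon>)"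
        by (rule primitive_on_le[OF pPhi _ _ _ DT]) (use t0 in \<open>auto intro!: int continuous_intros ce cP\<close>)
      also have "(LINT t:{0..T}|lebesgue. (-1) * (e t * P t) + 4 * b T * e T * \<epsilon>)
          = (LINT t:{0..T}|lebesgue. (-1) * (e t * P t)) + (LINT t:{0..T}|lebesgue. 4 * b T * e T * \<epsilon>)"
        by (rule set_integral_add(2)[OF set_integrable_mult_right set_integrable_const_Icc]) (use ieP in auto)
      also have "(LINT t:{0..T}|lebesgue. (-1) * (e t * P t)) = (-1) * (LINT t:{0..T}|lebesgue. e t * P t)"
        by (rule set_integral_mult_right)
      also have "(LINT t:{0..T}|lebesgue. 4 * b T * e T * \<epsilon>) = 4 * b T * e T * \<epsilon> * T"
        using t0 by (simp add: set_integral_const)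
      finally show ?thesis by linarith
    qed
    also have "\<dots> \<le> S"
    proof -
      \<comment> \<open>Only terms of favourable sign are dropped: those with a minus at
        \<open>0\<close>, those with a plus at \<open>T\<close>.\<close>
      have "\<Phi> 0 \<le> e 0 * (P 0 + l / 4 * J 0)" unfolding \<Phi>_def
      proof (rule mult_left_mono)
        have "0 \<le> b 0 * J 0" "0 \<le> C1 * V 0" using pos[of 0] t0 bt[of 0] l2 C by auto
        then show "P 0 + ((-1) * (b 0 * J 0) + (l / 4 * J 0 + (- C1) * V 0)) \<le> P 0 + l / 4 * J 0" by linarith
      qed (use e0[of 0] in simp)
      moreover have "e T * (- (b T * J T) - C1 * V T) \<le> \<Phi> T" unfolding \<Phi>_def
      proof (rule mult_left_mono)
        have "0 \<le> P T" "0 \<le> l / 4 * J T" using pos[of T] t0 l2 by auto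
        then show "- (b T * J T) - C1 * V T \<le> P T + ((-1) * (b T * J T) + (l / 4 * J T + (- C1) * V T))" by linarith
      qed (use e0[of T] in simp)
      ultimately show ?thesis by (simp add: S_def algebra_simps)
    qed
    finally show ?thesis .
  qed
  \<comment> \<open>\<open>Q \<ge> 0\<close> and \<open>C1 > 0\<close> reduce the last clause of
    \<open>energy_ineq\<close> to a lower bound for \<open>v\<close>.\<close>
  have vlow: "AE t in lebesgue. t \<in> {0<..<T} \<longrightarrow> - v t \<le> 2 * P t + C3 * V t"
    using E
  proof eventually_elim
    case (elim t)
    show ?case
    proof
      assume "t \<in> {0<..<T}"
      then have "0 \<le> C1 * (2 * P t + v t + C3 * V t)" using elim unfolding energy_ineq_def by fastforce
      then show "- v t \<le> 2 * P t + C3 * V t" using C(1) by (simp add: zero_le_mult_iff)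
    qed
  qed
  \<comment> \<open>Since \<open>C3 \<le> 2 * b t\<close>, the growth of \<open>e\<close> absorbs
    \<open>C3 * V\<close>, and integrating back from \<open>T\<close> works without a Gronwall
    argument.\<close>
  have eV: "e t * V t \<le> e T * V T + 2 * S" if t: "t \<in> {0..T}" for t
  proof -
    have p: "primitive_on T (\<lambda>t. (-1) * (e t * V t)) (\<lambda>t. (-1) * (e t * v t + 2 * b t * e t * V t))"
      by (intro primitive_on_cmult primitive_on_mult pe prim)
    have ae: "AE t in lebesgue. t \<in> {0<..<T} \<longrightarrow> (-1) * (e t * v t + 2 * b t * e t * V t) \<le> 2 * (e t * P t)"
      using vlow
    proof eventually_elim
      case (elim t)
      show ?case
      proof
        assume t: "t \<in> {0<..<T}"
        have "C3 * V t \<le> 2 * b t * V t" by (rule mult_right_mono) (use bt[of t] pos[of t] t in auto)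
        then have "- v t - 2 * b t * V t \<le> 2 * P t" using elim t by auto
        then have "e t * (- v t - 2 * b t * V t) \<le> e t * (2 * P t)" by (rule mult_left_mono) (use e0[of t] in simp)
        then show "(-1) * (e t * v t + 2 * b t * e t * V t) \<le> 2 * (e t * P t)" by (simp add: algebra_simps)
      qed
    qed
    have "(-1) * (e T * V T) \<le> (-1) * (e t * V t) + (LINT t:{t..T}|lebesgue. 2 * (e t * P t))"
      by (rule primitive_on_le[OF p _ _ _ ae]) (use t ieP in auto)
    also have "(LINT t:{t..T}|lebesgue. 2 * (e t * P t)) = 2 * (LINT t:{t..T}|lebesgue. e t * P t)"
      by (rule set_integral_mult_right)
    finally show ?thesis using eP_le[of t T] t by simp
  qed
  define \<tau> where "\<tau> = t0 / 2"
  have \<tau>: "0 < \<tau>" "\<tau> < t0" "\<tau> < T" using t0 by (auto simp: \<tau>_def)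
  have VY: "V t \<le> Y" if t: "\<tau> \<le> t" "t \<le> T" for t
  proof -
    have "e \<tau> * V t \<le> e t * V t" by (rule mult_right_mono) (use emono[OF t(1)] pos[of t] t \<tau> in auto)
    also have "\<dots> \<le> e T * V T + 2 * S" by (rule eV) (use t \<tau> in auto)
    finally show ?thesis using e0[of \<tau>] by (simp add: Y_def \<tau>_def[symmetric] field_simps)
  qed
  show "V t0 \<le> Y" by (rule VY) (use \<tau> t0 in auto)
  have iP: "set_integrable lebesgue {x..y} P" "set_integrable lebesgue {x..y} V" if "0 \<le> x" "y \<le> T" for x y
    using int cP cV that by auto
  have PY: "(LINT t:{x..t0}|lebesgue. P t) \<le> Y" if x: "\<tau> \<le> x" "x \<le> t0" for x
  proof -
    have "e \<tau> * (LINT t:{x..t0}|lebesgue. P t) = (LINT t:{x..t0}|lebesgue. e \<tau> * P t)" by simp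
    also have "\<dots> \<le> (LINT t:{x..t0}|lebesgue. e t * P t)"
      by (rule set_integral_mono) (use x \<tau> t0 iP ieP emono pos in \<open>auto intro!: mult_right_mono\<close>)
    also have "\<dots> \<le> S" by (rule eP_le) (use x \<tau> t0 in auto)
    also have "\<dots> \<le> e T * V T + 2 * S"
    proof -
      \<comment> \<open>The degenerate interval in \<open>eP_le\<close> shows
        \<open>0 \<le> S\<close>.\<close>
      have "(LINT t:{0..0}|lebesgue. e t * P t) = 0"
        using set_integral_Ioo_Icc(2)[of 0 0 "\<lambda>t. e t * P t"] by (simp add: set_lebesgue_integral_def)
      then have "0 \<le> S" using eP_le[of 0 0] t0 by simp
      then show ?thesis using e0[of T] pos[of T] t0 by simp
    qed
    finally show ?thesis using e0[of \<tau>] by (simp add: Y_def \<tau>_def[symmetric] field_simps)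
  qed
  have Y0: "0 \<le> Y" using VY[of t0] pos[of t0] t0 \<tau> by auto
  define G where "G = C1 / 2 * Y + C1 * Y + C1 * C3 / 2 * (T * Y)"
  \<comment> \<open>With \<open>\<beta> = 0\<close> only \<open>p \<le> Q / 2\<close> is left.
    Moving \<open>C1 / 2 * v\<close> to the left, \<open>P - C1 / 2 * V\<close> grows at most by
    integrals of \<open>P\<close> and \<open>V\<close>, which are already bounded.\<close>
  have Pt: "P t0 \<le> P t + G" if t: "t \<in> {\<tau>..t0}" for t
  proof -
    have p: "primitive_on T (\<lambda>t. P t + (- C1 / 2) * V t) (\<lambda>t. p t + (- C1 / 2) * v t)"
      by (intro primitive_on_add primitive_on_cmult prim)
    have ae: "AE t in lebesgue. t \<in> {0<..<T} \<longrightarrow> p t + (- C1 / 2) * v t \<le> C1 * P t + C1 * C3 / 2 * V t"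
      using E
    proof eventually_elim
      case (elim t)
      show ?case
      proof
        assume "t \<in> {0<..<T}"
        then obtain Q where "\<forall>\<beta>\<ge>0. p t - \<beta> * j t + 2 * \<beta> * P t - 2 * \<beta>\<^sup>2 * J t \<le> Q / 2 + 2 * \<beta> * \<epsilon>"
          "Q \<le> C1 * (2 * P t + v t + C3 * V t)"
          using elim unfolding energy_ineq_def by blast
        from this(1)[rule_format, of 0] this(2)
        show "p t + (- C1 / 2) * v t \<le> C1 * P t + C1 * C3 / 2 * V t" by (simp add: algebra_simps)
      qed
    qed
    have tT: "0 \<le> t" "t \<le> t0" "t0 \<le> T" "\<tau> \<le> t" using t \<tau> t0 by auto
    have "P t0 + (- C1 / 2) * V t0 \<le> P t + (- C1 / 2) * V t + (LINT t:{t..t0}|lebesgue. C1 * P t + C1 * C3 / 2 * V t)"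
      by (rule primitive_on_le[OF p tT(1,2,3) ae]) (use tT iP in auto)
    also have "(LINT t:{t..t0}|lebesgue. C1 * P t + C1 * C3 / 2 * V t) = C1 * (LINT t:{t..t0}|lebesgue. P t) + C1 * C3 / 2 * (LINT t:{t..t0}|lebesgue. V t)"
      by (subst set_integral_add(2)[OF set_integrable_mult_right set_integrable_mult_right]) (use tT iP in auto)
    also have "(LINT t:{t..t0}|lebesgue. V t) \<le> (LINT t:{t..t0}|lebesgue. Y)"
      by (rule set_integral_mono) (use tT iP VY in \<open>auto intro: set_integrable_const_Icc\<close>)
    also have "(LINT t:{t..t0}|lebesgue. Y) = (t0 - t) * Y" using tT by (simp add: set_integral_const)
    also have "\<dots> \<le> T * Y" by (rule mult_right_mono) (use tT Y0 in auto)
    finally have "P t0 + (- C1 / 2) * V t0 \<le> P t + (- C1 / 2) * V t + (C1 * (LINT t:{t..t0}|lebesgue. P t) + C1 * C3 / 2 * (T * Y))"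
      using C by (simp add: mult_left_mono)
    moreover have "C1 * (LINT t:{t..t0}|lebesgue. P t) \<le> C1 * Y" by (rule mult_left_mono[OF PY]) (use tT C in auto)
    moreover have "C1 / 2 * V t0 \<le> C1 / 2 * Y" by (rule mult_left_mono[OF VY]) (use \<tau> t0 C in auto)
    moreover have "0 \<le> C1 / 2 * V t" using pos[of t] tT C by auto
    ultimately show ?thesis unfolding G_def by linarith
  qed
  \<comment> \<open>Averaging over an interval of length \<open>t0 / 2\<close>; this is the origin
    of \<open>2 / t0\<close>.\<close>
  have "(LINT t:{\<tau>..t0}|lebesgue. P t0 - G) \<le> (LINT t:{\<tau>..t0}|lebesgue. P t)"
    by (rule set_integral_mono) (use \<tau> t0 iP Pt in \<open>auto intro: set_integrable_const_Icc simp: algebra_simps\<close>)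
  also have "(LINT t:{\<tau>..t0}|lebesgue. P t0 - G) = (t0 / 2) * (P t0 - G)"
    using \<tau> by (simp add: set_integral_const \<tau>_def right_diff_distrib)
  also have "(LINT t:{\<tau>..t0}|lebesgue. P t) \<le> Y" by (rule PY) (use \<tau> in auto)
  finally have "P t0 - G \<le> 2 / t0 * Y" using t0 by (simp add: field_simps)
  then show "P t0 \<le> (2 / t0 + 3 / 2 * C1 + C1 * C3 * T / 2) * Y"
    unfolding G_def by (simp add: algebra_simps)
qed

text \<open>The initial data are damped by \<open>e 0 / e (t0 / 2)\<close>, the final data amplified
  by a power of \<open>e T\<close>; optimising \<open>s\<close> balances the two. The exponent is
  \<open>2 * \<theta>\<close> because \<open>P\<close> and \<open>V\<close> are squares of
  norms.\<close>

lemma carleman_holder: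
  fixes T t0 C1 C3 \<kappa> B0 :: real
  assumes t0: "0 < t0" "t0 < T" and C: "0 < C1" "0 \<le> C3" "0 \<le> \<kappa>" "0 \<le> B0"
  shows "\<exists>C \<theta>. 0 < C \<and> 0 < \<theta> \<and> \<theta> < 1 \<and> (\<forall>\<delta> P J V p j v. 0 < \<delta> \<longrightarrow>
    primitive_on T P p \<longrightarrow> primitive_on T J j \<longrightarrow> primitive_on T V v \<longrightarrow>
    (\<forall>t\<in>{0..T}. 0 \<le> P t \<and> 0 \<le> J t \<and> 0 \<le> V t) \<longrightarrow>
    (AE t in lebesgue. t \<in> {0<..<T} \<longrightarrow> energy_ineq C1 C3 (\<kappa> * \<delta>) (P t) (J t) (V t) (p t) (j t) (v t)) \<longrightarrow>
    P 0 \<le> B0 \<longrightarrow> J 0 \<le> B0 \<longrightarrow> J T \<le> \<delta> \<longrightarrow> V T \<le> \<delta>\<^sup>2 \<longrightarrow>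
    P t0 + V t0 \<le> C * (\<delta> powr (2 * \<theta>) + \<delta>\<^sup>2))"
proof -
  define l where "l = 4 * C1 + 2"
  define \<phi>T where "\<phi>T = exp (l * T)"
  define \<eta> where "\<eta> = exp (l * (t0 / 2)) - 1"
  have l2: "2 \<le> l" using C by (simp add: l_def)
  have \<phi>1: "1 \<le> \<phi>T" and \<eta>: "0 < \<eta>" using l2 t0 by (auto simp: \<phi>T_def \<eta>_def)
  \<comment> \<open>\<open>L\<close> solves \<open>3 * \<phi>T * L + 2 * \<eta> * L = 1\<close>: for
    \<open>s = s0 - L * ln \<delta>\<close> both \<open>exp (- 2 * s * \<eta>)\<close> and
    \<open>exp (3 * s * \<phi>T) * \<delta>\<close> are constant multiples of
    \<open>\<delta> powr (2 * \<theta>)\<close>.\<close>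
  define L where "L = 1 / (3 * \<phi>T + 2 * \<eta>)"
  have L0: "0 < L" using \<phi>1 \<eta> by (simp add: L_def)
  define \<theta> where "\<theta> = \<eta> * L"
  have L1: "3 * \<phi>T * L + 2 * \<theta> = 1"
  proof -
    have "(3 * \<phi>T + 2 * \<eta>) * L = 1" using \<phi>1 \<eta> by (simp add: L_def)
    then show ?thesis by (simp add: \<theta>_def algebra_simps)
  qed
  have \<theta>: "0 < \<theta>" "\<theta> < 1"
  proof -
    show "0 < \<theta>" using \<eta> L0 by (simp add: \<theta>_def)
    have "0 < 3 * \<phi>T * L" using \<phi>1 L0 by simp
    then show "\<theta> < 1" using L1 \<open>0 < \<theta>\<close> by linarith
  qed
  define s0 where "s0 = 1 + C3"
  define c1 where "c1 = 1 + (2 / t0 + 3 / 2 * C1 + C1 * C3 * T / 2)"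
  define c2 where "c2 = 2 * (1 + l / 4) * B0 + (1 + 2 * C1 + 2 * (l + 4 * l * \<kappa> * T))"
  define C where "C = c1 * c2 * (2 * exp (3 * s0 * \<phi>T) + 1)"
  have c1: "1 \<le> c1" using C t0 by (simp add: c1_def)
  have c2: "1 \<le> c2" using C t0 l2 by (simp add: c2_def)
  have "0 < C" using c1 c2 unfolding C_def by (intro mult_pos_pos) (auto intro: add_pos_pos)
  have main: "P t0 + V t0 \<le> C * (\<delta> powr (2 * \<theta>) + \<delta>\<^sup>2)"
    if \<delta>: "0 < \<delta>" and prim: "primitive_on T P p" "primitive_on T J j" "primitive_on T V v"
      and pos: "\<forall>t\<in>{0..T}. 0 \<le> P t \<and> 0 \<le> J t \<and> 0 \<le> V t"
      and E: "AE t in lebesgue. t \<in> {0<..<T} \<longrightarrow> energy_ineq C1 C3 (\<kappa> * \<delta>) (P t) (J t) (V t) (p t) (j t) (v t)"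
      and bd: "P 0 \<le> B0" "J 0 \<le> B0" "J T \<le> \<delta>" "V T \<le> \<delta>\<^sup>2" for \<delta> P J V p j v
  proof -
    have step: "P t0 + V t0 \<le> c1 * c2 * (exp (- 2 * s * \<eta>) + exp (3 * s * \<phi>T) * (\<delta> + \<delta>\<^sup>2))" if s: "s0 \<le> s" for s
    proof -
      have s1: "1 \<le> s" using s C by (simp add: s0_def)
      define b where "b = s * l * exp (l * T)"
      define e where "e t = exp (2 * s * exp (l * t))" for t
      define S where "S = e 0 * (P 0 + l / 4 * J 0) + e T * (b * J T + C1 * V T + 4 * b * (\<kappa> * \<delta>) * T)"
      define Y where "Y = (e T * V T + 2 * S) / e (t0 / 2)"
      note B = carleman_bound[OF t0 C(1,2) _ prim _ E l_def s[unfolded s0_def], folded b_def e_def, folded S_def, folded Y_def]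
      have "V t0 \<le> Y" "P t0 \<le> (2 / t0 + 3 / 2 * C1 + C1 * C3 * T / 2) * Y"
        using B C \<delta> pos by auto
      then have "P t0 + V t0 \<le> c1 * Y" by (simp add: c1_def algebra_simps)
      also have "\<dots> \<le> c1 * (c2 * (exp (- 2 * s * \<eta>) + exp (3 * s * \<phi>T) * (\<delta> + \<delta>\<^sup>2)))"
      proof (rule mult_left_mono)
        have e1: "1 \<le> e t" "0 < e t" for t using s1 by (auto simp: e_def)
        have e0\<tau>: "e 0 / e (t0 / 2) = exp (- 2 * s * \<eta>)"
          by (simp add: e_def \<eta>_def exp_diff[symmetric] algebra_simps)
        \<comment> \<open>The factor \<open>s * \<phi>T\<close> stems from \<open>b\<close>;
          absorbing it into an exponential raises the exponent \<open>2 * s * \<phi>T\<close> of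
          \<open>e T\<close> to \<open>3 * s * \<phi>T\<close>.\<close>
        have "e T * (s * \<phi>T) \<le> e T * exp (s * \<phi>T)"
        proof (rule mult_left_mono)
          show "s * \<phi>T \<le> exp (s * \<phi>T)" using exp_ge_add_one_self[of "s * \<phi>T"] by linarith
        qed (use e1(2)[of T] in simp)
        also have "\<dots> = exp (3 * s * \<phi>T)" by (simp add: e_def \<phi>T_def exp_add[symmetric] algebra_simps)
        finally have eT: "e T * (s * \<phi>T) \<le> exp (3 * s * \<phi>T)" .
        have s\<phi>: "1 \<le> s * \<phi>T" using s1 \<phi>1 mult_mono[of 1 s 1 \<phi>T] by simp
        have eT1: "e T \<le> exp (3 * s * \<phi>T)"
        proof -
          have "e T * 1 \<le> e T * (s * \<phi>T)" by (rule mult_left_mono[OF s\<phi>]) (use e1(2)[of T] in simp)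
          then show ?thesis using eT by linarith
        qed
        have b: "b = l * (s * \<phi>T)" by (simp add: b_def \<phi>T_def)
        have b0: "0 \<le> b" unfolding b using l2 s\<phi> by simp
        let ?X = "exp (3 * s * \<phi>T)"
        have 1: "e T * V T \<le> ?X * \<delta>\<^sup>2" by (rule mult_mono[OF eT1 bd(4)]) (use pos t0 in auto)
        have 2: "e T * (b * J T) \<le> l * (?X * \<delta>)"
        proof -
          have "e T * (b * J T) \<le> e T * (b * \<delta>)" by (intro mult_left_mono) (use bd(3) b0 e1(2)[of T] in auto)
          also have "\<dots> = l * ((e T * (s * \<phi>T)) * \<delta>)" unfolding b by simp
          also have "\<dots> \<le> l * (?X * \<delta>)" by (intro mult_left_mono mult_right_mono eT) (use \<delta> l2 in auto)
          finally show ?thesis .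
        qed
        have 3: "e T * (4 * b * (\<kappa> * \<delta>) * T) \<le> 4 * l * \<kappa> * T * (?X * \<delta>)"
        proof -
          have "e T * (4 * b * (\<kappa> * \<delta>) * T) = 4 * l * \<kappa> * T * ((e T * (s * \<phi>T)) * \<delta>)" unfolding b by simp
          also have "\<dots> \<le> 4 * l * \<kappa> * T * (?X * \<delta>)"
            by (intro mult_left_mono mult_right_mono eT) (use \<delta> l2 C t0 in auto)
          finally show ?thesis .
        qed
        have 4: "e 0 * (P 0 + l / 4 * J 0) \<le> e 0 * ((1 + l / 4) * B0)"
        proof (rule mult_left_mono)
          have "l / 4 * J 0 \<le> l / 4 * B0" by (rule mult_left_mono[OF bd(2)]) (use l2 in auto)
          then show "P 0 + l / 4 * J 0 \<le> (1 + l / 4) * B0" using bd(1) by (simp add: algebra_simps)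
        qed (use e1(2)[of 0] in auto)
        have 5: "C1 * (e T * V T) \<le> C1 * (?X * \<delta>\<^sup>2)" by (rule mult_left_mono[OF 1]) (use C in auto)
        let ?R = "(1 + 2 * C1) * (?X * \<delta>\<^sup>2) + 2 * (l + 4 * l * \<kappa> * T) * (?X * \<delta>)"
        have num: "e T * V T + 2 * S \<le> 2 * (e 0 * ((1 + l / 4) * B0)) + ?R"
          using 1 2 3 4 5 unfolding S_def by (simp add: algebra_simps)
        have R0: "0 \<le> ?R" using C l2 t0 \<delta> by simp
        have "Y \<le> (2 * (e 0 * ((1 + l / 4) * B0)) + ?R) / e (t0 / 2)"
          unfolding Y_def by (rule divide_right_mono[OF num]) (use e1(2)[of "t0/2"] in auto)
        also have "\<dots> = 2 * (1 + l / 4) * B0 * exp (- 2 * s * \<eta>) + ?R / e (t0 / 2)"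
          unfolding e0\<tau>[symmetric] by (simp add: add_divide_distrib)
        also have "?R / e (t0 / 2) \<le> ?R / 1"
          by (rule divide_left_mono[OF e1(1) R0]) (use e1(2) in simp)
        also have "?R / 1 \<le> (1 + 2 * C1 + 2 * (l + 4 * l * \<kappa> * T)) * (?X * (\<delta> + \<delta>\<^sup>2))"
        proof -
          have x: "0 \<le> ?X * \<delta>" "0 \<le> ?X * \<delta>\<^sup>2" using \<delta> by auto
          have "(1 + 2 * C1) * (?X * \<delta>\<^sup>2) \<le> (1 + 2 * C1) * (?X * (\<delta> + \<delta>\<^sup>2))"
            by (rule mult_left_mono) (use C \<delta> in auto)
          moreover have "2 * (l + 4 * l * \<kappa> * T) * (?X * \<delta>) \<le> 2 * (l + 4 * l * \<kappa> * T) * (?X * (\<delta> + \<delta>\<^sup>2))"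
            by (rule mult_left_mono) (use C l2 t0 \<delta> in auto)
          ultimately show ?thesis by (simp add: distrib_right)
        qed
        finally have "Y \<le> 2 * (1 + l / 4) * B0 * exp (- 2 * s * \<eta>) + (1 + 2 * C1 + 2 * (l + 4 * l * \<kappa> * T)) * (?X * (\<delta> + \<delta>\<^sup>2))" by simp
        also have "\<dots> \<le> c2 * exp (- 2 * s * \<eta>) + c2 * (?X * (\<delta> + \<delta>\<^sup>2))"
          by (intro add_mono mult_right_mono) (use C l2 t0 \<delta> in \<open>auto simp: c2_def\<close>)
        finally show "Y \<le> c2 * (exp (- 2 * s * \<eta>) + ?X * (\<delta> + \<delta>\<^sup>2))" by (simp add: distrib_left)
      qed (use c1 in simp)
      finally show ?thesis by (simp add: mult.assoc)
    qed
    have c12: "0 \<le> c1 * c2" using c1 c2 by simp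
    have s0: "1 \<le> s0" using C by (simp add: s0_def)
    let ?E = "exp (3 * s0 * \<phi>T)"
    have "exp (- 2 * s * \<eta>) + exp (3 * s * \<phi>T) * (\<delta> + \<delta>\<^sup>2) \<le> (2 * ?E + 1) * (\<delta> powr (2 * \<theta>) + \<delta>\<^sup>2)"
      if sdef: "s = (if \<delta> < 1 then s0 - L * ln \<delta> else s0)" for s
    proof (cases "\<delta> < 1")
      case True
      have s: "s = s0 - L * ln \<delta>" using True sdef by simp
      have "exp (- 2 * s * \<eta>) = exp (- 2 * s0 * \<eta>) * \<delta> powr (2 * \<theta>)"
        using \<delta> by (simp add: s powr_def exp_add[symmetric] \<theta>_def algebra_simps)
      also have "\<dots> \<le> 1 * \<delta> powr (2 * \<theta>)" by (rule mult_right_mono) (use s0 \<eta> in auto)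
      finally have 1: "exp (- 2 * s * \<eta>) \<le> \<delta> powr (2 * \<theta>)" by simp
      have "exp (3 * s * \<phi>T) * \<delta> = ?E * \<delta> powr (1 - 3 * \<phi>T * L)"
        using \<delta> by (simp add: s powr_def exp_add[symmetric] exp_diff algebra_simps)
      also have "1 - 3 * \<phi>T * L = 2 * \<theta>" using L1 by simp
      finally have 2: "exp (3 * s * \<phi>T) * \<delta> = ?E * \<delta> powr (2 * \<theta>)" .
      have "\<delta> + \<delta>\<^sup>2 \<le> 2 * \<delta>" using True \<delta> by (simp add: power2_eq_square mult_left_le)
      then have "exp (3 * s * \<phi>T) * (\<delta> + \<delta>\<^sup>2) \<le> exp (3 * s * \<phi>T) * (2 * \<delta>)" by (rule mult_left_mono) simp
      also have "\<dots> = 2 * (?E * \<delta> powr (2 * \<theta>))" using 2 by simp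
      finally have "exp (- 2 * s * \<eta>) + exp (3 * s * \<phi>T) * (\<delta> + \<delta>\<^sup>2) \<le> (2 * ?E + 1) * \<delta> powr (2 * \<theta>)"
        using 1 by (simp add: distrib_right mult.assoc)
      also have "\<dots> \<le> (2 * ?E + 1) * (\<delta> powr (2 * \<theta>) + \<delta>\<^sup>2)" by (rule mult_left_mono) (auto intro: add_nonneg_nonneg)
      finally show ?thesis .
    next
      \<comment> \<open>For \<open>\<delta> \<ge> 1\<close> nothing has to be balanced:
        \<open>s = s0\<close> suffices, and \<open>\<delta>\<^sup>2\<close> dominates both
        \<open>1\<close> and \<open>\<delta>\<close>.\<close>
      case False
      have s: "s = s0" using False sdef by simp
      have d: "1 \<le> \<delta>\<^sup>2" "\<delta> \<le> \<delta>\<^sup>2" using False by (auto simp: power2_eq_square intro: mult_left_mono[of 1 \<delta> \<delta>, simplified] order_trans[of 1 \<delta>])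
      have "exp (- 2 * s * \<eta>) \<le> 1" using s s0 \<eta> by simp
      then have "exp (- 2 * s * \<eta>) \<le> \<delta>\<^sup>2" using d by linarith
      moreover have "?E * (\<delta> + \<delta>\<^sup>2) \<le> ?E * (2 * \<delta>\<^sup>2)" by (rule mult_left_mono) (use d in auto)
      moreover have "(2 * ?E + 1) * \<delta>\<^sup>2 = \<delta>\<^sup>2 + ?E * (2 * \<delta>\<^sup>2)" by (simp add: algebra_simps)
      ultimately have "exp (- 2 * s * \<eta>) + exp (3 * s * \<phi>T) * (\<delta> + \<delta>\<^sup>2) \<le> (2 * ?E + 1) * \<delta>\<^sup>2"
        unfolding s by linarith
      also have "\<dots> \<le> (2 * ?E + 1) * (\<delta> powr (2 * \<theta>) + \<delta>\<^sup>2)" by (rule mult_left_mono) (auto intro: add_nonneg_nonneg)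
      finally show ?thesis .
    qed
    then have fin: "exp (- 2 * s * \<eta>) + exp (3 * s * \<phi>T) * (\<delta> + \<delta>\<^sup>2) \<le> (2 * ?E + 1) * (\<delta> powr (2 * \<theta>) + \<delta>\<^sup>2)"
      if "s = (if \<delta> < 1 then s0 - L * ln \<delta> else s0)" for s using that by blast
    define s where "s = (if \<delta> < 1 then s0 - L * ln \<delta> else s0)"
    have "s0 \<le> s" using L0 \<delta> by (auto simp: s_def mult_le_0_iff)
    from step[OF this] have "P t0 + V t0 \<le> c1 * c2 * (exp (- 2 * s * \<eta>) + exp (3 * s * \<phi>T) * (\<delta> + \<delta>\<^sup>2))" .
    also have "\<dots> \<le> c1 * c2 * ((2 * ?E + 1) * (\<delta> powr (2 * \<theta>) + \<delta>\<^sup>2))"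
      by (rule mult_left_mono[OF fin[OF s_def] c12])
    finally show ?thesis by (simp add: C_def mult.assoc)
  qed
  show ?thesis
    by (rule exI[of _ C], rule exI[of _ \<theta>]) (use \<open>0 < C\<close> \<theta> main in blast)
qed

section \<open>Time derivatives of the energies\<close>

lemma lebesgue_lborel:
  fixes f :: "'a::euclidean_space \<Rightarrow> real"
  assumes f: "f \<in> borel_measurable borel" and A: "A \<in> sets borel"
  shows "set_integrable lebesgue A f \<longleftrightarrow> set_integrable lborel A f"
    "(LINT x:A|lebesgue. f x) = (LINT x:A|lborel. f x)"
proof -
  have m: "(\<lambda>x. indicator A x *\<^sub>R f x) \<in> borel_measurable lborel" using f A by simp
  show "set_integrable lebesgue A f \<longleftrightarrow> set_integrable lborel A f"
    unfolding set_integrable_def by (rule integrable_completion[OF m])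
  show "(LINT x:A|lebesgue. f x) = (LINT x:A|lborel. f x)"
    unfolding set_lebesgue_integral_def by (rule integral_completion[OF m])
qed

lemma integrable_indicator_Icc: "integrable lborel (indicator {\<alpha>..\<beta>::real} :: real \<Rightarrow> real)"
  by (rule integrable_real_indicator) (auto simp: emeasure_lborel_Icc_eq)

lemma set_integral_point_lborel: "(LINT s:{t..t}|lborel. (f s :: real)) = (0::real)" for t :: real
  unfolding set_lebesgue_integral_def
  by (rule integral_eq_zero_AE) (use AE_lborel_singleton[of t] in \<open>auto elim!: eventually_mono\<close>)

lemma integrable_if_square_integrable:
  fixes h :: "real \<Rightarrow> real"
  assumes m: "h \<in> borel_measurable borel" and i: "integrable lborel (\<lambda>t. (h t)\<^sup>2)"
    and z: "\<And>t. t \<notin> {\<alpha>..\<beta>} \<Longrightarrow> h t = 0"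
  shows "integrable lborel h"
proof (rule Bochner_Integration.integrable_bound)
  show "integrable lborel (\<lambda>t. indicator {\<alpha>..\<beta>} t + (h t)\<^sup>2)" by (intro Bochner_Integration.integrable_add i integrable_indicator_Icc)
  show "AE t in lborel. norm (h t) \<le> norm (indicator {\<alpha>..\<beta>} t + (h t)\<^sup>2)"
  proof (intro AE_I2)
    fix t
    have "2 * \<bar>h t\<bar> \<le> (h t)\<^sup>2 + 1" using sum_squares_bound[of "\<bar>h t\<bar>" 1] by simp
    then have "\<bar>h t\<bar> \<le> 1 + (h t)\<^sup>2" using abs_ge_zero[of "h t"] by linarith
    then show "norm (h t) \<le> norm (indicator {\<alpha>..\<beta>} t + (h t)\<^sup>2)" using z[of t] by (auto simp: indicator_def)
  qed
qed (use m in simp)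

text \<open>Cauchy-Schwarz against an indicator, read off from the nonnegative integral of
  \<open>((\<beta> - \<alpha>) * h - \<integral> h)\<^sup>2\<close> over the interval. Cancelling
  the length excludes \<open>\<alpha> = \<beta>\<close>, where \<open>h\<close> vanishes almost
  everywhere.\<close>

lemma square_integral_le:
  fixes h :: "real \<Rightarrow> real"
  assumes m: "h \<in> borel_measurable borel" and i: "integrable lborel (\<lambda>t. (h t)\<^sup>2)"
    and z: "\<And>t. t \<notin> {\<alpha>..\<beta>} \<Longrightarrow> h t = 0" and ab: "\<alpha> \<le> \<beta>"
  shows "(LINT t|lborel. h t)\<^sup>2 \<le> (\<beta> - \<alpha>) * (LINT t|lborel. (h t)\<^sup>2)"
proof -
  have ih: "integrable lborel h" by (rule integrable_if_square_integrable[OF m i z])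
  have ii: "integrable lborel (indicator {\<alpha>..\<beta>} :: real \<Rightarrow> real)" by (rule integrable_indicator_Icc)
  let ?a = "LINT t|lborel. h t" and ?b = "LINT t|lborel. (h t)\<^sup>2" and ?l = "\<beta> - \<alpha>"
  have "0 \<le> (LINT t|lborel. (?l * h t - ?a * indicator {\<alpha>..\<beta>} t)\<^sup>2)" by simp
  also have "\<dots> = (LINT t|lborel. ?l\<^sup>2 * (h t)\<^sup>2 - 2 * ?l * ?a * h t + ?a\<^sup>2 * indicator {\<alpha>..\<beta>} t)"
  proof (intro Bochner_Integration.integral_cong refl)
    fix t show "(?l * h t - ?a * indicator {\<alpha>..\<beta>} t)\<^sup>2 = ?l\<^sup>2 * (h t)\<^sup>2 - 2 * ?l * ?a * h t + ?a\<^sup>2 * indicator {\<alpha>..\<beta>} t"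
      using z[of t] by (auto simp: indicator_def power2_diff power_mult_distrib)
  qed
  also have "\<dots> = ?l\<^sup>2 * ?b - 2 * ?l * ?a * ?a + ?a\<^sup>2 * ?l"
    using ih i ii ab by simp
  also have "\<dots> = ?l * (?l * ?b - ?a\<^sup>2)" by (simp add: power2_eq_square algebra_simps)
  finally have *: "0 \<le> ?l * (?l * ?b - ?a\<^sup>2)" .
  show ?thesis
  proof (cases "\<alpha> = \<beta>")
    case True
    have "AE t in lborel. h t = 0"
      using AE_lborel_singleton[of \<alpha>] by eventually_elim (use z True in auto)
    then have "?a = 0" by (rule integral_eq_zero_AE)
    then show ?thesis using True by simp
  next
    case False
    then have "0 < ?l" using ab by simp
    then show ?thesis using * by (simp add: zero_le_mult_iff)
  qed
qed

text \<open>For almost every \<open>x\<close> the product rule in time gives the density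
  \<open>2 * y * g\<close> for \<open>y\<^sup>2\<close>; Fubini turns the integral over
  \<open>x\<close> into a primitive in time.\<close>

lemma energy_primitive_unit:
  fixes y0 :: "real \<Rightarrow> real" and g :: "real \<Rightarrow> real \<Rightarrow> real"
  assumes T: "0 \<le> T"
    and y0m[measurable]: "y0 \<in> borel_measurable borel"
    and gm[measurable]: "(\<lambda>(x, t). g x t) \<in> borel_measurable (borel \<Otimes>\<^sub>M borel)"
    and y0i: "integrable lborel (\<lambda>x. (y0 x)\<^sup>2)"
    and gi: "integrable (lborel \<Otimes>\<^sub>M lborel) (\<lambda>(x, t). (g x t)\<^sup>2)"
    and gz: "\<forall>x t. t \<notin> {0..T} \<longrightarrow> g x t = 0"
  defines "y \<equiv> \<lambda>x t. y0 x + (LINT s:{0..t}|lborel. g x s)"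
  shows "primitive_on T (\<lambda>t. LINT x|lborel. (y x t)\<^sup>2) (\<lambda>t. 2 * (LINT x|lborel. y x t * g x t))"
    and "t \<in> {0..T} \<Longrightarrow> integrable lborel (\<lambda>x. (y x t)\<^sup>2)"
    and "(\<lambda>(x, t). y x t) \<in> borel_measurable (borel \<Otimes>\<^sub>M borel)"
proof -
  have gx[measurable]: "g x \<in> borel_measurable borel" for x by measurable
  have gt[measurable]: "(\<lambda>x. g x t) \<in> borel_measurable borel" for t by measurable
  have eq: "(LINT s:{0..t}|lborel. g x s) = (LINT s|lborel. (if 0 \<le> s \<and> s \<le> t then g x s else 0))" for x t
    unfolding set_lebesgue_integral_def by (intro Bochner_Integration.integral_cong) auto
  have "(\<lambda>z. LINT s|lborel. (if 0 \<le> s \<and> s \<le> snd z then g (fst z) s else 0)) \<in> borel_measurable (borel \<Otimes>\<^sub>M borel)"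
    by (rule lborel.borel_measurable_lebesgue_integral) measurable
  then show ym[measurable]: "(\<lambda>(x, t). y x t) \<in> borel_measurable (borel \<Otimes>\<^sub>M borel)"
    unfolding y_def eq by (simp add: case_prod_unfold)
  have yt[measurable]: "(\<lambda>x. y x t) \<in> borel_measurable borel" for t by measurable
  \<comment> \<open>By Cauchy-Schwarz in time this integrable function of \<open>x\<close> dominates
    \<open>y\<^sup>2\<close> for all \<open>t\<close> in \<open>{0..T}\<close> at once.\<close>
  define H where "H x = 2 * (y0 x)\<^sup>2 + 2 * T * (LINT s|lborel. (g x s)\<^sup>2)" for x
  have iH: "integrable lborel H"
    unfolding H_def[abs_def] using lborel_pair.integrable_fst'[OF gi] y0i by simp
  have gx2: "AE x in lborel. integrable lborel (\<lambda>s. (g x s)\<^sup>2)"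
    using lborel_pair.AE_integrable_fst'[OF gi] by simp
  have yH: "AE x in lborel. \<forall>t\<in>{0..T}. (y x t)\<^sup>2 \<le> H x"
    using gx2
  proof eventually_elim
    case (elim x)
    show ?case
    proof
      fix t assume t: "t \<in> {0..T}"
      have i: "integrable lborel (\<lambda>s. (indicator {0..t} s * g x s)\<^sup>2)"
        by (rule Bochner_Integration.integrable_bound[OF elim]) (auto simp: indicator_def)
      have "(LINT s|lborel. indicator {0..t} s * g x s)\<^sup>2 \<le> (t - 0) * (LINT s|lborel. (indicator {0..t} s * g x s)\<^sup>2)"
        by (rule square_integral_le[OF _ i]) (use t in auto)
      also have "\<dots> \<le> T * (LINT s|lborel. (g x s)\<^sup>2)"
      proof (rule mult_mono)
        show "(LINT s|lborel. (indicator {0..t} s * g x s)\<^sup>2) \<le> (LINT s|lborel. (g x s)\<^sup>2)"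
          by (rule integral_mono[OF i elim]) (auto simp: indicator_def)
      qed (use t in auto)
      finally have "(LINT s:{0..t}|lborel. g x s)\<^sup>2 \<le> T * (LINT s|lborel. (g x s)\<^sup>2)"
        by (simp add: set_lebesgue_integral_def)
      moreover have "(y x t)\<^sup>2 \<le> 2 * (y0 x)\<^sup>2 + 2 * (LINT s:{0..t}|lborel. g x s)\<^sup>2"
        using sum_squares_bound[of "y0 x" "LINT s:{0..t}|lborel. g x s"] by (simp add: y_def power2_sum)
      ultimately show "(y x t)\<^sup>2 \<le> H x" by (simp add: H_def)
    qed
  qed
  show iy: "integrable lborel (\<lambda>x. (y x t)\<^sup>2)" if "t \<in> {0..T}" for t
    by (rule Bochner_Integration.integrable_bound[OF iH])
       (use yH that in \<open>auto elim!: eventually_mono intro: order_trans[OF _ abs_ge_self]\<close>)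
  have iHT: "integrable (lborel \<Otimes>\<^sub>M lborel) (\<lambda>(x, t). H x * indicator {0..T} t)"
    by (rule lborel_pair.integrable_prod_mult[OF iH integrable_indicator_Icc])
  have Hm[measurable]: "H \<in> borel_measurable borel" using iH by auto
  have iyg: "integrable (lborel \<Otimes>\<^sub>M lborel) (\<lambda>(x, t). y x t * g x t)"
  proof (rule Bochner_Integration.integrable_bound[OF Bochner_Integration.integrable_add[OF iHT gi]])
    have "AE z in lborel \<Otimes>\<^sub>M lborel. \<forall>t\<in>{0..T}. (y (fst z) t)\<^sup>2 \<le> H (fst z)"
    proof -
      have "AE x in lborel. \<forall>t\<in>{0..T}. (y x t)\<^sup>2 \<le> H x" by (rule yH)
      then obtain N where N: "N \<in> null_sets lborel" "{x. \<not> (\<forall>t\<in>{0..T}. (y x t)\<^sup>2 \<le> H x)} \<subseteq> N"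
        by (auto elim!: AE_E simp: null_sets_def)
      have "N \<times> UNIV \<in> null_sets (lborel \<Otimes>\<^sub>M lborel)"
        using lborel.times_in_null_sets1[OF N(1), of UNIV] by simp
      then show ?thesis by (rule AE_I'[OF _]) (use N(2) in auto)
    qed
    then show "AE z in lborel \<Otimes>\<^sub>M lborel. norm (case z of (x, t) \<Rightarrow> y x t * g x t)
        \<le> norm ((case z of (x, t) \<Rightarrow> H x * indicator {0..T} t) + (case z of (x, t) \<Rightarrow> (g x t)\<^sup>2))"
    proof eventually_elim
      case (elim z)
      obtain x t where z: "z = (x, t)" by (cases z)
      show ?case
      proof (cases "t \<in> {0..T}")
        case True
        have "2 * \<bar>y x t * g x t\<bar> \<le> (y x t)\<^sup>2 + (g x t)\<^sup>2"
          using sum_squares_bound[of "\<bar>y x t\<bar>" "\<bar>g x t\<bar>"] by (simp add: abs_mult mult.assoc)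
        then have "\<bar>y x t * g x t\<bar> \<le> H x + (g x t)\<^sup>2" using elim True z by (auto dest!: bspec[of _ _ t])
        then show ?thesis using True by (simp add: z)
      next
        case False
        then show ?thesis using gz by (simp add: z)
      qed
    qed
  qed measurable
  have pt: "AE x in lborel. \<forall>t\<in>{0..T}. (y x t)\<^sup>2 = (y0 x)\<^sup>2 + (LINT s|lborel. indicator {0..t} s * (2 * (y x s * g x s)))"
    using gx2
  proof eventually_elim
    case (elim x)
    show ?case
    proof
      fix t assume t: "t \<in> {0..T}"
      have ig: "integrable lborel (g x)" by (rule integrable_if_square_integrable[OF gx elim]) (use gz in blast)
      have si: "set_integrable lebesgue {0..t} (g x)"
      proof (subst lebesgue_lborel(1)[OF gx atLeastAtMost_borel])
        show "set_integrable lborel {0..t} (g x)"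
          unfolding set_integrable_def by (rule integrable_mult_indicator[OF _ ig]) simp
      qed
      have y00: "y x 0 = y0 x"
        using set_integral_point_lborel[of 0 "g x"] unfolding y_def by simp
      have prim: "y x u = y x 0 + (LINT s:{0..u}|lebesgue. g x s)" for u
        unfolding y00 lebesgue_lborel(2)[OF gx atLeastAtMost_borel] by (simp add: y_def)
      have ymx: "y x \<in> borel_measurable borel" by measurable
      note P = parts[OF _ si si prim prim]
      have "(y x t)\<^sup>2 - (y0 x)\<^sup>2 = (LINT s:{0..t}|lebesgue. y x s * g x s) + (LINT s:{0..t}|lebesgue. g x s * y x s)"
        using P(3) t y00 by (simp add: power2_eq_square)
      also have "\<dots> = 2 * (LINT s:{0..t}|lebesgue. y x s * g x s)" by (simp add: mult.commute)
      also have "(LINT s:{0..t}|lebesgue. y x s * g x s) = (LINT s:{0..t}|lborel. y x s * g x s)"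
        by (rule lebesgue_lborel(2)) (use ymx in auto)
      finally show "(y x t)\<^sup>2 = (y0 x)\<^sup>2 + (LINT s|lborel. indicator {0..t} s * (2 * (y x s * g x s)))"
        by (simp add: set_lebesgue_integral_def mult.left_commute[of _ 2])
    qed
  qed
  define D where "D s = 2 * (LINT x|lborel. y x s * g x s)" for s
  have Di: "integrable lborel D"
    unfolding D_def[abs_def] using lborel_pair.integrable_snd[of "\<lambda>x t. y x t * g x t"] iyg by simp
  have Dm: "D \<in> borel_measurable borel" using Di by auto
  show "primitive_on T (\<lambda>t. LINT x|lborel. (y x t)\<^sup>2) (\<lambda>t. 2 * (LINT x|lborel. y x t * g x t))"
    unfolding primitive_on_def D_def[symmetric]
  proof (intro conjI ballI)
    show "set_integrable lebesgue {0..T} D"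
    proof (subst lebesgue_lborel(1)[OF Dm atLeastAtMost_borel])
      show "set_integrable lborel {0..T} D"
        unfolding set_integrable_def by (rule integrable_mult_indicator[OF _ Di]) simp
    qed
    have yy0: "(LINT x|lborel. (y x 0)\<^sup>2) = (LINT x|lborel. (y0 x)\<^sup>2)"
      unfolding y_def set_integral_point_lborel by simp
    fix t assume t: "t \<in> {0..T}"
    have it: "integrable (lborel \<Otimes>\<^sub>M lborel) (\<lambda>(x, s). indicator {0..t} s * (2 * (y x s * g x s)))"
      by (rule Bochner_Integration.integrable_bound[OF integrable_mult_right[OF iyg, of 2]]) (auto simp: indicator_def)
    have "(LINT x|lborel. (y x t)\<^sup>2) = (LINT x|lborel. (y0 x)\<^sup>2 + (LINT s|lborel. indicator {0..t} s * (2 * (y x s * g x s))))"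
    proof (intro integral_cong_AE)
      show "(\<lambda>x. (y0 x)\<^sup>2 + (LINT s|lborel. indicator {0..t} s * (2 * (y x s * g x s)))) \<in> borel_measurable lborel"
        using lborel_pair.integrable_fst[OF it] by (intro borel_measurable_add) auto
    qed (use pt t in \<open>auto elim!: eventually_mono\<close>)
    also have "\<dots> = (LINT x|lborel. (y0 x)\<^sup>2) + (LINT x|lborel. LINT s|lborel. indicator {0..t} s * (2 * (y x s * g x s)))"
      by (rule Bochner_Integration.integral_add[OF y0i]) (use lborel_pair.integrable_fst[OF it] in simp)
    also have "(LINT x|lborel. LINT s|lborel. indicator {0..t} s * (2 * (y x s * g x s)))
      = (LINT s|lborel. LINT x|lborel. indicator {0..t} s * (2 * (y x s * g x s)))"
      by (rule lborel_pair.Fubini_integral[OF it, symmetric])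
    also have "\<dots> = (LINT s:{0..t}|lebesgue. D s)"
      by (subst lebesgue_lborel(2)[OF Dm atLeastAtMost_borel]) (simp add: set_lebesgue_integral_def D_def)
    finally show "(LINT x|lborel. (y x t)\<^sup>2) = (LINT x|lborel. (y x 0)\<^sup>2) + (LINT s:{0..t}|lebesgue. D s)"
      by (simp add: yy0)
  qed
qed

text \<open>The weighted version follows by multiplying the data with the square root of the weight.\<close>

lemma energy_primitive:
  fixes y0 :: "real \<Rightarrow> real" and g :: "real \<Rightarrow> real \<Rightarrow> real" and \<rho> :: "real \<Rightarrow> real"
  assumes T: "0 \<le> T" and \<rho>: "continuous_on {0<..<1} \<rho>" "\<And>x. x \<in> {0<..<1} \<Longrightarrow> 0 < \<rho> x"
    and y0m: "y0 \<in> borel_measurable borel"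
    and gm: "(\<lambda>(x, t). g x t) \<in> borel_measurable (borel \<Otimes>\<^sub>M borel)"
    and y0i: "set_integrable lebesgue {0<..<1} (\<lambda>x. \<rho> x * (y0 x)\<^sup>2)"
    and gi: "integrable (lborel \<Otimes>\<^sub>M lborel) (\<lambda>(x, t). \<rho> x * (g x t)\<^sup>2)"
    and gz: "\<And>x t. x \<notin> {0<..<1} \<or> t \<notin> {0<..<T} \<Longrightarrow> g x t = 0"
  defines "y \<equiv> \<lambda>x t. y0 x + (LINT s:{0..t}|lborel. g x s)"
  shows "primitive_on T (\<lambda>t. LINT x:{0<..<1}|lebesgue. \<rho> x * (y x t)\<^sup>2) (\<lambda>t. 2 * (LINT x:{0<..<1}|lebesgue. \<rho> x * (y x t * g x t)))"
    and "t \<in> {0..T} \<Longrightarrow> set_integrable lebesgue {0<..<1} (\<lambda>x. \<rho> x * (y x t)\<^sup>2)"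
    and "AE t in lebesgue. set_integrable lebesgue {0<..<1} (\<lambda>x. \<rho> x * (g x t)\<^sup>2)"
    and "(\<lambda>(x, t). y x t) \<in> borel_measurable (borel \<Otimes>\<^sub>M borel)"
proof -
  note [measurable] = y0m gm
  define r where "r x = indicator {0<..<1} x * sqrt (\<rho> x)" for x
  have "(\<lambda>x. indicator {0<..<1} x *\<^sub>R sqrt (\<rho> x)) \<in> borel_measurable borel"
    by (rule borel_measurable_continuous_on_indicator) (auto intro!: continuous_intros \<rho>)
  then have rm[measurable]: "r \<in> borel_measurable borel" by (simp add: r_def[abs_def])
  have r2: "(r x)\<^sup>2 = indicator {0<..<1} x * \<rho> x" for x
    using \<rho>(2)[of x] by (cases "x \<in> {0<..<1}") (simp_all add: r_def power_mult_distrib less_imp_le)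
  have \<rho>m[measurable]: "(\<lambda>x. indicator {0<..<1} x * \<rho> x) \<in> borel_measurable borel"
    unfolding r2[symmetric] by measurable
  define h where "h x t = r x * g x t" for x t
  have hm: "(\<lambda>(x, t). h x t) \<in> borel_measurable (borel \<Otimes>\<^sub>M borel)" unfolding h_def by measurable
  have ym: "(\<lambda>(x, t). r x * y x t) \<in> borel_measurable (borel \<Otimes>\<^sub>M borel) \<and> (\<lambda>(x, t). y x t) \<in> borel_measurable (borel \<Otimes>\<^sub>M borel)"
  proof -
    have eq: "(LINT s:{0..t}|lborel. g x s) = (LINT s|lborel. (if 0 \<le> s \<and> s \<le> t then g x s else 0))" for x t
      unfolding set_lebesgue_integral_def by (intro Bochner_Integration.integral_cong) auto
    have [measurable]: "(\<lambda>z. LINT s|lborel. (if 0 \<le> s \<and> s \<le> snd z then g (fst z) s else 0)) \<in> borel_measurable (borel \<Otimes>\<^sub>M borel)"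
      by (rule lborel.borel_measurable_lebesgue_integral) measurable
    show ?thesis unfolding y_def eq by (simp add: case_prod_unfold)
  qed
  then show y_m[measurable]: "(\<lambda>(x, t). y x t) \<in> borel_measurable (borel \<Otimes>\<^sub>M borel)" by simp
  have yr: "r x * y0 x + (LINT s:{0..t}|lborel. h x s) = r x * y x t" for x t
    unfolding h_def y_def by (simp add: algebra_simps)
  have i1: "integrable lborel (\<lambda>x. (r x * y0 x)\<^sup>2)"
  proof -
    have m: "(\<lambda>x. indicator {0<..<1} x * \<rho> x * (y0 x)\<^sup>2) \<in> borel_measurable lborel" by measurable
    have "integrable lebesgue (\<lambda>x. indicator {0<..<1} x * \<rho> x * (y0 x)\<^sup>2)"
      using y0i by (simp add: set_integrable_def mult.assoc)
    then have "integrable lborel (\<lambda>x. indicator {0<..<1} x * \<rho> x * (y0 x)\<^sup>2)"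
      using integrable_completion[OF m] by simp
    then show ?thesis by (simp add: power_mult_distrib r2)
  qed
  \<comment> \<open>The indicator inside \<open>r\<close> disappears because \<open>g\<close>
    vanishes off the cylinder.\<close>
  have h2: "(h x t)\<^sup>2 = \<rho> x * (g x t)\<^sup>2" for x t
    using gz[of x t] by (cases "x \<in> {0<..<1}") (simp_all add: h_def power_mult_distrib r2)
  have i2: "integrable (lborel \<Otimes>\<^sub>M lborel) (\<lambda>(x, t). (h x t)\<^sup>2)" using gi by (simp add: h2)
  have hz: "\<forall>x t. t \<notin> {0..T} \<longrightarrow> h x t = 0" using gz by (auto simp: h_def)
  have r0m: "(\<lambda>x. r x * y0 x) \<in> borel_measurable borel" by measurable
  note E = energy_primitive_unit[OF T r0m hm i1 i2 hz, unfolded yr]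
  have e: "(LINT x|lborel. (r x * u x) * (r x * v x)) = (LINT x:{0<..<1}|lebesgue. \<rho> x * (u x * v x))"
    and e': "integrable lborel (\<lambda>x. (r x * u x) * (r x * v x)) \<longleftrightarrow> set_integrable lebesgue {0<..<1} (\<lambda>x. \<rho> x * (u x * v x))"
    if [measurable]: "u \<in> borel_measurable borel" "v \<in> borel_measurable borel" for u v
  proof -
    have c: "(\<lambda>x. (r x * u x) * (r x * v x)) = (\<lambda>x. indicator {0<..<1} x *\<^sub>R (\<rho> x * (u x * v x)))"
      using r2 by (auto simp: fun_eq_iff power2_eq_square algebra_simps)
    have m: "(\<lambda>x. indicator {0<..<1} x *\<^sub>R (\<rho> x * (u x * v x))) \<in> borel_measurable lborel"
      unfolding c[symmetric] by measurable
    show "(LINT x|lborel. (r x * u x) * (r x * v x)) = (LINT x:{0<..<1}|lebesgue. \<rho> x * (u x * v x))"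
      unfolding c set_lebesgue_integral_def by (rule integral_completion[OF m, symmetric])
    show "integrable lborel (\<lambda>x. (r x * u x) * (r x * v x)) \<longleftrightarrow> set_integrable lebesgue {0<..<1} (\<lambda>x. \<rho> x * (u x * v x))"
      unfolding c set_integrable_def by (rule integrable_completion[OF m, symmetric])
  qed
  have yt: "(\<lambda>x. y x t) \<in> borel_measurable borel" and gt: "(\<lambda>x. g x t) \<in> borel_measurable borel" for t by measurable
  show "primitive_on T (\<lambda>t. LINT x:{0<..<1}|lebesgue. \<rho> x * (y x t)\<^sup>2) (\<lambda>t. 2 * (LINT x:{0<..<1}|lebesgue. \<rho> x * (y x t * g x t)))"
    using E(1) unfolding h_def power2_eq_square by (simp add: e[OF yt yt] e[OF yt gt])
  show "set_integrable lebesgue {0<..<1} (\<lambda>x. \<rho> x * (y x t)\<^sup>2)" if "t \<in> {0..T}"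
    using E(2)[OF that] unfolding power2_eq_square by (simp add: e'[OF yt yt])
  show "AE t in lebesgue. set_integrable lebesgue {0<..<1} (\<lambda>x. \<rho> x * (g x t)\<^sup>2)"
    unfolding AE_lebesgue_iff using lborel_pair.AE_integrable_snd[OF i2]
    unfolding h_def power2_eq_square by (simp add: e'[OF gt gt])
qed

lemma primitive_on_cong:
  assumes "primitive_on T f f'" "\<And>t. t \<in> {0..T} \<Longrightarrow> f t = g t" "\<And>t. t \<in> {0..T} \<Longrightarrow> f' t = g' t"
  shows "primitive_on T g g'"
  unfolding primitive_on_def
proof (intro conjI ballI)
  show "set_integrable lebesgue {0..T} g'"
    using assms(1,3) set_integrable_cong[of lebesgue lebesgue "{0..T}" "{0..T}" f' g'] by (auto simp: primitive_on_def)
  fix t assume t: "t \<in> {0..T}"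
  have "(LINT s:{0..t}|lebesgue. f' s) = (LINT s:{0..t}|lebesgue. g' s)"
    by (rule set_lebesgue_integral_cong) (use t assms(3) in auto)
  moreover have "f t = f 0 + (LINT s:{0..t}|lebesgue. f' s)" using assms(1) t unfolding primitive_on_def by blast
  ultimately show "g t = g 0 + (LINT s:{0..t}|lebesgue. g' s)" using assms(2)[OF t] assms(2)[of 0] t by simp
qed

text \<open>The hypothesis \<open>0 \<le> c\<close> also covers a non-integrable \<open>h\<close>,
  whose integral is \<open>0\<close> by convention; integrability then need not be checked in
  applications.\<close>

lemma set_integral_Ioo_le_const:
  fixes h :: "real \<Rightarrow> real"
  assumes "AE x in lebesgue. x \<in> {0<..<1} \<longrightarrow> h x \<le> c" "0 \<le> c"
  shows "(LINT x:{0<..<1}|lebesgue. h x) \<le> c"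
proof (cases "set_integrable lebesgue {0<..<1} h")
  case True
  have "(LINT x:{0<..<1}|lebesgue. h x) \<le> (LINT x:{0<..<1::real}|lebesgue. c)"
    by (rule set_integral_mono_AE[OF True ess_bounded_integrable[OF ess_bounded_const] assms(1)])
  also have "\<dots> = c" using set_integral_Ioo_Icc(2)[of 0 1 "\<lambda>_. c"] by (simp add: set_integral_const)
  finally show ?thesis .
next
  case False
  then show ?thesis using assms(2)
    by (simp add: set_integrable_def set_lebesgue_integral_def not_integrable_integral_eq)
qed

section \<open>The energy of the mean-free primitive as a function of time\<close>

context
  fixes a :: "real \<Rightarrow> real" and \<delta> :: real and \<C> :: "(real \<times> real) set"
  assumes L: "level_intervals a \<delta> \<C>" and \<delta>: "0 < \<delta>"
    and a_pos: "\<And>x. x \<in> {0<..<1} \<Longrightarrow> 0 < a x" and a_cont: "continuous_on {0<..<1} a"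
begin

lemma a_measurable: "(\<lambda>x. indicator {0<..<1} x * a x) \<in> borel_measurable borel"
  using borel_measurable_continuous_on_indicator[OF _ a_cont] by simp


lemma mfp_kernel_measurable [measurable]:
  "(\<lambda>z. mfp_kernel \<C> (fst z) (snd z)) \<in> borel_measurable (borel \<Otimes>\<^sub>M borel)"
proof -
  have fin: "finite \<C>" using L by (simp add: level_intervals_def)
  have eq: "mfp_kernel \<C> x \<xi> = (\<Sum>p\<in>\<C>. if fst p < x \<and> x < snd p \<and> fst p < \<xi> \<and> \<xi> < snd p
      then (if \<xi> \<le> x then 1 else 0) - (snd p - \<xi>) / (snd p - fst p) else 0)" for x \<xi>
    unfolding mfp_kernel_def by (intro sum.cong refl) (auto simp: indicator_def)
  show ?thesis unfolding eq by measurable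
qed

lemma mfp_kernel_measurable' [measurable]: "mfp_kernel \<C> x \<in> borel_measurable borel"
  using measurable_compose[OF measurable_Pair1', OF _ mfp_kernel_measurable, of x] by simp

lemma mfp_kernel_support:
  assumes "mfp_kernel \<C> x \<xi> \<noteq> 0"
  shows "x \<in> {0<..<1}" "\<xi> \<in> {0<..<1}" "\<delta> \<le> a \<xi>"
proof -
  obtain p where "p \<in> \<C>" "(case p of (\<alpha>, \<beta>) \<Rightarrow> indicator {\<alpha><..<\<beta>} x * indicator {\<alpha><..<\<beta>} \<xi> *
      (indicator {..x} \<xi> - (\<beta> - \<xi>) / (\<beta> - \<alpha>))) \<noteq> (0::real)"
    using assms unfolding mfp_kernel_def by (rule sum.not_neutral_contains_not_neutral)
  then obtain \<alpha> \<beta> where p: "(\<alpha>, \<beta>) \<in> \<C>" "x \<in> {\<alpha><..<\<beta>}" "\<xi> \<in> {\<alpha><..<\<beta>}"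
    by (cases p) (force simp: indicator_def simp del: greaterThanLessThan_iff split: if_splits)
  then have "0 < \<alpha>" "\<beta> < 1" "\<forall>y\<in>{\<alpha>..\<beta>}. \<delta> \<le> a y" using L by (auto simp: level_intervals_def)
  with p show "x \<in> {0<..<1}" "\<xi> \<in> {0<..<1}" "\<delta> \<le> a \<xi>" by auto
qed

lemma mfp_lborel:
  assumes [measurable]: "f \<in> borel_measurable borel"
  shows "mean_free_primitive \<C> f x = (LINT \<xi>|lborel. mfp_kernel \<C> x \<xi> * f \<xi>)"
proof -
  have m: "(\<lambda>\<xi>. mfp_kernel \<C> x \<xi> * f \<xi>) \<in> borel_measurable borel" by measurable
  have "mean_free_primitive \<C> f x = (LINT \<xi>:{0<..<1}|lborel. mfp_kernel \<C> x \<xi> * f \<xi>)"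
    unfolding mean_free_primitive_def by (rule lebesgue_lborel(2)[OF m]) simp
  also have "\<dots> = (LINT \<xi>|lborel. mfp_kernel \<C> x \<xi> * f \<xi>)"
    unfolding set_lebesgue_integral_def using mfp_kernel_support(2)
    by (intro Bochner_Integration.integral_cong) (auto simp: indicator_def)
  finally show ?thesis .
qed

text \<open>Where the kernel does not vanish, \<open>\<delta> \<le> a \<xi>\<close>, so the missing
  weight is bought by \<open>1 \<le> a \<xi> / \<delta>\<close>.\<close>

lemma mfp_kernel_square: "(mfp_kernel \<C> x \<xi> * y)\<^sup>2 \<le> indicator {0<..<1} x * (indicator {0<..<1} \<xi> * a \<xi> * y\<^sup>2) / \<delta>"
proof (cases "mfp_kernel \<C> x \<xi> = 0")
  case True
  then show ?thesis using a_pos[of \<xi>] \<delta> by (auto simp: indicator_def less_imp_le)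
next
  case False
  note s = mfp_kernel_support[OF False]
  have "(mfp_kernel \<C> x \<xi> * y)\<^sup>2 \<le> 1 * y\<^sup>2"
    unfolding power_mult_distrib
    by (rule mult_right_mono) (use mfp_kernel_bound[OF L, of x \<xi>] in \<open>auto simp: abs_square_le_1\<close>)
  also have "\<dots> \<le> a \<xi> / \<delta> * y\<^sup>2" by (rule mult_right_mono) (use s \<delta> in auto)
  finally show ?thesis using s by simp
qed

text \<open>Cauchy-Schwarz over an interval of length \<open>1\<close>, with
  \<open>mfp_kernel_square\<close>. It bounds the final value of \<open>J\<close> by that of
  \<open>P\<close>, and it controls the primitive of a time derivative that is known only in the
  weighted space.\<close>

lemma mfp_square_le:
  assumes f[measurable]: "f \<in> borel_measurable borel" and i: "set_integrable lebesgue {0<..<1} (\<lambda>x. a x * (f x)\<^sup>2)"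
  shows "(mean_free_primitive \<C> f x)\<^sup>2 \<le> indicator {0<..<1} x * (LINT x:{0<..<1}|lebesgue. a x * (f x)\<^sup>2) / \<delta>"
proof -
  note [measurable] = a_measurable
  have m: "(\<lambda>\<xi>. indicator {0<..<1} \<xi> * a \<xi> * (f \<xi>)\<^sup>2) \<in> borel_measurable lborel" by measurable
  have il: "integrable lborel (\<lambda>\<xi>. indicator {0<..<1} \<xi> * a \<xi> * (f \<xi>)\<^sup>2)"
    using i integrable_completion[OF m] by (simp add: set_integrable_def mult.assoc)
  have e: "(LINT x:{0<..<1}|lebesgue. a x * (f x)\<^sup>2) = (LINT \<xi>|lborel. indicator {0<..<1} \<xi> * a \<xi> * (f \<xi>)\<^sup>2)"
    using integral_completion[OF m] by (simp add: set_lebesgue_integral_def mult.assoc)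
  have i1: "integrable lborel (\<lambda>\<xi>. indicator {0<..<1} x * (indicator {0<..<1} \<xi> * a \<xi> * (f \<xi>)\<^sup>2) / \<delta>)"
    using il by simp
  have i2: "integrable lborel (\<lambda>\<xi>. (mfp_kernel \<C> x \<xi> * f \<xi>)\<^sup>2)"
  proof (rule Bochner_Integration.integrable_bound[OF i1])
    show "AE \<xi> in lborel. norm ((mfp_kernel \<C> x \<xi> * f \<xi>)\<^sup>2)
        \<le> norm (indicator {0<..<1} x * (indicator {0<..<1} \<xi> * a \<xi> * (f \<xi>)\<^sup>2) / \<delta>)"
    proof (intro AE_I2)
      fix \<xi>
      show "norm ((mfp_kernel \<C> x \<xi> * f \<xi>)\<^sup>2)
        \<le> norm (indicator {0<..<1} x * (indicator {0<..<1} \<xi> * a \<xi> * (f \<xi>)\<^sup>2) / \<delta>)"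
        unfolding real_norm_def abs_power2 by (rule order_trans[OF mfp_kernel_square abs_ge_self])
    qed
  qed measurable
  have "(LINT \<xi>|lborel. mfp_kernel \<C> x \<xi> * f \<xi>)\<^sup>2 \<le> (1 - 0) * (LINT \<xi>|lborel. (mfp_kernel \<C> x \<xi> * f \<xi>)\<^sup>2)"
    by (rule square_integral_le[OF _ i2]) (use mfp_kernel_support(2) in force)+
  also have "\<dots> \<le> (LINT \<xi>|lborel. indicator {0<..<1} x * (indicator {0<..<1} \<xi> * a \<xi> * (f \<xi>)\<^sup>2) / \<delta>)"
    using integral_mono[OF i2 i1 mfp_kernel_square] by simp
  finally show ?thesis unfolding mfp_lborel[OF f] e by simp
qed

text \<open>In contrast to \<open>mfp_square_le\<close> there is no factor
  \<open>1 / \<delta>\<close>: at time \<open>0\<close> the function is bounded but not small, so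
  the bound has to be uniform in \<open>\<delta>\<close>.\<close>

lemma mfp_abs_le:
  assumes f[measurable]: "f \<in> borel_measurable borel" and B: "AE \<xi> in lborel. \<xi> \<in> {0<..<1} \<longrightarrow> \<bar>f \<xi>\<bar> \<le> B" "0 \<le> B"
  shows "integrable lborel (\<lambda>\<xi>. mfp_kernel \<C> x \<xi> * f \<xi>)" "\<bar>mean_free_primitive \<C> f x\<bar> \<le> indicator {0<..<1} x * B"
proof -
  have i: "integrable lborel (\<lambda>\<xi>. indicator {0..1::real} \<xi> * (indicator {0<..<1} x * B))"
    using integrable_indicator_Icc by simp
  have le: "AE \<xi> in lborel. \<bar>mfp_kernel \<C> x \<xi> * f \<xi>\<bar> \<le> indicator {0..1} \<xi> * (indicator {0<..<1} x * B)"
    using B(1)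
  proof eventually_elim
    case (elim \<xi>)
    show ?case
    proof (cases "mfp_kernel \<C> x \<xi> = 0")
      case False
      note s = mfp_kernel_support[OF False]
      have "\<bar>mfp_kernel \<C> x \<xi>\<bar> * \<bar>f \<xi>\<bar> \<le> 1 * B"
        by (rule mult_mono) (use mfp_kernel_bound[OF L] elim s in auto)
      then show ?thesis using s by (simp add: abs_mult)
    qed (use B(2) in \<open>auto simp: indicator_def\<close>)
  qed
  show ii: "integrable lborel (\<lambda>\<xi>. mfp_kernel \<C> x \<xi> * f \<xi>)"
    by (rule Bochner_Integration.integrable_bound[OF i]) (use le in \<open>auto elim!: eventually_mono intro: order_trans[OF _ abs_ge_self]\<close>)
  have "\<bar>LINT \<xi>|lborel. mfp_kernel \<C> x \<xi> * f \<xi>\<bar> \<le> (LINT \<xi>|lborel. \<bar>mfp_kernel \<C> x \<xi> * f \<xi>\<bar>)"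
    by (rule integral_abs_bound)
  also have "\<dots> \<le> (LINT \<xi>|lborel. indicator {0..1::real} \<xi> * (indicator {0<..<1} x * B))"
    by (rule integral_mono_AE[OF integrable_abs[OF ii] i le])
  finally show "\<bar>mean_free_primitive \<C> f x\<bar> \<le> indicator {0<..<1} x * B" unfolding mfp_lborel[OF f] by simp
qed

text \<open>The mean-free primitive acts in \<open>x\<close> and commutes with the time integral.
  Hence it is again an initial value plus a time integral, and \<open>energy_primitive_unit\<close>
  applies to it.\<close>

lemma mfp_energy_primitive:
  fixes w0 :: "real \<Rightarrow> real" and g :: "real \<Rightarrow> real \<Rightarrow> real"
  assumes T: "0 \<le> T" and w0m[measurable]: "w0 \<in> borel_measurable borel"
    and gm[measurable]: "(\<lambda>(x, t). g x t) \<in> borel_measurable (borel \<Otimes>\<^sub>M borel)"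
    and B: "AE \<xi> in lborel. \<xi> \<in> {0<..<1} \<longrightarrow> \<bar>w0 \<xi>\<bar> \<le> B" "0 \<le> B"
    and gi: "integrable (lborel \<Otimes>\<^sub>M lborel) (\<lambda>(x, t). a x * (g x t)\<^sup>2)"
    and gz: "\<And>x t. x \<notin> {0<..<1} \<or> t \<notin> {0<..<T} \<Longrightarrow> g x t = 0"
  defines "y \<equiv> \<lambda>x t. w0 x + (LINT s:{0..t}|lborel. g x s)"
  shows "primitive_on T (\<lambda>t. LINT x:{0<..<1}|lebesgue. (mean_free_primitive \<C> (\<lambda>\<xi>. y \<xi> t) x)\<^sup>2)
    (\<lambda>t. 2 * (LINT x:{0<..<1}|lebesgue. mean_free_primitive \<C> (\<lambda>\<xi>. y \<xi> t) x * mean_free_primitive \<C> (\<lambda>\<xi>. g \<xi> t) x))"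
proof -
  note [measurable] = a_measurable
  have gx[measurable]: "g x \<in> borel_measurable borel" for x by measurable
  have gt[measurable]: "(\<lambda>x. g x t) \<in> borel_measurable borel" for t by measurable
  have eq: "(LINT s:{0..t}|lborel. g x s) = (LINT s|lborel. (if 0 \<le> s \<and> s \<le> t then g x s else 0))" for x t
    unfolding set_lebesgue_integral_def by (intro Bochner_Integration.integral_cong) auto
  have [measurable]: "(\<lambda>z. LINT s|lborel. (if 0 \<le> s \<and> s \<le> snd z then g (fst z) s else 0)) \<in> borel_measurable (borel \<Otimes>\<^sub>M borel)"
    by (rule lborel.borel_measurable_lebesgue_integral) measurable
  have ym[measurable]: "(\<lambda>(x, t). y x t) \<in> borel_measurable (borel \<Otimes>\<^sub>M borel)"
    unfolding y_def eq by (simp add: case_prod_unfold)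
  have yt[measurable]: "(\<lambda>x. y x t) \<in> borel_measurable borel" for t by measurable
  define Y0 where "Y0 x = (LINT \<xi>|lborel. mfp_kernel \<C> x \<xi> * w0 \<xi>)" for x
  define G where "G x t = (LINT \<xi>|lborel. mfp_kernel \<C> x \<xi> * g \<xi> t)" for x t
  have Y0eq: "Y0 x = mean_free_primitive \<C> w0 x" for x by (simp add: Y0_def mfp_lborel)
  have Geq: "G x t = mean_free_primitive \<C> (\<lambda>\<xi>. g \<xi> t) x" for x t by (simp add: G_def mfp_lborel)
  have Y0m[measurable]: "Y0 \<in> borel_measurable borel"
  proof -
    have "(\<lambda>x. LINT \<xi>|lborel. mfp_kernel \<C> x \<xi> * w0 \<xi>) \<in> borel_measurable borel"
    proof (rule lborel.borel_measurable_lebesgue_integral)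
      have "(\<lambda>z. mfp_kernel \<C> (fst z) (snd z) * w0 (snd z)) \<in> borel_measurable (borel \<Otimes>\<^sub>M borel)" by measurable
      then show "(\<lambda>(x, \<xi>). mfp_kernel \<C> x \<xi> * w0 \<xi>) \<in> borel_measurable (borel \<Otimes>\<^sub>M lborel)"
        by (simp add: case_prod_unfold)
    qed
    then show ?thesis by (simp add: Y0_def[abs_def])
  qed
  have Gm: "(\<lambda>(x, t). G x t) \<in> borel_measurable (borel \<Otimes>\<^sub>M borel)"
  proof -
    have "(\<lambda>z. LINT \<xi>|lborel. mfp_kernel \<C> (fst z) \<xi> * g \<xi> (snd z)) \<in> borel_measurable (borel \<Otimes>\<^sub>M borel)"
    proof (rule lborel.borel_measurable_lebesgue_integral)
      have "(\<lambda>p. (fst (fst p), snd p)) \<in> (borel \<Otimes>\<^sub>M borel) \<Otimes>\<^sub>M lborel \<rightarrow>\<^sub>M borel \<Otimes>\<^sub>M borel" by measurable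
      from measurable_compose[OF this mfp_kernel_measurable]
      have 1: "(\<lambda>p. mfp_kernel \<C> (fst (fst p)) (snd p)) \<in> borel_measurable ((borel \<Otimes>\<^sub>M borel) \<Otimes>\<^sub>M lborel)" by simp
      have "(\<lambda>p. (snd p, snd (fst p))) \<in> (borel \<Otimes>\<^sub>M borel) \<Otimes>\<^sub>M lborel \<rightarrow>\<^sub>M borel \<Otimes>\<^sub>M borel" by measurable
      from measurable_compose[OF this gm]
      have 2: "(\<lambda>p. g (snd p) (snd (fst p))) \<in> borel_measurable ((borel \<Otimes>\<^sub>M borel) \<Otimes>\<^sub>M lborel)" by simp
      show "(\<lambda>(z, \<xi>). mfp_kernel \<C> (fst z) \<xi> * g \<xi> (snd z)) \<in> borel_measurable ((borel \<Otimes>\<^sub>M borel) \<Otimes>\<^sub>M lborel)"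
        using borel_measurable_times[OF 1 2] by (simp add: case_prod_unfold)
    qed
    then show ?thesis by (simp add: G_def case_prod_unfold)
  qed
  have Y0i: "integrable lborel (\<lambda>x. (Y0 x)\<^sup>2)"
  proof (rule Bochner_Integration.integrable_bound)
    show "integrable lborel (\<lambda>x. indicator {0..1::real} x * B\<^sup>2)" using integrable_indicator_Icc by simp
    show "AE x in lborel. norm ((Y0 x)\<^sup>2) \<le> norm (indicator {0..1} x * B\<^sup>2)"
    proof (intro AE_I2)
      fix x
      have "\<bar>Y0 x\<bar> \<le> indicator {0<..<1} x * B" unfolding Y0eq by (rule mfp_abs_le(2)[OF w0m B])
      then have "(Y0 x)\<^sup>2 \<le> (indicator {0<..<1} x * B)\<^sup>2" by (simp add: abs_le_square_iff[symmetric])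
      also have "\<dots> \<le> indicator {0..1} x * B\<^sup>2" by (auto simp: indicator_def)
      finally show "norm ((Y0 x)\<^sup>2) \<le> norm (indicator {0..1} x * B\<^sup>2)" by simp
    qed
  qed measurable
  have ag: "a x * (g x t)\<^sup>2 = indicator {0<..<1} x * a x * (g x t)\<^sup>2" for x t
    using gz[of x t] by (cases "x \<in> {0<..<1}") auto
  define H where "H t = (LINT x|lborel. a x * (g x t)\<^sup>2)" for t
  have iH: "integrable lborel H" unfolding H_def[abs_def] using lborel_pair.integrable_snd[OF gi] by simp
  have agm: "(\<lambda>x. indicator {0<..<1} x * a x * (g x t)\<^sup>2) \<in> borel_measurable lborel" for t by measurable
  \<comment> \<open>The weighted square integral of \<open>g\<close> at time \<open>t\<close>,
    divided by \<open>\<delta>\<close>, dominates \<open>G\<^sup>2\<close> uniformly in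
    \<open>x\<close>.\<close>
  have GH: "AE t in lborel. \<forall>x. (G x t)\<^sup>2 \<le> indicator {0..1} x * (H t / \<delta>)"
    using lborel_pair.AE_integrable_snd[OF gi]
  proof eventually_elim
    case (elim t)
    have "integrable lborel (\<lambda>x. indicator {0<..<1} x * a x * (g x t)\<^sup>2)"
      using elim by (simp only: ag[symmetric])
    then have s: "set_integrable lebesgue {0<..<1} (\<lambda>x. a x * (g x t)\<^sup>2)"
      using integrable_completion[OF agm[of t]] by (simp add: set_integrable_def mult.assoc)
    have H_eq: "H t = (LINT x|lborel. indicator {0<..<1} x * a x * (g x t)\<^sup>2)"
      unfolding H_def by (intro Bochner_Integration.integral_cong refl ag)
    have e: "(LINT x:{0<..<1}|lebesgue. a x * (g x t)\<^sup>2) = H t"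
      using integral_completion[OF agm[of t]] by (simp add: set_lebesgue_integral_def H_eq mult.assoc)
    have H0: "0 \<le> H t" unfolding H_eq
      by (rule Bochner_Integration.integral_nonneg) (use a_pos in \<open>auto simp: indicator_def less_imp_le\<close>)
    show ?case
    proof
      fix x
      have "(G x t)\<^sup>2 \<le> indicator {0<..<1} x * H t / \<delta>" unfolding Geq e[symmetric] by (rule mfp_square_le[OF gt s])
      also have "\<dots> \<le> indicator {0..1} x * (H t / \<delta>)" using H0 \<delta> by (auto simp: indicator_def)
      finally show "(G x t)\<^sup>2 \<le> indicator {0..1} x * (H t / \<delta>)" .
    qed
  qed
  have Gi: "integrable (lborel \<Otimes>\<^sub>M lborel) (\<lambda>(x, t). (G x t)\<^sup>2)"
  proof (rule Bochner_Integration.integrable_bound)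
    show "integrable (lborel \<Otimes>\<^sub>M lborel) (\<lambda>(x, t). indicator {0..1::real} x * (H t / \<delta>))"
      by (rule lborel_pair.integrable_prod_mult[OF integrable_indicator_Icc]) (use iH in simp)
    show "(\<lambda>(x, t). (G x t)\<^sup>2) \<in> borel_measurable (lborel \<Otimes>\<^sub>M lborel)"
      using borel_measurable_power[OF Gm, of 2] by (simp add: case_prod_unfold cong: measurable_cong_sets)
    obtain N where N: "N \<in> null_sets lborel" "{t. \<not> (\<forall>x. (G x t)\<^sup>2 \<le> indicator {0..1} x * (H t / \<delta>))} \<subseteq> N"
      using GH by (auto elim!: AE_E simp: null_sets_def)
    have "UNIV \<times> N \<in> null_sets (lborel \<Otimes>\<^sub>M lborel)"
      using lborel.times_in_null_sets2[OF _ N(1), of UNIV lborel] by simp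
    then show "AE z in lborel \<Otimes>\<^sub>M lborel. norm (case z of (x, t) \<Rightarrow> (G x t)\<^sup>2)
        \<le> norm (case z of (x, t) \<Rightarrow> indicator {0..1} x * (H t / \<delta>))"
    proof (rule AE_I')
      show "{z \<in> space (lborel \<Otimes>\<^sub>M lborel). \<not> norm (case z of (x, t) \<Rightarrow> (G x t)\<^sup>2)
        \<le> norm (case z of (x, t) \<Rightarrow> indicator {0..1} x * (H t / \<delta>))} \<subseteq> UNIV \<times> N"
      proof
        fix z assume "z \<in> {z \<in> space (lborel \<Otimes>\<^sub>M lborel). \<not> norm (case z of (x, t) \<Rightarrow> (G x t)\<^sup>2)
          \<le> norm (case z of (x, t) \<Rightarrow> indicator {0..1} x * (H t / \<delta>))}"
        moreover obtain x t where z: "z = (x, t)" by (cases z)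
        ultimately have "\<not> (G x t)\<^sup>2 \<le> \<bar>indicator {0..1} x * (H t / \<delta>)\<bar>" by simp
        then have "\<not> (G x t)\<^sup>2 \<le> indicator {0..1} x * (H t / \<delta>)" by linarith
        then show "z \<in> UNIV \<times> N" using N(2) z by blast
      qed
    qed
  qed
  have Gz: "\<forall>x t. t \<notin> {0..T} \<longrightarrow> G x t = 0"
  proof (intro allI impI)
    fix x t assume "t \<notin> {0..T}"
    then have "g \<xi> t = 0" for \<xi> using gz by auto
    then show "G x t = 0" by (simp add: G_def)
  qed
  have key: "Y0 x + (LINT s:{0..t}|lborel. G x s) = mean_free_primitive \<C> (\<lambda>\<xi>. y \<xi> t) x" for x t
  proof -
    \<comment> \<open>Integrability for Fubini: \<open>|r| \<le> 1 + r\<^sup>2\<close>, where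
      \<open>1\<close> is integrable over the bounded cylinder and the square is dominated through
      \<open>mfp_kernel_square\<close>.\<close>
    have I: "integrable (lborel \<Otimes>\<^sub>M lborel) (\<lambda>(\<xi>, s). indicator {0..t} s * (mfp_kernel \<C> x \<xi> * g \<xi> s))"
    proof (rule Bochner_Integration.integrable_bound)
      have "integrable (lborel \<Otimes>\<^sub>M lborel) (\<lambda>(\<xi>::real, s::real). indicat_real {0..1} \<xi> * indicat_real {0..T} s)"
        by (rule lborel_pair.integrable_prod_mult[OF integrable_indicator_Icc integrable_indicator_Icc])
      then show "integrable (lborel \<Otimes>\<^sub>M lborel) (\<lambda>z. (case z of (\<xi>::real, s::real) \<Rightarrow> indicat_real {0..1} \<xi> * indicat_real {0..T} s) + (case z of (\<xi>, s) \<Rightarrow> a \<xi> * (g \<xi> s)\<^sup>2) / \<delta>)"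
        using gi by (intro Bochner_Integration.integrable_add integrable_divide) auto
      have "(\<lambda>z. indicator {0..t} (snd z) * (mfp_kernel \<C> x (fst z) * g (fst z) (snd z))) \<in> borel_measurable (borel \<Otimes>\<^sub>M borel)" by measurable
      then show "(\<lambda>(\<xi>, s). indicator {0..t} s * (mfp_kernel \<C> x \<xi> * g \<xi> s)) \<in> borel_measurable (lborel \<Otimes>\<^sub>M lborel)"
        by (simp add: case_prod_unfold cong: measurable_cong_sets)
      show "AE z in lborel \<Otimes>\<^sub>M lborel. norm (case z of (\<xi>, s) \<Rightarrow> indicator {0..t} s * (mfp_kernel \<C> x \<xi> * g \<xi> s))
          \<le> norm ((case z of (\<xi>::real, s::real) \<Rightarrow> indicat_real {0..1} \<xi> * indicat_real {0..T} s) + (case z of (\<xi>, s) \<Rightarrow> a \<xi> * (g \<xi> s)\<^sup>2) / \<delta>)"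
      proof (intro AE_I2)
        fix z :: "real \<times> real"
        obtain \<xi> s :: real where z: "z = (\<xi>, s)" by (cases z)
        let ?q = "mfp_kernel \<C> x \<xi> * g \<xi> s"
        show "norm (case z of (\<xi>, s) \<Rightarrow> indicator {0..t} s * (mfp_kernel \<C> x \<xi> * g \<xi> s))
          \<le> norm ((case z of (\<xi>::real, s::real) \<Rightarrow> indicat_real {0..1} \<xi> * indicat_real {0..T} s) + (case z of (\<xi>, s) \<Rightarrow> a \<xi> * (g \<xi> s)\<^sup>2) / \<delta>)"
        proof (cases "?q = 0")
          case False
          then have k: "mfp_kernel \<C> x \<xi> \<noteq> 0" "g \<xi> s \<noteq> 0" by auto
          note sp = mfp_kernel_support[OF k(1)]
          have s: "s \<in> {0<..<T}" using k(2) gz by blast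
          have "2 * \<bar>?q\<bar> \<le> ?q\<^sup>2 + 1" using sum_squares_bound[of "\<bar>?q\<bar>" 1] by simp
          then have "\<bar>?q\<bar> \<le> 1 + ?q\<^sup>2" using abs_ge_zero[of ?q] by linarith
          also have "?q\<^sup>2 \<le> a \<xi> * (g \<xi> s)\<^sup>2 / \<delta>" using mfp_kernel_square[of x \<xi> "g \<xi> s"] sp by simp
          finally have "\<bar>?q\<bar> \<le> 1 + a \<xi> * (g \<xi> s)\<^sup>2 / \<delta>" by simp
          moreover have "\<bar>indicator {0..t} s * ?q\<bar> \<le> \<bar>?q\<bar>" by (auto simp: indicator_def)
          moreover have "indicat_real {0..1} \<xi> * indicat_real {0..T} s = 1" using sp s by simp
          ultimately show ?thesis unfolding z prod.case real_norm_def by linarith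
        next
          case True
          then have "indicator {0..t} s * ?q = 0" by (simp only: mult_zero_right)
          then show ?thesis unfolding z prod.case by (simp only: norm_zero norm_ge_zero)
        qed
      qed
    qed
    have Gint: "(LINT s:{0..t}|lborel. G x s) = (LINT \<xi>|lborel. mfp_kernel \<C> x \<xi> * (LINT s:{0..t}|lborel. g \<xi> s))"
    proof -
      have "(LINT s:{0..t}|lborel. G x s) = (LINT s|lborel. LINT \<xi>|lborel. indicator {0..t} s * (mfp_kernel \<C> x \<xi> * g \<xi> s))"
        by (simp add: set_lebesgue_integral_def G_def)
      also have "\<dots> = (LINT \<xi>|lborel. LINT s|lborel. indicator {0..t} s * (mfp_kernel \<C> x \<xi> * g \<xi> s))"
        by (rule lborel_pair.Fubini_integral[OF I])
      also have "\<dots> = (LINT \<xi>|lborel. mfp_kernel \<C> x \<xi> * (LINT s:{0..t}|lborel. g \<xi> s))"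
        by (simp add: set_lebesgue_integral_def mult.left_commute)
      finally show ?thesis .
    qed
    have "integrable lborel (\<lambda>\<xi>. LINT s|lborel. indicator {0..t} s * (mfp_kernel \<C> x \<xi> * g \<xi> s))"
      using lborel_pair.integrable_fst[OF I] .
    then have i2: "integrable lborel (\<lambda>\<xi>. mfp_kernel \<C> x \<xi> * (LINT s:{0..t}|lborel. g \<xi> s))"
      by (simp add: set_lebesgue_integral_def mult.left_commute)
    show ?thesis
      unfolding mfp_lborel[OF yt] Gint Y0_def
      by (subst Bochner_Integration.integral_add[OF mfp_abs_le(1)[OF w0m B] i2, symmetric]) (simp add: y_def distrib_left)
  qed
  have E: "primitive_on T (\<lambda>t. LINT x|lborel. (mean_free_primitive \<C> (\<lambda>\<xi>. y \<xi> t) x)\<^sup>2) (\<lambda>t. 2 * (LINT x|lborel. mean_free_primitive \<C> (\<lambda>\<xi>. y \<xi> t) x * G x t))"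
    using energy_primitive_unit(1)[OF T Y0m Gm Y0i Gi Gz] unfolding key .
  have Ym: "(\<lambda>x. mean_free_primitive \<C> (\<lambda>\<xi>. y \<xi> t) x) \<in> borel_measurable borel" for t
  proof -
    have "(\<lambda>(x, t). Y0 x + (LINT s:{0..t}|lborel. G x s)) \<in> borel_measurable (borel \<Otimes>\<^sub>M borel)"
      by (rule energy_primitive_unit(3)[OF T Y0m Gm Y0i Gi Gz])
    from measurable_compose[OF measurable_Pair2'[of t borel borel] this]
    show ?thesis by (simp add: key)
  qed
  have Gm': "(\<lambda>x. G x t) \<in> borel_measurable borel" for t
    using measurable_compose[OF measurable_Pair2'[of t borel borel] Gm] by simp
  have out: "mean_free_primitive \<C> f x = 0" if "x \<notin> {0<..<1}" for f x
  proof -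
    have "mfp_kernel \<C> x \<xi> = 0" for \<xi> using mfp_kernel_support(1)[of x \<xi>] that by blast
    then show ?thesis by (simp add: mean_free_primitive_def)
  qed
  have conv: "(LINT x|lborel. mean_free_primitive \<C> f x * h x) = (LINT x:{0<..<1}|lebesgue. mean_free_primitive \<C> f x * h x)"
    if [measurable]: "mean_free_primitive \<C> f \<in> borel_measurable borel" "h \<in> borel_measurable borel" for f h
  proof -
    have m: "(\<lambda>x. mean_free_primitive \<C> f x * h x) \<in> borel_measurable borel" by measurable
    have "indicator {0<..<1} x *\<^sub>R (mean_free_primitive \<C> f x * h x) = mean_free_primitive \<C> f x * h x" for x
      using out[of x f] by (cases "x \<in> {0<..<1}") auto
    then show ?thesis
      by (subst lebesgue_lborel(2)[OF m]) (simp_all add: set_lebesgue_integral_def del: real_scaleR_def)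
  qed
  show ?thesis
    by (rule primitive_on_cong[OF E]) (simp_all add: power2_eq_square conv[OF Ym Ym] conv[OF Ym Gm'[unfolded Geq]] Geq)
qed

end

section \<open>Representatives of time-dependent functions\<close>

text \<open>Lebesgue measure on the plane is not the product of the Lebesgue measures, so the
  exceptional set is first enclosed in a Borel null set, to which Fubini applies.\<close>

lemma AE_lebesgue_slices:
  fixes P :: "real \<times> real \<Rightarrow> bool"
  assumes "AE z in lebesgue. P z"
  shows "AE x in lebesgue. AE t in lebesgue. P (x, t)" "AE t in lebesgue. AE x in lebesgue. P (x, t)"
proof -
  have "AE z in lborel. P z" using assms by (simp add: AE_lebesgue_iff)
  then obtain N where N: "N \<in> null_sets lborel" "{z. \<not> P z} \<subseteq> N" by (auto elim!: AE_E simp: null_sets_def)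
  then have N': "N \<in> null_sets (lborel \<Otimes>\<^sub>M lborel)" by (simp add: lborel_prod)
  then have 1: "AE x in lborel. AE t in lborel. (x, t) \<notin> N"
    by (intro lborel_pair.AE_pair AE_not_in)
  have "{z \<in> space (lborel \<Otimes>\<^sub>M lborel). (fst z, snd z) \<notin> N} = space (lborel \<Otimes>\<^sub>M lborel) - N" by auto
  then have "{z \<in> space (lborel \<Otimes>\<^sub>M lborel). (fst z, snd z) \<notin> N} \<in> sets (lborel \<Otimes>\<^sub>M lborel)"
    using sets.compl_sets[OF null_setsD2[OF N']] by simp
  from lborel_pair.AE_commute[OF this] 1 have 2: "AE t in lborel. AE x in lborel. (x, t) \<notin> N" by simp
  have s: "P z" if "z \<notin> N" for z using N(2) that by blast
  show "AE x in lebesgue. AE t in lebesgue. P (x, t)"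
    unfolding AE_lebesgue_iff using 1 by (rule eventually_mono) (auto elim!: eventually_mono intro: s)
  show "AE t in lebesgue. AE x in lebesgue. P (x, t)"
    unfolding AE_lebesgue_iff using 2 by (rule eventually_mono) (auto elim!: eventually_mono intro: s)
qed

lemma AE_Q_slice:
  assumes "AE_Q T P"
  shows "AE t in lebesgue. t \<in> {0<..<T} \<longrightarrow> (AE x in lebesgue. x \<in> {0<..<1} \<longrightarrow> P x t)"
  using AE_lebesgue_slices(2)[OF assms[unfolded AE_Q_def]]
  by eventually_elim (auto simp: Q_def elim!: eventually_mono)

text \<open>\<open>time_rep T \<rho> f ft f0 g\<close>: \<open>f0 + \<integral>\<^sub>0\<^sup>t g\<close> is a Borel version of \<open>f\<close> that is continuous in time.\<close>

definition time_rep where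
  "time_rep T \<rho> f ft f0 g \<longleftrightarrow> f0 \<in> borel_measurable borel \<and>
    (\<lambda>(x, t). g x t) \<in> borel_measurable (borel \<Otimes>\<^sub>M borel) \<and>
    (\<forall>x t. x \<notin> {0<..<1::real} \<or> t \<notin> {0<..<T::real} \<longrightarrow> g x t = (0::real)) \<and>
    set_integrable lebesgue {0<..<1} (\<lambda>x. \<rho> x * (f0 x :: real)\<^sup>2) \<and>
    integrable (lborel \<Otimes>\<^sub>M lborel) (\<lambda>(x, t). \<rho> x * (g x t)\<^sup>2) \<and>
    (AE t in lebesgue. t \<in> {0<..<T} \<longrightarrow> (AE x in lebesgue. x \<in> {0<..<1} \<longrightarrow> ft x t = g x t)) \<and>
    (\<forall>t\<in>{0..T}. AE x in lebesgue. x \<in> {0<..<1} \<longrightarrow> f x t = f0 x + (LINT s:{0..t}|lborel. g x s)) \<and>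
    (AE x in lebesgue. integrable lborel (g x))"

text \<open>\<open>f\<close> is tied to \<open>ft\<close> only at each single \<open>t\<close> for
  almost every \<open>x\<close>. Rebuilding it from a Borel version of \<open>ft\<close> gives a
  jointly measurable function that is a primitive in \<open>t\<close> for almost every
  \<open>x\<close>, as the energy lemmas require.\<close>

lemma time_H1_rep:
  assumes f: "time_H1 T \<rho> f ft" and \<rho>: "continuous_on {0<..<1} \<rho>" "\<And>x. x \<in> {0<..<1} \<Longrightarrow> 0 < \<rho> x" and T: "0 < T"
  obtains f0 g where "time_rep T \<rho> f ft f0 g"
proof -
  have mQ: "set_borel_measurable lebesgue (Q T) (\<lambda>z. ft (fst z) (snd z))"
    and L0: "set_borel_measurable lebesgue {0<..<1} (\<lambda>x. f x 0)" "set_integrable lebesgue {0<..<1} (\<lambda>x. \<rho> x * (f x 0)\<^sup>2)"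
    and int: "set_integrable lebesgue (Q T) (\<lambda>z. \<rho> (fst z) * (ft (fst z) (snd z))\<^sup>2)"
    and ftc: "\<forall>t\<in>{0..T}. AE x in lebesgue. x \<in> {0<..<1} \<longrightarrow> f x t = f x 0 + (LINT s:{0..t}|lebesgue. ft x s)"
    using f T by (auto simp: time_H1_def meas_Q_def L2w_def)
  have QB: "Q T \<in> sets borel" unfolding Q_def by (intro borel_open open_Times) auto
  obtain G where G: "G \<in> borel_measurable borel" "AE z in lborel. G z = indicator (Q T) z * ft (fst z) (snd z)"
    "\<And>z. z \<notin> Q T \<Longrightarrow> G z = 0" using lebesgue_borel_rep[OF mQ QB] by metis
  obtain f0 where f0: "f0 \<in> borel_measurable borel" "AE x in lborel. f0 x = indicator {0<..<1} x * f x 0"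
    using lebesgue_borel_rep[OF L0(1)] by auto
  define g where "g x t = G (x, t)" for x t
  have gm: "(\<lambda>(x, t). g x t) \<in> borel_measurable (borel \<Otimes>\<^sub>M borel)"
    unfolding g_def using G(1) by (simp add: borel_prod)
  have gz: "\<forall>x t. x \<notin> {0<..<1} \<or> t \<notin> {0<..<T} \<longrightarrow> g x t = 0" using G(3) by (auto simp: g_def Q_def)
  have aeG: "AE z in lebesgue. z \<in> Q T \<longrightarrow> ft (fst z) (snd z) = G z"
    unfolding AE_lebesgue_iff using G(2) by eventually_elim auto
  have rm: "(\<lambda>x. indicator {0<..<1} x * \<rho> x) \<in> borel_measurable borel"
    using borel_measurable_continuous_on_indicator[OF _ \<rho>(1)] by simp
  have rG: "\<rho> (fst z) * (G z)\<^sup>2 = (indicator {0<..<1} (fst z) * \<rho> (fst z)) * (G z)\<^sup>2" for z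
    using G(3)[of z] by (cases "z \<in> Q T") (auto simp: Q_def)
  have rGm: "(\<lambda>z. \<rho> (fst z) * (G z)\<^sup>2) \<in> borel_measurable borel"
  proof -
    have "(\<lambda>z. (indicator {0<..<1} (fst z) * \<rho> (fst z)) * (G z)\<^sup>2) \<in> borel_measurable (borel \<Otimes>\<^sub>M borel)"
      using G(1) rm by (intro borel_measurable_times borel_measurable_power measurable_compose[OF measurable_fst rm]) (simp add: borel_prod)
    then show ?thesis unfolding rG by (simp add: borel_prod)
  qed
  have gi: "integrable (lborel \<Otimes>\<^sub>M lborel) (\<lambda>(x, t). \<rho> x * (g x t)\<^sup>2)"
  proof -
    have "AE z in lebesgue. z \<in> Q T \<longrightarrow> \<rho> (fst z) * (ft (fst z) (snd z))\<^sup>2 = \<rho> (fst z) * (G z)\<^sup>2"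
      using aeG by eventually_elim simp
    from set_integral_cong_lebesgue(1)[OF this]
    have "set_integrable lebesgue (Q T) (\<lambda>z. \<rho> (fst z) * (G z)\<^sup>2)" using int by blast
    then have "set_integrable lborel (Q T) (\<lambda>z. \<rho> (fst z) * (G z)\<^sup>2)" by (simp add: lebesgue_lborel(1)[OF rGm QB])
    moreover have "(\<lambda>z. indicator (Q T) z *\<^sub>R (\<rho> (fst z) * (G z)\<^sup>2)) = (\<lambda>z. \<rho> (fst z) * (G z)\<^sup>2)"
      using G(3) by (auto simp: indicator_def fun_eq_iff)
    ultimately show ?thesis by (simp add: set_integrable_def g_def lborel_prod case_prod_unfold)
  qed
  \<comment> \<open>For fixed \<open>x\<close> the weight is a positive constant, so
    \<open>g x\<close> is square integrable on a bounded interval, hence integrable.\<close>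
  have AEg: "AE x in lebesgue. integrable lborel (g x)"
    unfolding AE_lebesgue_iff using lborel_pair.AE_integrable_fst[OF gi]
  proof eventually_elim
    case (elim x)
    show ?case
    proof (cases "x \<in> {0<..<1}")
      case True
      have sq: "integrable lborel (\<lambda>t. (g x t)\<^sup>2)"
        using elim \<rho>(2)[OF True] integrable_mult_right[of "1 / \<rho> x" lborel "\<lambda>t. \<rho> x * (g x t)\<^sup>2"] by simp
      have mx: "g x \<in> borel_measurable borel"
        using measurable_compose[OF measurable_Pair1'[of x borel borel] gm] by simp
      have "g x t = 0" if "t \<notin> {0..T}" for t
      proof -
        have "t \<notin> {0<..<T}" using that by auto
        then show ?thesis using gz by blast
      qed
      then show ?thesis by (rule integrable_if_square_integrable[OF mx sq])
    next
      case False
      then have "g x = (\<lambda>_. 0)" using gz by blast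
      then show ?thesis by simp
    qed
  qed
  show ?thesis
  proof (rule that[of f0 g], unfold time_rep_def, intro conjI)
    have "AE x in lebesgue. x \<in> {0<..<1} \<longrightarrow> \<rho> x * (f x 0)\<^sup>2 = \<rho> x * (f0 x)\<^sup>2"
      unfolding AE_lebesgue_iff using f0(2) by eventually_elim simp
    from set_integral_cong_lebesgue(1)[OF this]
    show "set_integrable lebesgue {0<..<1} (\<lambda>x. \<rho> x * (f0 x)\<^sup>2)" using L0(2) by blast
    show "AE t in lebesgue. t \<in> {0<..<T} \<longrightarrow> (AE x in lebesgue. x \<in> {0<..<1} \<longrightarrow> ft x t = g x t)"
      using AE_lebesgue_slices(2)[OF aeG] by eventually_elim (auto simp: Q_def g_def elim!: eventually_mono)
    show "\<forall>t\<in>{0..T}. AE x in lebesgue. x \<in> {0<..<1} \<longrightarrow> f x t = f0 x + (LINT s:{0..t}|lborel. g x s)"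
    proof
      fix t assume t: "t \<in> {0..T}"
      have "AE x in lebesgue. f0 x = indicator {0<..<1} x * f x 0" using f0(2) unfolding AE_lebesgue_iff .
      with bspec[OF ftc t] AE_lebesgue_slices(1)[OF aeG]
      show "AE x in lebesgue. x \<in> {0<..<1} \<longrightarrow> f x t = f0 x + (LINT s:{0..t}|lborel. g x s)"
      proof eventually_elim
        case (elim x)
        show ?case
        proof
          assume x: "x \<in> {0<..<1}"
          have "AE s in lebesgue. s \<noteq> 0" "AE s in lebesgue. s \<noteq> T" unfolding AE_lebesgue_iff by (rule AE_lborel_singleton)+
          with elim(2) have "AE s in lebesgue. s \<in> {0..t} \<longrightarrow> ft x s = g x s"
            by eventually_elim (use x t in \<open>auto simp: Q_def g_def\<close>)
          then have "(LINT s:{0..t}|lebesgue. ft x s) = (LINT s:{0..t}|lebesgue. g x s)"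
            by (rule set_integral_cong_lebesgue(2))
          also have "\<dots> = (LINT s:{0..t}|lborel. g x s)"
            by (rule lebesgue_lborel(2)) (use measurable_compose[OF measurable_Pair1'[of x borel borel] gm] in auto)
          finally show "f x t = f0 x + (LINT s:{0..t}|lborel. g x s)" using elim x by simp
        qed
      qed
    qed
  qed (use f0 gm gz gi AEg in auto)
qed

lemma time_rep_diff:
  assumes 1: "time_rep T \<rho> f ft f0 g" and 2: "time_rep T \<rho> f' ft' f0' g'"
    and \<rho>: "continuous_on {0<..<1} \<rho>" "\<And>x. x \<in> {0<..<1} \<Longrightarrow> 0 < \<rho> x"
  shows "time_rep T \<rho> (\<lambda>x t. f' x t - f x t) (\<lambda>x t. ft' x t - ft x t) (\<lambda>x. f0' x - f0 x) (\<lambda>x t. g' x t - g x t)"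
proof -
  have m[measurable]: "f0 \<in> borel_measurable borel" "f0' \<in> borel_measurable borel"
    "(\<lambda>(x, t). g x t) \<in> borel_measurable (borel \<Otimes>\<^sub>M borel)" "(\<lambda>(x, t). g' x t) \<in> borel_measurable (borel \<Otimes>\<^sub>M borel)"
    using 1 2 by (auto simp: time_rep_def)
  have rm[measurable]: "(\<lambda>x. indicator {0<..<1} x * \<rho> x) \<in> borel_measurable borel"
    using borel_measurable_continuous_on_indicator[OF _ \<rho>(1)] by simp
  have sq: "r * (x - y)\<^sup>2 \<le> 2 * (r * x\<^sup>2) + 2 * (r * y\<^sup>2)" if "0 \<le> r" for r x y :: real
  proof -
    have "(x - y)\<^sup>2 \<le> 2 * x\<^sup>2 + 2 * y\<^sup>2" using sum_squares_bound[of x "- y"] by (simp add: power2_diff)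
    then have "r * (x - y)\<^sup>2 \<le> r * (2 * x\<^sup>2 + 2 * y\<^sup>2)" by (rule mult_left_mono) fact
    then show ?thesis by (simp add: algebra_simps)
  qed
  show ?thesis
    unfolding time_rep_def
  proof (intro conjI)
    show "(\<lambda>x. f0' x - f0 x) \<in> borel_measurable borel" by measurable
    show "(\<lambda>(x, t). g' x t - g x t) \<in> borel_measurable (borel \<Otimes>\<^sub>M borel)" by measurable
    show "\<forall>x t. x \<notin> {0<..<1} \<or> t \<notin> {0<..<T} \<longrightarrow> g' x t - g x t = 0" using 1 2 by (simp add: time_rep_def)
    show "set_integrable lebesgue {0<..<1} (\<lambda>x. \<rho> x * (f0' x - f0 x)\<^sup>2)"
    proof (rule set_integrable_bound)
      show "set_integrable lebesgue {0<..<1} (\<lambda>x. 2 * (\<rho> x * (f0' x)\<^sup>2) + 2 * (\<rho> x * (f0 x)\<^sup>2))"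
        using 1 2 by (intro set_integral_add(1) set_integrable_mult_right) (auto simp: time_rep_def)
      have "set_borel_measurable lebesgue {0<..<1} \<rho>" by (rule continuous_set_borel_measurable[OF \<rho>(1)]) simp
      moreover have "set_borel_measurable lebesgue {0<..<1} (\<lambda>x. (f0' x - f0 x)\<^sup>2)"
        unfolding set_borel_measurable_def by (rule measurable_completion) measurable
      ultimately show "set_borel_measurable lebesgue {0<..<1} (\<lambda>x. \<rho> x * (f0' x - f0 x)\<^sup>2)"
        by (rule set_borel_measurable_arith(3))
      show "AE x in lebesgue. x \<in> {0<..<1} \<longrightarrow> norm (\<rho> x * (f0' x - f0 x)\<^sup>2) \<le> norm (2 * (\<rho> x * (f0' x)\<^sup>2) + 2 * (\<rho> x * (f0 x)\<^sup>2))"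
      proof (intro AE_I2 impI)
        fix x :: real assume x: "x \<in> {0<..<1}"
        then have "0 \<le> \<rho> x * (f0' x - f0 x)\<^sup>2" using \<rho>(2)[OF x] by simp
        then show "norm (\<rho> x * (f0' x - f0 x)\<^sup>2) \<le> norm (2 * (\<rho> x * (f0' x)\<^sup>2) + 2 * (\<rho> x * (f0 x)\<^sup>2))"
          using sq[of "\<rho> x" "f0' x" "f0 x"] \<rho>(2)[OF x] unfolding real_norm_def by linarith
      qed
    qed
    show "integrable (lborel \<Otimes>\<^sub>M lborel) (\<lambda>(x, t). \<rho> x * (g' x t - g x t)\<^sup>2)"
    proof (rule Bochner_Integration.integrable_bound)
      show "integrable (lborel \<Otimes>\<^sub>M lborel) (\<lambda>z. 2 * (case z of (x, t) \<Rightarrow> \<rho> x * (g' x t)\<^sup>2) + 2 * (case z of (x, t) \<Rightarrow> \<rho> x * (g x t)\<^sup>2))"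
        using 1 2 by (intro Bochner_Integration.integrable_add integrable_mult_right) (auto simp: time_rep_def)
      have e: "\<rho> x * (g' x t - g x t)\<^sup>2 = (indicator {0<..<1} x * \<rho> x) * (g' x t - g x t)\<^sup>2" for x t
        using 1 2 by (cases "x \<in> {0<..<1}") (auto simp: time_rep_def)
      have "(\<lambda>(x, t). (indicator {0<..<1} x * \<rho> x) * (g' x t - g x t)\<^sup>2) \<in> borel_measurable (borel \<Otimes>\<^sub>M borel)" by measurable
      then show "(\<lambda>(x, t). \<rho> x * (g' x t - g x t)\<^sup>2) \<in> borel_measurable (lborel \<Otimes>\<^sub>M lborel)"
        unfolding e by (simp cong: measurable_cong_sets)
      show "AE z in lborel \<Otimes>\<^sub>M lborel. norm (case z of (x, t) \<Rightarrow> \<rho> x * (g' x t - g x t)\<^sup>2)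
        \<le> norm (2 * (case z of (x, t) \<Rightarrow> \<rho> x * (g' x t)\<^sup>2) + 2 * (case z of (x, t) \<Rightarrow> \<rho> x * (g x t)\<^sup>2))"
      proof (intro AE_I2)
        fix z :: "real \<times> real"
        obtain x t where z: "z = (x, t)" by (cases z)
        show "norm (case z of (x, t) \<Rightarrow> \<rho> x * (g' x t - g x t)\<^sup>2)
          \<le> norm (2 * (case z of (x, t) \<Rightarrow> \<rho> x * (g' x t)\<^sup>2) + 2 * (case z of (x, t) \<Rightarrow> \<rho> x * (g x t)\<^sup>2))"
        proof (cases "x \<in> {0<..<1}")
          case True
          then have "0 \<le> \<rho> x * (g' x t - g x t)\<^sup>2" using \<rho>(2)[OF True] by simp
          then show ?thesis
            using sq[of "\<rho> x" "g' x t" "g x t"] \<rho>(2)[OF True] unfolding z prod.case real_norm_def by linarith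
        next
          case False
          then have "g x t = 0" "g' x t = 0" using 1 2 unfolding time_rep_def by blast+
          then show ?thesis by (simp add: z)
        qed
      qed
    qed
    have "AE t in lebesgue. t \<in> {0<..<T} \<longrightarrow> (AE x in lebesgue. x \<in> {0<..<1} \<longrightarrow> ft x t = g x t)"
      "AE t in lebesgue. t \<in> {0<..<T} \<longrightarrow> (AE x in lebesgue. x \<in> {0<..<1} \<longrightarrow> ft' x t = g' x t)"
      using 1 2 unfolding time_rep_def by blast+
    then show "AE t in lebesgue. t \<in> {0<..<T} \<longrightarrow> (AE x in lebesgue. x \<in> {0<..<1} \<longrightarrow> ft' x t - ft x t = g' x t - g x t)"
    proof eventually_elim
      case (elim t)
      show ?case
      proof
        assume "t \<in> {0<..<T}"
        with elim have "AE x in lebesgue. x \<in> {0<..<1} \<longrightarrow> ft x t = g x t" "AE x in lebesgue. x \<in> {0<..<1} \<longrightarrow> ft' x t = g' x t" by blast+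
        then show "AE x in lebesgue. x \<in> {0<..<1} \<longrightarrow> ft' x t - ft x t = g' x t - g x t" by eventually_elim simp
      qed
    qed
    have AEg: "AE x in lebesgue. integrable lborel (g x)" "AE x in lebesgue. integrable lborel (g' x)"
      using 1 2 unfolding time_rep_def by blast+
    then show "AE x in lebesgue. integrable lborel (\<lambda>t. g' x t - g x t)"
      by eventually_elim simp
    show "\<forall>t\<in>{0..T}. AE x in lebesgue. x \<in> {0<..<1} \<longrightarrow> f' x t - f x t = f0' x - f0 x + (LINT s:{0..t}|lborel. g' x s - g x s)"
    proof
      fix t assume t: "t \<in> {0..T}"
      have "AE x in lebesgue. x \<in> {0<..<1} \<longrightarrow> f x t = f0 x + (LINT s:{0..t}|lborel. g x s)"
        "AE x in lebesgue. x \<in> {0<..<1} \<longrightarrow> f' x t = f0' x + (LINT s:{0..t}|lborel. g' x s)"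
        using 1 2 t unfolding time_rep_def by blast+
      with AEg show "AE x in lebesgue. x \<in> {0<..<1} \<longrightarrow> f' x t - f x t = f0' x - f0 x + (LINT s:{0..t}|lborel. g' x s - g x s)"
      proof eventually_elim
        case (elim x)
        have "set_integrable lborel {0..t} (g x)" "set_integrable lborel {0..t} (g' x)"
          unfolding set_integrable_def using elim(1,2) by (auto intro!: integrable_mult_indicator simp del: real_scaleR_def)
        from set_integral_diff(2)[OF this(2,1)] elim(3,4) show ?case by auto
      qed
    qed
  qed
qed

text \<open>The bound is given for almost every time only; for almost every \<open>x\<close> the
  representative is continuous in \<open>t\<close>, which carries the bound to
  \<open>t = 0\<close>.\<close>

lemma time_rep_initial_bound:
  assumes r: "time_rep T \<rho> f ft f0 g" and T: "0 < T"
    and B: "AE t in lebesgue. t \<in> {0<..<T} \<longrightarrow> (AE x in lebesgue. x \<in> {0<..<1} \<longrightarrow> \<bar>f x t\<bar> \<le> B)"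
  shows "AE x in lborel. x \<in> {0<..<1} \<longrightarrow> \<bar>f0 x\<bar> \<le> B"
proof -
  define y where "y x t = f0 x + (LINT s:{0..t}|lborel. g x s)" for x t
  have m[measurable]: "f0 \<in> borel_measurable borel" "(\<lambda>(x, t). g x t) \<in> borel_measurable (borel \<Otimes>\<^sub>M borel)"
    using r by (auto simp: time_rep_def)
  have eq: "(LINT s:{0..t}|lborel. g x s) = (LINT s|lborel. (if 0 \<le> s \<and> s \<le> t then g x s else 0))" for x t
    unfolding set_lebesgue_integral_def by (intro Bochner_Integration.integral_cong) auto
  have [measurable]: "(\<lambda>z. LINT s|lborel. (if 0 \<le> s \<and> s \<le> snd z then g (fst z) s else 0)) \<in> borel_measurable (borel \<Otimes>\<^sub>M borel)"
    by (rule lborel.borel_measurable_lebesgue_integral) measurable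
  have ym: "(\<lambda>z. y (fst z) (snd z)) \<in> borel_measurable (borel \<Otimes>\<^sub>M borel)"
    unfolding y_def eq by measurable
  have Y: "AE t in lborel. AE x in lborel. t \<in> {0<..<T} \<longrightarrow> x \<in> {0<..<1} \<longrightarrow> \<bar>y x t\<bar> \<le> B"
    using B unfolding AE_lebesgue_iff
  proof eventually_elim
    case (elim t)
    show ?case
    proof (cases "t \<in> {0<..<T}")
      case True
      then have "AE x in lborel. x \<in> {0<..<1} \<longrightarrow> f x t = y x t"
        using r unfolding time_rep_def y_def AE_lebesgue_iff by auto
      moreover have "AE x in lborel. x \<in> {0<..<1} \<longrightarrow> \<bar>f x t\<bar> \<le> B" using elim True by blast
      ultimately show ?thesis by eventually_elim auto
    next
      case False
      then show ?thesis by (intro AE_I2) blast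
    qed
  qed
  \<comment> \<open>Joint measurability of the representative allows the two almost-everywhere
    quantifiers to be exchanged.\<close>
  have "{z \<in> space (lborel \<Otimes>\<^sub>M lborel). snd z \<in> {0<..<T} \<longrightarrow> fst z \<in> {0<..<1} \<longrightarrow> \<bar>y (fst z) (snd z)\<bar> \<le> B} \<in> sets (lborel \<Otimes>\<^sub>M lborel)"
    using ym by measurable
  from lborel_pair.AE_commute[OF this] Y
  have "AE x in lborel. AE t in lborel. t \<in> {0<..<T} \<longrightarrow> x \<in> {0<..<1} \<longrightarrow> \<bar>y x t\<bar> \<le> B" by simp
  moreover have "AE x in lborel. integrable lborel (g x)" using r unfolding time_rep_def AE_lebesgue_iff by blast
  ultimately show ?thesis
  proof eventually_elim
    case (elim x)
    show ?case
    proof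
      assume x: "x \<in> {0<..<1}"
      have gx: "g x \<in> borel_measurable borel"
        using measurable_compose[OF measurable_Pair1'[of x borel borel] m(2)] by simp
      have "set_integrable lebesgue {0..T} (g x)"
        unfolding lebesgue_lborel(1)[OF gx atLeastAtMost_borel] unfolding set_integrable_def
        by (rule integrable_mult_indicator[OF _ elim(2)]) simp
      then have c: "continuous_on {0..T} (y x)"
        by (rule primitive_continuous[where c="f0 x"]) (simp add: y_def lebesgue_lborel(2)[OF gx atLeastAtMost_borel])
      have y0: "y x 0 = f0 x" using set_integral_point_lborel[of 0 "g x"] by (simp add: y_def)
      show "\<bar>f0 x\<bar> \<le> B"
      proof (rule ccontr)
        assume "\<not> \<bar>f0 x\<bar> \<le> B"
        then have "0 < \<bar>y x 0\<bar> - B" using y0 by simp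
        then obtain d where d: "0 < d" "\<forall>t\<in>{0..T}. dist t 0 < d \<longrightarrow> dist (y x t) (y x 0) < \<bar>y x 0\<bar> - B"
          using c T unfolding continuous_on_iff by (meson atLeastAtMost_iff less_imp_le order_refl)
        have big: "B < \<bar>y x t\<bar>" if "t \<in> {0<..<min d T}" for t
        proof -
          have "dist (y x t) (y x 0) < \<bar>y x 0\<bar> - B" using d(2) that by auto
          then show ?thesis unfolding dist_real_def by linarith
        qed
        have "AE t in lborel. t \<notin> {0<..<min d T}"
          using elim(1) by eventually_elim (use big x in force)
        then have "emeasure lborel {0<..<min d T} = 0"
          by (subst (asm) AE_iff_null_sets[symmetric]) auto
        with d(1) T show False by (simp add: min_def split: if_splits)
      qed
    qed
  qed
qed

section \<open>Differences of two solutions\<close>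

lemma zero_trace_diff:
  assumes "zero_trace f" "zero_trace g" shows "zero_trace (\<lambda>x. f x - g x)"
proof -
  obtain f' g' where f: "continuous_on {0..1} f'" "AE x in lebesgue. x \<in> {0<..<1} \<longrightarrow> f x = f' x" "f' 0 = 0" "f' 1 = 0"
    and g: "continuous_on {0..1} g'" "AE x in lebesgue. x \<in> {0<..<1} \<longrightarrow> g x = g' x" "g' 0 = 0" "g' 1 = 0"
    using assms unfolding zero_trace_def by blast
  have "AE x in lebesgue. x \<in> {0<..<1} \<longrightarrow> f x - g x = f' x - g' x" using f(2) g(2) by eventually_elim auto
  then show ?thesis unfolding zero_trace_def
    using f g by (intro exI[of _ "\<lambda>x. f' x - g' x"]) (auto intro!: continuous_intros)
qed

lemma zero_trace_cong_AE:
  assumes "zero_trace f" "AE x in lebesgue. x \<in> {0<..<1} \<longrightarrow> f x = g x" shows "zero_trace g"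
proof -
  obtain f' where f: "continuous_on {0..1} f'" "AE x in lebesgue. x \<in> {0<..<1} \<longrightarrow> f x = f' x" "f' 0 = 0" "f' 1 = 0"
    using assms(1) unfolding zero_trace_def by blast
  have "AE x in lebesgue. x \<in> {0<..<1} \<longrightarrow> g x = f' x" using f(2) assms(2) by eventually_elim auto
  then show ?thesis unfolding zero_trace_def using f by blast
qed

text \<open>A solution frozen at one time: the time derivatives are mere functions of
  \<open>x\<close>, and the bounds are attached to the very space derivatives that occur in the
  equations.\<close>

definition slice_solution where
  "slice_solution a p d F G N u ut m mt \<longleftrightarrow> (\<exists>ux uxx mx amx amxx qx.
     weak_deriv u ux \<and> weak_deriv ux uxx \<and> weak_deriv m mx \<and>
     weak_deriv (\<lambda>x. a x * m x) amx \<and> weak_deriv amx amxx \<and> weak_deriv (\<lambda>x. p x * m x * ux x) qx \<and>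
     zero_trace u \<and> zero_trace (\<lambda>x. a x * m x) \<and>
     (AE x in lebesgue. x \<in> {0<..<1} \<longrightarrow> \<bar>ux x\<bar> \<le> N \<and> \<bar>uxx x\<bar> \<le> N \<and> \<bar>m x\<bar> \<le> N \<and> \<bar>mx x\<bar> \<le> N) \<and>
     (AE x in lebesgue. x \<in> {0<..<1} \<longrightarrow> ut x + a x * uxx x - p x / 2 * (ux x)\<^sup>2 + d x * m x = F x) \<and>
     (AE x in lebesgue. x \<in> {0<..<1} \<longrightarrow> mt x - amxx x - qx x = (G x :: real)))"

lemma slice_solution_bound:
  assumes "slice_solution a p d F G N u ut m mt"
  shows "AE x in lebesgue. x \<in> {0<..<1} \<longrightarrow> \<bar>m x\<bar> \<le> N"
proof -
  obtain ux uxx mx where "AE x in lebesgue. x \<in> {0<..<1} \<longrightarrow> \<bar>ux x\<bar> \<le> N \<and> \<bar>uxx x\<bar> \<le> N \<and> \<bar>m x\<bar> \<le> N \<and> \<bar>mx x\<bar> \<le> N"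
    using assms unfolding slice_solution_def by blast
  then show ?thesis by eventually_elim blast
qed

text \<open>The equations and the boundedness hypotheses come with separate choices of the space
  derivatives. By uniqueness of weak derivatives they agree on almost every time slice, so the
  bounds pass to the derivatives in the equations.\<close>

lemma mfg_solution_slices:
  assumes sol: "mfg_solution T a p d F G u m"
    and bu: "\<forall>l\<le>2. \<exists>g. weak_dx_iter T l u g \<and> Linf_le T N g"
    and bm: "\<forall>n\<le>1. \<exists>g. weak_dx_iter T n m g \<and> Linf_le T N g"
  obtains ut mt where "time_H1 T (\<lambda>x. 1 / a x) u ut" "time_H1 T a m mt"
    "AE t in lebesgue. t \<in> {0<..<T} \<longrightarrow> slice_solution a (\<lambda>x. p x t) (\<lambda>x. d x t) (\<lambda>x. F x t) (\<lambda>x. G x t) N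
       (\<lambda>x. u x t) (\<lambda>x. ut x t) (\<lambda>x. m x t) (\<lambda>x. mt x t)"
proof -
  obtain ut ux uxx mt amx amxx qx where
    s: "time_H1 T (\<lambda>x. 1 / a x) u ut" "weak_dx T u ux" "weak_dx T ux uxx"
    "time_H1 T a m mt" "weak_dx T (\<lambda>x t. a x * m x t) amx" "weak_dx T amx amxx"
    "weak_dx T (\<lambda>x t. p x t * m x t * ux x t) qx"
    "AE_Q T (\<lambda>x t. ut x t + a x * uxx x t - p x t / 2 * (ux x t)\<^sup>2 + d x t * m x t = F x t)"
    "AE_Q T (\<lambda>x t. mt x t - amxx x t - qx x t = G x t)"
    and tr: "AE t in lebesgue. t \<in> {0<..<T} \<longrightarrow> zero_trace (\<lambda>x. u x t) \<and> zero_trace (\<lambda>x. a x * m x t)"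
    using sol unfolding mfg_solution_def by blast
  have "\<exists>g. weak_dx_iter T 1 u g \<and> Linf_le T N g" by (rule bu[rule_format]) simp
  then obtain u1 where u1: "weak_dx T u u1" "Linf_le T N u1" by auto
  have "\<exists>g. weak_dx_iter T 2 u g \<and> Linf_le T N g" by (rule bu[rule_format]) simp
  \<comment> \<open>\<open>weak_dx_iter\<close> brings its own first derivative \<open>u1'\<close>,
    which has to be identified with \<open>ux\<close> before \<open>u2\<close> can be compared with
    \<open>uxx\<close>.\<close>
  then obtain u1' u2 where u2: "weak_dx T u u1'" "weak_dx T u1' u2" "Linf_le T N u2" by (auto simp: numeral_2_eq_2)
  have "\<exists>g. weak_dx_iter T 0 m g \<and> Linf_le T N g" by (rule bm[rule_format]) simp
  then have m0: "Linf_le T N m" by auto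
  have "\<exists>g. weak_dx_iter T 1 m g \<and> Linf_le T N g" by (rule bm[rule_format]) simp
  then obtain m1 where m1: "weak_dx T m m1" "Linf_le T N m1" by auto
  have W: "AE t in lebesgue. t \<in> {0<..<T} \<longrightarrow> weak_deriv (\<lambda>x. f x t) (\<lambda>x. g x t)" if "weak_dx T f g" for f g
    using that by (simp add: weak_dx_def)
  have B: "AE t in lebesgue. t \<in> {0<..<T} \<longrightarrow> (AE x in lebesgue. x \<in> {0<..<1} \<longrightarrow> \<bar>f x t\<bar> \<le> N)" if "Linf_le T N f" for f
    by (rule AE_Q_slice) (use that in \<open>simp add: Linf_le_def\<close>)
  have "AE t in lebesgue. t \<in> {0<..<T} \<longrightarrow> slice_solution a (\<lambda>x. p x t) (\<lambda>x. d x t) (\<lambda>x. F x t) (\<lambda>x. G x t) N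
       (\<lambda>x. u x t) (\<lambda>x. ut x t) (\<lambda>x. m x t) (\<lambda>x. mt x t)"
    using W[OF s(2)] W[OF s(3)] W[OF s(5)] W[OF s(6)] W[OF s(7)] AE_Q_slice[OF s(8)] AE_Q_slice[OF s(9)] tr
      W[OF u1(1)] W[OF u2(1)] W[OF u2(2)] W[OF m1(1)] B[OF u1(2)] B[OF u2(3)] B[OF m0] B[OF m1(2)]
  proof eventually_elim
    case (elim t)
    show ?case
    proof
      assume t: "t \<in> {0<..<T}"
      note e = elim[rule_format, OF t]
      have eq1: "AE x in lebesgue. x \<in> {0<..<1} \<longrightarrow> ux x t = u1 x t" by (rule weak_deriv_unique[OF e(1) e(9)])
      have eq2: "AE x in lebesgue. x \<in> {0<..<1} \<longrightarrow> u1' x t = ux x t" by (rule weak_deriv_unique[OF e(10) e(1)])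
      have "weak_deriv (\<lambda>x. ux x t) (\<lambda>x. u2 x t)"
        by (rule weak_deriv_cong_AE[OF e(11) eq2]) simp
      from weak_deriv_unique[OF e(2) this]
      have eq3: "AE x in lebesgue. x \<in> {0<..<1} \<longrightarrow> uxx x t = u2 x t" .
      have "AE x in lebesgue. x \<in> {0<..<1} \<longrightarrow> \<bar>ux x t\<bar> \<le> N \<and> \<bar>uxx x t\<bar> \<le> N \<and> \<bar>m x t\<bar> \<le> N \<and> \<bar>m1 x t\<bar> \<le> N"
        using eq1 eq3 e(13) e(14) e(15) e(16) by eventually_elim auto
      then show "slice_solution a (\<lambda>x. p x t) (\<lambda>x. d x t) (\<lambda>x. F x t) (\<lambda>x. G x t) N
         (\<lambda>x. u x t) (\<lambda>x. ut x t) (\<lambda>x. m x t) (\<lambda>x. mt x t)"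
        unfolding slice_solution_def using e by blast
    qed
  qed
  with s(1,4) show ?thesis by (rule that)
qed

text \<open>\<open>F\<close> and \<open>G\<close> cancel in the differences, and the nonlinear terms
  become linear in \<open>vx\<close> and \<open>w\<close> with bounded coefficients. The flux
  satisfies \<open>q\<^sup>2 \<le> C (a w\<^sup>2 + vx\<^sup>2)\<close>, and \<open>slice_v\<close>
  trades \<open>\<integral> vx\<^sup>2\<close> for the time derivative of the energy of
  \<open>v\<close>.\<close>

lemma slice_difference:
  assumes a: "continuous_on {0..1} a" "a C1_differentiable_on {0<..<1}" "\<And>x. x \<in> {0<..<1} \<Longrightarrow> 0 < a x"
      "\<And>x. x \<in> {0<..<1} \<Longrightarrow> \<bar>deriv a x\<bar> \<le> K * sqrt (a x)" "\<And>x. x \<in> {0<..<1} \<Longrightarrow> a x \<le> A" "0 < K" "0 \<le> N"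
    and pd: "\<And>x. x \<in> {0<..<1} \<Longrightarrow> \<bar>p x\<bar> \<le> K * sqrt (a x)" "\<And>x. x \<in> {0<..<1} \<Longrightarrow> \<bar>d x\<bar> \<le> K * a x"
    and L: "level_intervals a \<delta> \<C>" and \<delta>: "0 < \<delta>"
    and s1: "slice_solution a p d F G N u1 ut1 m1 mt1" and s2: "slice_solution a p d F G N u2 ut2 m2 mt2"
    and v: "AE x in lebesgue. x \<in> {0<..<1} \<longrightarrow> u2 x - u1 x = v x"
    and vt: "AE x in lebesgue. x \<in> {0<..<1} \<longrightarrow> ut2 x - ut1 x = vt x"
    and w: "AE x in lebesgue. x \<in> {0<..<1} \<longrightarrow> m2 x - m1 x = w x"
    and wt: "AE x in lebesgue. x \<in> {0<..<1} \<longrightarrow> mt2 x - mt1 x = wt x"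
    and mvt: "set_borel_measurable lebesgue {0<..<1} vt"
    and iv: "set_integrable lebesgue {0<..<1} (\<lambda>x. 1 / a x * (v x)\<^sup>2)"
    and ivt: "set_integrable lebesgue {0<..<1} (\<lambda>x. 1 / a x * (vt x)\<^sup>2)"
    and iwt: "set_integrable lebesgue {0<..<1} (\<lambda>x. a x * (wt x)\<^sup>2)"
  defines "B \<equiv> 2 * N"
  shows "energy_ineq (2 * K\<^sup>2 * B\<^sup>2 * (1 + A) + 1) (K\<^sup>2 * B\<^sup>2 + K\<^sup>2) (6 * B\<^sup>2 * \<delta>)
    (LINT x:{0<..<1}|lebesgue. a x * (w x)\<^sup>2) (LINT x:{0<..<1}|lebesgue. (mean_free_primitive \<C> w x)\<^sup>2)
    (LINT x:{0<..<1}|lebesgue. 1 / a x * (v x)\<^sup>2) (2 * (LINT x:{0<..<1}|lebesgue. a x * (w x * wt x)))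
    (2 * (LINT x:{0<..<1}|lebesgue. mean_free_primitive \<C> w x * mean_free_primitive \<C> wt x))
    (2 * (LINT x:{0<..<1}|lebesgue. 1 / a x * (v x * vt x)))"
proof -
  obtain ux1 uxx1 mx1 amx1 amxx1 qx1 where
    S1: "weak_deriv u1 ux1" "weak_deriv ux1 uxx1" "weak_deriv m1 mx1" "weak_deriv (\<lambda>x. a x * m1 x) amx1"
     "weak_deriv amx1 amxx1" "weak_deriv (\<lambda>x. p x * m1 x * ux1 x) qx1" "zero_trace u1" "zero_trace (\<lambda>x. a x * m1 x)"
     "AE x in lebesgue. x \<in> {0<..<1} \<longrightarrow> \<bar>ux1 x\<bar> \<le> N \<and> \<bar>uxx1 x\<bar> \<le> N \<and> \<bar>m1 x\<bar> \<le> N \<and> \<bar>mx1 x\<bar> \<le> N"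
     "AE x in lebesgue. x \<in> {0<..<1} \<longrightarrow> ut1 x + a x * uxx1 x - p x / 2 * (ux1 x)\<^sup>2 + d x * m1 x = F x"
     "AE x in lebesgue. x \<in> {0<..<1} \<longrightarrow> mt1 x - amxx1 x - qx1 x = G x"
    using s1 unfolding slice_solution_def by blast
  obtain ux2 uxx2 mx2 amx2 amxx2 qx2 where
    S2: "weak_deriv u2 ux2" "weak_deriv ux2 uxx2" "weak_deriv m2 mx2" "weak_deriv (\<lambda>x. a x * m2 x) amx2"
     "weak_deriv amx2 amxx2" "weak_deriv (\<lambda>x. p x * m2 x * ux2 x) qx2" "zero_trace u2" "zero_trace (\<lambda>x. a x * m2 x)"
     "AE x in lebesgue. x \<in> {0<..<1} \<longrightarrow> \<bar>ux2 x\<bar> \<le> N \<and> \<bar>uxx2 x\<bar> \<le> N \<and> \<bar>m2 x\<bar> \<le> N \<and> \<bar>mx2 x\<bar> \<le> N"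
     "AE x in lebesgue. x \<in> {0<..<1} \<longrightarrow> ut2 x + a x * uxx2 x - p x / 2 * (ux2 x)\<^sup>2 + d x * m2 x = F x"
     "AE x in lebesgue. x \<in> {0<..<1} \<longrightarrow> mt2 x - amxx2 x - qx2 x = G x"
    using s2 unfolding slice_solution_def by blast
  have K0: "0 \<le> K" and B0: "0 \<le> B" using a(6,7) by (auto simp: B_def)
  have ca: "continuous_on {0<..<1} a" by (rule continuous_on_subset[OF a(1)]) auto
  define vx where "vx x = ux2 x - ux1 x" for x
  define vxx where "vxx x = uxx2 x - uxx1 x" for x
  define wx where "wx x = mx2 x - mx1 x" for x
  define zx where "zx x = amx2 x - amx1 x" for x
  define q where "q x = p x * m2 x * ux2 x - p x * m1 x * ux1 x" for x
  have Dv: "weak_deriv v vx"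
    by (rule weak_deriv_cong_AE[OF weak_deriv_diff[OF S2(1) S1(1)] v]) (simp add: vx_def)
  have Dvx: "weak_deriv vx vxx" unfolding vx_def[abs_def] vxx_def[abs_def] by (rule weak_deriv_diff[OF S2(2) S1(2)])
  have tv: "zero_trace v" by (rule zero_trace_cong_AE[OF zero_trace_diff[OF S2(7) S1(7)] v])
  have bvx: "AE x in lebesgue. x \<in> {0<..<1} \<longrightarrow> \<bar>vx x\<bar> \<le> B" and bvxx: "AE x in lebesgue. x \<in> {0<..<1} \<longrightarrow> \<bar>vxx x\<bar> \<le> B"
    and bwx: "AE x in lebesgue. x \<in> {0<..<1} \<longrightarrow> \<bar>wx x\<bar> \<le> B"
  proof -
    have diff: "\<bar>s - r\<bar> \<le> B" if "\<bar>r\<bar> \<le> N" "\<bar>s\<bar> \<le> N" for r s using that by (simp add: B_def)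
    show "AE x in lebesgue. x \<in> {0<..<1} \<longrightarrow> \<bar>vx x\<bar> \<le> B"
      using S1(9) S2(9) unfolding vx_def by eventually_elim (blast intro: diff)
    show "AE x in lebesgue. x \<in> {0<..<1} \<longrightarrow> \<bar>vxx x\<bar> \<le> B"
      using S1(9) S2(9) unfolding vxx_def by eventually_elim (blast intro: diff)
    show "AE x in lebesgue. x \<in> {0<..<1} \<longrightarrow> \<bar>wx x\<bar> \<le> B"
      using S1(9) S2(9) unfolding wx_def by eventually_elim (blast intro: diff)
  qed
  have bw: "AE x in lebesgue. x \<in> {0<..<1} \<longrightarrow> \<bar>w x\<bar> \<le> B"
    using S1(9) S2(9) w by eventually_elim (auto simp: B_def)
  have Dw: "weak_deriv w wx"
    by (rule weak_deriv_cong_AE[OF weak_deriv_diff[OF S2(3) S1(3)] w]) (simp add: wx_def)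
  have aw: "AE x in lebesgue. x \<in> {0<..<1} \<longrightarrow> a x * m2 x - a x * m1 x = a x * w x"
    using w by eventually_elim (auto simp: right_diff_distrib[symmetric])
  have Dz: "weak_deriv (\<lambda>x. a x * w x) zx"
    by (rule weak_deriv_cong_AE[OF weak_deriv_diff[OF S2(4) S1(4)] aw]) (simp add: zx_def)
  have tz: "zero_trace (\<lambda>x. a x * w x)" by (rule zero_trace_cong_AE[OF zero_trace_diff[OF S2(8) S1(8)] aw])
  \<comment> \<open>Subtracting the second equations shows that \<open>wt\<close> is the weak
    derivative of the whole flux.\<close>
  have DR: "weak_deriv (\<lambda>x. zx x + q x) wt"
  proof -
    have 1: "weak_deriv (\<lambda>x. (amx2 x - amx1 x) + (p x * m2 x * ux2 x - p x * m1 x * ux1 x)) (\<lambda>x. (amxx2 x - amxx1 x) + (qx2 x - qx1 x))"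
      by (intro weak_deriv_add weak_deriv_diff S1 S2)
    have 2: "AE x in lebesgue. x \<in> {0<..<1} \<longrightarrow> (amxx2 x - amxx1 x) + (qx2 x - qx1 x) = wt x"
      using S1(11) S2(11) wt by eventually_elim auto
    show ?thesis unfolding zx_def q_def by (rule weak_deriv_cong_AE[OF 1 _ 2]) simp
  qed
  have qb: "AE x in lebesgue. x \<in> {0<..<1} \<longrightarrow> \<bar>q x\<bar> \<le> K * sqrt (a x) * (N * (\<bar>w x\<bar> + \<bar>vx x\<bar>))"
    using S1(9) S2(9) w
  proof eventually_elim
    case (elim x)
    show ?case
    proof
      assume x: "x \<in> {0<..<1}"
      have w_x: "w x = m2 x - m1 x" using elim x by simp
      \<comment> \<open>The difference of the products \<open>m ux\<close> is split so that each
        summand has one small and one bounded factor.\<close>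
      have "q x = p x * (w x * ux2 x + m1 x * vx x)" by (simp add: q_def w_x vx_def algebra_simps)
      moreover have "\<bar>w x * ux2 x + m1 x * vx x\<bar> \<le> \<bar>w x\<bar> * N + N * \<bar>vx x\<bar>"
        by (rule order_trans[OF abs_triangle_ineq]) (use elim x a(7) in \<open>auto simp: abs_mult intro!: add_mono mult_mono\<close>)
      ultimately have "\<bar>q x\<bar> \<le> \<bar>p x\<bar> * (\<bar>w x\<bar> * N + N * \<bar>vx x\<bar>)"
        by (simp add: abs_mult mult_left_mono)
      also have "\<dots> \<le> K * sqrt (a x) * (\<bar>w x\<bar> * N + N * \<bar>vx x\<bar>)"
        by (rule mult_right_mono[OF pd(1)[OF x]]) (use a(7) in simp)
      finally show "\<bar>q x\<bar> \<le> K * sqrt (a x) * (N * (\<bar>w x\<bar> + \<bar>vx x\<bar>))"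
        by (simp add: algebra_simps)
    qed
  qed
  have A0: "0 \<le> A" using a(3)[of "1/2"] a(5)[of "1/2"] by simp
  have ess_q: "ess_bounded q"
  proof (rule ess_boundedI)
    show "L1_loc q" unfolding q_def[abs_def]
      by (rule L1_loc_diff[OF weak_derivD(1)[OF S2(6)] weak_derivD(1)[OF S1(6)]])
    show "AE x in lebesgue. x \<in> {0<..<1} \<longrightarrow> \<bar>q x\<bar> \<le> K * sqrt A * (N * (B + B))"
      using qb bw bvx
    proof eventually_elim
      case (elim x)
      show ?case
      proof
        assume x: "x \<in> {0<..<1}"
        have "K * sqrt (a x) * (N * (\<bar>w x\<bar> + \<bar>vx x\<bar>)) \<le> K * sqrt A * (N * (B + B))"
          by (intro mult_mono add_mono) (use elim x a(5)[OF x] a(3)[OF x] a(7) K0 A0 B0 in auto)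
        with elim x show "\<bar>q x\<bar> \<le> K * sqrt A * (N * (B + B))" by force
      qed
    qed
  qed
  have vteq: "AE x in lebesgue. x \<in> {0<..<1} \<longrightarrow> \<bar>vt x + a x * vxx x\<bar> \<le> K * B * sqrt (a x) * \<bar>vx x\<bar> + K * a x * \<bar>w x\<bar>"
    using S1(9) S2(9) S1(10) S2(10) w vt
  proof eventually_elim
    case (elim x)
    show ?case
    proof
      assume x: "x \<in> {0<..<1}"
      have w_x: "w x = m2 x - m1 x" and vt_x: "vt x = ut2 x - ut1 x" using elim x by simp_all
      have e: "ut2 x = F x - a x * uxx2 x + p x / 2 * (ux2 x)\<^sup>2 - d x * m2 x"
        "ut1 x = F x - a x * uxx1 x + p x / 2 * (ux1 x)\<^sup>2 - d x * m1 x" using elim x by (simp_all add: algebra_simps)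
      \<comment> \<open>Half the difference of the squares of \<open>ux2\<close> and
        \<open>ux1\<close> is \<open>vx\<close> times their average, whose modulus is at most
        \<open>N\<close>, hence at most \<open>B\<close>.\<close>
      have eq: "vt x + a x * vxx x = (p x * vx x) * ((ux1 x + ux2 x) / 2) - d x * w x"
        unfolding vt_x w_x e vxx_def vx_def by (simp add: power2_eq_square field_simps)
      have 1: "\<bar>(p x * vx x) * ((ux1 x + ux2 x) / 2)\<bar> \<le> (K * sqrt (a x) * \<bar>vx x\<bar>) * B"
        unfolding abs_mult
        by (intro mult_mono pd(1)[OF x]) (use elim x a(3)[OF x] a(7) K0 in \<open>auto simp: B_def\<close>)
      have 2: "\<bar>d x * w x\<bar> \<le> K * a x * \<bar>w x\<bar>"
        unfolding abs_mult by (intro mult_mono pd(2)[OF x]) (use a(3)[OF x] K0 in auto)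
      have "\<bar>vt x + a x * vxx x\<bar> \<le> (K * sqrt (a x) * \<bar>vx x\<bar>) * B + K * a x * \<bar>w x\<bar>"
        unfolding eq using 1 2 by linarith
      then show "\<bar>vt x + a x * vxx x\<bar> \<le> K * B * sqrt (a x) * \<bar>vx x\<bar> + K * a x * \<bar>w x\<bar>"
        by (simp add: algebra_simps)
    qed
  qed
  have ess_w: "ess_bounded w" by (rule ess_boundedI[OF weak_derivD(1)[OF Dw] bw])
  have ess_vx: "ess_bounded vx" by (rule ess_boundedI[OF weak_derivD(2)[OF Dv] bvx])
  have ess_a: "ess_bounded a" by (rule ess_bounded_continuous[OF a(1)])
  have iw: "set_integrable lebesgue {0<..<1} (\<lambda>x. a x * (w x)\<^sup>2)"
    and iX: "set_integrable lebesgue {0<..<1} (\<lambda>x. (vx x)\<^sup>2)"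
    and iq: "set_integrable lebesgue {0<..<1} (\<lambda>x. (q x)\<^sup>2)"
    unfolding power2_eq_square by (intro ess_bounded_integrable ess_bounded_mult ess_a ess_w ess_vx ess_q)+
  define P where "P = (LINT x:{0<..<1}|lebesgue. a x * (w x)\<^sup>2)"
  define V where "V = (LINT x:{0<..<1}|lebesgue. 1 / a x * (v x)\<^sup>2)"
  define X where "X = (LINT x:{0<..<1}|lebesgue. (vx x)\<^sup>2)"
  define Qq where "Qq = (LINT x:{0<..<1}|lebesgue. (q x)\<^sup>2)"
  define v' where "v' = 2 * (LINT x:{0<..<1}|lebesgue. 1 / a x * (v x * vt x))"
  let ?c = "2 * K\<^sup>2 * B\<^sup>2 * (1 + A)"
  have v': "v' \<ge> X - (K\<^sup>2 * B\<^sup>2 + K\<^sup>2) * V - P"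
    unfolding v'_def X_def V_def P_def
    by (rule slice_v[OF ca a(3) K0 B0 Dv Dvx tv bvx bvxx mvt vteq iv ivt iw])
  have nonneg: "0 \<le> P" "0 \<le> X" "0 \<le> Qq"
    unfolding P_def X_def Qq_def set_lebesgue_integral_def
    by (auto intro!: Bochner_Integration.integral_nonneg simp: indicator_def less_imp_le[OF a(3)])
  have "Qq \<le> (LINT x:{0<..<1}|lebesgue. ?c * (a x * (w x)\<^sup>2 + (vx x)\<^sup>2))"
    unfolding Qq_def
  proof (rule set_integral_mono_AE[OF iq set_integrable_mult_right[OF set_integral_add(1)[OF iw iX]]])
    show "AE x\<in>{0<..<1} in lebesgue. (q x)\<^sup>2 \<le> ?c * (a x * (w x)\<^sup>2 + (vx x)\<^sup>2)"
      using qb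
    proof eventually_elim
      case (elim x)
      show ?case
      proof
        assume x: "x \<in> {0<..<1}"
        let ?s = "\<bar>w x\<bar> + \<bar>vx x\<bar>"
        have ax: "0 < a x" "a x \<le> A" using a(3,5)[OF x] by auto
        have "\<bar>q x\<bar> \<le> \<bar>K * sqrt (a x) * (N * ?s)\<bar>" using elim x by force
        then have "(q x)\<^sup>2 \<le> (K * sqrt (a x) * (N * ?s))\<^sup>2" by (simp only: abs_le_square_iff)
        also have "\<dots> = K\<^sup>2 * N\<^sup>2 * (a x * ?s\<^sup>2)" using ax by (simp add: power_mult_distrib)
        also have "\<dots> \<le> K\<^sup>2 * B\<^sup>2 * (2 * (1 + A) * (a x * (w x)\<^sup>2 + (vx x)\<^sup>2))"
        proof (rule mult_mono)
          show "K\<^sup>2 * N\<^sup>2 \<le> K\<^sup>2 * B\<^sup>2" using a(7) by (intro mult_left_mono power_mono) (auto simp: B_def)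
          have "?s\<^sup>2 \<le> 2 * (w x)\<^sup>2 + 2 * (vx x)\<^sup>2"
            using sum_squares_bound[of "\<bar>w x\<bar>" "\<bar>vx x\<bar>"] by (simp add: power2_sum)
          then have "a x * ?s\<^sup>2 \<le> a x * (2 * (w x)\<^sup>2 + 2 * (vx x)\<^sup>2)" by (rule mult_left_mono) (use ax in simp)
          also have "\<dots> = 2 * (a x * (w x)\<^sup>2) + 2 * (a x * (vx x)\<^sup>2)" by (simp add: algebra_simps)
          also have "a x * (vx x)\<^sup>2 \<le> A * (vx x)\<^sup>2" by (rule mult_right_mono) (use ax in auto)
          also have "2 * (a x * (w x)\<^sup>2) + 2 * (A * (vx x)\<^sup>2) \<le> 2 * (1 + A) * (a x * (w x)\<^sup>2 + (vx x)\<^sup>2)"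
          proof -
            have "0 \<le> A * (a x * (w x)\<^sup>2)" "0 \<le> (vx x)\<^sup>2" using ax A0 by auto
            then show ?thesis by (simp add: algebra_simps)
          qed
          finally show "a x * ?s\<^sup>2 \<le> 2 * (1 + A) * (a x * (w x)\<^sup>2 + (vx x)\<^sup>2)" by simp
        qed (use ax in auto)
        finally show "(q x)\<^sup>2 \<le> ?c * (a x * (w x)\<^sup>2 + (vx x)\<^sup>2)" by (simp only: mult_ac)
      qed
    qed
  qed
  also have "\<dots> = ?c * (P + X)"
    unfolding P_def X_def set_integral_mult_right using set_integral_add(2)[OF iw iX] by simp
  \<comment> \<open>\<open>slice_v\<close> gives
    \<open>X \<le> v' + (K\<^sup>2 * B\<^sup>2 + K\<^sup>2) * V + P\<close>. The added
    \<open>1\<close> keeps the constant positive even for \<open>N = 0\<close>, as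
    \<open>carleman_holder\<close> requires.\<close>
  also have "\<dots> \<le> (?c + 1) * (2 * P + v' + (K\<^sup>2 * B\<^sup>2 + K\<^sup>2) * V)"
    by (rule mult_mono) (use v' nonneg A0 in auto)
  finally have Qq: "Qq \<le> (?c + 1) * (2 * P + v' + (K\<^sup>2 * B\<^sup>2 + K\<^sup>2) * V)" .
  note W = slice_w[OF a(1-4) K0 B0 L \<delta> Dw bw bwx Dz tz ess_q DR iwt, folded P_def Qq_def]
  show ?thesis
    unfolding energy_ineq_def P_def[symmetric] V_def[symmetric] v'_def[symmetric]
    using nonneg(3) W Qq by blast
qed

text \<open>The constants are fixed before \<open>F\<close>, \<open>G\<close>, \<open>u\<close> and
  \<open>m\<close>; this is why the boundedness of the derivatives enters with a common bound
  \<open>N\<close> rather than through \<open>Linf\<close>.\<close>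

theorem theorem4p1:
  fixes T K t0 M N :: real
    and a :: "real \<Rightarrow> real"
    and p d :: "real \<Rightarrow> real \<Rightarrow> real"
  assumes "T > 0"
    and "continuous_on {0..1} a" and "a C1_differentiable_on {0<..<1}"
    and "\<forall>x\<in>{0<..<1}. a x > 0" and "a 0 = 0" and "a 1 = 0"
    and "Linf T p" and "\<exists>px. weak_dx T p px \<and> Linf T px" and "Linf T d"
    and "K > 0"
    and "\<forall>(x, t)\<in>Q T. \<bar>p x t\<bar> \<le> K * sqrt (a x) \<and> \<bar>d x t\<bar> \<le> K * a x \<and>
           \<bar>deriv a x\<bar> \<le> K * sqrt (a x)"
    and "t0 \<in> {0<..<T}"
  shows "\<exists>C \<theta>. C > 0 \<and> 0 < \<theta> \<and> \<theta> < 1 \<and>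
    (\<forall>(F :: real \<Rightarrow> real \<Rightarrow> real) (G :: real \<Rightarrow> real \<Rightarrow> real)
       (u :: nat \<Rightarrow> real \<Rightarrow> real \<Rightarrow> real) (m :: nat \<Rightarrow> real \<Rightarrow> real \<Rightarrow> real).
       (\<forall>k\<in>{1, 2}.
          mfg_solution T a p d F G (u k) (m k) \<and>
          norm1_inv a (\<lambda>x. u k x 0) \<le> M \<and> norm1_a a (\<lambda>x. m k x 0) \<le> M \<and>
          (\<forall>l\<le>2. \<exists>g. weak_dx_iter T l (u k) g \<and> Linf_le T N g) \<and>
          (\<forall>n\<le>1. \<exists>g. weak_dx_iter T n (m k) g \<and> Linf_le T N g)) \<longrightarrow>
       (let D0 = norm1_inv a (\<lambda>x. u 2 x T - u 1 x T) + norm1_a a (\<lambda>x. m 2 x T - m 1 x T)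
        in norm_inv a (\<lambda>x. u 2 x t0 - u 1 x t0) + norm_a a (\<lambda>x. m 2 x t0 - m 1 x t0)
             \<le> C * (D0 powr \<theta> + D0)))"
proof -
  have T: "0 < T" and t0: "0 < t0" "t0 < T" and K: "0 < K" using assms by auto
  have a_pos: "0 < a x" if "x \<in> {0<..<1}" for x using assms(4) that by auto
  have a_cont: "continuous_on {0<..<1} a" by (rule continuous_on_subset[OF assms(2)]) auto
  have Q_mem: "(x, t) \<in> Q T" if "x \<in> {0<..<1}" "t \<in> {0<..<T}" for x t using that by (simp add: Q_def)
  have pt: "\<bar>p x t\<bar> \<le> K * sqrt (a x)" "\<bar>d x t\<bar> \<le> K * a x" "\<bar>deriv a x\<bar> \<le> K * sqrt (a x)"
    if "x \<in> {0<..<1}" "t \<in> {0<..<T}" for x t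
    using bspec[OF assms(11) Q_mem[OF that]] by auto
  have a': "\<bar>deriv a x\<bar> \<le> K * sqrt (a x)" if "x \<in> {0<..<1}" for x
    by (rule pt(3)[OF that, of t0]) (use t0 in simp)
  have inv_cont: "continuous_on {0<..<1} (\<lambda>x. 1 / a x)"
    by (intro continuous_intros a_cont) (use a_pos in force)
  have inv_pos: "0 < 1 / a x" if "x \<in> {0<..<1}" for x using a_pos[OF that] by simp
  obtain A where A: "\<forall>x\<in>{0..1}. \<bar>a x\<bar> \<le> A"
    using compact_imp_bounded[OF compact_continuous_image[OF assms(2) compact_Icc]] by (auto simp: bounded_iff)
  have aA: "a x \<le> A" if "x \<in> {0<..<1}" for x using bspec[OF A, of x] that by auto
  have A0: "0 \<le> A" using a_pos[of "1/2"] aA[of "1/2"] by simp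
  \<comment> \<open>\<open>N\<close> is not assumed nonnegative; its absolute value is a bound as
    well.\<close>
  define N' where "N' = \<bar>N\<bar>"
  define B where "B = 2 * N'"
  have B0: "0 \<le> B" and N0: "0 \<le> N'" by (auto simp: B_def N'_def)
  define C1 where "C1 = 2 * K\<^sup>2 * B\<^sup>2 * (1 + A) + 1"
  define C3 where "C3 = K\<^sup>2 * B\<^sup>2 + K\<^sup>2"
  have C1: "0 < C1" using A0 by (auto simp: C1_def intro!: add_nonneg_pos mult_nonneg_nonneg)
  have C3: "0 \<le> C3" by (simp add: C3_def)
  \<comment> \<open>\<open>6 * B\<^sup>2\<close> is the factor in the errors of
    \<open>slice_w\<close>; \<open>(1 + A) * B\<^sup>2\<close> dominates both
    \<open>A * B\<^sup>2\<close>, for \<open>P 0\<close>, and \<open>B\<^sup>2\<close>, for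
    \<open>J 0\<close>.\<close>
  have k0: "0 \<le> 6 * B\<^sup>2" and b0: "0 \<le> (1 + A) * B\<^sup>2" using A0 by auto
  from carleman_holder[OF t0 C1 C3 k0 b0] obtain C \<theta> where C: "0 < C" "0 < \<theta>" "\<theta> < 1"
    and est: "\<And>\<delta> P J V p j v. 0 < \<delta> \<Longrightarrow> primitive_on T P p \<Longrightarrow> primitive_on T J j \<Longrightarrow> primitive_on T V v \<Longrightarrow>
      \<forall>t\<in>{0..T}. 0 \<le> P t \<and> 0 \<le> J t \<and> 0 \<le> V t \<Longrightarrow>
      AE t in lebesgue. t \<in> {0<..<T} \<longrightarrow> energy_ineq C1 C3 (6 * B\<^sup>2 * \<delta>) (P t) (J t) (V t) (p t) (j t) (v t) \<Longrightarrow>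
      P 0 \<le> (1 + A) * B\<^sup>2 \<Longrightarrow> J 0 \<le> (1 + A) * B\<^sup>2 \<Longrightarrow> J T \<le> \<delta> \<Longrightarrow> V T \<le> \<delta>\<^sup>2 \<Longrightarrow>
      P t0 + V t0 \<le> C * (\<delta> powr (2 * \<theta>) + \<delta>\<^sup>2)" by blast
  \<comment> \<open>The square root leads from \<open>P\<close> and \<open>V\<close> to the norms,
    and the \<open>2\<close> counts the two norms.\<close>
  define C' where "C' = 2 * sqrt C"
  have C'0: "0 < C'" using C by (simp add: C'_def)
  \<comment> \<open>Proved for any \<open>\<delta> > 0\<close> above the final norms, since a level
    of \<open>a\<close> must be positive while \<open>D0\<close> may vanish.\<close>
  have main: "norm_inv a (\<lambda>x. u 2 x t0 - u 1 x t0) + norm_a a (\<lambda>x. m 2 x t0 - m 1 x t0) \<le> C' * (\<delta> powr \<theta> + \<delta>)"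
    if H: "\<forall>k\<in>{1, 2::nat}. mfg_solution T a p d F G (u k) (m k) \<and>
          (\<forall>l\<le>2. \<exists>g. weak_dx_iter T l (u k) g \<and> Linf_le T N g) \<and>
          (\<forall>n\<le>1. \<exists>g. weak_dx_iter T n (m k) g \<and> Linf_le T N g)"
      and \<delta>: "0 < \<delta>" and D: "norm_inv a (\<lambda>x. u 2 x T - u 1 x T) \<le> \<delta>" "norm_a a (\<lambda>x. m 2 x T - m 1 x T) \<le> \<delta>"
    for F G u m \<delta>
  proof -
    have bmono: "\<exists>g. weak_dx_iter T n f g \<and> Linf_le T N' g" if ex: "\<exists>g. weak_dx_iter T n f g \<and> Linf_le T N g" for n f
    proof -
      obtain g where g: "weak_dx_iter T n f g" "Linf_le T N g" using ex by blast
      have "Linf_le T N' g" using g(2) unfolding Linf_le_def AE_Q_def N'_def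
        by (auto elim!: eventually_mono)
      with g(1) show ?thesis by blast
    qed
    have h: "mfg_solution T a p d F G (u k) (m k)" "\<forall>l\<le>2. \<exists>g. weak_dx_iter T l (u k) g \<and> Linf_le T N' g"
      "\<forall>n\<le>1. \<exists>g. weak_dx_iter T n (m k) g \<and> Linf_le T N' g" if "k = 1 \<or> k = 2" for k
      using H that bmono by auto
    obtain ut1 mt1 where s1: "time_H1 T (\<lambda>x. 1 / a x) (u 1) ut1" "time_H1 T a (m 1) mt1"
      "AE t in lebesgue. t \<in> {0<..<T} \<longrightarrow> slice_solution a (\<lambda>x. p x t) (\<lambda>x. d x t) (\<lambda>x. F x t) (\<lambda>x. G x t) N'
       (\<lambda>x. u 1 x t) (\<lambda>x. ut1 x t) (\<lambda>x. m 1 x t) (\<lambda>x. mt1 x t)"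
      by (rule mfg_solution_slices[OF h(1)[of 1] h(2)[of 1] h(3)[of 1]]) auto
    obtain ut2 mt2 where s2: "time_H1 T (\<lambda>x. 1 / a x) (u 2) ut2" "time_H1 T a (m 2) mt2"
      "AE t in lebesgue. t \<in> {0<..<T} \<longrightarrow> slice_solution a (\<lambda>x. p x t) (\<lambda>x. d x t) (\<lambda>x. F x t) (\<lambda>x. G x t) N'
       (\<lambda>x. u 2 x t) (\<lambda>x. ut2 x t) (\<lambda>x. m 2 x t) (\<lambda>x. mt2 x t)"
      by (rule mfg_solution_slices[OF h(1)[of 2] h(2)[of 2] h(3)[of 2]]) auto
    obtain v01 gv1 where ru1: "time_rep T (\<lambda>x. 1 / a x) (u 1) ut1 v01 gv1" using time_H1_rep[OF s1(1) inv_cont inv_pos T] .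
    obtain v02 gv2 where ru2: "time_rep T (\<lambda>x. 1 / a x) (u 2) ut2 v02 gv2" using time_H1_rep[OF s2(1) inv_cont inv_pos T] .
    obtain w01 gw1 where rm1: "time_rep T a (m 1) mt1 w01 gw1" using time_H1_rep[OF s1(2) a_cont a_pos T] .
    obtain w02 gw2 where rm2: "time_rep T a (m 2) mt2 w02 gw2" using time_H1_rep[OF s2(2) a_cont a_pos T] .
    define v0 where "v0 x = v02 x - v01 x" for x
    define vt where "vt x t = gv2 x t - gv1 x t" for x t
    define w0 where "w0 x = w02 x - w01 x" for x
    define wt where "wt x t = gw2 x t - gw1 x t" for x t
    have rv: "time_rep T (\<lambda>x. 1 / a x) (\<lambda>x t. u 2 x t - u 1 x t) (\<lambda>x t. ut2 x t - ut1 x t) v0 vt"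
      unfolding v0_def[abs_def] vt_def[abs_def] by (rule time_rep_diff[OF ru1 ru2 inv_cont inv_pos])
    have rw: "time_rep T a (\<lambda>x t. m 2 x t - m 1 x t) (\<lambda>x t. mt2 x t - mt1 x t) w0 wt"
      unfolding w0_def[abs_def] wt_def[abs_def] by (rule time_rep_diff[OF rm1 rm2 a_cont a_pos])
    have v: "v0 \<in> borel_measurable borel" "(\<lambda>(x, t). vt x t) \<in> borel_measurable (borel \<Otimes>\<^sub>M borel)"
      "set_integrable lebesgue {0<..<1} (\<lambda>x. 1 / a x * (v0 x)\<^sup>2)"
      "integrable (lborel \<Otimes>\<^sub>M lborel) (\<lambda>(x, t). 1 / a x * (vt x t)\<^sup>2)"
      and vz: "\<And>x t. x \<notin> {0<..<1} \<or> t \<notin> {0<..<T} \<Longrightarrow> vt x t = 0"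
      and veq: "\<And>t. t \<in> {0..T} \<Longrightarrow> AE x in lebesgue. x \<in> {0<..<1} \<longrightarrow> u 2 x t - u 1 x t = v0 x + (LINT s:{0..t}|lborel. vt x s)"
      and vteq: "AE t in lebesgue. t \<in> {0<..<T} \<longrightarrow> (AE x in lebesgue. x \<in> {0<..<1} \<longrightarrow> ut2 x t - ut1 x t = vt x t)"
      using rv unfolding time_rep_def by blast+
    have w: "w0 \<in> borel_measurable borel" "(\<lambda>(x, t). wt x t) \<in> borel_measurable (borel \<Otimes>\<^sub>M borel)"
      "set_integrable lebesgue {0<..<1} (\<lambda>x. a x * (w0 x)\<^sup>2)"
      "integrable (lborel \<Otimes>\<^sub>M lborel) (\<lambda>(x, t). a x * (wt x t)\<^sup>2)"
      and wz: "\<And>x t. x \<notin> {0<..<1} \<or> t \<notin> {0<..<T} \<Longrightarrow> wt x t = 0"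
      and weq: "\<And>t. t \<in> {0..T} \<Longrightarrow> AE x in lebesgue. x \<in> {0<..<1} \<longrightarrow> m 2 x t - m 1 x t = w0 x + (LINT s:{0..t}|lborel. wt x s)"
      and wteq: "AE t in lebesgue. t \<in> {0<..<T} \<longrightarrow> (AE x in lebesgue. x \<in> {0<..<1} \<longrightarrow> mt2 x t - mt1 x t = wt x t)"
      using rw unfolding time_rep_def by blast+
    define y where "y x t = v0 x + (LINT s:{0..t}|lborel. vt x s)" for x t
    define z where "z x t = w0 x + (LINT s:{0..t}|lborel. wt x s)" for x t
    \<comment> \<open>The truncation level is the bound on the final data itself.\<close>
    obtain \<C> where L: "level_intervals a \<delta> \<C>" using level_intervals_exist[OF assms(2,5,6) \<delta>] .
    have "AE t in lebesgue. t \<in> {0<..<T} \<longrightarrow> (AE x in lebesgue. x \<in> {0<..<1} \<longrightarrow> \<bar>m 2 x t - m 1 x t\<bar> \<le> B)"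
      using s1(3) s2(3)
    proof eventually_elim
      case (elim t)
      show ?case
      proof
        assume t: "t \<in> {0<..<T}"
        show "AE x in lebesgue. x \<in> {0<..<1} \<longrightarrow> \<bar>m 2 x t - m 1 x t\<bar> \<le> B"
          using slice_solution_bound[OF elim(1)[rule_format, OF t]] slice_solution_bound[OF elim(2)[rule_format, OF t]]
          by eventually_elim (auto simp: B_def)
      qed
    qed
    from time_rep_initial_bound[OF rw T this]
    have w0B: "AE x in lborel. x \<in> {0<..<1} \<longrightarrow> \<bar>w0 x\<bar> \<le> B" .
    define P where "P t = (LINT x:{0<..<1}|lebesgue. a x * (z x t)\<^sup>2)" for t
    define V where "V t = (LINT x:{0<..<1}|lebesgue. 1 / a x * (y x t)\<^sup>2)" for t
    define J where "J t = (LINT x:{0<..<1}|lebesgue. (mean_free_primitive \<C> (\<lambda>\<xi>. z \<xi> t) x)\<^sup>2)" for t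
    have E: "primitive_on T V (\<lambda>t. 2 * (LINT x:{0<..<1}|lebesgue. 1 / a x * (y x t * vt x t)))"
      "AE t in lebesgue. set_integrable lebesgue {0<..<1} (\<lambda>x. 1 / a x * (vt x t)\<^sup>2)"
      unfolding V_def[abs_def] y_def
      by (rule energy_primitive(1,3)[OF less_imp_le[OF T] inv_cont inv_pos v vz]; assumption)+
    have Ei: "set_integrable lebesgue {0<..<1} (\<lambda>x. 1 / a x * (y x t)\<^sup>2)" if "t \<in> {0..T}" for t
      unfolding y_def by (rule energy_primitive(2)[OF less_imp_le[OF T] inv_cont inv_pos v vz that])
    have EP: "primitive_on T P (\<lambda>t. 2 * (LINT x:{0<..<1}|lebesgue. a x * (z x t * wt x t)))"
      "AE t in lebesgue. set_integrable lebesgue {0<..<1} (\<lambda>x. a x * (wt x t)\<^sup>2)"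
      "(\<lambda>(x, t). z x t) \<in> borel_measurable (borel \<Otimes>\<^sub>M borel)"
      unfolding P_def[abs_def] z_def
      by (rule energy_primitive(1,3,4)[OF less_imp_le[OF T] a_cont a_pos w wz]; assumption)+
    have EPi: "set_integrable lebesgue {0<..<1} (\<lambda>x. a x * (z x t)\<^sup>2)" if "t \<in> {0..T}" for t
      unfolding z_def by (rule energy_primitive(2)[OF less_imp_le[OF T] a_cont a_pos w wz that])
    have EJ: "primitive_on T J (\<lambda>t. 2 * (LINT x:{0<..<1}|lebesgue.
        mean_free_primitive \<C> (\<lambda>\<xi>. z \<xi> t) x * mean_free_primitive \<C> (\<lambda>\<xi>. wt \<xi> t) x))"
      unfolding J_def[abs_def] z_def
      by (rule mfp_energy_primitive[OF L \<delta> a_pos a_cont less_imp_le[OF T] w(1,2) w0B B0 w(4) wz]; assumption)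
    have pos: "0 \<le> P t \<and> 0 \<le> J t \<and> 0 \<le> V t" for t
      unfolding P_def J_def V_def set_lebesgue_integral_def
      by (auto intro!: Bochner_Integration.integral_nonneg simp: indicator_def less_imp_le[OF a_pos])
    have energy: "AE t in lebesgue. t \<in> {0<..<T} \<longrightarrow> energy_ineq C1 C3 (6 * B\<^sup>2 * \<delta>) (P t) (J t) (V t)
        (2 * (LINT x:{0<..<1}|lebesgue. a x * (z x t * wt x t)))
        (2 * (LINT x:{0<..<1}|lebesgue. mean_free_primitive \<C> (\<lambda>\<xi>. z \<xi> t) x * mean_free_primitive \<C> (\<lambda>\<xi>. wt \<xi> t) x))
        (2 * (LINT x:{0<..<1}|lebesgue. 1 / a x * (y x t * vt x t)))"
      using s1(3) s2(3) vteq wteq E(2) EP(2)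
    proof eventually_elim
      case (elim t)
      show ?case
      proof
        assume t: "t \<in> {0<..<T}"
        then have t': "t \<in> {0..T}" by auto
        have "(\<lambda>x. vt x t) \<in> borel_measurable borel"
          using measurable_compose[OF measurable_Pair2'[of t borel borel] v(2)] by simp
        then have "set_borel_measurable lebesgue {0<..<1} (\<lambda>x. vt x t)"
          unfolding set_borel_measurable_def by (intro measurable_completion) measurable
        then show "energy_ineq C1 C3 (6 * B\<^sup>2 * \<delta>) (P t) (J t) (V t)
          (2 * (LINT x:{0<..<1}|lebesgue. a x * (z x t * wt x t)))
          (2 * (LINT x:{0<..<1}|lebesgue. mean_free_primitive \<C> (\<lambda>\<xi>. z \<xi> t) x * mean_free_primitive \<C> (\<lambda>\<xi>. wt \<xi> t) x))
          (2 * (LINT x:{0<..<1}|lebesgue. 1 / a x * (y x t * vt x t)))"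
          unfolding P_def J_def V_def C1_def C3_def B_def
          using elim t veq[OF t', folded y_def] weq[OF t', folded z_def] Ei[OF t']
          by (intro slice_difference[OF assms(2,3) a_pos a' aA K N0 pt(1,2)[OF _ t] L \<delta>]) auto
      qed
    qed
    have P0: "P 0 \<le> (1 + A) * B\<^sup>2"
      unfolding P_def
    proof (rule set_integral_Ioo_le_const[OF _ b0])
      show "AE x in lebesgue. x \<in> {0<..<1} \<longrightarrow> a x * (z x 0)\<^sup>2 \<le> (1 + A) * B\<^sup>2"
        using w0B unfolding AE_lebesgue_iff
      proof eventually_elim
        case (elim x)
        show ?case
        proof
          assume x: "x \<in> {0<..<1}"
          have "z x 0 = w0 x" using set_integral_point_lborel[of 0 "wt x"] by (simp add: z_def)
          moreover have "(w0 x)\<^sup>2 \<le> B\<^sup>2" using elim x B0 abs_le_square_iff[of "w0 x" B] by auto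
          ultimately show "a x * (z x 0)\<^sup>2 \<le> (1 + A) * B\<^sup>2"
            by (simp only:) (intro mult_mono; use aA[OF x] A0 in simp)
        qed
      qed
    qed
    have J0: "J 0 \<le> (1 + A) * B\<^sup>2"
      unfolding J_def
    proof (rule set_integral_Ioo_le_const[OF _ b0], intro AE_I2 impI)
      fix x :: real assume x: "x \<in> {0<..<1}"
      have "(\<lambda>\<xi>. z \<xi> 0) = w0" using set_integral_point_lborel[of 0] by (simp add: z_def fun_eq_iff)
      then have "\<bar>mean_free_primitive \<C> (\<lambda>\<xi>. z \<xi> 0) x\<bar> \<le> B"
        using mfp_abs_le(2)[OF L \<delta> a_pos a_cont w(1) w0B B0, of x] x by simp
      then have "(mean_free_primitive \<C> (\<lambda>\<xi>. z \<xi> 0) x)\<^sup>2 \<le> 1 * B\<^sup>2" using B0 abs_le_square_iff[of _ B] by auto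
      also have "\<dots> \<le> (1 + A) * B\<^sup>2" by (rule mult_right_mono) (use A0 in auto)
      finally show "(mean_free_primitive \<C> (\<lambda>\<xi>. z \<xi> 0) x)\<^sup>2 \<le> (1 + A) * B\<^sup>2" .
    qed
    have nV: "norm_inv a (\<lambda>x. u 2 x t - u 1 x t) = sqrt (V t)" if t: "t \<in> {0..T}" for t
    proof -
      have "AE x in lebesgue. x \<in> {0<..<1} \<longrightarrow> 1 / a x * (u 2 x t - u 1 x t)\<^sup>2 = 1 / a x * (y x t)\<^sup>2"
        using veq[OF t] by eventually_elim (simp add: y_def)
      from set_integral_cong_lebesgue(2)[OF this] show ?thesis by (simp add: norm_inv_def normw_def V_def)
    qed
    have nP: "norm_a a (\<lambda>x. m 2 x t - m 1 x t) = sqrt (P t)" if t: "t \<in> {0..T}" for t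
    proof -
      have "AE x in lebesgue. x \<in> {0<..<1} \<longrightarrow> a x * (m 2 x t - m 1 x t)\<^sup>2 = a x * (z x t)\<^sup>2"
        using weq[OF t] by eventually_elim (simp add: z_def)
      from set_integral_cong_lebesgue(2)[OF this] show ?thesis by (simp add: norm_a_def normw_def P_def)
    qed
    have VT: "V T \<le> \<delta>\<^sup>2" and PT: "P T \<le> \<delta>\<^sup>2"
      using D nV[of T] nP[of T] T \<delta> by (auto simp: real_le_lsqrt sqrt_le_D)
    \<comment> \<open>\<open>P T \<le> \<delta>\<^sup>2\<close> leaves one power of
      \<open>\<delta>\<close> after the loss of \<open>1 / \<delta>\<close>; this is why the level
      has the size of the norm and not of its square.\<close>
    have JT: "J T \<le> \<delta>"
      unfolding J_def
    proof (rule set_integral_Ioo_le_const, intro AE_I2 impI)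
      fix x :: real assume x: "x \<in> {0<..<1}"
      have zm: "(\<lambda>x. z x T) \<in> borel_measurable borel"
        using measurable_compose[OF measurable_Pair2'[of T borel borel] EP(3)] by simp
      have "set_integrable lebesgue {0<..<1} (\<lambda>x. a x * (z x T)\<^sup>2)" by (rule EPi) (use T in auto)
      from mfp_square_le[OF L \<delta> a_pos a_cont zm this, of x]
      have "(mean_free_primitive \<C> (\<lambda>\<xi>. z \<xi> T) x)\<^sup>2 \<le> P T / \<delta>" using x by (simp add: P_def)
      also have "\<dots> \<le> \<delta>\<^sup>2 / \<delta>" by (rule divide_right_mono[OF PT]) (use \<delta> in simp)
      also have "\<dots> = \<delta>" using \<delta> by (simp add: power2_eq_square)
      finally show "(mean_free_primitive \<C> (\<lambda>\<xi>. z \<xi> T) x)\<^sup>2 \<le> \<delta>" .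
    qed (use \<delta> in simp)
    have final: "P t0 + V t0 \<le> C * (\<delta> powr (2 * \<theta>) + \<delta>\<^sup>2)"
      by (rule est[OF \<delta> EP(1) EJ E(1) _ energy P0 J0 JT VT]) (use pos in blast)
    have t0': "t0 \<in> {0..T}" using t0 by auto
    have pw: "\<delta> powr (2 * \<theta>) = (\<delta> powr \<theta>)\<^sup>2" using powr_add[of \<delta> \<theta> \<theta>] by (simp add: power2_eq_square)
    have "C * (\<delta> powr (2 * \<theta>) + \<delta>\<^sup>2) \<le> C * (\<delta> powr \<theta> + \<delta>)\<^sup>2"
      unfolding pw by (rule mult_left_mono) (use C \<delta> in \<open>auto simp: power2_sum\<close>)
    then have bound: "P t0 + V t0 \<le> C * (\<delta> powr \<theta> + \<delta>)\<^sup>2" using final by simp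
    have root: "sqrt r \<le> sqrt C * (\<delta> powr \<theta> + \<delta>)" if "r \<le> C * (\<delta> powr \<theta> + \<delta>)\<^sup>2" for r
    proof -
      have "sqrt r \<le> sqrt (C * (\<delta> powr \<theta> + \<delta>)\<^sup>2)" using that by simp
      also have "\<dots> = sqrt C * (\<delta> powr \<theta> + \<delta>)" using \<delta> by (simp add: real_sqrt_mult)
      finally show ?thesis .
    qed
    have "sqrt (P t0) \<le> sqrt C * (\<delta> powr \<theta> + \<delta>)" "sqrt (V t0) \<le> sqrt C * (\<delta> powr \<theta> + \<delta>)"
      by (rule root; use bound pos[of t0] in linarith)+
    then show ?thesis unfolding nV[OF t0'] nP[OF t0'] C'_def by simp
  qed
  show ?thesis
  proof (rule exI[of _ C'], rule exI[of _ \<theta>], intro conjI allI impI C'0 C(2,3))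
    fix F G :: "real \<Rightarrow> real \<Rightarrow> real" and u m :: "nat \<Rightarrow> real \<Rightarrow> real \<Rightarrow> real"
    assume H: "\<forall>k\<in>{1, 2}. mfg_solution T a p d F G (u k) (m k) \<and>
          norm1_inv a (\<lambda>x. u k x 0) \<le> M \<and> norm1_a a (\<lambda>x. m k x 0) \<le> M \<and>
          (\<forall>l\<le>2. \<exists>g. weak_dx_iter T l (u k) g \<and> Linf_le T N g) \<and>
          (\<forall>n\<le>1. \<exists>g. weak_dx_iter T n (m k) g \<and> Linf_le T N g)"
    define D0 where "D0 = norm1_inv a (\<lambda>x. u 2 x T - u 1 x T) + norm1_a a (\<lambda>x. m 2 x T - m 1 x T)"
    let ?l = "norm_inv a (\<lambda>x. u 2 x t0 - u 1 x t0) + norm_a a (\<lambda>x. m 2 x t0 - m 1 x t0)"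
    have D: "norm_inv a (\<lambda>x. u 2 x T - u 1 x T) \<le> D0" "norm_a a (\<lambda>x. m 2 x T - m 1 x T) \<le> D0" "0 \<le> D0"
    proof -
      have 1: "norm_inv a f \<le> norm1_inv a f" "norm_a a f \<le> norm1_a a f" for f
        unfolding norm1_inv_def norm1_a_def by (auto intro!: real_le_rsqrt)
      have 2: "0 \<le> norm1_inv a f" "0 \<le> norm1_a a f" for f
        unfolding norm1_inv_def norm1_a_def by auto
      show "norm_inv a (\<lambda>x. u 2 x T - u 1 x T) \<le> D0" "norm_a a (\<lambda>x. m 2 x T - m 1 x T) \<le> D0" "0 \<le> D0"
        unfolding D0_def using 1[of "\<lambda>x. u 2 x T - u 1 x T"] 1[of "\<lambda>x. m 2 x T - m 1 x T"]
          2[of "\<lambda>x. u 2 x T - u 1 x T"] 2[of "\<lambda>x. m 2 x T - m 1 x T"] by linarith+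
    qed
    have bound: "?l \<le> C' * (\<delta> powr \<theta> + \<delta>)" if "0 < \<delta>" "D0 \<le> \<delta>" for \<delta>
      by (rule main[of F G u m \<delta>]) (use H D that in auto)
    have "?l \<le> C' * (D0 powr \<theta> + D0)"
    proof (cases "D0 = 0")
      case False
      then show ?thesis using bound[of D0] D by simp
    next
      \<comment> \<open>For \<open>D0 = 0\<close> every \<open>\<delta> > 0\<close> is admissible;
        the bound tends to \<open>0\<close> with \<open>\<delta>\<close>, and
        \<open>0 powr \<theta> = 0\<close>.\<close>
      case True
      have "((\<lambda>\<delta>. \<delta> powr \<theta>) \<longlongrightarrow> 0 powr \<theta>) (at_right 0)"
        using tendsto_powr'[of "\<lambda>\<delta>. \<delta>" 0 "at_right 0" "\<lambda>_. \<theta>" \<theta>] C(2)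
        by (auto simp: eventually_at_filter)
      then have "((\<lambda>\<delta>. C' * (\<delta> powr \<theta> + \<delta>)) \<longlongrightarrow> C' * (0 powr \<theta> + 0)) (at_right 0)"
        by (intro tendsto_mult tendsto_const tendsto_add tendsto_ident_at)
      moreover have "eventually (\<lambda>\<delta>. ?l \<le> C' * (\<delta> powr \<theta> + \<delta>)) (at_right 0)"
        unfolding eventually_at_filter by (intro always_eventually) (use bound True in auto)
      ultimately have "?l \<le> C' * (0 powr \<theta> + 0)"
        by (rule tendsto_lowerbound) simp
      then show ?thesis unfolding True .
    qed
    then show "let D0 = norm1_inv a (\<lambda>x. u 2 x T - u 1 x T) + norm1_a a (\<lambda>x. m 2 x T - m 1 x T)
        in ?l \<le> C' * (D0 powr \<theta> + D0)" by (simp add: D0_def Let_def)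
  qed
qed

end
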